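(* Let $\mathcal{D}_H$ be a left $H$-category, let $M$ be a right-left SAYD module over $H$, let $n\ge 0$ and let $\phi \in C^n_H(\mathcal{D}_H,M)$. The following conditions are equivalent: (1) $\phi$ is the character of an $n$-dimensional cycle over $\mathcal D_H$, i.e., there is an $n$-dimensional cycle $(\mathcal{S}_H,\hat{\partial}_H, \hat{\mathscr T}^H)$ with coefficients in $M$ and an $H$-linear semifunctor $\rho:\mathcal{D}_H \longrightarrow \mathcal{S}_H^0$ such that $$\phi(m \otimes f^0 \otimes \ldots \otimes f^n)=\hat{\mathscr T}^H_{\rho(X_0)}\big(m \otimes \hat\rho(f^0df^1\cdots df^n)\big)=\hat{\mathscr T}^H_{\rho(X_0)}\big(m \otimes \rho(f^0)\,\hat{\partial}_H^0(\rho(f^1)) \cdots \hat{\partial}_H^0(\rho(f^n))\big)$$ for all $m \in M$ and $f^0 \otimes \ldots \otimes f^n \in Hom_{\mathcal{D}_H}(X_1,X_0) \otimes Hom_{\mathcal{D}_H}(X_2,X_1) \otimes \ldots \otimes Hom_{\mathcal{D}_H}(X_0,X_n)$. (2) There exists a closed graded $(H,M)$-trace $\mathscr{T}^H$ of dimension $n$ on the universal DGH-semicategory $(\Omega(\mathcal{D}_H),\partial_H)$ such that $$\phi(m \otimes f^0 \otimes \ldots \otimes f^n)=\mathscr{T}^H_{X_0}(m \otimes f^0df^1 \cdots df^n)$$ for all $m \in M$ and $f^0 \otimes \ldots \otimes f^n \in Hom_{\mathcal{D}_H}(X_1,X_0) \otimes Hom_{\mathcal{D}_H}(X_2,X_1)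 \otimes \ldots \otimes Hom_{\mathcal{D}_H}(X_0,X_n)$. (3) $\phi \in Z^n_H(\mathcal{D}_H,M)$.
   Context: **Hopf data.** $H$ is a Hopf algebra over a field $k$ of characteristic zero, with comultiplication $\Delta(h)=h_1\otimes h_2$ (Sweedler notation, summation suppressed), counit $\varepsilon$ and bijective antipode $S$. A semicategory is like a category except that identity morphisms are not required; a semifunctor preserves composition (not necessarily identities). A left $H$-semicategory is a small $k$-linear semicategory whose Hom spaces are left $H$-modules with $h(gf)=(h_1g)(h_2f)$ for composable $g,f$. A left $H$-category is a small $k$-linear category that is a left $H$-semicategory with $h(\mathrm{id}_X)=\varepsilon(h)\mathrm{id}_X$. An $H$-linear semifunctor is a $k$-linear semifunctor that is $H$-linear on Hom spaces. A right-left SAYD (stable anti-Yetter-Drinfeld) module is a right $H$-module and left $H$-comodule $M$, $m\mapsto m_{(-1)}\otimes m_{(0)}$, with $(mh)_{(-1)}\otimes (mh)_{(0)}=S(h_3)m_{(-1)}h_1\otimes m_{(0)}h_2$ and $m_{(0)}m_{(-1)}=m$. **Hopf-cyclic cocycles.** $CN_n(\mathcal D_H)=\bigoplus_{(X_0,\dots,X_n)} Hom(X_1,X_0)\otimes Hom(X_2,X_1)\otimes\cdots\otimes Hom(X_0,X_n)$, with diagonal $H$-action. $C^n_H(\mathcal D_H,M)$ is the space of $k$-linear maps $\phi:M\otimes CN_n(\mathcal D_H)\to k$ with $\phi(mh_1\otimes S(h_2)(f^0\otimes\cdots\otimes f^n))=\varepsilon(h)\phi(m\otimes f^0\otimes\cdots\otimes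 f^n)$. For $\phi\in C^n_H$, put $b\phi=\sum_{i=0}^{n+1}(-1)^i\delta_i\phi$, where $(\delta_i\phi)(m\otimes f^0\otimes\cdots\otimes f^{n+1})=\phi(m\otimes f^0\otimes\cdots\otimes f^if^{i+1}\otimes\cdots\otimes f^{n+1})$ for $0\le i\le n$ and $(\delta_{n+1}\phi)(m\otimes f^0\otimes\cdots\otimes f^{n+1})=\phi(m_{(0)}\otimes (S^{-1}(m_{(-1)})f^{n+1})f^0\otimes f^1\otimes\cdots\otimes f^n)$. Put $\lambda\phi=(-1)^n\tau_n\phi$ with $(\tau_n\phi)(m\otimes f^0\otimes\cdots\otimes f^n)=\phi(m_{(0)}\otimes S^{-1}(m_{(-1)})f^n\otimes f^0\otimes\cdots\otimes f^{n-1})$. $Z^n_H(\mathcal D_H,M)=\{\phi\in C^n_H(\mathcal D_H,M): b\phi=0,\ \lambda\phi=\phi\}$. **DGH-semicategories and cycles.** A DG-semicategory $(\mathcal S,\hat\partial)$ is a $k$-linear semicategory whose Hom spaces are cochain complexes $Hom^\bullet_{\mathcal S}(X,Y)$ in degrees $\ge0$, with composition additive in degrees and $\hat\partial(gf)=\hat\partial(g)f+(-1)^{\deg g}g\hat\partial(f)$; its degree-$0$ morphisms form a semicategory $\mathcal S^0$. A left DGH-semicategory $(\mathcal S_H,\hat\partial_H)$ is a left $H$-semicategory with a DG-semicategory structure such that each $Hom^n_{\mathcal S_H}(X,Y)$ is a left $H$-module and $\hat\partial_H$ is $H$-linear. A closed graded $(H,M)$-trace of dimension $n$ on it is a collection of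 $k$-linear maps $\hat{\mathscr T}^H_X:M\otimes Hom^n_{\mathcal S_H}(X,X)\to k$, $X\in Ob(\mathcal S_H)$, such that (i) $\hat{\mathscr T}^H_X(mh_1\otimes S(h_2)f)=\varepsilon(h)\hat{\mathscr T}^H_X(m\otimes f)$; (ii) $\hat{\mathscr T}^H_X(m\otimes\hat\partial_H^{n-1}(f'))=0$; (iii) $\hat{\mathscr T}^H_X(m\otimes g'g)=(-1)^{ij}\hat{\mathscr T}^H_Y(m_{(0)}\otimes(S^{-1}(m_{(-1)})g)g')$ for $h\in H$, $m\in M$, $f\in Hom^n(X,X)$, $f'\in Hom^{n-1}(X,X)$, $g\in Hom^i(X,Y)$, $g'\in Hom^j(Y,X)$, $i+j=n$. An $n$-dimensional cycle with coefficients in $M$ is a triple $(\mathcal S_H,\hat\partial_H,\hat{\mathscr T}^H)$ of this kind; together with an $H$-linear semifunctor $\rho:\mathcal D_H\to\mathcal S_H^0$ it is an $n$-dimensional cycle over $\mathcal D_H$. Its character is the cochain $m\otimes f^0\otimes\cdots\otimes f^n\mapsto\hat{\mathscr T}^H_{\rho(X_0)}(m\otimes\rho(f^0)\hat\partial_H^0(\rho(f^1))\cdots\hat\partial_H^0(\rho(f^n)))$. **Universal DGH-semicategory.** $\Omega(\mathcal D_H)$ has the objects of $\mathcal D_H$, $Hom^0(X,Y)=Hom_{\mathcal D_H}(X,Y)$, and for $n\ge1$, $Hom^n(X,Y)=\bigoplus_{(X_1,\dots,X_n)}Hom_{\tilde{\mathcal D}_H}(X_1,Y)\otimes Hom_{\mathcal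 D_H}(X_2,X_1)\otimes\cdots\otimes Hom_{\mathcal D_H}(X,X_n)$, where $Hom_{\tilde{\mathcal D}_H}(X,X)=Hom_{\mathcal D_H}(X,X)\oplus k$ (a new unit is adjoined) and $Hom_{\tilde{\mathcal D}_H}(X,Y)=Hom_{\mathcal D_H}(X,Y)$ for $X\ne Y$. Elements are written $(f^0+\mu)df^1\cdots df^n$ (with $\mu\in k$, $\mu=0$ if $n=0$ or if $X_1\neq Y$). Composition is determined by $f^0\circ df^1\circ\cdots\circ df^n=f^0df^1\cdots df^n$, $df^1\circ\cdots\circ df^n=df^1\cdots df^n$ and $(df^0)\circ f^1=d(f^0f^1)-f^0df^1$; the differential is $\partial_H((f^0+\mu)df^1\cdots df^n)=df^0df^1\cdots df^n$; and $h\cdot((f^0+\mu)df^1\cdots df^n)=(h_1f^0+\mu\varepsilon(h_1))d(h_2f^1)\cdots d(h_{n+1}f^n)$. Given $\rho:\mathcal D_H\to\mathcal S_H^0$, $\hat\rho:\Omega(\mathcal D_H)\to\mathcal S_H$ is its extension $\hat\rho((f^0+\mu)df^1\cdots df^n)=\rho(f^0)\hat\partial_H^0(\rho(f^1))\cdots\hat\partial_H^0(\rho(f^n))+\mu\,\hat\partial_H^0(\rho(f^1))\cdots\hat\partial_H^0(\rho(f^n))$. *)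

theory Defs
  imports Complex_Main "HOL-Library.Function_Algebras" "HOL-Library.Product_Plus"
begin

section \<open>Tensor products over a field\<close>

text \<open>
  Vector spaces are subspaces of an ambient type of class \<open>ab_group_add\<close> that carries a
  \<^locale>\<open>vector_space\<close> structure.

  A tensor product (or a direct sum of tensor products) is the vector space generated by a set of
  symbols (the elementary tensors) subject to multilinearity.  Over a field such a space embeds
  into the dual of the space \<open>\<Phi>\<close> of all multilinear forms on the symbols, a symbol \<open>g\<close> being sent
  to the evaluation \<open>\<beta> \<mapsto> \<beta> g\<close>; the tensor product is realised as the span of these evaluations.
  The lemmas at the end of this section establish the universal property.
\<close>

type_synonym ('k, 'g) tens = "('g \<Rightarrow> 'k) \<Rightarrow> 'k"

definition fscale :: "'k::field \<Rightarrow> ('i \<Rightarrow> 'k) \<Rightarrow> 'i \<Rightarrow> 'k" where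
  "fscale c x = (\<lambda>i. c * x i)"

definition linear_on ::
  "('k::field \<Rightarrow> 'v::ab_group_add \<Rightarrow> 'v) \<Rightarrow> 'v set \<Rightarrow> ('k \<Rightarrow> 'w::ab_group_add \<Rightarrow> 'w) \<Rightarrow> ('v \<Rightarrow> 'w) \<Rightarrow> bool"
where
  "linear_on sV V sW f \<longleftrightarrow>
     (\<forall>x\<in>V. \<forall>y\<in>V. f (x + y) = f x + f y) \<and> (\<forall>c. \<forall>x\<in>V. f (sV c x) = sW c (f x))"

definition elem_tensor :: "('g \<Rightarrow> 'k::field) set \<Rightarrow> 'g \<Rightarrow> ('k, 'g) tens" where
  "elem_tensor \<Phi> g = (\<lambda>\<beta>. if \<beta> \<in> \<Phi> then \<beta> g else 0)"

definition tensor_space :: "('g \<Rightarrow> 'k::field) set \<Rightarrow> 'g set \<Rightarrow> ('k, 'g) tens set" where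
  "tensor_space \<Phi> G = module.span fscale (elem_tensor \<Phi> ` G)"

text \<open>
  \<open>tensor_lift p G F\<close> is the linear map with \<open>p g \<mapsto> F g\<close> for \<open>g \<in> G\<close>: every element of a tensor
  product is a finite sum of elementary tensors, and for multilinear \<open>F\<close> the value does not
  depend on the chosen sum.
\<close>

definition tensor_lift ::
  "('g \<Rightarrow> 't::ab_group_add) \<Rightarrow> 'g set \<Rightarrow> ('g \<Rightarrow> 'w::ab_group_add) \<Rightarrow> 't \<Rightarrow> 'w"
where
  "tensor_lift p G F t =
     sum_list (map F (SOME gs. set gs \<subseteq> G \<and> sum_list (map p gs) = t))"

definition bilinear_on ::
  "('k::field \<Rightarrow> 'u::ab_group_add \<Rightarrow> 'u) \<Rightarrow> 'u set \<Rightarrow> ('k \<Rightarrow> 'v::ab_group_add \<Rightarrow> 'v) \<Rightarrow> 'v set \<Rightarrow>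
   ('k \<Rightarrow> 'w::ab_group_add \<Rightarrow> 'w) \<Rightarrow> ('u \<times> 'v \<Rightarrow> 'w) \<Rightarrow> bool"
where
  "bilinear_on sU U sV V sW F \<longleftrightarrow>
     (\<forall>u\<in>U. linear_on sV V sW (\<lambda>v. F (u, v))) \<and> (\<forall>v\<in>V. linear_on sU U sW (\<lambda>u. F (u, v)))"

definition bilinear_forms ::
  "('k::field \<Rightarrow> 'u::ab_group_add \<Rightarrow> 'u) \<Rightarrow> 'u set \<Rightarrow> ('k \<Rightarrow> 'v::ab_group_add \<Rightarrow> 'v) \<Rightarrow> 'v set \<Rightarrow>
   ('u \<times> 'v \<Rightarrow> 'k) set"
where
  "bilinear_forms sU U sV V = {\<beta>. bilinear_on sU U sV V (*) \<beta>}"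

definition tmul ::
  "('k::field \<Rightarrow> 'u::ab_group_add \<Rightarrow> 'u) \<Rightarrow> 'u set \<Rightarrow> ('k \<Rightarrow> 'v::ab_group_add \<Rightarrow> 'v) \<Rightarrow> 'v set \<Rightarrow>
   'u \<Rightarrow> 'v \<Rightarrow> ('k, 'u \<times> 'v) tens"
where
  "tmul sU U sV V u v = elem_tensor (bilinear_forms sU U sV V) (u, v)"

definition tprod ::
  "('k::field \<Rightarrow> 'u::ab_group_add \<Rightarrow> 'u) \<Rightarrow> 'u set \<Rightarrow> ('k \<Rightarrow> 'v::ab_group_add \<Rightarrow> 'v) \<Rightarrow> 'v set \<Rightarrow>
   ('k, 'u \<times> 'v) tens set"
where
  "tprod sU U sV V = tensor_space (bilinear_forms sU U sV V) (U \<times> V)"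

subsection \<open>Universal property\<close>

lemma vector_space_fscale: "vector_space (fscale :: 'k::field \<Rightarrow> ('i \<Rightarrow> 'k) \<Rightarrow> 'i \<Rightarrow> 'k)"
  by unfold_locales (auto simp: fscale_def fun_eq_iff algebra_simps)

lemma linear_functionals_separate:
  fixes sW :: "'k::field \<Rightarrow> 'w::ab_group_add \<Rightarrow> 'w"
  assumes W: "vector_space sW"
    and eq: "\<And>l. Vector_Spaces.linear sW (*) l \<Longrightarrow> l v = l w"
  shows "v = w"
proof -
  interpret W: vector_space sW by fact
  define B where "B = W.extend_basis {}"
  have B: "W.independent B" "W.span B = UNIV"
    unfolding B_def
    by (rule W.independent_extend_basis W.span_extend_basis; rule W.independent_empty)+
  have "W.representation B v b = W.representation B w b" for b
    by (rule eq) (rule W.linear_representation [OF B])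
  then have "W.representation B v = W.representation B w"
    by (rule ext)
  moreover have "(\<Sum>b | W.representation B x b \<noteq> 0. sW (W.representation B x b) b) = x" for x
    by (rule W.sum_nonzero_representation_eq [OF B(1)]) (simp add: B(2))
  ultimately show ?thesis
    by metis
qed

lemma sum_list_fun_apply: "sum_list (map f gs) \<beta> = sum_list (map (\<lambda>g. f g \<beta>) gs)"
  by (induction gs) auto

lemma tensor_lift_eq:
  fixes F :: "'g \<Rightarrow> 'w::ab_group_add" and sW :: "'k::field \<Rightarrow> 'w \<Rightarrow> 'w"
  assumes W: "vector_space sW"
    and F: "\<And>l. Vector_Spaces.linear sW (*) l \<Longrightarrow> (\<lambda>g. l (F g)) \<in> \<Phi>"
    and gs: "set gs \<subseteq> G" "sum_list (map (elem_tensor \<Phi>) gs) = t"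
  shows "tensor_lift (elem_tensor \<Phi>) G F t = sum_list (map F gs)"
proof -
  define hs where "hs = (SOME gs. set gs \<subseteq> G \<and> sum_list (map (elem_tensor \<Phi>) gs) = t)"
  have hs: "set hs \<subseteq> G \<and> sum_list (map (elem_tensor \<Phi>) hs) = t"
    unfolding hs_def by (rule someI [of _ gs]) (use gs in auto)
  have "sum_list (map F hs) = sum_list (map F gs)"
  proof (rule linear_functionals_separate [OF W])
    fix l :: "'w \<Rightarrow> 'k"
    assume l: "Vector_Spaces.linear sW (*) l"
    interpret l: Vector_Spaces.linear sW "(*)" l by fact
    have *: "l (sum_list (map F xs)) = sum_list (map (elem_tensor \<Phi>) xs) (\<lambda>g. l (F g))" for xs
      using F [OF l] by (induction xs) (auto simp: l.add l.zero elem_tensor_def)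
    show "l (sum_list (map F hs)) = l (sum_list (map F gs))"
      using hs gs by (simp add: *)
  qed
  then show ?thesis
    by (simp add: tensor_lift_def hs_def)
qed

text \<open>If \<open>G\<close> is closed under absorbing scalars, the span consists of sums of elementary tensors.\<close>

lemma tensor_space_sums:
  fixes \<Phi> :: "('g \<Rightarrow> 'k::field) set"
  assumes scale: "\<And>c g. g \<in> G \<Longrightarrow> \<exists>g'\<in>G. elem_tensor \<Phi> g' = fscale c (elem_tensor \<Phi> g)"
    and t: "t \<in> tensor_space \<Phi> G"
  shows "\<exists>gs. set gs \<subseteq> G \<and> sum_list (map (elem_tensor \<Phi>) gs) = t"
proof -
  interpret T: vector_space "fscale :: 'k \<Rightarrow> ('k, 'g) tens \<Rightarrow> ('k, 'g) tens"
    by (rule vector_space_fscale)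
  show ?thesis
    using t unfolding tensor_space_def
  proof (induction rule: T.span_induct_alt)
    case base
    show ?case by (rule exI [of _ "[]"]) auto
  next
    case (step c x y)
    then obtain g gs where "g \<in> G" "x = elem_tensor \<Phi> g" "set gs \<subseteq> G"
      "sum_list (map (elem_tensor \<Phi>) gs) = y" by auto
    moreover obtain g' where "g' \<in> G" "elem_tensor \<Phi> g' = fscale c (elem_tensor \<Phi> g)"
      using scale [OF \<open>g \<in> G\<close>] by blast
    ultimately show ?case
      by (intro exI [of _ "g' # gs"]) auto
  qed
qed

lemma tprod_sums:
  assumes "module.subspace sU U" "vector_space sU" "t \<in> tprod sU U sV V"
  shows "\<exists>gs. set gs \<subseteq> U \<times> V \<and> sum_list (map (case_prod (tmul sU U sV V)) gs) = t"
proof -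
  interpret U: vector_space sU by fact
  have eq: "case_prod (tmul sU U sV V) = elem_tensor (bilinear_forms sU U sV V)"
    by (auto simp: tmul_def)
  show ?thesis
    unfolding eq
  proof (rule tensor_space_sums [OF _ assms(3) [unfolded tprod_def]])
    fix c g assume "g \<in> U \<times> V"
    then obtain u v where "g = (u, v)" "u \<in> U" "v \<in> V" by auto
    then show "\<exists>g'\<in>U \<times> V. elem_tensor (bilinear_forms sU U sV V) g' =
        fscale c (elem_tensor (bilinear_forms sU U sV V) g)"
      using U.subspace_scale [OF assms(1)]
      by (intro bexI [of _ "(sU c u, v)"])
        (auto simp: elem_tensor_def fscale_def fun_eq_iff bilinear_forms_def bilinear_on_def
          linear_on_def)
  qed
qed

theorem tprod_universal:
  fixes F :: "'u::ab_group_add \<times> 'v::ab_group_add \<Rightarrow> 'w::ab_group_add"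
    and sU :: "'k::field \<Rightarrow> 'u \<Rightarrow> 'u"
  assumes U: "vector_space sU" "module.subspace sU U"
    and V: "vector_space sV" "module.subspace sV V"
    and W: "vector_space sW" and F: "bilinear_on sU U sV V sW F"
  defines "L \<equiv> tensor_lift (case_prod (tmul sU U sV V)) (U \<times> V) F"
  shows "linear_on fscale (tprod sU U sV V) sW L"
    and "u \<in> U \<Longrightarrow> v \<in> V \<Longrightarrow> L (tmul sU U sV V u v) = F (u, v)"
proof -
  interpret U: vector_space sU by fact
  interpret W: vector_space sW by fact
  let ?\<Phi> = "bilinear_forms sU U sV V"
  have eq: "case_prod (tmul sU U sV V) = elem_tensor ?\<Phi>"
    by (auto simp: tmul_def)
  have F': "(\<lambda>g. l (F g)) \<in> ?\<Phi>" if "Vector_Spaces.linear sW (*) l" for l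
  proof -
    interpret l: Vector_Spaces.linear sW "(*)" l by fact
    show ?thesis using F
      by (auto simp: bilinear_forms_def bilinear_on_def linear_on_def l.add l.scale)
  qed
  have L: "L (sum_list (map (elem_tensor ?\<Phi>) gs)) = sum_list (map F gs)"
    if "set gs \<subseteq> U \<times> V" for gs
    unfolding L_def eq by (rule tensor_lift_eq [OF W F' that refl])
  show "L (tmul sU U sV V u v) = F (u, v)" if "u \<in> U" "v \<in> V"
    using L [of "[(u, v)]"] that by (simp add: tmul_def)
  have sums: "\<exists>gs. set gs \<subseteq> U \<times> V \<and> sum_list (map (elem_tensor ?\<Phi>) gs) = t"
    if "t \<in> tprod sU U sV V" for t
    using tprod_sums [OF U(2,1) that] unfolding eq .
  show "linear_on fscale (tprod sU U sV V) sW L"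
    unfolding linear_on_def
  proof (intro conjI ballI allI)
    fix x y assume "x \<in> tprod sU U sV V" "y \<in> tprod sU U sV V"
    then obtain gs hs where "set gs \<subseteq> U \<times> V" "sum_list (map (elem_tensor ?\<Phi>) gs) = x"
      "set hs \<subseteq> U \<times> V" "sum_list (map (elem_tensor ?\<Phi>) hs) = y"
      using sums by metis
    then show "L (x + y) = L x + L y"
      using L [of "gs @ hs"] L [of gs] L [of hs] by simp
  next
    fix c x assume "x \<in> tprod sU U sV V"
    then obtain gs where gs: "set gs \<subseteq> U \<times> V" "sum_list (map (elem_tensor ?\<Phi>) gs) = x"
      using sums by metis
    let ?hs = "map (\<lambda>(u, v). (sU c u, v)) gs"
    have 1: "set ?hs \<subseteq> U \<times> V"
      using gs(1) U.subspace_scale [OF U(2)] by auto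
    have 2: "sum_list (map (elem_tensor ?\<Phi>) ?hs) = fscale c (sum_list (map (elem_tensor ?\<Phi>) gs))"
      using gs(1)
      by (induction gs)
        (auto simp: fscale_def fun_eq_iff elem_tensor_def bilinear_forms_def bilinear_on_def
          linear_on_def algebra_simps)
    have 3: "sum_list (map F ?hs) = sW c (sum_list (map F gs))"
      using gs(1) F
      by (induction gs) (auto simp: bilinear_on_def linear_on_def W.scale_right_distrib)
    show "L (fscale c x) = sW c (L x)"
      using L [OF 1] L [OF gs(1)] gs(2) 2 3 by simp
  qed
qed

section \<open>Hopf algebras\<close>

text \<open>The multiplication and the unit of \<open>H\<close> are those of the type \<open>'h\<close>.\<close>

record ('k, 'h) hopf =
  hscale :: "'k \<Rightarrow> 'h \<Rightarrow> 'h"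
  comult :: "'h \<Rightarrow> ('k, 'h \<times> 'h) tens"
  counit :: "'h \<Rightarrow> 'k"
  antipode :: "'h \<Rightarrow> 'h"

definition hten :: "('k::field, 'h::ring_1) hopf \<Rightarrow> 'h \<Rightarrow> 'h \<Rightarrow> ('k, 'h \<times> 'h) tens" where
  "hten H = tmul (hscale H) UNIV (hscale H) UNIV"

definition hh :: "('k::field, 'h::ring_1) hopf \<Rightarrow> ('k, 'h \<times> 'h) tens set" where
  "hh H = tprod (hscale H) UNIV (hscale H) UNIV"

text \<open>\<open>sweedler H h (\<lambda>h\<^sub>1 h\<^sub>2. F h\<^sub>1 h\<^sub>2)\<close> is the expression usually written \<open>F h\<^sub>1 h\<^sub>2\<close>.\<close>

definition sweedler ::
  "('k::field, 'h::ring_1) hopf \<Rightarrow> 'h \<Rightarrow> ('h \<Rightarrow> 'h \<Rightarrow> 'w::ab_group_add) \<Rightarrow> 'w"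
where
  "sweedler H h F = tensor_lift (case_prod (hten H)) UNIV (case_prod F) (comult H h)"

definition hopf_algebra :: "('k::field_char_0, 'h::ring_1) hopf \<Rightarrow> bool" where
  "hopf_algebra H \<longleftrightarrow>
     vector_space (hscale H) \<and>
     (\<forall>c x y. hscale H c (x * y) = hscale H c x * y \<and> hscale H c (x * y) = x * hscale H c y) \<and>
     Vector_Spaces.linear (hscale H) fscale (comult H) \<and> range (comult H) \<subseteq> hh H \<and>
     Vector_Spaces.linear (hscale H) (*) (counit H) \<and>
     (\<forall>h. sweedler H h (\<lambda>a b. sweedler H a (\<lambda>a1 a2.
            tmul (hscale H) UNIV fscale (hh H) a1 (hten H a2 b))) =
          sweedler H h (\<lambda>a b. tmul (hscale H) UNIV fscale (hh H) a (comult H b))) \<and>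
     (\<forall>h. sweedler H h (\<lambda>a b. hscale H (counit H a) b) = h) \<and>
     (\<forall>h. sweedler H h (\<lambda>a b. hscale H (counit H b) a) = h) \<and>
     (\<forall>x y. comult H (x * y) =
        sweedler H x (\<lambda>x1 x2. sweedler H y (\<lambda>y1 y2. hten H (x1 * y1) (x2 * y2)))) \<and>
     comult H 1 = hten H 1 1 \<and>
     (\<forall>x y. counit H (x * y) = counit H x * counit H y) \<and> counit H 1 = 1 \<and>
     Vector_Spaces.linear (hscale H) (hscale H) (antipode H) \<and>
     (\<forall>h. sweedler H h (\<lambda>a b. antipode H a * b) = hscale H (counit H h) 1) \<and>
     (\<forall>h. sweedler H h (\<lambda>a b. a * antipode H b) = hscale H (counit H h) 1) \<and>
     bij (antipode H)"

text \<open>Iterated Sweedler notation: \<open>sweedlers H p h (\<lambda>[h\<^sub>1, \<dots>, h\<^sub>p]. \<dots>)\<close>, for \<open>p \<ge> 1\<close>.\<close>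

fun sweedlers ::
  "('k::field, 'h::ring_1) hopf \<Rightarrow> nat \<Rightarrow> 'h \<Rightarrow> ('h list \<Rightarrow> 'w::ab_group_add) \<Rightarrow> 'w"
where
  "sweedlers H 0 h F = 0"
| "sweedlers H (Suc 0) h F = F [h]"
| "sweedlers H (Suc (Suc p)) h F = sweedler H h (\<lambda>a b. sweedlers H (Suc p) b (\<lambda>hs. F (a # hs)))"

section \<open>Stable anti-Yetter-Drinfeld modules\<close>

record ('k, 'h, 'm) hmod =
  mscale :: "'k \<Rightarrow> 'm \<Rightarrow> 'm"
  ract :: "'m \<Rightarrow> 'h \<Rightarrow> 'm"
  coact :: "'m \<Rightarrow> ('k, 'h \<times> 'm) tens"

definition hmten ::
  "('k::field, 'h::ring_1) hopf \<Rightarrow> ('k, 'h, 'm::ab_group_add) hmod \<Rightarrow> 'h \<Rightarrow> 'm \<Rightarrow> ('k, 'h \<times> 'm) tens"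
where
  "hmten H M = tmul (hscale H) UNIV (mscale M) UNIV"

definition hm ::
  "('k::field, 'h::ring_1) hopf \<Rightarrow> ('k, 'h, 'm::ab_group_add) hmod \<Rightarrow> ('k, 'h \<times> 'm) tens set"
where
  "hm H M = tprod (hscale H) UNIV (mscale M) UNIV"

text \<open>Sweedler notation for coactions: the bound variables stand for \<open>m\<^sub>(\<^sub>-\<^sub>1\<^sub>)\<close> and \<open>m\<^sub>(\<^sub>0\<^sub>)\<close>.\<close>

definition cosweedler ::
  "('k::field, 'h::ring_1) hopf \<Rightarrow> ('k, 'h, 'm::ab_group_add) hmod \<Rightarrow> 'm \<Rightarrow>
   ('h \<Rightarrow> 'm \<Rightarrow> 'w::ab_group_add) \<Rightarrow> 'w"
where
  "cosweedler H M m F = tensor_lift (case_prod (hmten H M)) UNIV (case_prod F) (coact M m)"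

definition sayd_module ::
  "('k::field_char_0, 'h::ring_1) hopf \<Rightarrow> ('k, 'h, 'm::ab_group_add) hmod \<Rightarrow> bool"
where
  "sayd_module H M \<longleftrightarrow>
     vector_space (mscale M) \<and>
     bilinear_on (mscale M) UNIV (hscale H) UNIV (mscale M) (\<lambda>(m, h). ract M m h) \<and>
     (\<forall>m h h'. ract M m (h * h') = ract M (ract M m h) h') \<and> (\<forall>m. ract M m 1 = m) \<and>
     Vector_Spaces.linear (mscale M) fscale (coact M) \<and> range (coact M) \<subseteq> hm H M \<and>
     (\<forall>m. cosweedler H M m (\<lambda>a m0. sweedler H a (\<lambda>a1 a2.
            tmul (hscale H) UNIV fscale (hm H M) a1 (hmten H M a2 m0))) =
          cosweedler H M m (\<lambda>a m0. tmul (hscale H) UNIV fscale (hm H M) a (coact M m0))) \<and>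
     (\<forall>m. cosweedler H M m (\<lambda>a m0. mscale M (counit H a) m0) = m) \<and>
     (\<forall>m h. coact M (ract M m h) =
        sweedler H h (\<lambda>h1 h'. sweedler H h' (\<lambda>h2 h3.
          cosweedler H M m (\<lambda>a m0. hmten H M (antipode H h3 * a * h1) (ract M m0 h2))))) \<and>
     (\<forall>m. cosweedler H M m (\<lambda>a m0. ract M m0 a) = m)"

section \<open>Left H-semicategories\<close>

text \<open>
  \<open>hom C X Y\<close> is the space of morphisms from \<open>X\<close> to \<open>Y\<close>.  All Hom spaces are subspaces of one
  ambient vector space (for a small category one may take their direct sum).  They need not be
  disjoint; therefore composition and action carry the objects: \<open>cmp C X Y Z g f\<close> is the composite
  of \<open>f : X \<rightarrow> Y\<close> and \<open>g : Y \<rightarrow> Z\<close>, and \<open>act C X Y h f\<close> is \<open>h f\<close> for \<open>f : X \<rightarrow> Y\<close>.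
\<close>

record ('k, 'h, 'o, 'a) semicat =
  ob :: "'o set"
  hom :: "'o \<Rightarrow> 'o \<Rightarrow> 'a set"
  scl :: "'k \<Rightarrow> 'a \<Rightarrow> 'a"
  cmp :: "'o \<Rightarrow> 'o \<Rightarrow> 'o \<Rightarrow> 'a \<Rightarrow> 'a \<Rightarrow> 'a"
  act :: "'o \<Rightarrow> 'o \<Rightarrow> 'h \<Rightarrow> 'a \<Rightarrow> 'a"

definition linear_semicategory ::
  "('k::field, 'h, 'o, 'a::ab_group_add, 'z) semicat_scheme \<Rightarrow> bool"
where
  "linear_semicategory C \<longleftrightarrow>
     vector_space (scl C) \<and>
     (\<forall>X\<in>ob C. \<forall>Y\<in>ob C. module.subspace (scl C) (hom C X Y)) \<and>
     (\<forall>X\<in>ob C. \<forall>Y\<in>ob C. \<forall>Z\<in>ob C.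
        (\<forall>g\<in>hom C Y Z. \<forall>f\<in>hom C X Y. cmp C X Y Z g f \<in> hom C X Z) \<and>
        bilinear_on (scl C) (hom C Y Z) (scl C) (hom C X Y) (scl C) (\<lambda>(g, f). cmp C X Y Z g f)) \<and>
     (\<forall>W\<in>ob C. \<forall>X\<in>ob C. \<forall>Y\<in>ob C. \<forall>Z\<in>ob C. \<forall>p\<in>hom C Y Z. \<forall>g\<in>hom C X Y. \<forall>f\<in>hom C W X.
        cmp C W X Z (cmp C X Y Z p g) f = cmp C W Y Z p (cmp C W X Y g f))"

definition left_H_semicategory ::
  "('k::field, 'h::ring_1) hopf \<Rightarrow> ('k, 'h, 'o, 'a::ab_group_add, 'z) semicat_scheme \<Rightarrow> bool"
where
  "left_H_semicategory H C \<longleftrightarrow>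
     linear_semicategory C \<and>
     (\<forall>X\<in>ob C. \<forall>Y\<in>ob C.
        (\<forall>h. \<forall>f\<in>hom C X Y. act C X Y h f \<in> hom C X Y) \<and>
        bilinear_on (hscale H) UNIV (scl C) (hom C X Y) (scl C) (\<lambda>(h, f). act C X Y h f) \<and>
        (\<forall>h h'. \<forall>f\<in>hom C X Y. act C X Y (h * h') f = act C X Y h (act C X Y h' f)) \<and>
        (\<forall>f\<in>hom C X Y. act C X Y 1 f = f)) \<and>
     (\<forall>X\<in>ob C. \<forall>Y\<in>ob C. \<forall>Z\<in>ob C. \<forall>h. \<forall>g\<in>hom C Y Z. \<forall>f\<in>hom C X Y.
        act C X Z h (cmp C X Y Z g f) =
          sweedler H h (\<lambda>h1 h2. cmp C X Y Z (act C Y Z h1 g) (act C X Y h2 f)))"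

definition left_H_category ::
  "('k::field, 'h::ring_1) hopf \<Rightarrow> ('k, 'h, 'o, 'a::ab_group_add, 'z) semicat_scheme \<Rightarrow> bool"
where
  "left_H_category H C \<longleftrightarrow>
     left_H_semicategory H C \<and>
     (\<forall>X\<in>ob C. \<exists>e\<in>hom C X X.
        (\<forall>Y\<in>ob C. (\<forall>f\<in>hom C X Y. cmp C X X Y f e = f) \<and> (\<forall>f\<in>hom C Y X. cmp C Y X X e f = f)) \<and>
        (\<forall>h. act C X X h e = scl C (counit H h) e))"

definition H_semifunctor ::
  "('k::field, 'h, 'o, 'a::ab_group_add, 'z) semicat_scheme \<Rightarrow>
   ('k, 'h, 'p, 'b::ab_group_add, 'y) semicat_scheme \<Rightarrow> ('o \<Rightarrow> 'p) \<Rightarrow> ('o \<Rightarrow> 'o \<Rightarrow> 'a \<Rightarrow> 'b) \<Rightarrow> bool"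
where
  "H_semifunctor C D Fo Fm \<longleftrightarrow>
     (\<forall>X\<in>ob C. Fo X \<in> ob D) \<and>
     (\<forall>X\<in>ob C. \<forall>Y\<in>ob C.
        (\<forall>f\<in>hom C X Y. Fm X Y f \<in> hom D (Fo X) (Fo Y)) \<and>
        linear_on (scl C) (hom C X Y) (scl D) (Fm X Y) \<and>
        (\<forall>h. \<forall>f\<in>hom C X Y. Fm X Y (act C X Y h f) = act D (Fo X) (Fo Y) h (Fm X Y f))) \<and>
     (\<forall>X\<in>ob C. \<forall>Y\<in>ob C. \<forall>Z\<in>ob C. \<forall>g\<in>hom C Y Z. \<forall>f\<in>hom C X Y.
        Fm X Z (cmp C X Y Z g f) = cmp D (Fo X) (Fo Y) (Fo Z) (Fm Y Z g) (Fm X Y f))"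

text \<open>
  Strings of morphisms are written as they are composed: a path with objects
  \<open>[Y\<^sub>0, \<dots>, Y\<^sub>p]\<close> and morphisms \<open>[f\<^sub>0, \<dots>, f\<^sub>p\<^sub>-\<^sub>1]\<close> has \<open>f\<^sub>i : Y\<^sub>i\<^sub>+\<^sub>1 \<rightarrow> Y\<^sub>i\<close>.
\<close>

definition is_path ::
  "('k, 'h, 'o, 'a, 'z) semicat_scheme \<Rightarrow> 'o list \<Rightarrow> 'a list \<Rightarrow> bool"
where
  "is_path C Ys fs \<longleftrightarrow> length Ys = Suc (length fs) \<and> set Ys \<subseteq> ob C \<and>
     (\<forall>i<length fs. fs ! i \<in> hom C (Ys ! Suc i) (Ys ! i))"

fun compose_path ::
  "('k, 'h, 'o, 'a::ab_group_add, 'z) semicat_scheme \<Rightarrow> 'o list \<Rightarrow> 'a list \<Rightarrow> 'a"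
where
  "compose_path C Ys [] = 0"
| "compose_path C Ys [g] = g"
| "compose_path C Ys (g # g' # gs) =
     cmp C (last Ys) (Ys ! 1) (Ys ! 0) g (compose_path C (tl Ys) (g' # gs))"

text \<open>Replace \<open>f\<^sub>i, f\<^sub>i\<^sub>+\<^sub>1\<close> by \<open>f\<^sub>i f\<^sub>i\<^sub>+\<^sub>1\<close>; the object \<open>Y\<^sub>i\<^sub>+\<^sub>1\<close> disappears.\<close>

definition merge :: "('k, 'h, 'o, 'a, 'z) semicat_scheme \<Rightarrow> 'o list \<Rightarrow> nat \<Rightarrow> 'a list \<Rightarrow> 'a list" where
  "merge C Ys i fs =
     take i fs @ cmp C (Ys ! (i + 2)) (Ys ! (i + 1)) (Ys ! i) (fs ! i) (fs ! (i + 1)) # drop (i + 2) fs"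

definition del_nth :: "nat \<Rightarrow> 'o list \<Rightarrow> 'o list" where
  "del_nth i Ys = take i Ys @ drop (Suc i) Ys"

definition act_path ::
  "('k, 'h, 'o, 'a, 'z) semicat_scheme \<Rightarrow> 'o list \<Rightarrow> 'h list \<Rightarrow> 'a list \<Rightarrow> 'a list"
where
  "act_path C Ys hs fs = map (\<lambda>i. act C (Ys ! Suc i) (Ys ! i) (hs ! i) (fs ! i)) [0..<length fs]"

section \<open>Hopf-cyclic cocycles\<close>

text \<open>
  The symbols \<open>f\<^sup>0 \<otimes> \<dots> \<otimes> f\<^sup>n\<close> generating \<open>CN\<^sub>n\<close>, recorded together with the objects
  \<open>[X\<^sub>0, \<dots>, X\<^sub>n]\<close>; here \<open>f\<^sup>n : X\<^sub>0 \<rightarrow> X\<^sub>n\<close>.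
\<close>

definition cn_gens ::
  "('k, 'h, 'o, 'a, 'z) semicat_scheme \<Rightarrow> nat \<Rightarrow> ('o list \<times> 'a list) set"
where
  "cn_gens D n = {(Xs, fs). length fs = Suc n \<and> Xs \<noteq> [] \<and> is_path D (Xs @ [hd Xs]) fs}"

definition cn_forms ::
  "('k::field, 'h, 'o, 'a::ab_group_add, 'z) semicat_scheme \<Rightarrow> nat \<Rightarrow> ('o list \<times> 'a list \<Rightarrow> 'k) set"
where
  "cn_forms D n =
     {\<beta>. \<forall>(Xs, fs)\<in>cn_gens D n. \<forall>i\<le>n.
        linear_on (scl D) (hom D ((Xs @ [hd Xs]) ! Suc i) (Xs ! i)) (*) (\<lambda>g. \<beta> (Xs, fs[i := g]))}"

definition cn_gen ::
  "('k::field, 'h, 'o, 'a::ab_group_add, 'z) semicat_scheme \<Rightarrow> nat \<Rightarrow> 'o list \<times> 'a list \<Rightarrow>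
   ('k, 'o list \<times> 'a list) tens"
where
  "cn_gen D n = elem_tensor (cn_forms D n)"

definition CN ::
  "('k::field, 'h, 'o, 'a::ab_group_add, 'z) semicat_scheme \<Rightarrow> nat \<Rightarrow> ('k, 'o list \<times> 'a list) tens set"
where
  "CN D n = tensor_space (cn_forms D n) (cn_gens D n)"

definition cn_act ::
  "('k::field, 'h::ring_1) hopf \<Rightarrow> ('k, 'h, 'o, 'a::ab_group_add, 'z) semicat_scheme \<Rightarrow> nat \<Rightarrow> 'h \<Rightarrow>
   ('k, 'o list \<times> 'a list) tens \<Rightarrow> ('k, 'o list \<times> 'a list) tens"
where
  "cn_act H D n h = tensor_lift (cn_gen D n) (cn_gens D n)
     (\<lambda>(Xs, fs). sweedlers H (Suc n) h (\<lambda>hs. cn_gen D n (Xs, act_path D (Xs @ [hd Xs]) hs fs)))"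

type_synonym ('k, 'o, 'a, 'm) cochain =
  "('k, 'm \<times> ('k, 'o list \<times> 'a list) tens) tens \<Rightarrow> 'k"

definition mcn ::
  "('k::field, 'h, 'm::ab_group_add) hmod \<Rightarrow> ('k, 'h, 'o, 'a::ab_group_add, 'z) semicat_scheme \<Rightarrow> nat \<Rightarrow>
   'm \<Rightarrow> ('k, 'o list \<times> 'a list) tens \<Rightarrow> ('k, 'm \<times> ('k, 'o list \<times> 'a list) tens) tens"
where
  "mcn M D n = tmul (mscale M) UNIV fscale (CN D n)"

definition MCN ::
  "('k::field, 'h, 'm::ab_group_add) hmod \<Rightarrow> ('k, 'h, 'o, 'a::ab_group_add, 'z) semicat_scheme \<Rightarrow> nat \<Rightarrow>
   ('k, 'm \<times> ('k, 'o list \<times> 'a list) tens) tens set"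
where
  "MCN M D n = tprod (mscale M) UNIV fscale (CN D n)"

definition hopf_cochains ::
  "('k::field_char_0, 'h::ring_1) hopf \<Rightarrow> ('k, 'h, 'o, 'a::ab_group_add, 'z) semicat_scheme \<Rightarrow>
   ('k, 'h, 'm::ab_group_add) hmod \<Rightarrow> nat \<Rightarrow> ('k, 'o, 'a, 'm) cochain set"
where
  "hopf_cochains H D M n =
     {\<phi>. linear_on fscale (MCN M D n) (*) \<phi> \<and>
         (\<forall>h m. \<forall>x\<in>cn_gens D n.
            sweedler H h (\<lambda>h1 h2.
              \<phi> (mcn M D n (ract M m h1) (cn_act H D n (antipode H h2) (cn_gen D n x)))) =
            counit H h * \<phi> (mcn M D n m (cn_gen D n x)))}"

text \<open>The linear map on \<open>M \<otimes> CN\<^sub>n\<close> with the given values on the elements \<open>m \<otimes> f\<^sup>0 \<otimes> \<dots> \<otimes> f\<^sup>n\<close>.\<close>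

definition cochain_of ::
  "('k::field, 'h, 'o, 'a::ab_group_add, 'z) semicat_scheme \<Rightarrow> ('k, 'h, 'm::ab_group_add) hmod \<Rightarrow> nat \<Rightarrow>
   ('m \<Rightarrow> 'o list \<Rightarrow> 'a list \<Rightarrow> 'k) \<Rightarrow> ('k, 'o, 'a, 'm) cochain"
where
  "cochain_of D M n F = tensor_lift (\<lambda>(m, x). mcn M D n m (cn_gen D n x)) (UNIV \<times> cn_gens D n)
     (\<lambda>(m, Xs, fs). F m Xs fs)"

definition face ::
  "('k::field, 'h::ring_1) hopf \<Rightarrow> ('k, 'h, 'o, 'a::ab_group_add, 'z) semicat_scheme \<Rightarrow>
   ('k, 'h, 'm::ab_group_add) hmod \<Rightarrow> nat \<Rightarrow> nat \<Rightarrow> ('k, 'o, 'a, 'm) cochain \<Rightarrow> ('k, 'o, 'a, 'm) cochain"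
where
  "face H D M n i \<phi> = cochain_of D M (Suc n) (\<lambda>m Xs fs.
     if i \<le> n then
       \<phi> (mcn M D n m (cn_gen D n (del_nth (Suc i) Xs, merge D (Xs @ [hd Xs]) i fs)))
     else
       cosweedler H M m (\<lambda>a m0. \<phi> (mcn M D n m0 (cn_gen D n
         (last Xs # butlast (tl Xs),
          cmp D (Xs ! 1) (Xs ! 0) (last Xs) (act D (Xs ! 0) (last Xs) (inv (antipode H) a) (last fs)) (hd fs)
            # butlast (tl fs))))))"

definition coboundary ::
  "('k::field, 'h::ring_1) hopf \<Rightarrow> ('k, 'h, 'o, 'a::ab_group_add, 'z) semicat_scheme \<Rightarrow>
   ('k, 'h, 'm::ab_group_add) hmod \<Rightarrow> nat \<Rightarrow> ('k, 'o, 'a, 'm) cochain \<Rightarrow> ('k, 'o, 'a, 'm) cochain"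
where
  "coboundary H D M n \<phi> = (\<lambda>t. \<Sum>i\<le>Suc n. (-1) ^ i * face H D M n i \<phi> t)"

definition rotation ::
  "('k::field, 'h::ring_1) hopf \<Rightarrow> ('k, 'h, 'o, 'a::ab_group_add, 'z) semicat_scheme \<Rightarrow>
   ('k, 'h, 'm::ab_group_add) hmod \<Rightarrow> nat \<Rightarrow> ('k, 'o, 'a, 'm) cochain \<Rightarrow> ('k, 'o, 'a, 'm) cochain"
where
  "rotation H D M n \<phi> = cochain_of D M n (\<lambda>m Xs fs.
     cosweedler H M m (\<lambda>a m0. \<phi> (mcn M D n m0 (cn_gen D n
       (last Xs # butlast Xs,
        act D (hd Xs) (last Xs) (inv (antipode H) a) (last fs) # butlast fs)))))"

definition hopf_cyclic_cocycles ::
  "('k::field_char_0, 'h::ring_1) hopf \<Rightarrow> ('k, 'h, 'o, 'a::ab_group_add, 'z) semicat_scheme \<Rightarrow>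
   ('k, 'h, 'm::ab_group_add) hmod \<Rightarrow> nat \<Rightarrow> ('k, 'o, 'a, 'm) cochain set"
where
  "hopf_cyclic_cocycles H D M n =
     {\<phi> \<in> hopf_cochains H D M n.
        (\<forall>t\<in>MCN M D (Suc n). coboundary H D M n \<phi> t = 0) \<and>
        (\<forall>t\<in>MCN M D n. (-1) ^ n * rotation H D M n \<phi> t = \<phi> t)}"

section \<open>DGH-semicategories, closed graded traces and cycles\<close>

record ('k, 'h, 'o, 'a) dgsemicat = "('k, 'h, 'o, 'a) semicat" +
  homd :: "nat \<Rightarrow> 'o \<Rightarrow> 'o \<Rightarrow> 'a set"
  dif :: "'o \<Rightarrow> 'o \<Rightarrow> 'a \<Rightarrow> 'a"

text \<open>\<open>hom S X Y\<close> is the internal direct sum of the spaces \<open>homd S n X Y\<close>, \<open>n \<ge> 0\<close>.\<close>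

definition DG_semicategory ::
  "('k::field, 'h, 'o, 'a::ab_group_add, 'z) dgsemicat_scheme \<Rightarrow> bool"
where
  "DG_semicategory S \<longleftrightarrow>
     linear_semicategory S \<and>
     (\<forall>X\<in>ob S. \<forall>Y\<in>ob S.
        (\<forall>n. module.subspace (scl S) (homd S n X Y)) \<and>
        hom S X Y = module.span (scl S) (\<Union>n. homd S n X Y) \<and>
        (\<forall>I x. finite I \<and> (\<forall>n\<in>I. x n \<in> homd S n X Y) \<and> (\<Sum>n\<in>I. x n) = 0 \<longrightarrow> (\<forall>n\<in>I. x n = 0)) \<and>
        linear_on (scl S) (hom S X Y) (scl S) (dif S X Y) \<and>
        (\<forall>n. \<forall>f\<in>homd S n X Y. dif S X Y f \<in> homd S (Suc n) X Y) \<and>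
        (\<forall>f\<in>hom S X Y. dif S X Y (dif S X Y f) = 0)) \<and>
     (\<forall>X\<in>ob S. \<forall>Y\<in>ob S. \<forall>Z\<in>ob S. \<forall>i j. \<forall>g\<in>homd S i Y Z. \<forall>f\<in>homd S j X Y.
        cmp S X Y Z g f \<in> homd S (i + j) X Z \<and>
        dif S X Z (cmp S X Y Z g f) =
          cmp S X Y Z (dif S Y Z g) f + scl S ((-1) ^ i) (cmp S X Y Z g (dif S X Y f)))"

definition DGH_semicategory ::
  "('k::field, 'h::ring_1) hopf \<Rightarrow> ('k, 'h, 'o, 'a::ab_group_add, 'z) dgsemicat_scheme \<Rightarrow> bool"
where
  "DGH_semicategory H S \<longleftrightarrow>
     left_H_semicategory H S \<and> DG_semicategory S \<and>
     (\<forall>X\<in>ob S. \<forall>Y\<in>ob S.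
        (\<forall>n h. \<forall>f\<in>homd S n X Y. act S X Y h f \<in> homd S n X Y) \<and>
        (\<forall>h. \<forall>f\<in>hom S X Y. dif S X Y (act S X Y h f) = act S X Y h (dif S X Y f)))"

definition degree_zero ::
  "('k, 'h, 'o, 'a, 'z) dgsemicat_scheme \<Rightarrow> ('k, 'h, 'o, 'a) semicat"
where
  "degree_zero S = \<lparr>ob = ob S, hom = homd S 0, scl = scl S, cmp = cmp S, act = act S\<rparr>"

definition mten ::
  "('k::field, 'h, 'm::ab_group_add) hmod \<Rightarrow> ('k, 'h, 'o, 'a::ab_group_add, 'z) dgsemicat_scheme \<Rightarrow>
   nat \<Rightarrow> 'o \<Rightarrow> 'm \<Rightarrow> 'a \<Rightarrow> ('k, 'm \<times> 'a) tens"
where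
  "mten M S n X = tmul (mscale M) UNIV (scl S) (homd S n X X)"

definition closed_graded_trace ::
  "('k::field_char_0, 'h::ring_1) hopf \<Rightarrow> ('k, 'h, 'm::ab_group_add) hmod \<Rightarrow> nat \<Rightarrow>
   ('k, 'h, 'o, 'a::ab_group_add, 'z) dgsemicat_scheme \<Rightarrow> ('o \<Rightarrow> ('k, 'm \<times> 'a) tens \<Rightarrow> 'k) \<Rightarrow> bool"
where
  "closed_graded_trace H M n S T \<longleftrightarrow>
     (\<forall>X\<in>ob S. linear_on fscale (tprod (mscale M) UNIV (scl S) (homd S n X X)) (*) (T X)) \<and>
     (\<forall>X\<in>ob S. \<forall>h m. \<forall>f\<in>homd S n X X.
        sweedler H h (\<lambda>h1 h2. T X (mten M S n X (ract M m h1) (act S X X (antipode H h2) f))) =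
        counit H h * T X (mten M S n X m f)) \<and>
     (\<forall>X\<in>ob S. \<forall>m l. Suc l = n \<longrightarrow> (\<forall>f'\<in>homd S l X X. T X (mten M S n X m (dif S X X f')) = 0)) \<and>
     (\<forall>X\<in>ob S. \<forall>Y\<in>ob S. \<forall>m i j. i + j = n \<longrightarrow> (\<forall>g\<in>homd S i X Y. \<forall>g'\<in>homd S j Y X.
        T X (mten M S n X m (cmp S X Y X g' g)) =
        (-1) ^ (i * j) * cosweedler H M m (\<lambda>a m0.
          T Y (mten M S n Y m0 (cmp S Y X Y (act S X Y (inv (antipode H) a) g) g')))))"

definition cycle ::
  "('k::field_char_0, 'h::ring_1) hopf \<Rightarrow> ('k, 'h, 'm::ab_group_add) hmod \<Rightarrow> nat \<Rightarrow>
   ('k, 'h, 'o, 'a::ab_group_add, 'z) dgsemicat_scheme \<Rightarrow> ('o \<Rightarrow> ('k, 'm \<times> 'a) tens \<Rightarrow> 'k) \<Rightarrow> bool"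
where
  "cycle H M n S T \<longleftrightarrow> DGH_semicategory H S \<and> closed_graded_trace H M n S T"

section \<open>The universal DGH-semicategory\<close>

text \<open>
  The symbol \<open>(f\<^sup>0 + \<mu>) df\<^sup>1 \<dots> df\<^sup>n : X \<rightarrow> Y\<close> is encoded as
  \<open>([Y, X\<^sub>1, \<dots>, X\<^sub>n, X], (f\<^sup>0, \<mu>), [f\<^sup>1, \<dots>, f\<^sup>n])\<close>.
\<close>

type_synonym ('k, 'o, 'a) omega_symbol = "'o list \<times> ('a \<times> 'k) \<times> 'a list"
type_synonym ('k, 'o, 'a) omega = "('k, ('k, 'o, 'a) omega_symbol) tens"

definition omega_gens ::
  "('k::field, 'h, 'o, 'a, 'z) semicat_scheme \<Rightarrow> 'o \<Rightarrow> 'o \<Rightarrow> ('k, 'o, 'a) omega_symbol set"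
where
  "omega_gens D X Y =
     {(Ys, (f, \<mu>), fs). is_path D Ys (f # fs) \<and> hd Ys = Y \<and> last Ys = X \<and>
        (fs = [] \<or> Ys ! 1 \<noteq> Y \<longrightarrow> \<mu> = 0)}"

definition omega_forms ::
  "('k::field, 'h, 'o, 'a::ab_group_add, 'z) semicat_scheme \<Rightarrow> (('k, 'o, 'a) omega_symbol \<Rightarrow> 'k) set"
where
  "omega_forms D =
     {\<beta>. \<forall>X\<in>ob D. \<forall>Y\<in>ob D. \<forall>(Ys, a, fs)\<in>omega_gens D X Y.
        linear_on (\<lambda>c (f, \<mu>). (scl D c f, c * \<mu>)) {a'. (Ys, a', fs) \<in> omega_gens D X Y} (*)
          (\<lambda>a'. \<beta> (Ys, a', fs)) \<and>
        (\<forall>i<length fs. linear_on (scl D) (hom D (Ys ! (i + 2)) (Ys ! (i + 1))) (*)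
          (\<lambda>g. \<beta> (Ys, a, fs[i := g])))}"

definition omega_gen ::
  "('k::field, 'h, 'o, 'a::ab_group_add, 'z) semicat_scheme \<Rightarrow> ('k, 'o, 'a) omega_symbol \<Rightarrow>
   ('k, 'o, 'a) omega"
where
  "omega_gen D = elem_tensor (omega_forms D)"

text \<open>
  Applying \<open>(df) g = d(f g) - f dg\<close> repeatedly, with \<open>a\<^sub>0 = f\<^sup>0 + \<mu>\<close>, \<open>a\<^sub>i = f\<^sup>i\<close> for
  \<open>1 \<le> i \<le> n\<close> and \<open>a\<^sub>n\<^sub>+\<^sub>1 = g\<^sup>0\<close>, gives
  \<open>(a\<^sub>0 da\<^sub>1 \<dots> da\<^sub>n) ((g\<^sup>0 + \<nu>) dg\<^sup>1 \<dots> dg\<^sup>m) =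
     (\<Sum>i\<le>n. (-1)\<^sup>n\<^sup>-\<^sup>i a\<^sub>0 da\<^sub>1 \<dots> d(a\<^sub>i a\<^sub>i\<^sub>+\<^sub>1) \<dots> da\<^sub>n\<^sub>+\<^sub>1 dg\<^sup>1 \<dots> dg\<^sup>m) + \<nu> a\<^sub>0 da\<^sub>1 \<dots> da\<^sub>n dg\<^sup>1 \<dots> dg\<^sup>m\<close>,
  where the summand for \<open>i = 0\<close> is \<open>(f\<^sup>0 a\<^sub>1 + \<mu> a\<^sub>1) da\<^sub>2 \<dots>\<close>.
\<close>

definition omega_mult ::
  "('k::field, 'h, 'o, 'a::ab_group_add, 'z) semicat_scheme \<Rightarrow> ('k, 'o, 'a) omega_symbol \<Rightarrow>
   ('k, 'o, 'a) omega_symbol \<Rightarrow> ('k, 'o, 'a) omega"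
where
  "omega_mult D = (\<lambda>(Ys, (f, \<mu>), fs) (Zs, (g, \<nu>), gs).
     let Ws = Ys @ tl Zs; as = fs @ g # gs in
     (\<Sum>i\<le>length fs. fscale ((-1) ^ (length fs - i)) (omega_gen D
        (case i of
           0 \<Rightarrow> (del_nth 1 Ws,
                (cmp D (Ws ! 2) (Ws ! 1) (Ws ! 0) f (hd as) + scl D \<mu> (hd as), 0),
                tl as)
         | Suc j \<Rightarrow> (del_nth (Suc i) Ws, (f, \<mu>), merge D (tl Ws) j as)))) +
     fscale \<nu> (omega_gen D (Ys @ drop 2 Zs, (f, \<mu>), fs @ gs)))"

definition Omega ::
  "('k::field, 'h::ring_1) hopf \<Rightarrow> ('k, 'h, 'o, 'a::ab_group_add, 'z) semicat_scheme \<Rightarrow>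
   ('k, 'h, 'o, ('k, 'o, 'a) omega) dgsemicat"
where
  "Omega H D = \<lparr>
     ob = ob D,
     hom = (\<lambda>X Y. tensor_space (omega_forms D) (omega_gens D X Y)),
     scl = fscale,
     cmp = (\<lambda>X Y Z x y.
       tensor_lift (omega_gen D) (omega_gens D Y Z) (\<lambda>u.
         tensor_lift (omega_gen D) (omega_gens D X Y) (\<lambda>v. omega_mult D u v) y) x),
     act = (\<lambda>X Y h.
       tensor_lift (omega_gen D) (omega_gens D X Y) (\<lambda>(Ys, (f, \<mu>), fs).
         sweedlers H (Suc (length fs)) h (\<lambda>hs. omega_gen D
           (Ys, (act D (Ys ! 1) (Ys ! 0) (hd hs) f, \<mu> * counit H (hd hs)),
            act_path D (tl Ys) (tl hs) fs)))),
     homd = (\<lambda>n X Y. tensor_space (omega_forms D)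
       {(Ys, a, fs). (Ys, a, fs) \<in> omega_gens D X Y \<and> length fs = n}),
     dif = (\<lambda>X Y.
       tensor_lift (omega_gen D) (omega_gens D X Y) (\<lambda>(Ys, (f, \<mu>), fs).
         omega_gen D (Y # Ys, (0, 1), f # fs)))\<rparr>"

text \<open>The element \<open>f\<^sup>0 df\<^sup>1 \<dots> df\<^sup>n\<close> of \<open>Hom\<^sup>n(X\<^sub>0, X\<^sub>0)\<close> attached to \<open>f\<^sup>0 \<otimes> \<dots> \<otimes> f\<^sup>n\<close>.\<close>

definition omega_word ::
  "('k::field, 'h, 'o, 'a::ab_group_add, 'z) semicat_scheme \<Rightarrow> 'o list \<Rightarrow> 'a list \<Rightarrow> ('k, 'o, 'a) omega"
where
  "omega_word D Xs fs = omega_gen D (Xs @ [hd Xs], (hd fs, 0), tl fs)"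

text \<open>The list \<open>[\<partial>(\<rho>(f\<^sub>0)), \<dots>, \<partial>(\<rho>(f\<^sub>p\<^sub>-\<^sub>1))]\<close> for a path with objects \<open>Ys\<close>.\<close>

definition dif_path ::
  "('k, 'h, 'p, 'b, 'y) dgsemicat_scheme \<Rightarrow> ('o \<Rightarrow> 'p) \<Rightarrow> ('o \<Rightarrow> 'o \<Rightarrow> 'a \<Rightarrow> 'b) \<Rightarrow> 'o list \<Rightarrow> 'a list \<Rightarrow> 'b list"
where
  "dif_path S Fo Fm Ys fs = map (\<lambda>i.
     dif S (Fo (Ys ! Suc i)) (Fo (Ys ! i)) (Fm (Ys ! Suc i) (Ys ! i) (fs ! i))) [0..<length fs]"

text \<open>\<open>\<rho>(f) \<partial>(\<rho>(f\<^sub>1)) \<dots> \<partial>(\<rho>(f\<^sub>n))\<close> for a path with objects \<open>Ys\<close> and morphisms \<open>f # fs\<close>.\<close>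

definition image_word ::
  "('k, 'h, 'p, 'b::ab_group_add, 'y) dgsemicat_scheme \<Rightarrow> ('o \<Rightarrow> 'p) \<Rightarrow> ('o \<Rightarrow> 'o \<Rightarrow> 'a \<Rightarrow> 'b) \<Rightarrow>
   'o list \<Rightarrow> 'a \<Rightarrow> 'a list \<Rightarrow> 'b"
where
  "image_word S Fo Fm Ys f fs =
     compose_path S (map Fo Ys) (Fm (Ys ! 1) (Ys ! 0) f # dif_path S Fo Fm (tl Ys) fs)"

definition rho_hat ::
  "('k::field, 'h, 'o, 'a::ab_group_add, 'z) semicat_scheme \<Rightarrow>
   ('k, 'h, 'p, 'b::ab_group_add, 'y) dgsemicat_scheme \<Rightarrow>
   ('o \<Rightarrow> 'p) \<Rightarrow> ('o \<Rightarrow> 'o \<Rightarrow> 'a \<Rightarrow> 'b) \<Rightarrow> 'o \<Rightarrow> 'o \<Rightarrow> ('k, 'o, 'a) omega \<Rightarrow> 'b"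
where
  "rho_hat D S Fo Fm X Y =
     tensor_lift (omega_gen D) (omega_gens D X Y) (\<lambda>(Ys, (f, \<mu>), fs).
       image_word S Fo Fm Ys f fs +
       scl S \<mu> (compose_path S (map Fo (tl Ys)) (dif_path S Fo Fm (tl Ys) fs)))"

section \<open>Characters\<close>

definition is_character ::
  "('k::field_char_0, 'h::ring_1) hopf \<Rightarrow> ('k, 'h, 'o, 'a::ab_group_add, 'z) semicat_scheme \<Rightarrow>
   ('k, 'h, 'm::ab_group_add) hmod \<Rightarrow> nat \<Rightarrow> ('k, 'o, 'a, 'm) cochain \<Rightarrow>
   ('k, 'h, 'p, 'b::ab_group_add, 'y) dgsemicat_scheme \<Rightarrow> ('p \<Rightarrow> ('k, 'm \<times> 'b) tens \<Rightarrow> 'k) \<Rightarrow>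
   ('o \<Rightarrow> 'p) \<Rightarrow> ('o \<Rightarrow> 'o \<Rightarrow> 'a \<Rightarrow> 'b) \<Rightarrow> bool"
where
  "is_character H D M n \<phi> S T Fo Fm \<longleftrightarrow>
     cycle H M n S T \<and> H_semifunctor D (degree_zero S) Fo Fm \<and>
     (\<forall>m. \<forall>(Xs, fs)\<in>cn_gens D n.
        let X0 = hd Xs; x = mcn M D n m (cn_gen D n (Xs, fs)) in
        \<phi> x = T (Fo X0) (mten M S n (Fo X0) m (rho_hat D S Fo Fm X0 X0 (omega_word D Xs fs))) \<and>
        \<phi> x = T (Fo X0) (mten M S n (Fo X0) m
                 (image_word S Fo Fm (Xs @ [hd Xs]) (hd fs) (tl fs))))"

text \<open>
  The first two arguments fix the types of the objects and of the morphisms of the cycle, since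
  HOL has no existential quantification over types.
\<close>

definition character_of_cycle ::
  "'p itself \<Rightarrow> 'b::ab_group_add itself \<Rightarrow>
   ('k::field_char_0, 'h::ring_1) hopf \<Rightarrow> ('k, 'h, 'o, 'a::ab_group_add, 'z) semicat_scheme \<Rightarrow>
   ('k, 'h, 'm::ab_group_add) hmod \<Rightarrow> nat \<Rightarrow> ('k, 'o, 'a, 'm) cochain \<Rightarrow> bool"
where
  "character_of_cycle TO TM H D M n \<phi> \<longleftrightarrow>
     (\<exists>(S :: ('k, 'h, 'p, 'b) dgsemicat) T Fo Fm. is_character H D M n \<phi> S T Fo Fm)"

definition character_of_Omega_trace ::
  "('k::field_char_0, 'h::ring_1) hopf \<Rightarrow> ('k, 'h, 'o, 'a::ab_group_add, 'z) semicat_scheme \<Rightarrow>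
   ('k, 'h, 'm::ab_group_add) hmod \<Rightarrow> nat \<Rightarrow> ('k, 'o, 'a, 'm) cochain \<Rightarrow> bool"
where
  "character_of_Omega_trace H D M n \<phi> \<longleftrightarrow>
     (\<exists>T. closed_graded_trace H M n (Omega H D) T \<and>
        (\<forall>m. \<forall>(Xs, fs)\<in>cn_gens D n.
           \<phi> (mcn M D n m (cn_gen D n (Xs, fs))) =
             T (hd Xs) (mten M (Omega H D) n (hd Xs) m (omega_word D Xs fs))))"

end

theory Submission
  imports Defs
begin

text \<open>
  The universal semicategory is generated by the morphisms \<open>f\<close> under the differential and left
  multiplication, so its structural identities (associativity, equivariance, the extension of a
  semifunctor) follow by induction from the Leibniz rule \<open>(dx) y = d(x y) - (-1)\<^sup>\<bar>\<^sup>x\<^sup>\<bar> x dy\<close>.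
  A cycle pulls its trace back to \<open>\<Omega>(D)\<close>, and \<open>\<Omega>(D)\<close> with a trace is itself a cycle, whence
  (1) and (2) are equivalent.  A trace restricted to the elements \<open>f\<^sup>0 df\<^sup>1 \<dots> df\<^sup>n\<close> is a cyclic cocycle:
  \<open>b\<phi> = 0\<close> is the trace property against a morphism, and \<open>\<lambda>\<phi> = \<phi>\<close> the one against an exact \<open>df\<close>.
  Conversely let \<open>\<phi>\<close> define \<open>T\<close> on \<open>f\<^sup>0 df\<^sup>1 \<dots> df\<^sup>n\<close> and \<open>0\<close> on \<open>df\<^sup>1 \<dots> df\<^sup>n\<close>.  The trace property
  against a morphism is \<open>b\<phi> = 0\<close> together with \<open>\<lambda>\<phi> = \<phi>\<close>; closedness passes it from \<open>x\<close> to \<open>dx\<close>,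
  and coassociativity of the coaction passes it from \<open>f\<close> and \<open>x\<close> to \<open>f x\<close>, because the inverse of the
  antipode reverses the coproduct.
\<close>

section \<open>Linear maps on subspaces\<close>

text \<open>A map out of a tensor product is defined by choosing a sum of elementary tensors, so a
  formula on generators says nothing until the choice is shown to be irrelevant. For Omega this is
  settled once: every symbol splits into \<open>f\<^sup>0 df\<^sup>1 ... df\<^sup>n\<close> plus
  \<mu> times \<open>df\<^sup>1 ... df\<^sup>n\<close>, and a map is given by one multilinear family
  for each kind of word. The explicit alternating sum for the product resists induction; it is shown
  to be the closed form of a recursion, and the recursion takes its place. The value 0 of the trace
  on \<open>df\<^sup>1 ... df\<^sup>n\<close> is forced, because these words are exact. That the
  antipode reverses the coproduct is not among the axioms and has to be derived from them. Degree 0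
  is the exception in the passage from traces to cocycles: no differential can be moved around the
  trace, and \<lambda>\<phi> = \<phi> comes from the identity morphisms of D.\<close>

lemma linear_onI:
  assumes "\<And>x y. x \<in> V \<Longrightarrow> y \<in> V \<Longrightarrow> f (x + y) = f x + f y"
    and "\<And>c x. x \<in> V \<Longrightarrow> f (sV c x) = sW c (f x)"
  shows "linear_on sV V sW f"
  using assms by (simp add: linear_on_def)

lemma linear_on_add: "linear_on sV V sW f \<Longrightarrow> x \<in> V \<Longrightarrow> y \<in> V \<Longrightarrow> f (x + y) = f x + f y"
  by (simp add: linear_on_def)

lemma linear_on_scale: "linear_on sV V sW f \<Longrightarrow> x \<in> V \<Longrightarrow> f (sV c x) = sW c (f x)"
  by (simp add: linear_on_def)

lemma linear_on_0:
  assumes "linear_on sV V sW f" "0 \<in> V"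
  shows "f 0 = 0"
  using linear_on_add [OF assms(1,2,2)] by simp

lemma linear_on_diff:
  assumes "linear_on sV V sW f" "vector_space sV" "module.subspace sV V" "x \<in> V" "y \<in> V"
  shows "f (x - y) = f x - f y"
proof -
  interpret V: vector_space sV by fact
  have "f (x - y) + f y = f (x - y + y)"
    using linear_on_add [OF assms(1), of "x - y" y] V.subspace_diff [OF assms(3)] assms(4,5) by simp
  then show ?thesis by (simp add: algebra_simps)
qed

text \<open>The maps agree on V only; closure of V under the operations makes them agree at x + y
  and at c x too.\<close>

lemma linear_on_cong:
  assumes "linear_on sV V sW f" "module.subspace sV V" "vector_space sV" "\<And>x. x \<in> V \<Longrightarrow> f x = g x"
  shows "linear_on sV V sW g"
proof -
  interpret V: vector_space sV by fact
  show ?thesis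
    using assms V.subspace_add [OF assms(2)] V.subspace_scale [OF assms(2)]
    by (simp add: linear_on_def)
qed

lemma linear_on_comp:
  assumes "linear_on sV V sW f" "linear_on sW W sX g" "\<And>x. x \<in> V \<Longrightarrow> f x \<in> W"
  shows "linear_on sV V sX (\<lambda>x. g (f x))"
  using assms by (simp add: linear_on_def)

lemma linear_on_plus:
  assumes "vector_space sW" "linear_on sV V sW f" "linear_on sV V sW g"
  shows "linear_on sV V sW (\<lambda>x. f x + g x)"
proof -
  interpret W: vector_space sW by fact
  show ?thesis using assms by (simp add: linear_on_def W.scale_right_distrib algebra_simps)
qed

lemma linear_on_scaled:
  assumes "vector_space sW" "linear_on sV V sW f"
  shows "linear_on sV V sW (\<lambda>x. sW c (f x))"
proof -
  interpret W: vector_space sW by fact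
  show ?thesis using assms by (simp add: linear_on_def W.scale_right_distrib mult.commute)
qed

lemma linear_on_zero:
  assumes "vector_space sW"
  shows "linear_on sV V sW (\<lambda>x. 0)"
proof -
  interpret W: vector_space sW by fact
  show ?thesis by (simp add: linear_on_def)
qed

lemma linear_on_sum_list:
  assumes "vector_space sW" "\<And>a. a \<in> set as \<Longrightarrow> linear_on sV V sW (f a)"
  shows "linear_on sV V sW (\<lambda>x. sum_list (map (\<lambda>a. f a x) as))"
  using assms(2)
  by (induction as) (auto intro: linear_on_zero linear_on_plus assms(1))

lemma linear_on_subset: "linear_on sV V sW f \<Longrightarrow> V' \<subseteq> V \<Longrightarrow> linear_on sV V' sW f"
  unfolding linear_on_def by blast

lemma linear_linear_on: "Vector_Spaces.linear sV sW f \<Longrightarrow> linear_on sV V sW f"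
  by (auto simp: linear_on_def Vector_Spaces.linear.axioms module_hom.add module_hom.scale
    linear_iff_module_hom)

lemma sum_list_mem_subspace:
  assumes "vector_space sV" "module.subspace sV V" "\<And>a. a \<in> set as \<Longrightarrow> f a \<in> V"
  shows "sum_list (map f as) \<in> V"
proof -
  interpret V: vector_space sV by fact
  show ?thesis
    using assms(3) V.subspace_0 [OF assms(2)] V.subspace_add [OF assms(2)]
    by (induction as) auto
qed

lemma linear_on_apply_sum_list:
  assumes V: "vector_space sV" "module.subspace sV V" and L: "linear_on sV V sW L"
    and "\<And>a. a \<in> set as \<Longrightarrow> f a \<in> V"
  shows "L (sum_list (map f as)) = sum_list (map (\<lambda>a. L (f a)) as)"
proof -
  interpret V: vector_space sV by fact
  show ?thesis
    using assms(4)
  proof (induction as)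
    case Nil
    show ?case using linear_on_0 [OF L V.subspace_0 [OF V(2)]] by simp
  next
    case (Cons a as)
    then show ?case
      using linear_on_add [OF L, of "f a" "sum_list (map f as)"]
        sum_list_mem_subspace [OF V, of as f] by simp
  qed
qed

lemma vector_space_mult: "vector_space ((*) :: 'k::field \<Rightarrow> 'k \<Rightarrow> 'k)"
  by unfold_locales (auto simp: algebra_simps)

interpretation fscale: vector_space "fscale :: 'k::field \<Rightarrow> ('i \<Rightarrow> 'k) \<Rightarrow> 'i \<Rightarrow> 'k"
  by (rule vector_space_fscale)

text \<open>Fubini for finite lists; it interchanges two independent Sweedler sums.\<close>

lemma sum_list_swap:
  "sum_list (map (\<lambda>a. sum_list (map (\<lambda>b. f a b :: 'w::comm_monoid_add) bs)) as) =
   sum_list (map (\<lambda>b. sum_list (map (\<lambda>a. f a b) as)) bs)"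
  by (induction as) (auto simp: sum_list_addf)

section \<open>Sweedler notation\<close>

text \<open>Composing \<open>F\<close> with a linear functional gives a bilinear form, equal tensors
  agree at every form, and functionals separate points. Hence an equation between tensors, such as
  an axiom on the coproduct, can be read as an equation between sums of values of any bilinear
  map.\<close>

lemma tensor_bilinear_eq:
  fixes sW :: "'k::field \<Rightarrow> 'w::ab_group_add \<Rightarrow> 'w"
  assumes W: "vector_space sW" and F: "bilinear_on sU U sV V sW (case_prod F)"
    and eq: "sum_list (map (case_prod (tmul sU U sV V)) gs) =
      sum_list (map (case_prod (tmul sU U sV V)) hs)"
  shows "sum_list (map (case_prod F) gs) = sum_list (map (case_prod F) hs)"
proof (rule linear_functionals_separate [OF W])
  fix l :: "'w \<Rightarrow> 'k"
  assume l: "Vector_Spaces.linear sW (*) l"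
  interpret l: Vector_Spaces.linear sW "(*)" l by fact
  let ?\<beta> = "\<lambda>(u, v). l (F u v)"
  have \<beta>: "?\<beta> \<in> bilinear_forms sU U sV V"
    using F by (auto simp: bilinear_forms_def bilinear_on_def linear_on_def l.add l.scale)
  have *: "l (sum_list (map (case_prod F) xs)) =
      sum_list (map (case_prod (tmul sU U sV V)) xs) ?\<beta>" for xs
    using \<beta> by (induction xs) (auto simp: l.add l.zero tmul_def elem_tensor_def)
  show "l (sum_list (map (case_prod F) gs)) = l (sum_list (map (case_prod F) hs))"
    by (simp add: * eq)
qed

text \<open>The functional on threefold tensors against which coassociativity is tested.\<close>

lemma trilinear_form:
  fixes sW :: "'k::field \<Rightarrow> 'w::ab_group_add \<Rightarrow> 'w"
  assumes V: "vector_space sV" and X: "vector_space sX" and W: "vector_space sW"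
    and F1: "\<And>x y. linear_on sU UNIV sW (\<lambda>a. F a x y)"
    and F2: "\<And>a y. linear_on sV UNIV sW (\<lambda>x. F a x y)"
    and F3: "\<And>a x. linear_on sX UNIV sW (\<lambda>y. F a x y)"
    and l: "Vector_Spaces.linear sW (*) l"
  defines "\<beta> \<equiv> \<lambda>(a, t). l (tensor_lift (case_prod (tmul sV UNIV sX UNIV)) UNIV (case_prod (F a)) t)"
  shows "\<beta> \<in> bilinear_forms sU UNIV fscale (tprod sV UNIV sX UNIV)"
    and "\<beta> (a, tmul sV UNIV sX UNIV x y) = l (F a x y)"
proof -
  interpret V: vector_space sV by fact
  interpret X: vector_space sX by fact
  interpret W: vector_space sW by fact
  interpret l: Vector_Spaces.linear sW "(*)" l by fact
  let ?L = "\<lambda>a. tensor_lift (case_prod (tmul sV UNIV sX UNIV)) UNIV (case_prod (F a))"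
  have F: "bilinear_on sV UNIV sX UNIV sW (case_prod (F a))" for a
    using F2 F3 by (simp add: bilinear_on_def)
  note u = tprod_universal [OF V V.subspace_UNIV X X.subspace_UNIV W F]
  show "\<beta> (a, tmul sV UNIV sX UNIV x y) = l (F a x y)"
    using u(2) [of x y a] by (simp add: \<beta>_def)
  \<comment> \<open>The decomposition of \<open>t\<close> is chosen without regard to
    \<open>a\<close>, so linearity in \<open>a\<close> holds term by term.\<close>
  have 1: "linear_on sU UNIV sW (\<lambda>a. ?L a t)" for t
    unfolding tensor_lift_def
    by (rule linear_on_sum_list [OF W]) (auto simp: F1 split: prod.splits)
  show "\<beta> \<in> bilinear_forms sU UNIV fscale (tprod sV UNIV sX UNIV)"
    using u(1) 1
    by (auto simp: bilinear_forms_def bilinear_on_def \<beta>_def linear_on_def l.add l.scale)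
qed

definition sw_list :: "('k::field, 'h::ring_1) hopf \<Rightarrow> 'h \<Rightarrow> ('h \<times> 'h) list" where
  "sw_list H h = (SOME gs. set gs \<subseteq> UNIV \<and> sum_list (map (case_prod (hten H)) gs) = comult H h)"

definition cosw_list ::
  "('k::field, 'h::ring_1) hopf \<Rightarrow> ('k, 'h, 'm::ab_group_add) hmod \<Rightarrow> 'm \<Rightarrow> ('h \<times> 'm) list"
where
  "cosw_list H M m =
     (SOME gs. set gs \<subseteq> UNIV \<and> sum_list (map (case_prod (hmten H M)) gs) = coact M m)"

text \<open>
  Since \<^const>\<open>tensor_lift\<close> chooses a decomposition independently of the map, a Sweedler sum is a
  sum over one fixed list.
\<close>

lemma sweedler_eq: "sweedler H h F = sum_list (map (\<lambda>(a, b). F a b) (sw_list H h))"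
  by (simp add: sweedler_def tensor_lift_def sw_list_def)

lemma cosweedler_eq: "cosweedler H M m F = sum_list (map (\<lambda>(a, m0). F a m0) (cosw_list H M m))"
  by (simp add: cosweedler_def tensor_lift_def cosw_list_def)

lemma sweedler_mem:
  assumes "vector_space sV" "module.subspace sV V" "\<And>a b. F a b \<in> V"
  shows "sweedler H h F \<in> V"
  unfolding sweedler_eq by (rule sum_list_mem_subspace [OF assms(1,2)]) (auto simp: assms(3))

lemma linear_on_sweedler:
  assumes "vector_space sV" "module.subspace sV V" "linear_on sV V sW L" "\<And>a b. F a b \<in> V"
  shows "L (sweedler H h F) = sweedler H h (\<lambda>a b. L (F a b))"
  unfolding sweedler_eq
  by (subst linear_on_apply_sum_list [OF assms(1-3)]) (auto simp: assms(4) case_prod_unfold)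

lemma linear_on_cosweedler:
  assumes "vector_space sV" "module.subspace sV V" "linear_on sV V sW L" "\<And>a b. F a b \<in> V"
  shows "L (cosweedler H M m F) = cosweedler H M m (\<lambda>a b. L (F a b))"
  unfolding cosweedler_eq
  by (subst linear_on_apply_sum_list [OF assms(1-3)]) (auto simp: assms(4) case_prod_unfold)

lemma sweedler_swap:
  "sweedler H h (\<lambda>a b. sweedler H h' (\<lambda>c d. F a b c d)) =
   sweedler H h' (\<lambda>c d. sweedler H h (\<lambda>a b. F a b c d))"
  unfolding sweedler_eq case_prod_unfold by (rule sum_list_swap)

lemma sweedler_add: "sweedler H h (\<lambda>a b. F a b + G a b) = sweedler H h F + sweedler H h G"
  unfolding sweedler_eq case_prod_unfold by (rule sum_list_addf)

lemma sweedler_scale: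
  assumes "vector_space sW"
  shows "sweedler H h (\<lambda>a b. sW c (F a b)) = sW c (sweedler H h F)"
proof -
  interpret W: vector_space sW by fact
  show ?thesis
    by (rule linear_on_sweedler [where sV = sW and sW = sW, symmetric, OF assms W.subspace_UNIV])
      (auto simp: linear_on_def W.scale_right_distrib mult.commute)
qed

lemma cosweedler_add:
  "cosweedler H M m (\<lambda>a b. F a b + G a b) = cosweedler H M m F + cosweedler H M m G"
  unfolding cosweedler_eq case_prod_unfold by (rule sum_list_addf)

lemma cosweedler_scale:
  assumes "vector_space sW"
  shows "cosweedler H M m (\<lambda>a b. sW c (F a b)) = sW c (cosweedler H M m F)"
proof -
  interpret W: vector_space sW by fact
  show ?thesis
    by (rule linear_on_cosweedler [where sV = sW and sW = sW, symmetric, OF assms W.subspace_UNIV])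
      (auto simp: linear_on_def W.scale_right_distrib mult.commute)
qed

lemma sweedler_apply: "sweedler H h F \<beta> = sweedler H h (\<lambda>a b. F a b \<beta>)"
  by (simp add: sweedler_eq sum_list_fun_apply case_prod_unfold)

lemma cosweedler_apply: "cosweedler H M m F \<beta> = cosweedler H M m (\<lambda>a b. F a b \<beta>)"
  by (simp add: cosweedler_eq sum_list_fun_apply case_prod_unfold)

text \<open>The parameter enters the summands only; the list of summands depends on \<open>h\<close>
  alone.\<close>

lemma linear_on_sweedler_param:
  assumes "vector_space sW" "\<And>a b. linear_on sV V sW (\<lambda>x. F x a b)"
  shows "linear_on sV V sW (\<lambda>x. sweedler H h (\<lambda>a b. F x a b))"
  unfolding sweedler_eq
  by (rule linear_on_sum_list [OF assms(1)]) (auto simp: assms(2) split: prod.splits)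

lemma linear_on_cosweedler_param:
  assumes "vector_space sW" "\<And>a b. linear_on sV V sW (\<lambda>x. F x a b)"
  shows "linear_on sV V sW (\<lambda>x. cosweedler H M m (\<lambda>a b. F x a b))"
  unfolding cosweedler_eq
  by (rule linear_on_sum_list [OF assms(1)]) (auto simp: assms(2) split: prod.splits)

section \<open>Hopf algebras and SAYD modules in Sweedler notation\<close>

text \<open>The list chosen at x + y has nothing to do with the lists chosen at x and y. Both
  represent the same tensor, though, and a bilinear \<open>F\<close> depends on the tensor only. The
  map \<open>c\<close> stands for the coproduct or the coaction.\<close>

lemma sweedler_linear_gen:
  fixes sW :: "'k::field \<Rightarrow> 'w::ab_group_add \<Rightarrow> 'w"
  assumes W: "vector_space sW" and U: "vector_space sU" and V: "vector_space sV"
    and c: "linear_on sM UNIV fscale c"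
    and l: "\<And>m. sum_list (map (case_prod (tmul sU UNIV sV UNIV)) (L m)) = c m"
    and F: "bilinear_on sU UNIV sV UNIV sW (case_prod F)"
  shows "linear_on sM UNIV sW (\<lambda>m. sum_list (map (case_prod F) (L m)))"
proof -
  interpret W: vector_space sW by fact
  let ?t = "case_prod (tmul sU UNIV sV UNIV)"
  show ?thesis
  proof (rule linear_onI)
    fix x y
    have "sum_list (map ?t (L (x + y))) = sum_list (map ?t (L x @ L y))"
      using linear_on_add [OF c, of x y] by (simp add: l)
    from tensor_bilinear_eq [OF W F this]
    show "sum_list (map (case_prod F) (L (x + y))) =
        sum_list (map (case_prod F) (L x)) + sum_list (map (case_prod F) (L y))" by simp
  next
    fix k x
    \<comment> \<open>A scalar is absorbed into the left leg of each elementary tensor.\<close>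
    let ?L = "map (\<lambda>(a, b). (sU k a, b)) (L x)"
    have "sum_list (map ?t (map (\<lambda>(a, b). (sU k a, b)) gs)) = fscale k (sum_list (map ?t gs))" for gs
      by (induction gs)
        (auto simp: fscale_def fun_eq_iff tmul_def elem_tensor_def bilinear_forms_def
          bilinear_on_def linear_on_def algebra_simps)
    then have "sum_list (map ?t (L (sM k x))) = sum_list (map ?t ?L)"
      using linear_on_scale [OF c, of x k] by (simp add: l)
    from tensor_bilinear_eq [OF W F this]
    have "sum_list (map (case_prod F) (L (sM k x))) = sum_list (map (case_prod F) ?L)" .
    also have "sum_list (map (case_prod F) (map (\<lambda>(a, b). (sU k a, b)) gs)) =
        sW k (sum_list (map (case_prod F) gs))" for gs
      using F by (induction gs) (auto simp: bilinear_on_def linear_on_def W.scale_right_distrib)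
    finally show "sum_list (map (case_prod F) (L (sM k x))) = sW k (sum_list (map (case_prod F) (L x)))" .
  qed
qed

section \<open>The Hopf algebra axioms as identities between Sweedler sums\<close>

locale hopf_alg =
  fixes H :: "('k::field_char_0, 'h::ring_1) hopf"
  assumes hopf: "hopf_algebra H"
begin

lemma hvs: "vector_space (hscale H)"
  using hopf by (simp add: hopf_algebra_def)

sublocale hv: vector_space "hscale H"
  by (rule hvs)

lemma hscale_mult: "hscale H c x * y = hscale H c (x * y)" "x * hscale H c y = hscale H c (x * y)"
proof -
  have "\<forall>c x y. hscale H c (x * y) = hscale H c x * y \<and> hscale H c (x * y) = x * hscale H c y"
    using hopf unfolding hopf_algebra_def by blast
  then show "hscale H c x * y = hscale H c (x * y)" "x * hscale H c y = hscale H c (x * y)"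
    by metis+
qed

lemma linear_antipode: "linear_on (hscale H) UNIV (hscale H) (antipode H)"
  using hopf by (intro linear_linear_on) (simp add: hopf_algebra_def)

lemma bij_antipode: "bij (antipode H)"
  using hopf by (simp add: hopf_algebra_def)

lemma antipode_inv [simp]: "antipode H (inv (antipode H) a) = a" "inv (antipode H) (antipode H a) = a"
  using bij_antipode by (simp_all add: bij_is_surj surj_f_inv_f bij_is_inj)

lemma linear_inv_antipode: "linear_on (hscale H) UNIV (hscale H) (inv (antipode H))"
proof (rule linear_onI)
  fix x y c
  show "inv (antipode H) (x + y) = inv (antipode H) x + inv (antipode H) y"
    using linear_on_add [OF linear_antipode, of "inv (antipode H) x" "inv (antipode H) y"]
    by (metis UNIV_I antipode_inv)
  show "inv (antipode H) (hscale H c x) = hscale H c (inv (antipode H) x)"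
    using linear_on_scale [OF linear_antipode, of "inv (antipode H) x" c]
    by (metis UNIV_I antipode_inv)
qed

lemma sw_list: "sum_list (map (case_prod (hten H)) (sw_list H h)) = comult H h"
proof -
  have "comult H h \<in> hh H"
    using hopf by (auto simp: hopf_algebra_def)
  then have "\<exists>gs. set gs \<subseteq> UNIV \<and> sum_list (map (case_prod (hten H)) gs) = comult H h"
    using tprod_sums [OF hv.subspace_UNIV hvs, of "comult H h" "hscale H" UNIV]
    by (simp add: hh_def hten_def)
  then show ?thesis
    unfolding sw_list_def by (rule someI2_ex) auto
qed

lemma linear_sweedler:
  fixes sW :: "'k \<Rightarrow> 'w::ab_group_add \<Rightarrow> 'w"
  assumes "vector_space sW" "\<And>b. linear_on (hscale H) UNIV sW (\<lambda>a. F a b)"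
    "\<And>a. linear_on (hscale H) UNIV sW (F a)"
  shows "linear_on (hscale H) UNIV sW (\<lambda>h. sweedler H h F)"
  unfolding sweedler_eq
proof (rule sweedler_linear_gen [OF assms(1) hvs hvs])
  show "linear_on (hscale H) UNIV fscale (comult H)"
    using hopf by (intro linear_linear_on) (simp add: hopf_algebra_def)
  show "sum_list (map (case_prod (tmul (hscale H) UNIV (hscale H) UNIV)) (sw_list H m)) = comult H m" for m
    using sw_list by (simp add: hten_def)
  show "bilinear_on (hscale H) UNIV (hscale H) UNIV sW (case_prod F)"
    using assms by (simp add: bilinear_on_def)
qed

lemma linear_mult_left: "linear_on (hscale H) UNIV (hscale H) (\<lambda>x. x * c)"
  by (simp add: linear_on_def distrib_right hscale_mult)

lemma linear_mult_right: "linear_on (hscale H) UNIV (hscale H) (\<lambda>x. c * x)"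
  by (simp add: linear_on_def distrib_left hscale_mult)

lemma linear_hcomp:
  assumes "linear_on (hscale H) UNIV sW F" "linear_on (hscale H) UNIV (hscale H) g"
  shows "linear_on (hscale H) UNIV sW (\<lambda>x. F (g x))"
  by (rule linear_on_comp [OF assms(2,1)]) auto

text \<open>The axiom is an equality in H \<otimes> (H \<otimes> H), whose elements are functions of
  bilinear forms. Evaluating it at the form made of \<open>F\<close> and a functional
  \<open>l\<close> gives the claim after \<open>l\<close>, and functionals separate points.\<close>

lemma sweedler_coassoc:
  fixes sW :: "'k \<Rightarrow> 'w::ab_group_add \<Rightarrow> 'w"
  assumes W: "vector_space sW"
    and F1: "\<And>x y. linear_on (hscale H) UNIV sW (\<lambda>a. F a x y)"
    and F2: "\<And>a y. linear_on (hscale H) UNIV sW (\<lambda>x. F a x y)"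
    and F3: "\<And>a x. linear_on (hscale H) UNIV sW (\<lambda>y. F a x y)"
  shows "sweedler H h (\<lambda>a b. sweedler H a (\<lambda>a1 a2. F a1 a2 b)) =
    sweedler H h (\<lambda>a b. sweedler H b (\<lambda>b1 b2. F a b1 b2))"
proof (rule linear_functionals_separate [OF W])
  fix l :: "'w \<Rightarrow> 'k"
  assume l: "Vector_Spaces.linear sW (*) l"
  have ll: "linear_on sW UNIV (*) l" by (rule linear_linear_on [OF l])
  interpret W: vector_space sW by fact
  note lsw = linear_on_sweedler [OF W W.subspace_UNIV ll UNIV_I]
  define \<beta> where "\<beta> = (\<lambda>(a, t). l (tensor_lift (case_prod (hten H)) UNIV (case_prod (F a)) t))"
  note tf = trilinear_form [OF hvs hvs W F1 F2 F3 l, folded hten_def hh_def, folded \<beta>_def]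
  have *: "tmul (hscale H) UNIV fscale (hh H) a t \<beta> = \<beta> (a, t)" for a t
    using tf(1) by (simp add: tmul_def elem_tensor_def)
  \<comment> \<open>The second leg is the tensor \<open>comult H b\<close> itself rather than an
    elementary one; lifting \<open>F a\<close> over it is by definition a Sweedler sum.\<close>
  have comul: "\<beta> (a, comult H b) = sweedler H b (\<lambda>b1 b2. l (F a b1 b2))" for a b
    by (simp add: \<beta>_def lsw flip: sweedler_def)
  have "sweedler H h (\<lambda>a b. sweedler H a (\<lambda>a1 a2. tmul (hscale H) UNIV fscale (hh H) a1 (hten H a2 b))) \<beta> =
      sweedler H h (\<lambda>a b. tmul (hscale H) UNIV fscale (hh H) a (comult H b)) \<beta>"
    using hopf by (simp add: hopf_algebra_def)
  then show "l (sweedler H h (\<lambda>a b. sweedler H a (\<lambda>a1 a2. F a1 a2 b))) =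
      l (sweedler H h (\<lambda>a b. sweedler H b (\<lambda>b1 b2. F a b1 b2)))"
    by (simp add: sweedler_apply * tf(2) lsw comul)
qed

lemma sweedler_counit_left:
  assumes "vector_space sW" "linear_on (hscale H) UNIV sW F"
  shows "sweedler H h (\<lambda>a b. sW (counit H a) (F b)) = F h"
proof -
  have "F h = F (sweedler H h (\<lambda>a b. hscale H (counit H a) b))"
    using hopf by (simp add: hopf_algebra_def)
  also have "\<dots> = sweedler H h (\<lambda>a b. F (hscale H (counit H a) b))"
    by (rule linear_on_sweedler [OF hvs hv.subspace_UNIV assms(2)]) auto
  finally show ?thesis using linear_on_scale [OF assms(2)] by simp
qed

lemma sweedler_counit_right:
  assumes "vector_space sW" "linear_on (hscale H) UNIV sW F"
  shows "sweedler H h (\<lambda>a b. sW (counit H b) (F a)) = F h"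
proof -
  have "F h = F (sweedler H h (\<lambda>a b. hscale H (counit H b) a))"
    using hopf by (simp add: hopf_algebra_def)
  also have "\<dots> = sweedler H h (\<lambda>a b. F (hscale H (counit H b) a))"
    by (rule linear_on_sweedler [OF hvs hv.subspace_UNIV assms(2)]) auto
  finally show ?thesis using linear_on_scale [OF assms(2)] by simp
qed

lemma sweedler_antipode_left:
  assumes "linear_on (hscale H) UNIV sW F"
  shows "sweedler H h (\<lambda>a b. F (antipode H a * b)) = sW (counit H h) (F 1)"
proof -
  have "sweedler H h (\<lambda>a b. F (antipode H a * b)) = F (sweedler H h (\<lambda>a b. antipode H a * b))"
    by (rule linear_on_sweedler [symmetric, OF hvs hv.subspace_UNIV assms]) auto
  also have "\<dots> = F (hscale H (counit H h) 1)"
    using hopf by (simp add: hopf_algebra_def)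
  finally show ?thesis using linear_on_scale [OF assms] by simp
qed

lemma sweedler_antipode_right:
  assumes "linear_on (hscale H) UNIV sW F"
  shows "sweedler H h (\<lambda>a b. F (a * antipode H b)) = sW (counit H h) (F 1)"
proof -
  have "sweedler H h (\<lambda>a b. F (a * antipode H b)) = F (sweedler H h (\<lambda>a b. a * antipode H b))"
    by (rule linear_on_sweedler [symmetric, OF hvs hv.subspace_UNIV assms]) auto
  also have "\<dots> = F (hscale H (counit H h) 1)"
    using hopf by (simp add: hopf_algebra_def)
  finally show ?thesis using linear_on_scale [OF assms] by simp
qed

lemma sweedler_mult:
  fixes sW :: "'k \<Rightarrow> 'w::ab_group_add \<Rightarrow> 'w"
  assumes W: "vector_space sW" and "\<And>b. linear_on (hscale H) UNIV sW (\<lambda>a. F a b)"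
    "\<And>a. linear_on (hscale H) UNIV sW (F a)"
  shows "sweedler H (x * y) F =
    sweedler H x (\<lambda>x1 x2. sweedler H y (\<lambda>y1 y2. F (x1 * y1) (x2 * y2)))"
proof -
  \<comment> \<open>A decomposition of the product of the two coproducts, assembled from those
    chosen at \<open>x\<close> and \<open>y\<close>. It represents the same tensor as the one chosen
    at \<open>x * y\<close>.\<close>
  let ?gs = "concat (map (\<lambda>(x1, x2). map (\<lambda>(y1, y2). (x1 * y1, x2 * y2)) (sw_list H y)) (sw_list H x))"
  have *: "sum_list (map (case_prod G) ?gs) =
      sweedler H x (\<lambda>x1 x2. sweedler H y (\<lambda>y1 y2. G (x1 * y1) (x2 * y2)))"
    for G :: "'h \<Rightarrow> 'h \<Rightarrow> 'v::ab_group_add"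
  proof -
    have "sum_list (map (case_prod G) (concat (map (\<lambda>(x1, x2). map (\<lambda>(y1, y2). (x1 * y1, x2 * y2)) ys) xs))) =
      sum_list (map (\<lambda>(x1, x2). sum_list (map (\<lambda>(y1, y2). G (x1 * y1) (x2 * y2)) ys)) xs)" for xs ys
      by (induction xs) (auto simp: comp_def case_prod_unfold)
    then show ?thesis by (simp add: sweedler_eq)
  qed
  have "sum_list (map (case_prod (hten H)) (sw_list H (x * y))) = sum_list (map (case_prod (hten H)) ?gs)"
    unfolding sw_list * using hopf by (simp add: hopf_algebra_def)
  moreover have "bilinear_on (hscale H) UNIV (hscale H) UNIV sW (case_prod F)"
    using assms by (simp add: bilinear_on_def)
  ultimately show ?thesis
    using tensor_bilinear_eq [OF W, where gs = "sw_list H (x * y)" and hs = ?gs] * [of F]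
    by (simp add: hten_def sweedler_eq)
qed

lemma sweedler_1:
  fixes sW :: "'k \<Rightarrow> 'w::ab_group_add \<Rightarrow> 'w"
  assumes W: "vector_space sW" and "\<And>b. linear_on (hscale H) UNIV sW (\<lambda>a. F a b)"
    "\<And>a. linear_on (hscale H) UNIV sW (F a)"
  shows "sweedler H 1 F = F 1 1"
proof -
  have "sum_list (map (case_prod (hten H)) (sw_list H 1)) = sum_list (map (case_prod (hten H)) [(1, 1)])"
    unfolding sw_list using hopf by (simp add: hopf_algebra_def)
  from tensor_bilinear_eq [OF W _ this [unfolded hten_def], of F]
  show ?thesis
    unfolding sweedler_eq using assms by (auto simp: bilinear_on_def)
qed

text \<open>
  Uniqueness of convolution inverses: \<open>h \<mapsto> S h\<^sub>(\<^sub>1\<^sub>) \<otimes> S h\<^sub>(\<^sub>2\<^sub>)\<close> (the coproduct of \<open>S h\<close>) and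
  \<open>h \<mapsto> S h\<^sub>2 \<otimes> S h\<^sub>1\<close> are a left and a right convolution inverse of the coproduct.
\<close>

lemma sweedler_antipode:
  fixes sW :: "'k \<Rightarrow> 'w::ab_group_add \<Rightarrow> 'w"
  assumes W: "vector_space sW" and F1: "\<And>b. linear_on (hscale H) UNIV sW (\<lambda>a. F a b)"
    and F2: "\<And>a. linear_on (hscale H) UNIV sW (F a)"
  shows "sweedler H (antipode H h) F = sweedler H h (\<lambda>a b. F (antipode H b) (antipode H a))"
proof -
  \<comment> \<open>\<open>K\<close> is the integrand of the triple convolution of the coproduct
    after S, the coproduct, and the flipped S \<otimes> S. Coassociativity lets it be summed with
    either pair bracketed first.\<close>
  define K where "K = (\<lambda>a c e. sweedler H (antipode H a) (\<lambda>p q. sweedler H c (\<lambda>r s. sweedler H e (\<lambda>u v.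
      F (p * r * antipode H v) (q * s * antipode H u)))))"
  have multl: "linear_on (hscale H) UNIV (hscale H) (\<lambda>x. x * c * d)" and multr: "linear_on (hscale H) UNIV (hscale H) (\<lambda>x. c * x * d)"
    and Smult: "linear_on (hscale H) UNIV (hscale H) (\<lambda>x. c * antipode H x)" for c d
    using linear_on_comp [OF linear_mult_left linear_mult_left]
      linear_on_comp [OF linear_mult_right linear_mult_left]
      linear_on_comp [OF linear_antipode linear_mult_right] by auto
  have F1': "linear_on (hscale H) UNIV sW (\<lambda>x. F (f x) b)" if "linear_on (hscale H) UNIV (hscale H) f" for f b
    by (rule linear_hcomp [OF F1 that])
  have F2': "linear_on (hscale H) UNIV sW (\<lambda>x. F a (f x))" if "linear_on (hscale H) UNIV (hscale H) f" for f a
    by (rule linear_hcomp [OF F2 that])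
  note fl = F1' F2' multl multr Smult
  have Ka: "linear_on (hscale H) UNIV sW (\<lambda>a. K a c e)" for c e
    unfolding K_def
    by (rule linear_hcomp [OF _ linear_antipode], rule linear_sweedler [OF W];
        intro linear_on_sweedler_param W fl)
  have Kc: "linear_on (hscale H) UNIV sW (\<lambda>c. K a c e)" for a e
    unfolding K_def
    by (rule linear_on_sweedler_param [OF W], rule linear_sweedler [OF W];
        intro linear_on_sweedler_param W fl)
  have Ke: "linear_on (hscale H) UNIV sW (\<lambda>e. K a c e)" for a c
    unfolding K_def
    by (rule linear_on_sweedler_param [OF W], rule linear_on_sweedler_param [OF W], rule linear_sweedler [OF W];
        intro linear_on_sweedler_param W fl)
  \<comment> \<open>The legs of \<open>b\<close> stand in the order r, s, u, v: first s meets S u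
    and leaves a counit, then r meets S v.\<close>
  have inv_r: "sweedler H b (\<lambda>c e. sweedler H c (\<lambda>r s. sweedler H e (\<lambda>u v.
      F (p * r * antipode H v) (q * s * antipode H u)))) = sW (counit H b) (F p q)" for b p q
  proof -
    have "sweedler H b (\<lambda>c e. sweedler H c (\<lambda>r s. sweedler H e (\<lambda>u v. F (p * r * antipode H v) (q * s * antipode H u)))) =
        sweedler H b (\<lambda>r x. sweedler H x (\<lambda>s e. sweedler H e (\<lambda>u v. F (p * r * antipode H v) (q * s * antipode H u))))"
      by (rule sweedler_coassoc [OF W]; intro linear_on_sweedler_param linear_sweedler W fl)
    also have "\<dots> = sweedler H b (\<lambda>r x. F (p * r * antipode H x) q)"
    proof -
      have "sweedler H x (\<lambda>s e. sweedler H e (\<lambda>u v. F (p * r * antipode H v) (q * s * antipode H u))) = F (p * r * antipode H x) q"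
        for r x
      proof -
        have "sweedler H x (\<lambda>s e. sweedler H e (\<lambda>u v. F (p * r * antipode H v) (q * s * antipode H u))) =
            sweedler H x (\<lambda>y v. sweedler H y (\<lambda>s u. F (p * r * antipode H v) (q * s * antipode H u)))"
          by (rule sweedler_coassoc [OF W, symmetric]; intro linear_on_sweedler_param linear_sweedler W fl)
        also have "\<dots> = sweedler H x (\<lambda>y v. sW (counit H y) (F (p * r * antipode H v) q))"
          using sweedler_antipode_right [OF F2' [OF linear_mult_right]]
          by (simp add: mult.assoc)
        also have "\<dots> = F (p * r * antipode H x) q"
          by (rule sweedler_counit_left [OF W]; intro fl)
        finally show ?thesis .
      qed
      then show ?thesis by simp
    qed
    also have "\<dots> = sW (counit H b) (F p q)"
      using sweedler_antipode_right [OF F1' [OF linear_mult_right], of b p q]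
      by (simp add: mult.assoc)
    finally show ?thesis .
  qed
  have "sweedler H h (\<lambda>a b. sweedler H b (\<lambda>c e. K a c e)) =
      sweedler H h (\<lambda>a b. sweedler H (antipode H a) (\<lambda>p q. sW (counit H b) (F p q)))"
    unfolding K_def
    by (subst sweedler_swap [where h' = "antipode H _"]) (simp add: inv_r)
  also have "\<dots> = sweedler H h (\<lambda>a b. sW (counit H b) (sweedler H (antipode H a) F))"
    by (simp add: sweedler_scale [OF W])
  also have "\<dots> = sweedler H (antipode H h) F"
    by (rule sweedler_counit_right [OF W], rule linear_hcomp [OF _ linear_antipode],
        rule linear_sweedler [OF W F1 F2])
  finally have 1: "sweedler H h (\<lambda>a b. sweedler H b (\<lambda>c e. K a c e)) = sweedler H (antipode H h) F" .
  \<comment> \<open>What remains of \<open>K\<close> once its first two factors are joined: by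
    multiplicativity they form the coproduct of \<open>antipode H a1 * a2\<close>, which collapses
    to a counit.\<close>
  define G where "G = (\<lambda>b x y. sweedler H b (\<lambda>u v. F (x * antipode H v) (y * antipode H u)))"
  have G1: "linear_on (hscale H) UNIV sW (\<lambda>x. G b x y)" and G2: "linear_on (hscale H) UNIV sW (\<lambda>y. G b x y)" for b x y
    unfolding G_def by (intro linear_on_sweedler_param W F1' F2' linear_mult_left)+
  have "sweedler H h (\<lambda>a b. sweedler H a (\<lambda>a1 a2. K a1 a2 b)) =
      sweedler H h (\<lambda>a b. sweedler H a (\<lambda>a1 a2. sweedler H (antipode H a1 * a2) (G b)))"
    by (simp add: K_def G_def sweedler_mult [OF W G1 G2, unfolded G_def])
  also have "\<dots> = sweedler H h (\<lambda>a b. sW (counit H a) (G b 1 1))"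
    using sweedler_antipode_left [OF linear_sweedler [OF W G1 G2]] sweedler_1 [OF W G1 G2]
    by simp
  also have "\<dots> = G h 1 1"
    unfolding G_def
    by (rule sweedler_counit_left [OF W], rule linear_sweedler [OF W]; simp; intro F1' F2' linear_antipode)
  finally have 2: "sweedler H h (\<lambda>a b. sweedler H a (\<lambda>a1 a2. K a1 a2 b)) =
      sweedler H h (\<lambda>a b. F (antipode H b) (antipode H a))" by (simp add: G_def)
  have "sweedler H h (\<lambda>a b. sweedler H a (\<lambda>a1 a2. K a1 a2 b)) =
      sweedler H h (\<lambda>a b. sweedler H b (\<lambda>c e. K a c e))"
    by (rule sweedler_coassoc [OF W Ka Kc Ke])
  then show ?thesis using 1 2 by simp
qed

text \<open>This is \<open>sweedler_antipode\<close> at the preimage of \<open>h\<close>, with both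
  arguments of \<open>F\<close> precomposed with the inverse. It is needed when a twist is
  distributed over the factors of a composite.\<close>

lemma sweedler_inv_antipode:
  fixes sW :: "'k \<Rightarrow> 'w::ab_group_add \<Rightarrow> 'w"
  assumes W: "vector_space sW" and F1: "\<And>b. linear_on (hscale H) UNIV sW (\<lambda>a. F a b)"
    and F2: "\<And>a. linear_on (hscale H) UNIV sW (F a)"
  shows "sweedler H (inv (antipode H) h) F = sweedler H h (\<lambda>a b. F (inv (antipode H) b) (inv (antipode H) a))"
  using sweedler_antipode [OF W, of "\<lambda>a b. F (inv (antipode H) b) (inv (antipode H) a)" "inv (antipode H) h"]
    linear_hcomp [OF F1 linear_inv_antipode] linear_hcomp [OF F2 linear_inv_antipode]
  by simp

end

section \<open>The coaction of an SAYD module in Sweedler notation\<close>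

locale sayd = hopf_alg H for H :: "('k::field_char_0, 'h::ring_1) hopf" +
  fixes M :: "('k, 'h, 'm::ab_group_add) hmod"
  assumes sayd: "sayd_module H M"
begin

lemma mvs: "vector_space (mscale M)"
  using sayd by (simp add: sayd_module_def)

sublocale mv: vector_space "mscale M"
  by (rule mvs)

lemma cosw_list: "sum_list (map (case_prod (hmten H M)) (cosw_list H M m)) = coact M m"
proof -
  have "coact M m \<in> hm H M"
    using sayd by (auto simp: sayd_module_def)
  then have "\<exists>gs. set gs \<subseteq> UNIV \<and> sum_list (map (case_prod (hmten H M)) gs) = coact M m"
    using tprod_sums [OF hv.subspace_UNIV hvs, of "coact M m" "mscale M" UNIV]
    by (simp add: hm_def hmten_def)
  then show ?thesis
    unfolding cosw_list_def by (rule someI2_ex) auto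
qed

lemma linear_cosweedler:
  fixes sW :: "'k \<Rightarrow> 'w::ab_group_add \<Rightarrow> 'w"
  assumes "vector_space sW" "\<And>b. linear_on (hscale H) UNIV sW (\<lambda>a. F a b)"
    "\<And>a. linear_on (mscale M) UNIV sW (F a)"
  shows "linear_on (mscale M) UNIV sW (\<lambda>m. cosweedler H M m F)"
  unfolding cosweedler_eq
proof (rule sweedler_linear_gen [OF assms(1) hvs mvs])
  show "linear_on (mscale M) UNIV fscale (coact M)"
    using sayd by (intro linear_linear_on) (simp add: sayd_module_def)
  show "sum_list (map (case_prod (tmul (hscale H) UNIV (mscale M) UNIV)) (cosw_list H M m)) = coact M m" for m
    using cosw_list by (simp add: hmten_def)
  show "bilinear_on (hscale H) UNIV (mscale M) UNIV sW (case_prod F)"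
    using assms by (simp add: bilinear_on_def)
qed

text \<open>As for the coproduct: the comodule axiom is evaluated at the form on H \<otimes> (H
  \<otimes> M) made of \<open>F\<close> and a functional. It later identifies two successive twists
  around the trace with one twist by a coproduct.\<close>

lemma cosweedler_coassoc:
  fixes sW :: "'k \<Rightarrow> 'w::ab_group_add \<Rightarrow> 'w"
  assumes W: "vector_space sW"
    and F1: "\<And>x y. linear_on (hscale H) UNIV sW (\<lambda>a. F a x y)"
    and F2: "\<And>a y. linear_on (hscale H) UNIV sW (\<lambda>x. F a x y)"
    and F3: "\<And>a x. linear_on (mscale M) UNIV sW (\<lambda>y. F a x y)"
  shows "cosweedler H M m (\<lambda>a m0. sweedler H a (\<lambda>a1 a2. F a1 a2 m0)) =
    cosweedler H M m (\<lambda>a m0. cosweedler H M m0 (\<lambda>b m00. F a b m00))"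
proof (rule linear_functionals_separate [OF W])
  fix l :: "'w \<Rightarrow> 'k"
  assume l: "Vector_Spaces.linear sW (*) l"
  have ll: "linear_on sW UNIV (*) l" by (rule linear_linear_on [OF l])
  interpret W: vector_space sW by fact
  note lsw = linear_on_sweedler [OF W W.subspace_UNIV ll UNIV_I]
    linear_on_cosweedler [OF W W.subspace_UNIV ll UNIV_I]
  define \<beta> where "\<beta> = (\<lambda>(a, t). l (tensor_lift (case_prod (hmten H M)) UNIV (case_prod (F a)) t))"
  note tf = trilinear_form [OF hvs mvs W F1 F2 F3 l, folded hmten_def hm_def, folded \<beta>_def]
  have *: "tmul (hscale H) UNIV fscale (hm H M) a t \<beta> = \<beta> (a, t)" for a t
    using tf(1) by (simp add: tmul_def elem_tensor_def)
  have comul: "\<beta> (a, coact M b) = cosweedler H M b (\<lambda>b1 b2. l (F a b1 b2))" for a b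
    by (simp add: \<beta>_def lsw flip: cosweedler_def)
  have "cosweedler H M m (\<lambda>a m0. sweedler H a (\<lambda>a1 a2. tmul (hscale H) UNIV fscale (hm H M) a1 (hmten H M a2 m0))) \<beta> =
      cosweedler H M m (\<lambda>a m0. tmul (hscale H) UNIV fscale (hm H M) a (coact M m0)) \<beta>"
    using sayd by (simp add: sayd_module_def)
  then show "l (cosweedler H M m (\<lambda>a m0. sweedler H a (\<lambda>a1 a2. F a1 a2 m0))) =
      l (cosweedler H M m (\<lambda>a m0. cosweedler H M m0 (\<lambda>b m00. F a b m00)))"
    by (simp add: sweedler_apply cosweedler_apply * tf(2) lsw comul)
qed

end

section \<open>Multilinear maps on paths\<close>

text \<open>For a functional \<open>l\<close>, the value of \<open>l\<close> on the lift at
  \<open>t\<close> is \<open>t\<close> evaluated at the form \<open>l\<close> after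
  \<open>F'\<close>; it depends on \<open>t\<close> alone, and linearly. Membership in
  \<open>\<Phi>\<close> concerns all symbols, whereas a formula is meaningful on \<open>G\<close>
  only, hence the extension \<open>F'\<close> of \<open>F\<close>.\<close>

lemma elem_tensor_lift:
  fixes sW :: "'k::field \<Rightarrow> 'w::ab_group_add \<Rightarrow> 'w" and F :: "'g \<Rightarrow> 'w"
  assumes W: "vector_space sW"
    and scale: "\<And>c g. g \<in> G \<Longrightarrow> \<exists>g'\<in>G. elem_tensor \<Phi> g' = fscale c (elem_tensor \<Phi> g)"
    and F': "\<And>l. Vector_Spaces.linear sW (*) l \<Longrightarrow> (\<lambda>g. l (F' g)) \<in> \<Phi>"
    and F: "\<And>g. g \<in> G \<Longrightarrow> F g = F' g"
  shows "linear_on fscale (tensor_space \<Phi> G) sW (tensor_lift (elem_tensor \<Phi>) G F)"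
    and "g \<in> G \<Longrightarrow> tensor_lift (elem_tensor \<Phi>) G F (elem_tensor \<Phi> g) = F g"
proof -
  let ?L = "tensor_lift (elem_tensor \<Phi>) G F"
  interpret W: vector_space sW by fact
  have L: "l (?L t) = t (\<lambda>g. l (F' g))"
    if l: "Vector_Spaces.linear sW (*) l" and t: "t \<in> tensor_space \<Phi> G" for l t
  proof -
    interpret l: Vector_Spaces.linear sW "(*)" l by fact
    define hs where "hs = (SOME gs. set gs \<subseteq> G \<and> sum_list (map (elem_tensor \<Phi>) gs) = t)"
    have hs: "set hs \<subseteq> G \<and> sum_list (map (elem_tensor \<Phi>) hs) = t"
      unfolding hs_def by (rule someI_ex, rule tensor_space_sums [OF scale t])
    have "l (sum_list (map F gs)) = sum_list (map (elem_tensor \<Phi>) gs) (\<lambda>g. l (F' g))"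
      if "set gs \<subseteq> G" for gs
      using F' [OF l] that by (induction gs) (auto simp: l.add l.zero elem_tensor_def F)
    then show ?thesis using hs by (auto simp: tensor_lift_def hs_def [symmetric])
  qed
  have sub: "fscale.subspace (tensor_space \<Phi> G)"
    unfolding tensor_space_def by (rule fscale.subspace_span)
  show "linear_on fscale (tensor_space \<Phi> G) sW ?L"
  proof (rule linear_onI; rule linear_functionals_separate [OF W])
    fix x y and l :: "'w \<Rightarrow> 'k"
    assume xy: "x \<in> tensor_space \<Phi> G" "y \<in> tensor_space \<Phi> G" and l: "Vector_Spaces.linear sW (*) l"
    interpret l: Vector_Spaces.linear sW "(*)" l by fact
    show "l (?L (x + y)) = l (?L x + ?L y)"
      using xy fscale.subspace_add [OF sub xy] by (simp add: L [OF l] l.add)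
  next
    fix c x and l :: "'w \<Rightarrow> 'k"
    assume x: "x \<in> tensor_space \<Phi> G" and l: "Vector_Spaces.linear sW (*) l"
    interpret l: Vector_Spaces.linear sW "(*)" l by fact
    show "l (?L (fscale c x)) = l (sW c (?L x))"
      using x fscale.subspace_scale [OF sub x] by (simp add: L [OF l] l.scale fscale_def)
  qed
  show "?L (elem_tensor \<Phi> g) = F g" if g: "g \<in> G"
  proof (rule linear_functionals_separate [OF W])
    fix l :: "'w \<Rightarrow> 'k" assume l: "Vector_Spaces.linear sW (*) l"
    have "elem_tensor \<Phi> g \<in> tensor_space \<Phi> G"
      unfolding tensor_space_def using g by (intro fscale.span_base) auto
    then show "l (?L (elem_tensor \<Phi> g)) = l (F g)"
      using F' [OF l] F [OF g] by (simp add: L [OF l] elem_tensor_def)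
  qed
qed

text \<open>The number of slots varies with the path, so slot i is isolated by a list update; only
  values on genuine paths are constrained.\<close>

definition multilin ::
  "('k::field, 'h, 'o, 'a::ab_group_add, 'z) semicat_scheme \<Rightarrow> ('k \<Rightarrow> 'w::ab_group_add \<Rightarrow> 'w) \<Rightarrow>
   'o list \<Rightarrow> ('a list \<Rightarrow> 'w) \<Rightarrow> bool"
where
  "multilin D sW Ys F \<longleftrightarrow> (\<forall>fs. is_path D Ys fs \<longrightarrow> (\<forall>i<length fs.
     linear_on (scl D) (hom D (Ys ! Suc i) (Ys ! i)) sW (\<lambda>g. F (fs[i := g]))))"

text \<open>Objects are listed as in a composite, so the target stands at the head and the source at
  the end, whereas the arguments follow the order of \<open>hom D X Y\<close>.\<close>

definition path_between ::
  "('k, 'h, 'o, 'a, 'z) semicat_scheme \<Rightarrow> 'o \<Rightarrow> 'o \<Rightarrow> 'o list \<Rightarrow> 'a list \<Rightarrow> bool"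
where
  "path_between D X Y Ys fs \<longleftrightarrow> is_path D Ys fs \<and> hd Ys = Y \<and> last Ys = X"

lemma is_path_Nil: "is_path D Ys [] \<longleftrightarrow> (\<exists>Y\<in>ob D. Ys = [Y])"
  by (auto simp: is_path_def length_Suc_conv)

lemma is_path_Cons:
  "is_path D (Y # Ys) (f # fs) \<longleftrightarrow> Y \<in> ob D \<and> f \<in> hom D (hd Ys) Y \<and> is_path D Ys fs"
  by (cases Ys) (auto simp: is_path_def less_Suc_eq_0_disj)

lemma is_path_not_Nil: "is_path D Ys fs \<Longrightarrow> Ys \<noteq> []"
  by (auto simp: is_path_def)

lemma is_path_length: "is_path D Ys fs \<Longrightarrow> length Ys = Suc (length fs)"
  by (simp add: is_path_def)

lemma is_path_hd: "is_path D Ys fs \<Longrightarrow> hd Ys \<in> ob D"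
  by (cases Ys) (auto simp: is_path_def)

lemma is_path_update:
  "is_path D Ys fs \<Longrightarrow> g \<in> hom D (Ys ! Suc i) (Ys ! i) \<Longrightarrow> is_path D Ys (fs[i := g])"
  by (cases "i < length fs") (auto simp: is_path_def nth_list_update)

lemma is_path_append:
  assumes "is_path D Ys fs" "is_path D Zs gs" "hd Zs = last Ys"
  shows "is_path D (Ys @ tl Zs) (fs @ gs)"
  using assms
proof (induction fs arbitrary: Ys)
  case Nil
  then show ?case using is_path_not_Nil [of D Zs gs] by (cases Zs) (auto simp: is_path_Nil)
next
  case (Cons f fs)
  from Cons.prems obtain Y Ys' where Ys: "Ys = Y # Ys'" by (cases Ys) (auto simp: is_path_def)
  with Cons.prems have "Ys' \<noteq> []" by (auto simp: is_path_Cons is_path_def)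
  with Cons Ys show ?case by (auto simp: is_path_Cons)
qed

lemma path_between_Cons:
  "path_between D X Y (Z # Ys) (f # fs) \<longleftrightarrow>
    Z = Y \<and> Y \<in> ob D \<and> f \<in> hom D (hd Ys) Y \<and> path_between D X (hd Ys) Ys fs"
  using is_path_not_Nil [of D Ys fs] by (auto simp: path_between_def is_path_Cons)

lemma path_between_ob: "path_between D X Y Ys fs \<Longrightarrow> X \<in> ob D \<and> Y \<in> ob D"
  using last_in_set [of Ys] is_path_not_Nil [of D Ys fs] is_path_hd [of D Ys fs]
  by (auto simp: path_between_def is_path_def)

text \<open>Without identities the empty path has no composite, so the induction starts from one
  morphism. It extends paths at the target end, where \<open>compose_path\<close> and the words of
  Omega are peeled.\<close>

lemma path_between_induct [consumes 2, case_names single Cons]: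
  assumes p: "path_between D X Y Ys fs" "fs \<noteq> []"
    and single: "\<And>Y f. X \<in> ob D \<Longrightarrow> Y \<in> ob D \<Longrightarrow> f \<in> hom D X Y \<Longrightarrow> P Y [Y, X] [f]"
    and Cons: "\<And>Y Z Ys f fs. Y \<in> ob D \<Longrightarrow> Z \<in> ob D \<Longrightarrow> f \<in> hom D Z Y \<Longrightarrow>
      path_between D X Z (Z # Ys) fs \<Longrightarrow> fs \<noteq> [] \<Longrightarrow> P Z (Z # Ys) fs \<Longrightarrow> P Y (Y # Z # Ys) (f # fs)"
  shows "P Y Ys fs"
  using p
proof (induction fs arbitrary: Y Ys)
  case Nil
  then show ?case by simp
next
  case IH: (Cons f fs)
  then obtain Ys' where Ys: "Ys = Y # Ys'"
    by (cases Ys) (auto simp: path_between_def is_path_def)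
  with IH.prems have p': "Y \<in> ob D" "f \<in> hom D (hd Ys') Y" "path_between D X (hd Ys') Ys' fs"
    by (auto simp: path_between_Cons)
  show ?case
  proof (cases "fs = []")
    case True
    with p' show ?thesis
      unfolding Ys by (auto simp: path_between_def is_path_Nil intro: single)
  next
    case False
    have "Ys' \<noteq> []" using p' is_path_not_Nil by (auto simp: path_between_def)
    then obtain Z Zs where "Ys' = Z # Zs" by (cases Ys') auto
    with False p' IH.IH [OF p'(3) False] path_between_ob [OF p'(3)] show ?thesis
      unfolding Ys by (auto intro: Cons)
  qed
qed

locale semicat =
  fixes D :: "('k::field, 'h, 'o, 'a::ab_group_add, 'z) semicat_scheme"
  assumes lin: "linear_semicategory D"
begin

lemma avs: "vector_space (scl D)"
  using lin by (simp add: linear_semicategory_def)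

sublocale av: vector_space "scl D"
  by (rule avs)

lemma hom_sub: "X \<in> ob D \<Longrightarrow> Y \<in> ob D \<Longrightarrow> av.subspace (hom D X Y)"
  using lin by (simp add: linear_semicategory_def)

lemma hom_0 [simp]: "X \<in> ob D \<Longrightarrow> Y \<in> ob D \<Longrightarrow> 0 \<in> hom D X Y"
  by (rule av.subspace_0 [OF hom_sub])

lemma cmp_mem [simp]:
  "X \<in> ob D \<Longrightarrow> Y \<in> ob D \<Longrightarrow> Z \<in> ob D \<Longrightarrow> g \<in> hom D Y Z \<Longrightarrow> f \<in> hom D X Y \<Longrightarrow>
    cmp D X Y Z g f \<in> hom D X Z"
  using lin by (simp add: linear_semicategory_def)

lemma cmp_linear:
  assumes "X \<in> ob D" "Y \<in> ob D" "Z \<in> ob D"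
  shows "g \<in> hom D Y Z \<Longrightarrow> linear_on (scl D) (hom D X Y) (scl D) (cmp D X Y Z g)"
    and "f \<in> hom D X Y \<Longrightarrow> linear_on (scl D) (hom D Y Z) (scl D) (\<lambda>g. cmp D X Y Z g f)"
  using lin assms by (auto simp: linear_semicategory_def bilinear_on_def)

lemma cmp_assoc:
  "W \<in> ob D \<Longrightarrow> X \<in> ob D \<Longrightarrow> Y \<in> ob D \<Longrightarrow> Z \<in> ob D \<Longrightarrow>
    p \<in> hom D Y Z \<Longrightarrow> g \<in> hom D X Y \<Longrightarrow> f \<in> hom D W X \<Longrightarrow>
    cmp D W X Z (cmp D X Y Z p g) f = cmp D W Y Z p (cmp D W X Y g f)"
  using lin by (simp add: linear_semicategory_def)

text \<open>Replaces slot indices by a recursion on the list of objects: the first slot alone, then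
  the others with the first one fixed. \<open>multilin_hd\<close> and \<open>multilin_tl\<close> are
  the converse.\<close>

lemma multilin_Cons:
  assumes "\<And>fs. Y \<in> ob D \<Longrightarrow> is_path D Ys fs \<Longrightarrow>
      linear_on (scl D) (hom D (hd Ys) Y) sW (\<lambda>g. F (g # fs))"
    and "\<And>f. Y \<in> ob D \<Longrightarrow> Ys \<noteq> [] \<Longrightarrow> hd Ys \<in> ob D \<Longrightarrow> f \<in> hom D (hd Ys) Y \<Longrightarrow>
      multilin D sW Ys (\<lambda>fs. F (f # fs))"
  shows "multilin D sW (Y # Ys) F"
  unfolding multilin_def
proof (intro allI impI)
  fix fs i assume p: "is_path D (Y # Ys) fs" and i: "i < length fs"
  then obtain f fs' where fs: "fs = f # fs'" by (cases fs) auto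
  with p have f: "Y \<in> ob D" "f \<in> hom D (hd Ys) Y" "is_path D Ys fs'" by (auto simp: is_path_Cons)
  have hd: "Ys ! 0 = hd Ys" using is_path_not_Nil [OF f(3)] by (simp add: hd_conv_nth)
  show "linear_on (scl D) (hom D ((Y # Ys) ! Suc i) ((Y # Ys) ! i)) sW (\<lambda>g. F (fs[i := g]))"
    using assms(1) [OF f(1,3)] assms(2) [OF f(1) _ _ f(2)] is_path_not_Nil [OF f(3)] is_path_hd [OF f(3)] f(3) i
    by (cases i) (auto simp: fs hd multilin_def)
qed

lemma multilin_short: "length Ys \<le> 1 \<Longrightarrow> multilin D sW Ys F"
  by (auto simp: multilin_def is_path_def)

lemma multilin_hd:
  assumes "multilin D sW (Y # Ys) F" "is_path D Ys fs" "Y \<in> ob D"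
  shows "linear_on (scl D) (hom D (hd Ys) Y) sW (\<lambda>g. F (g # fs))"
proof -
  \<comment> \<open>Slots are defined on complete paths, so the zero morphism serves as a
    placeholder at the head.\<close>
  have "is_path D (Y # Ys) (0 # fs)"
    using assms is_path_hd [OF assms(2)] by (simp add: is_path_Cons)
  moreover have "Ys ! 0 = hd Ys" using is_path_not_Nil [OF assms(2)] by (simp add: hd_conv_nth)
  moreover from calculation(1) have "\<forall>i<length (0 # fs). linear_on (scl D)
      (hom D ((Y # Ys) ! Suc i) ((Y # Ys) ! i)) sW (\<lambda>g. F ((0 # fs)[i := g]))"
    using assms(1) unfolding multilin_def by blast
  from this [rule_format, of 0] calculation show ?thesis by simp
qed

lemma multilin_tl:
  assumes "multilin D sW (Y # Ys) F" "f \<in> hom D (hd Ys) Y" "Y \<in> ob D"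
  shows "multilin D sW Ys (\<lambda>fs. F (f # fs))"
  unfolding multilin_def
proof (intro allI impI)
  fix fs i assume p: "is_path D Ys fs" and i: "i < length fs"
  have "is_path D (Y # Ys) (f # fs)" using p assms by (simp add: is_path_Cons)
  then have "\<forall>i<length (f # fs). linear_on (scl D) (hom D ((Y # Ys) ! Suc i) ((Y # Ys) ! i)) sW
      (\<lambda>g. F ((f # fs)[i := g]))"
    using assms(1) unfolding multilin_def by blast
  from this [rule_format, of "Suc i"] i
  show "linear_on (scl D) (hom D (Ys ! Suc i) (Ys ! i)) sW (\<lambda>g. F (f # fs[i := g]))" by simp
qed

lemma multilin_comp:
  assumes "multilin D sW Ys F" "linear_on sW V sX L" "\<And>fs. is_path D Ys fs \<Longrightarrow> F fs \<in> V"
  shows "multilin D sX Ys (\<lambda>fs. L (F fs))"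
  unfolding multilin_def
proof (intro allI impI)
  fix fs i assume p: "is_path D Ys fs" "i < length fs"
  then have "linear_on (scl D) (hom D (Ys ! Suc i) (Ys ! i)) sW (\<lambda>g. F (fs[i := g]))"
    using assms(1) unfolding multilin_def by blast
  from linear_on_comp [OF this assms(2)] assms(3) is_path_update [OF p(1)]
  show "linear_on (scl D) (hom D (Ys ! Suc i) (Ys ! i)) sX (\<lambda>g. L (F (fs[i := g])))" by blast
qed

lemma multilin_cong:
  assumes "multilin D sW Ys F" "\<And>fs. is_path D Ys fs \<Longrightarrow> F fs = G fs"
  shows "multilin D sW Ys G"
  unfolding multilin_def
proof (intro allI impI)
  fix fs i assume p: "is_path D Ys fs" "i < length fs"
  then have ob: "Ys ! Suc i \<in> ob D" "Ys ! i \<in> ob D" by (auto simp: is_path_def)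
  have "linear_on (scl D) (hom D (Ys ! Suc i) (Ys ! i)) sW (\<lambda>g. F (fs[i := g]))"
    using assms(1) p unfolding multilin_def by blast
  then show "linear_on (scl D) (hom D (Ys ! Suc i) (Ys ! i)) sW (\<lambda>g. G (fs[i := g]))"
    by (rule linear_on_cong [OF _ hom_sub [OF ob] avs]) (rule assms(2) [OF is_path_update [OF p(1)]])
qed

lemma multilin_plus:
  "vector_space sW \<Longrightarrow> multilin D sW Ys F \<Longrightarrow> multilin D sW Ys G \<Longrightarrow> multilin D sW Ys (\<lambda>fs. F fs + G fs)"
  by (simp add: multilin_def linear_on_plus)

lemma multilin_scaled:
  "vector_space sW \<Longrightarrow> multilin D sW Ys F \<Longrightarrow> multilin D sW Ys (\<lambda>fs. sW c (F fs))"
  by (auto simp: multilin_def intro: linear_on_scaled)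

lemma multilin_zero: "vector_space sW \<Longrightarrow> multilin D sW Ys (\<lambda>fs. 0)"
  by (simp add: multilin_def linear_on_zero)

text \<open>
  \<open>wd Ys [f\<^sub>0, \<dots>, f\<^sub>n]\<close> is \<open>f\<^sub>0 df\<^sub>1 \<dots> df\<^sub>n\<close> and \<open>dwd Ys [f\<^sub>1, \<dots>, f\<^sub>n]\<close> is \<open>df\<^sub>1 \<dots> df\<^sub>n\<close>; together they span
  the universal DGH-semicategory.
\<close>

definition wd :: "'o list \<Rightarrow> 'a list \<Rightarrow> ('k, 'o, 'a) omega" where
  "wd Ys fs = omega_gen D (Ys, (hd fs, 0), tl fs)"

definition dwd :: "'o list \<Rightarrow> 'a list \<Rightarrow> ('k, 'o, 'a) omega" where
  "dwd Ys fs = omega_gen D (hd Ys # Ys, (0, 1), fs)"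

text \<open>The Hom spaces do not see the action, so they are available before H enters;
  \<open>Omega_simps\<close> later matches them with the fields of \<open>Omega H D\<close>.\<close>

definition om :: "'o \<Rightarrow> 'o \<Rightarrow> ('k, 'o, 'a) omega set" where
  "om X Y = tensor_space (omega_forms D) (omega_gens D X Y)"

definition omd :: "nat \<Rightarrow> 'o \<Rightarrow> 'o \<Rightarrow> ('k, 'o, 'a) omega set" where
  "omd n X Y = tensor_space (omega_forms D)
     {(Ys, a, fs). (Ys, a, fs) \<in> omega_gens D X Y \<and> length fs = n}"

lemma om_sub [simp]: "fscale.subspace (om X Y)" and omd_sub [simp]: "fscale.subspace (omd n X Y)"
  unfolding om_def omd_def tensor_space_def by simp_all

lemmas om_0 [simp] = fscale.subspace_0 [OF om_sub]
  and om_add [simp] = fscale.subspace_add [OF om_sub]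
  and om_diff [simp] = fscale.subspace_diff [OF om_sub]
  and om_scale [simp] = fscale.subspace_scale [OF om_sub]
  and omd_0 [simp] = fscale.subspace_0 [OF omd_sub]
  and omd_add [simp] = fscale.subspace_add [OF omd_sub]
  and omd_diff [simp] = fscale.subspace_diff [OF omd_sub]
  and omd_scale [simp] = fscale.subspace_scale [OF omd_sub]

lemma omd_om: "x \<in> omd n X Y \<Longrightarrow> x \<in> om X Y"
  unfolding om_def omd_def tensor_space_def by (rule subsetD [OF fscale.span_mono]) auto

lemma omega_formD:
  assumes \<beta>: "\<beta> \<in> omega_forms D" and g: "(Ys, (f, \<mu>), fs) \<in> omega_gens D X Y"
  shows "linear_on (\<lambda>c (f, \<mu>). (scl D c f, c * \<mu>)) {a'. (Ys, a', fs) \<in> omega_gens D X Y} (*)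
          (\<lambda>a'. \<beta> (Ys, a', fs))"
    and "i < length fs \<Longrightarrow> linear_on (scl D) (hom D (Ys ! (i + 2)) (Ys ! (i + 1))) (*)
          (\<lambda>g. \<beta> (Ys, (f, \<mu>), fs[i := g]))"
proof -
  have "Ys \<noteq> []" using g by (auto simp: omega_gens_def is_path_def)
  then have "X \<in> ob D" "Y \<in> ob D"
    using g last_in_set [of Ys] hd_in_set [of Ys] unfolding omega_gens_def is_path_def by auto
  with \<beta> g show "linear_on (\<lambda>c (f, \<mu>). (scl D c f, c * \<mu>)) {a'. (Ys, a', fs) \<in> omega_gens D X Y} (*)
          (\<lambda>a'. \<beta> (Ys, a', fs))"
    and "i < length fs \<Longrightarrow> linear_on (scl D) (hom D (Ys ! (i + 2)) (Ys ! (i + 1))) (*)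
          (\<lambda>g. \<beta> (Ys, (f, \<mu>), fs[i := g]))"
    unfolding omega_forms_def by blast+
qed

lemma omega_gens_path:
  "(Ys, (f, \<mu>), fs) \<in> omega_gens D X Y \<longleftrightarrow>
    path_between D X Y Ys (f # fs) \<and> (fs = [] \<or> Ys ! 1 \<noteq> Y \<longrightarrow> \<mu> = 0)"
  by (auto simp: omega_gens_def path_between_def)

lemma wd_gen: "path_between D X Y Ys fs \<Longrightarrow> fs \<noteq> [] \<Longrightarrow> (Ys, (hd fs, 0), tl fs) \<in> omega_gens D X Y"
  by (simp add: omega_gens_path)

lemma dwd_gen:
  assumes "path_between D X Y Ys fs" "fs \<noteq> []"
  shows "(hd Ys # Ys, (0, 1), fs) \<in> omega_gens D X Y"
proof -
  have "Ys ! 0 = Y" "hd Ys = Y" "Ys \<noteq> []"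
    using assms is_path_not_Nil [of D Ys fs] by (auto simp: path_between_def hd_conv_nth)
  then show ?thesis
    using assms path_between_ob [OF assms(1)] by (simp add: omega_gens_path path_between_Cons)
qed

lemma form_wd:
  assumes "\<beta> \<in> omega_forms D"
  shows "multilin D (*) Ys (\<lambda>fs. \<beta> (Ys, (hd fs, 0), tl fs))"
  unfolding multilin_def
proof (intro allI impI)
  fix fs i assume p: "is_path D Ys fs" and i: "i < length fs"
  then obtain f fs' where fs: "fs = f # fs'" by (cases fs) auto
  have g: "(Ys, (f, 0), fs') \<in> omega_gens D (last Ys) (hd Ys)"
    using p by (simp add: fs omega_gens_def)
  show "linear_on (scl D) (hom D (Ys ! Suc i) (Ys ! i)) (*) (\<lambda>g. \<beta> (Ys, (hd (fs[i := g]), 0), tl (fs[i := g])))"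
  proof (cases i)
    case 0
    have *: "(Ys, (g, 0), fs') \<in> omega_gens D (last Ys) (hd Ys)" if "g \<in> hom D (Ys ! Suc 0) (Ys ! 0)" for g
      using is_path_update [OF p that] by (simp add: fs omega_gens_def)
    show ?thesis
      using linear_on_add [OF omega_formD(1) [OF assms g], OF CollectI CollectI, OF * *]
        linear_on_scale [OF omega_formD(1) [OF assms g], OF CollectI, OF *]
      by (auto simp: 0 fs intro!: linear_onI)
  next
    case (Suc j)
    then show ?thesis using omega_formD(2) [OF assms g, of j] i by (simp add: fs)
  qed
qed

lemma form_dwd:
  assumes "\<beta> \<in> omega_forms D"
  shows "multilin D (*) Ys (\<lambda>fs. \<beta> (hd Ys # Ys, (0, 1), fs))"
  unfolding multilin_def
proof (intro allI impI)
  fix fs i assume p: "is_path D Ys fs" and i: "i < length fs"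
  then have "(hd Ys # Ys, (0, 1), fs) \<in> omega_gens D (last Ys) (hd Ys)"
    by (intro dwd_gen) (auto simp: path_between_def)
  from omega_formD(2) [OF assms this i]
  show "linear_on (scl D) (hom D (Ys ! Suc i) (Ys ! i)) (*) (\<lambda>g. \<beta> (hd Ys # Ys, (0, 1), fs[i := g]))"
    by simp
qed

text \<open>An elementary tensor is a function of forms, namely the value of the form inside
  \<open>\<Phi>\<close> and 0 outside, so linearity is tested one form at a time.\<close>

lemma multilin_elem:
  assumes "\<And>\<beta>. \<beta> \<in> \<Phi> \<Longrightarrow> multilin D (*) Ys (\<lambda>fs. \<beta> (s fs))"
  shows "multilin D fscale Ys (\<lambda>fs. elem_tensor \<Phi> (s fs))"
  using assms unfolding multilin_def linear_on_def
  by (auto simp: elem_tensor_def fscale_def fun_eq_iff)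

lemma multilin_wd: "multilin D fscale Ys (wd Ys)"
  unfolding wd_def omega_gen_def by (rule multilin_elem [OF form_wd])

lemma multilin_dwd: "multilin D fscale Ys (dwd Ys)"
  unfolding dwd_def omega_gen_def by (rule multilin_elem [OF form_dwd])

text \<open>Forms are linear in the pair (f, \<mu>) jointly, so the pair splits into (f, 0) and
  \<mu> times (0, 1). This reduces every map on Omega to two kinds of words.\<close>

lemma omega_gen_split:
  assumes g: "(Ys, (f, \<mu>), fs) \<in> omega_gens D X Y"
  shows "omega_gen D (Ys, (f, \<mu>), fs) = wd Ys (f # fs) + fscale \<mu> (dwd (tl Ys) fs)"
proof (cases "\<mu> = 0")
  case True
  then show ?thesis by (simp add: wd_def)
next
  case False
  with g have "fs \<noteq> []" "Ys ! 1 = Y" and p: "path_between D X Y Ys (f # fs)"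
    by (auto simp: omega_gens_path)
  moreover obtain Ys' where Ys: "Ys = Y # Ys'"
    using p by (cases Ys) (auto simp: path_between_def is_path_def)
  moreover have "Ys' \<noteq> []" using p is_path_length [of D Ys "f # fs"] by (auto simp: Ys path_between_def)
  ultimately have Y: "hd Ys' = Y" by (simp add: hd_conv_nth)
  have ob: "Y \<in> ob D" using path_between_ob [OF p] by simp
  have 1: "(Ys, (f, 0), fs) \<in> omega_gens D X Y" "(Ys, (0, 1), fs) \<in> omega_gens D X Y"
      "(Ys, (0, \<mu>), fs) \<in> omega_gens D X Y"
    using g \<open>fs \<noteq> []\<close> \<open>Ys ! 1 = Y\<close> Y ob by (auto simp: omega_gens_path Ys path_between_Cons)
  have "\<beta> (Ys, (f, \<mu>), fs) = \<beta> (Ys, (f, 0), fs) + \<mu> * \<beta> (Ys, (0, 1), fs)"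
    if "\<beta> \<in> omega_forms D" for \<beta>
    using linear_on_add [OF omega_formD(1) [OF that g], of "(f, 0)" "(0, \<mu>)"]
      linear_on_scale [OF omega_formD(1) [OF that g], of "(0, 1)" \<mu>] 1
    by simp
  then show ?thesis
    by (auto simp: wd_def dwd_def omega_gen_def elem_tensor_def fscale_def fun_eq_iff Ys Y)
qed

lemma omega_scale:
  assumes "(Ys, (f, \<mu>), fs) \<in> omega_gens D X Y"
  shows "(Ys, (scl D c f, c * \<mu>), fs) \<in> omega_gens D X Y"
    "omega_gen D (Ys, (scl D c f, c * \<mu>), fs) = fscale c (omega_gen D (Ys, (f, \<mu>), fs))"
proof -
  obtain Y' Ys' where "Ys = Y' # Ys'"
    using assms by (cases Ys) (auto simp: omega_gens_path path_between_def is_path_def)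
  then show "(Ys, (scl D c f, c * \<mu>), fs) \<in> omega_gens D X Y"
    using assms av.subspace_scale [OF hom_sub]
    by (auto simp: omega_gens_path path_between_Cons dest: path_between_ob)
  show "omega_gen D (Ys, (scl D c f, c * \<mu>), fs) = fscale c (omega_gen D (Ys, (f, \<mu>), fs))"
    using linear_on_scale [OF omega_formD(1) [OF _ assms], of _ "(f, \<mu>)" c] assms
    by (auto simp: omega_gen_def elem_tensor_def fscale_def fun_eq_iff)
qed

text \<open>
  Elements of tensor spaces are functions; pointwise rewriting of their sums would only get in the way.
\<close>

declare plus_fun_apply [simp del] zero_fun_apply [simp del] minus_apply [simp del] uminus_apply [simp del]

text \<open>Multilinearity of the two families, \<open>A\<close> for words that start with a
  morphism and \<open>B\<close> for those that start with a differential, makes the choice inside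
  \<open>tensor_lift\<close> harmless. The differential, the composition, the action, the extension
  of a semifunctor and the passage to \<open>CN\<close> are all instances.\<close>

lemma omega_lift:
  fixes sW :: "'k \<Rightarrow> 'w::ab_group_add \<Rightarrow> 'w"
  assumes W: "vector_space sW"
    and A': "\<forall>Ys. hd Ys = Y \<and> last Ys = X \<longrightarrow> multilin D sW Ys (A Ys)"
    and B': "\<forall>Ys. hd Ys = Y \<and> last Ys = X \<longrightarrow> multilin D sW Ys (B Ys)"
    and F: "\<forall>Ys f \<mu> fs. (Ys, (f, \<mu>), fs) \<in> omega_gens D X Y \<longrightarrow>
      F (Ys, (f, \<mu>), fs) = A Ys (f # fs) + sW \<mu> (B (tl Ys) fs)"
  defines "L \<equiv> tensor_lift (omega_gen D) (omega_gens D X Y) F"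
  shows "linear_on fscale (om X Y) sW L"
    and "path_between D X Y Ys fs \<Longrightarrow> fs \<noteq> [] \<Longrightarrow> L (wd Ys fs) = A Ys fs"
    and "path_between D X Y Ys fs \<Longrightarrow> fs \<noteq> [] \<Longrightarrow> L (dwd Ys fs) = B Ys fs"
proof -
  interpret W: vector_space sW by fact
  note A = A' [rule_format, OF conjI] and B = B' [rule_format, OF conjI] and F = F [rule_format]
  \<comment> \<open>Forms are tested on symbols between all pairs of objects, so \<open>F\<close> is
    extended by 0 to other endpoints, and its \<mu>-part by 0 where no unit is adjoined.\<close>
  define F' where "F' = (\<lambda>(Ys, (f, \<mu>), fs). if hd Ys = Y \<and> last Ys = X then A Ys (f # fs) +
      (if hd (tl Ys) = Y \<and> fs \<noteq> [] then sW \<mu> (B (tl Ys) fs) else 0) else 0)"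
  have FF': "F g = F' g" if "g \<in> omega_gens D X Y" for g
  proof -
    obtain Ys f \<mu> fs where g: "g = (Ys, (f, \<mu>), fs)" by (metis surj_pair)
    have "Ys ! 1 = hd (tl Ys)" if "fs \<noteq> []"
      using \<open>g \<in> omega_gens D X Y\<close> that
      by (cases Ys; cases "tl Ys") (auto simp: g omega_gens_path path_between_def is_path_def)
    then show ?thesis using that F [of Ys f \<mu> fs]
      by (auto simp: g F'_def omega_gens_path path_between_def)
  qed
  have F': "(\<lambda>g. l (F' g)) \<in> omega_forms D" if "Vector_Spaces.linear sW (*) l" for l
  proof -
    interpret l: Vector_Spaces.linear sW "(*)" l by fact
    show ?thesis
      unfolding omega_forms_def
    proof (intro CollectI ballI, clarify, intro conjI allI impI)
      fix X' Y' Ys f \<mu> fs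
      assume g: "(Ys, (f, \<mu>), fs) \<in> omega_gens D X' Y'"
      then obtain Ys' where Ys: "Ys = Y' # Ys'"
        by (cases Ys) (auto simp: omega_gens_path path_between_def is_path_def)
      from g have f: "f \<in> hom D (hd Ys') Y'" and p: "path_between D X' (hd Ys') Ys' fs" and Y': "Y' \<in> ob D"
        by (auto simp: omega_gens_path Ys path_between_Cons)
      then have Ys': "Ys' \<noteq> []" "Ys' ! 0 = hd Ys'" "last Ys' = X'" "is_path D Ys' fs"
        using is_path_not_Nil [of D Ys' fs] by (auto simp: path_between_def hd_conv_nth)
      show "linear_on (\<lambda>c (f, \<mu>). (scl D c f, c * \<mu>)) {a'. (Ys, a', fs) \<in> omega_gens D X' Y'} (*)
          (\<lambda>a'. l (F' (Ys, a', fs)))"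
      proof (cases "Y' = Y \<and> X' = X")
        case True
        have A': "linear_on (scl D) (hom D (hd Ys') Y) sW (\<lambda>g. A Ys (g # fs))"
          using multilin_hd [OF A [of "Y # Ys'"] Ys'(4)] Y' True Ys' by (simp add: Ys)
        \<comment> \<open>The coefficient of \<mu> is constant in the first morphism, which makes
          \<open>F'\<close> linear in the pair.\<close>
        define b where "b = (if hd Ys' = Y \<and> fs \<noteq> [] then B Ys' fs else 0)"
        have v: "F' (Ys, (f', \<mu>'), fs) = A Ys (f' # fs) + sW \<mu>' b" for f' \<mu>'
          using True Ys' by (simp add: F'_def Ys b_def)
        have m: "f' \<in> hom D (hd Ys') Y" if "(Ys, (f', \<mu>'), fs) \<in> omega_gens D X' Y'" for f' \<mu>'
          using that True by (simp add: omega_gens_path Ys path_between_Cons)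
        show ?thesis
        proof (rule linear_onI; clarify)
          fix f1 \<mu>1 f2 \<mu>2
          assume "(Ys, (f1, \<mu>1), fs) \<in> omega_gens D X' Y'" "(Ys, (f2, \<mu>2), fs) \<in> omega_gens D X' Y'"
          from linear_on_add [OF A' m [OF this(1)] m [OF this(2)]]
          show "l (F' (Ys, (f1, \<mu>1) + (f2, \<mu>2), fs)) = l (F' (Ys, (f1, \<mu>1), fs)) + l (F' (Ys, (f2, \<mu>2), fs))"
            by (simp add: v l.add W.scale_left_distrib)
        next
          fix c f1 \<mu>1 assume "(Ys, (f1, \<mu>1), fs) \<in> omega_gens D X' Y'"
          from linear_on_scale [OF A' m [OF this]]
          show "l (F' (Ys, (scl D c f1, c * \<mu>1), fs)) = c * l (F' (Ys, (f1, \<mu>1), fs))"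
            by (simp add: v l.add l.scale distrib_left)
        qed
      qed (auto simp: F'_def Ys Ys' linear_on_def)
      fix i assume i: "i < length fs"
      have AA: "linear_on (scl D) (hom D (Ys ! (i + 2)) (Ys ! (i + 1))) sW (\<lambda>g. A Ys (f # fs[i := g]))"
        if "Y' = Y" "X' = X"
      proof -
        have "multilin D sW Ys' (\<lambda>fs. A Ys (f # fs))"
          unfolding Ys by (rule multilin_tl) (use f Y' that Ys' A [of Ys] in \<open>auto simp: Ys\<close>)
        then show ?thesis using Ys'(4) i by (auto simp: multilin_def Ys)
      qed
      have BB: "linear_on (scl D) (hom D (Ys ! (i + 2)) (Ys ! (i + 1))) sW (\<lambda>g. B Ys' (fs[i := g]))"
        if "hd Ys' = Y" "X' = X"
        using B [of Ys'] that Ys'(3,4) i by (auto simp: multilin_def Ys)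
      have v: "F' (Ys, (f, \<mu>), fs[i := g]) = (if Y' = Y \<and> X' = X then A Ys (f # fs[i := g]) +
          (if hd Ys' = Y then sW \<mu> (B Ys' (fs[i := g])) else 0) else 0)" for g
        using Ys'(1,3) i by (auto simp: F'_def Ys)
      have "linear_on (scl D) (hom D (Ys ! (i + 2)) (Ys ! (i + 1))) sW
          (\<lambda>g. F' (Ys, (f, \<mu>), fs[i := g]))"
        unfolding v
        by (cases "Y' = Y \<and> X' = X"; cases "hd Ys' = Y")
          (use AA BB W in \<open>auto intro!: linear_on_plus linear_on_scaled linear_on_zero\<close>)
      from linear_on_comp [OF this linear_linear_on [OF that]]
      show "linear_on (scl D) (hom D (Ys ! (i + 2)) (Ys ! (i + 1))) (*)
          (\<lambda>g. l (F' (Ys, (f, \<mu>), fs[i := g])))" by blast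
    qed
  qed
  have scale: "\<exists>g'\<in>omega_gens D X Y. elem_tensor (omega_forms D) g' = fscale c (elem_tensor (omega_forms D) g)"
    if g: "g \<in> omega_gens D X Y" for c g
  proof -
    obtain Ys f \<mu> fs where "g = (Ys, (f, \<mu>), fs)" by (metis surj_pair)
    then show ?thesis using omega_scale [of Ys f \<mu> fs X Y c] g unfolding omega_gen_def by blast
  qed
  note lift = elem_tensor_lift [where F = F and F' = F' and G = "omega_gens D X Y" and \<Phi> = "omega_forms D", OF W]
  have L: "linear_on fscale (om X Y) sW L" "\<And>g. g \<in> omega_gens D X Y \<Longrightarrow> L (omega_gen D g) = F g"
    unfolding om_def L_def omega_gen_def
    by (rule lift(1), erule scale, erule F', erule FF')
      (rule lift(2), erule scale, erule F', erule FF')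
  show "linear_on fscale (om X Y) sW L" by (rule L(1))
  show "L (wd Ys fs) = A Ys fs" if "path_between D X Y Ys fs" "fs \<noteq> []"
    using L(2) [OF wd_gen [OF that]] F [OF wd_gen [OF that]] that by (simp add: wd_def)
  show "L (dwd Ys fs) = B Ys fs" if p: "path_between D X Y Ys fs" "fs \<noteq> []"
  proof -
    have "Y \<in> ob D" "hd Ys = Y" "is_path D Ys fs" "last Ys = X" "Ys \<noteq> []"
      using p path_between_ob [OF p(1)] is_path_not_Nil [of D Ys fs] by (auto simp: path_between_def)
    \<comment> \<open>The symbol of \<open>dwd\<close> carries the zero morphism in front, and
      \<open>A\<close> vanishes there by linearity in the first slot.\<close>
    then have "linear_on (scl D) (hom D Y Y) sW (\<lambda>g. A (Y # Ys) (g # fs))"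
      using multilin_hd [OF A [of "Y # Ys"], of fs] by simp
    then have "A (Y # Ys) (0 # fs) = 0"
      by (rule linear_on_0) (simp add: \<open>Y \<in> ob D\<close>)
    then show ?thesis
      using L(2) [OF dwd_gen [OF p]] F [OF dwd_gen [OF p]] \<open>hd Ys = Y\<close> by (simp add: dwd_def)
  qed
qed

lemma omd_mem:
  assumes "path_between D X Y Ys fs" "fs \<noteq> []"
  shows "length fs = Suc n \<Longrightarrow> wd Ys fs \<in> omd n X Y" "dwd Ys fs \<in> omd (length fs) X Y"
    "wd Ys fs \<in> om X Y" "dwd Ys fs \<in> om X Y"
  using wd_gen [OF assms] dwd_gen [OF assms]
  by (auto simp: wd_def dwd_def omega_gen_def om_def omd_def tensor_space_def intro!: fscale.span_base imageI)

lemma omega_span_induct: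
  assumes x: "x \<in> tensor_space (omega_forms D) G" and G: "G \<subseteq> omega_gens D X Y"
    and zero: "P 0"
    and add: "\<And>x y. x \<in> tensor_space (omega_forms D) G \<Longrightarrow> y \<in> tensor_space (omega_forms D) G \<Longrightarrow>
      P x \<Longrightarrow> P y \<Longrightarrow> P (x + y)"
    and gen: "\<And>c g. g \<in> G \<Longrightarrow> P (fscale c (omega_gen D g))"
  shows "P x"
proof -
  have "x \<in> tensor_space (omega_forms D) G \<and> P x"
    using x unfolding tensor_space_def
  proof (induction rule: fscale.span_induct_alt)
    case (step c x y)
    then have "fscale c x \<in> tensor_space (omega_forms D) G" "P (fscale c x)"
      using gen by (auto simp: tensor_space_def omega_gen_def intro: fscale.span_scale fscale.span_base)
    with step add [of "fscale c x" y] show ?case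
      unfolding tensor_space_def using fscale.span_add by blast
  next
    case base
    show ?case using zero fscale.span_zero by blast
  qed
  then show ?thesis by simp
qed

text \<open>A word of degree n has n + 1 morphisms if it starts with a morphism and n if it starts
  with a differential. The condition \<open>fs \<noteq> []\<close> makes the second case void in
  degree 0.\<close>

lemma omd_induct [consumes 1, case_names zero add scale wd dwd]:
  assumes x: "x \<in> omd n X Y"
    and zero: "P 0"
    and add: "\<And>x y. x \<in> omd n X Y \<Longrightarrow> y \<in> omd n X Y \<Longrightarrow> P x \<Longrightarrow> P y \<Longrightarrow> P (x + y)"
    and scale: "\<And>c x. x \<in> omd n X Y \<Longrightarrow> P x \<Longrightarrow> P (fscale c x)"
    and wd: "\<And>Ys fs. path_between D X Y Ys fs \<Longrightarrow> length fs = Suc n \<Longrightarrow> P (wd Ys fs)"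
    and dwd: "\<And>Ys fs. path_between D X Y Ys fs \<Longrightarrow> length fs = n \<Longrightarrow> fs \<noteq> [] \<Longrightarrow> P (dwd Ys fs)"
  shows "P x"
  using x unfolding omd_def
proof (rule omega_span_induct [where P = P and X = X and Y = Y])
  fix c g assume "g \<in> {(Ys, a, fs). (Ys, a, fs) \<in> omega_gens D X Y \<and> length fs = n}"
  then obtain Ys f \<mu> fs where g: "g = (Ys, (f, \<mu>), fs)" "g \<in> omega_gens D X Y" "length fs = n" by auto
  have p: "path_between D X Y Ys (f # fs)" using g by (simp add: omega_gens_path)
  have 1: "wd Ys (f # fs) \<in> omd n X Y" "P (wd Ys (f # fs))"
    using p g wd omd_mem(1) by auto
  have 2: "fscale \<mu> (dwd (tl Ys) fs) \<in> omd n X Y \<and> P (fscale \<mu> (dwd (tl Ys) fs))"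
  proof (cases "\<mu> = 0")
    case False
    then have "fs \<noteq> []" "Ys ! 1 = Y" using g by (auto simp: omega_gens_path)
    moreover obtain Ys' where Ys: "Ys = Y # Ys'"
      using p by (cases Ys) (auto simp: path_between_def is_path_def)
    ultimately have "path_between D X Y Ys' fs"
      using p is_path_not_Nil [of D Ys' fs] by (auto simp: path_between_def is_path_Cons hd_conv_nth)
    then show ?thesis using dwd [of Ys' fs] scale omd_mem(2) [of X Y Ys' fs] g \<open>fs \<noteq> []\<close> by (simp add: Ys)
  qed (simp add: zero)
  show "P (fscale c (omega_gen D g))"
    using omega_gen_split [of Ys f \<mu> fs X Y] g 1 2 scale add by simp
qed (auto simp: zero add omd_def [symmetric])

lemma om_span: "om X Y = fscale.span (\<Union>n. omd n X Y)"
proof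
  show "fscale.span (\<Union>n. omd n X Y) \<subseteq> om X Y"
    by (rule fscale.span_minimal) (auto intro: omd_om)
  have "omega_gen D g \<in> (\<Union>n. omd n X Y)" if "g \<in> omega_gens D X Y" for g
    using that by (auto simp: omd_def tensor_space_def omega_gen_def intro!: fscale.span_base)
  then show "om X Y \<subseteq> fscale.span (\<Union>n. omd n X Y)"
    unfolding om_def tensor_space_def by (intro fscale.span_mono) (auto simp: omega_gen_def)
qed

lemma om_induct [consumes 1, case_names add hmg]:
  assumes x: "x \<in> om X Y"
    and add: "\<And>x y. x \<in> om X Y \<Longrightarrow> y \<in> om X Y \<Longrightarrow> P x \<Longrightarrow> P y \<Longrightarrow> P (x + y)"
    and hmg: "\<And>n x. x \<in> omd n X Y \<Longrightarrow> P x"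
  shows "P x"
proof -
  have "x \<in> om X Y \<and> P x"
    using x unfolding om_span
  proof (induction rule: fscale.span_induct_alt)
    case (step c x y)
    then obtain n where "x \<in> omd n X Y" by auto
    then have "fscale c x \<in> omd n X Y" by simp
    then show ?case using step hmg add omd_om by (metis om_add om_span)
  next
    case base
    show ?case using hmg [OF omd_0 [of 0]] fscale.span_zero by blast
  qed
  then show ?thesis by simp
qed

lemma linear_om_eqI:
  assumes "linear_on fscale (om X Y) sW F" "linear_on fscale (om X Y) sW G"
    and "\<And>Ys fs. path_between D X Y Ys fs \<Longrightarrow> fs \<noteq> [] \<Longrightarrow> F (wd Ys fs) = G (wd Ys fs)"
    and "\<And>Ys fs. path_between D X Y Ys fs \<Longrightarrow> fs \<noteq> [] \<Longrightarrow> F (dwd Ys fs) = G (dwd Ys fs)"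
    and x: "x \<in> om X Y"
  shows "F x = G x"
  using x
proof (induction rule: om_induct)
  case (add x y)
  then show ?case using linear_on_add [OF assms(1)] linear_on_add [OF assms(2)] by simp
next
  case (hmg n x)
  then show ?case
  proof (induction rule: omd_induct)
    case zero
    show ?case using linear_on_0 [OF assms(1)] linear_on_0 [OF assms(2)] by simp
  next
    case (wd Ys fs)
    then have "fs \<noteq> []" by auto
    with wd show ?case by (simp add: assms(3))
  qed (use assms(4) linear_on_add [OF assms(1)] linear_on_add [OF assms(2)]
    linear_on_scale [OF assms(1)] linear_on_scale [OF assms(2)] in \<open>auto simp: omd_om\<close>)
qed

end

lemma linear_on_apply_sum:
  assumes V: "vector_space sV" "module.subspace sV V" and L: "linear_on sV V sW L"
    and "\<And>a. a \<in> A \<Longrightarrow> f a \<in> V"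
  shows "L (\<Sum>a\<in>A. f a) = (\<Sum>a\<in>A. L (f a))"
proof -
  interpret V: vector_space sV by fact
  have L0: "L 0 = 0" by (rule linear_on_0 [OF L V.subspace_0 [OF V(2)]])
  show ?thesis
    using assms(4)
  proof (induction A rule: infinite_finite_induct)
    case (insert a A)
    then show ?case
      using linear_on_add [OF L, of "f a" "sum f A"] V.subspace_sum [OF V(2), of A f] by simp
  qed (simp_all add: L0)
qed

lemma del_nth_Cons [simp]: "del_nth (Suc i) (Y # Ys) = Y # del_nth i Ys" "del_nth 0 (Y # Ys) = Ys"
  by (simp_all add: del_nth_def)

lemma merge_Cons [simp]: "merge D (Y # Ys) (Suc i) (f # fs) = f # merge D Ys i fs"
  by (simp add: merge_def)

context semicat
begin

section \<open>Differential and composition of the universal DGH-semicategory\<close>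

text \<open>Composing the morphisms at i and i + 1 removes the object between them, the one at
  \<open>Suc i\<close>, which is never an endpoint.\<close>

lemma is_path_merge:
  "is_path D Ys fs \<Longrightarrow> Suc i < length fs \<Longrightarrow>
    is_path D (del_nth (Suc i) Ys) (merge D Ys i fs) \<and>
    hd (del_nth (Suc i) Ys) = hd Ys \<and> last (del_nth (Suc i) Ys) = last Ys"
proof (induction i arbitrary: Ys fs)
  case 0
  then obtain f g fs' where fs: "fs = f # g # fs'"
    by (cases fs; cases "tl fs") auto
  with 0 obtain Y Z Ys' where Ys: "Ys = Y # Z # Ys'"
    by (auto simp: is_path_def length_Suc_conv)
  from 0 have p: "is_path D Ys' fs'" "Y \<in> ob D" "Z \<in> ob D" "f \<in> hom D Z Y" "g \<in> hom D (hd Ys') Z"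
    by (auto simp: fs Ys is_path_Cons)
  then show ?case
    using is_path_hd [OF p(1)] is_path_not_Nil [OF p(1)]
    by (auto simp: fs Ys is_path_Cons merge_def hd_conv_nth)
next
  case (Suc i)
  then obtain f fs' where fs: "fs = f # fs'" by (cases fs) auto
  with Suc.prems obtain Y Ys' where Ys: "Ys = Y # Ys'"
    by (auto simp: is_path_def length_Suc_conv)
  with Suc.prems fs have p: "is_path D Ys' fs'" "Y \<in> ob D" "f \<in> hom D (hd Ys') Y" "Suc i < length fs'"
    by (auto simp: is_path_Cons)
  from Suc.IH [OF p(1,4)] p show ?case
    using is_path_not_Nil [of D "del_nth (Suc i) Ys'" "merge D Ys' i fs'"] is_path_not_Nil [OF p(1)]
    by (auto simp: fs Ys is_path_Cons)
qed

lemma path_merge: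
  "path_between D X Y Ys fs \<Longrightarrow> Suc i < length fs \<Longrightarrow>
    path_between D X Y (del_nth (Suc i) Ys) (merge D Ys i fs)"
  using is_path_merge [of Ys fs i] by (auto simp: path_between_def)

lemma merge_not_Nil [simp]: "merge D' Ys i fs \<noteq> []"
  by (simp add: merge_def)

lemma length_merge: "Suc i < length fs \<Longrightarrow> length (merge D' Ys i fs) = length fs - 1"
  by (simp add: merge_def)

lemma path_append:
  assumes "path_between D Z Y Ys fs" "path_between D X Z Zs gs"
  shows "path_between D X Y (Ys @ tl Zs) (fs @ gs)"
proof -
  have p: "is_path D Ys fs" "is_path D Zs gs" "hd Zs = last Ys" "hd Ys = Y" "last Zs = X" "last Ys = Z" "hd Zs = Z"
    using assms by (auto simp: path_between_def)
  then obtain Zs' where "Zs = Z # Zs'"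
    using is_path_not_Nil [OF p(2)] by (cases Zs) auto
  then show ?thesis
    using is_path_append [OF p(1-3)] is_path_not_Nil [OF p(1)] p
    by (auto simp: path_between_def)
qed

section \<open>Differential, inclusion of morphisms and left multiplication\<close>

definition odif :: "'o \<Rightarrow> 'o \<Rightarrow> ('k, 'o, 'a) omega \<Rightarrow> ('k, 'o, 'a) omega" where
  "odif X Y = tensor_lift (omega_gen D) (omega_gens D X Y) (\<lambda>(Ys, (f, \<mu>), fs).
     omega_gen D (Y # Ys, (0, 1), f # fs))"

definition ocmp ::
  "'o \<Rightarrow> 'o \<Rightarrow> 'o \<Rightarrow> ('k, 'o, 'a) omega \<Rightarrow> ('k, 'o, 'a) omega \<Rightarrow> ('k, 'o, 'a) omega"
where
  "ocmp X Y Z x y = tensor_lift (omega_gen D) (omega_gens D Y Z) (\<lambda>u.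
     tensor_lift (omega_gen D) (omega_gens D X Y) (\<lambda>v. omega_mult D u v) y) x"

definition iota :: "'o \<Rightarrow> 'o \<Rightarrow> 'a \<Rightarrow> ('k, 'o, 'a) omega" where
  "iota X Y f = wd [Y, X] [f]"

text \<open>Left multiplication by a morphism \<open>f : Z \<rightarrow> Y\<close> on \<open>Hom(X, Z)\<close>.\<close>

definition lm :: "'o \<Rightarrow> 'o \<Rightarrow> 'o \<Rightarrow> 'a \<Rightarrow> ('k, 'o, 'a) omega \<Rightarrow> ('k, 'o, 'a) omega" where
  "lm X Z Y f = tensor_lift (omega_gen D) (omega_gens D X Z) (\<lambda>(Zs, (g, \<nu>), gs).
     wd (Y # tl Zs) (cmp D (Zs ! 1) Z Y f g # gs) + fscale \<nu> (wd (Y # tl Zs) (f # gs)))"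

lemma path_single: "path_between D X Y [Y, X] [f] \<longleftrightarrow> X \<in> ob D \<and> Y \<in> ob D \<and> f \<in> hom D X Y"
  by (auto simp: path_between_def is_path_Cons is_path_Nil)

lemma path_hd: "path_between D X Y Ys fs \<Longrightarrow> \<exists>Ys'. Ys = Y # Ys'"
  using is_path_not_Nil [of D Ys fs] by (cases Ys) (auto simp: path_between_def)

lemma odif_lift:
  shows odif_linear: "linear_on fscale (om X Y) fscale (odif X Y)"
    and odif_wd: "path_between D X Y Ys fs \<Longrightarrow> fs \<noteq> [] \<Longrightarrow> odif X Y (wd Ys fs) = dwd Ys fs"
    and odif_dwd: "path_between D X Y Ys fs \<Longrightarrow> fs \<noteq> [] \<Longrightarrow> odif X Y (dwd Ys fs) = 0"
proof -
  let ?F = "\<lambda>(Ys, (f, \<mu>), fs). omega_gen D (Y # Ys, (0, 1), f # fs)"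
  \<comment> \<open>The defining symbol ignores \<mu>: the differential of the adjoined unit is 0,
    so the family \<open>B\<close> is 0.\<close>
  have F: "\<forall>Ys f \<mu> fs. (Ys, (f, \<mu>), fs) \<in> omega_gens D X Y \<longrightarrow>
      ?F (Ys, (f, \<mu>), fs) = dwd Ys (f # fs) + fscale \<mu> 0"
    by (simp add: dwd_def omega_gens_path path_between_def)
  have A: "\<forall>Ys. hd Ys = Y \<and> last Ys = X \<longrightarrow> multilin D fscale Ys (dwd Ys)"
    and B: "\<forall>Ys. hd Ys = Y \<and> last Ys = X \<longrightarrow> multilin D fscale Ys (\<lambda>fs. 0)"
    by (simp_all add: multilin_dwd multilin_zero vector_space_fscale)
  note L = omega_lift [where A = dwd and B = "\<lambda>Ys fs. 0" and F = ?F, OF vector_space_fscale A B F, folded odif_def]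
  show "linear_on fscale (om X Y) fscale (odif X Y)" by (rule L(1))
  show "path_between D X Y Ys fs \<Longrightarrow> fs \<noteq> [] \<Longrightarrow> odif X Y (wd Ys fs) = dwd Ys fs" by (rule L(2))
  show "path_between D X Y Ys fs \<Longrightarrow> fs \<noteq> [] \<Longrightarrow> odif X Y (dwd Ys fs) = 0" by (rule L(3))
qed

lemma odif_memd: "x \<in> omd n X Y \<Longrightarrow> odif X Y x \<in> omd (Suc n) X Y"
proof (induction rule: omd_induct)
  case zero
  then show ?case using linear_on_0 [OF odif_linear [of X Y]] by simp
next
  case (wd Ys fs)
  moreover from wd have "fs \<noteq> []" by auto
  ultimately show ?case using omd_mem(2) [of X Y Ys fs] by (simp add: odif_wd)
qed (simp_all add: odif_dwd omd_om linear_on_add [OF odif_linear] linear_on_scale [OF odif_linear])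

lemma odif_mem [simp]: "x \<in> om X Y \<Longrightarrow> odif X Y x \<in> om X Y"
  by (induction rule: om_induct)
    (auto simp: linear_on_add [OF odif_linear] intro: omd_om odif_memd)

lemma odif_odif [simp]:
  assumes "x \<in> om X Y"
  shows "odif X Y (odif X Y x) = 0"
proof -
  have 1: "linear_on fscale (om X Y) fscale (\<lambda>x. odif X Y (odif X Y x))"
    by (rule linear_on_comp [OF odif_linear odif_linear]) simp
  have 2: "odif X Y 0 = 0" by (rule linear_on_0 [OF odif_linear]) simp
  show ?thesis
    by (rule linear_om_eqI [where F = "\<lambda>x. odif X Y (odif X Y x)" and G = "\<lambda>x. 0",
        OF 1 linear_on_zero [OF vector_space_fscale] _ _ assms]) (simp_all add: odif_wd odif_dwd 2)
qed

text \<open>A morphism composes with a leading morphism; in front of a leading differential it takes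
  the place of the adjoined unit.\<close>

lemma lm_lift:
  assumes ob: "Z \<in> ob D" "Y \<in> ob D" and f: "f \<in> hom D Z Y"
  shows lm_linear: "linear_on fscale (om X Z) fscale (lm X Z Y f)"
    and lm_wd: "path_between D X Z Zs (g # gs) \<Longrightarrow>
      lm X Z Y f (wd Zs (g # gs)) = wd (Y # tl Zs) (cmp D (hd (tl Zs)) Z Y f g # gs)"
    and lm_dwd: "path_between D X Z Zs gs \<Longrightarrow> gs \<noteq> [] \<Longrightarrow>
      lm X Z Y f (dwd Zs gs) = wd (Y # Zs) (f # gs)"
proof -
  define A where "A = (\<lambda>Zs gs. wd (Y # tl Zs) (cmp D (hd (tl Zs)) Z Y f (hd gs) # tl gs))"
  have A: "multilin D fscale Zs (A Zs)" if "hd Zs = Z" for Zs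
  proof (cases Zs)
    case Nil
    then show ?thesis by (simp add: multilin_short)
  next
    case (Cons Z' Zs')
    with that have Zs: "Zs = Z # Zs'" by simp
    show ?thesis
      unfolding Zs
    proof (rule multilin_Cons)
      fix gs assume p: "is_path D Zs' gs"
      have "linear_on (scl D) (hom D (hd Zs') Z) fscale (\<lambda>g. wd (Y # Zs') (cmp D (hd Zs') Z Y f g # gs))"
        using is_path_hd [OF p] ob f
        by (intro linear_on_comp [OF cmp_linear(1) multilin_hd [OF multilin_wd p]]) auto
      then show "linear_on (scl D) (hom D (hd Zs') Z) fscale (\<lambda>g. A (Z # Zs') (g # gs))"
        by (simp add: A_def)
    next
      fix g assume g: "hd Zs' \<in> ob D" "g \<in> hom D (hd Zs') Z"
      show "multilin D fscale Zs' (\<lambda>fs. A (Z # Zs') (g # fs))"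
        unfolding A_def list.sel by (rule multilin_tl [OF multilin_wd]) (use ob f g in auto)
    qed
  qed
  define B where "B = (\<lambda>Zs gs. wd (Y # Zs) (f # gs))"
  have B: "multilin D fscale Zs (B Zs)" if "hd Zs = Z" for Zs
    unfolding B_def by (rule multilin_tl [OF multilin_wd]) (use ob f that in auto)
  let ?F = "\<lambda>(Zs, (g, \<nu>), gs).
     wd (Y # tl Zs) (cmp D (Zs ! 1) Z Y f g # gs) + fscale \<nu> (wd (Y # tl Zs) (f # gs))"
  have F: "\<forall>Zs g \<nu> gs. (Zs, (g, \<nu>), gs) \<in> omega_gens D X Z \<longrightarrow>
     ?F (Zs, (g, \<nu>), gs) = A Zs (g # gs) + fscale \<nu> (B (tl Zs) gs)"
  proof (intro allI impI)
    fix Zs g \<nu> gs assume that: "(Zs, (g, \<nu>), gs) \<in> omega_gens D X Z"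
    have "Zs ! 1 = hd (tl Zs)"
      using that by (cases Zs; cases "tl Zs") (auto simp: omega_gens_path path_between_def is_path_def)
    then show "?F (Zs, (g, \<nu>), gs) = A Zs (g # gs) + fscale \<nu> (B (tl Zs) gs)" by (simp add: A_def B_def)
  qed
  have AA: "\<forall>Zs. hd Zs = Z \<and> last Zs = X \<longrightarrow> multilin D fscale Zs (A Zs)"
    and BB: "\<forall>Zs. hd Zs = Z \<and> last Zs = X \<longrightarrow> multilin D fscale Zs (B Zs)"
    using A B by simp_all
  note L = omega_lift [where A = A and B = B and F = ?F, OF vector_space_fscale AA BB F, folded lm_def]
  show "linear_on fscale (om X Z) fscale (lm X Z Y f)" by (rule L(1))
  show "path_between D X Z Zs (g # gs) \<Longrightarrow>
      lm X Z Y f (wd Zs (g # gs)) = wd (Y # tl Zs) (cmp D (hd (tl Zs)) Z Y f g # gs)"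
    using L(2) [of Zs "g # gs"] by (simp add: A_def)
  show "path_between D X Z Zs gs \<Longrightarrow> gs \<noteq> [] \<Longrightarrow> lm X Z Y f (dwd Zs gs) = wd (Y # Zs) (f # gs)"
    using L(3) [of Zs gs] by (simp add: B_def)
qed

lemma path_cmp:
  assumes "path_between D X Z Zs (g # gs)" "Y \<in> ob D" "f \<in> hom D Z Y"
  shows "path_between D X Y (Y # tl Zs) (cmp D (hd (tl Zs)) Z Y f g # gs)"
  using assms path_hd [OF assms(1)] path_between_ob [of D X "hd (tl Zs)" "tl Zs" gs]
  by (auto simp: path_between_Cons)

lemma path_Cons:
  assumes "path_between D X Z Zs gs" "Y \<in> ob D" "f \<in> hom D Z Y"
  shows "path_between D X Y (Y # Zs) (f # gs)"
  using assms path_hd [OF assms(1)] by (auto simp: path_between_Cons)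

lemma lm_memd:
  assumes ob: "Z \<in> ob D" "Y \<in> ob D" and f: "f \<in> hom D Z Y" and x: "x \<in> omd n X Z"
  shows "lm X Z Y f x \<in> omd n X Y"
  using x
proof (induction rule: omd_induct)
  case zero
  then show ?case using linear_on_0 [OF lm_linear [OF ob f, of X]] by simp
next
  case (wd Zs gs)
  then obtain g gs' where gs: "gs = g # gs'" by (cases gs) auto
  show ?case
    using omd_mem(1) [OF path_cmp [OF wd(1) [unfolded gs] ob(2) f]] lm_wd [OF ob f wd(1) [unfolded gs]] wd gs
    by simp
next
  case (dwd Zs gs)
  then show ?case
    using omd_mem(1) [OF path_Cons [OF dwd(1) ob(2) f]] lm_dwd [OF ob f dwd(1,3)] by simp
qed (simp_all add: omd_om linear_on_add [OF lm_linear [OF ob f]] linear_on_scale [OF lm_linear [OF ob f]])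

lemma lm_mem [simp]:
  assumes "Z \<in> ob D" "Y \<in> ob D" "f \<in> hom D Z Y" "x \<in> om X Z"
  shows "lm X Z Y f x \<in> om X Y"
  using assms(4)
  by (induction rule: om_induct)
    (auto simp: linear_on_add [OF lm_linear [OF assms(1-3)]] intro: omd_om lm_memd [OF assms(1-3)])

lemma lm_linear_left:
  assumes ob: "Z \<in> ob D" "Y \<in> ob D" and x: "x \<in> om X Z"
  shows "linear_on (scl D) (hom D Z Y) fscale (\<lambda>f. lm X Z Y f x)"
proof (rule linear_onI)
  fix f f' assume f: "f \<in> hom D Z Y" "f' \<in> hom D Z Y"
  have s: "f + f' \<in> hom D Z Y" using f av.subspace_add [OF hom_sub [OF ob]] by simp
  show "lm X Z Y (f + f') x = lm X Z Y f x + lm X Z Y f' x"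
  proof (rule linear_om_eqI [OF lm_linear [OF ob s]
        linear_on_plus [OF vector_space_fscale lm_linear [OF ob f(1)] lm_linear [OF ob f(2)]] _ _ x])
    fix Zs gs assume p: "path_between D X Z Zs gs" "gs \<noteq> []"
    obtain Zs' where Zs: "Zs = Z # Zs'" using path_hd [OF p(1)] by blast
    obtain g gs' where "gs = g # gs'" using p(2) by (cases gs) auto
    note gs = this Zs
    from p have q: "is_path D Zs' gs'" "hd Zs' \<in> ob D" "g \<in> hom D (hd Zs') Z" "is_path D Zs gs" "hd Zs = Z"
      using is_path_hd [of D Zs' gs'] by (auto simp: gs path_between_def is_path_Cons)
    show "lm X Z Y (f + f') (wd Zs gs) = lm X Z Y f (wd Zs gs) + lm X Z Y f' (wd Zs gs)"
      using p linear_on_add [OF cmp_linear(2) [OF q(2) ob q(3)] f]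
        linear_on_add [OF multilin_hd [OF multilin_wd q(1) ob(2)]] ob f s q
      by (simp add: gs lm_wd)
    show "lm X Z Y (f + f') (dwd Zs gs) = lm X Z Y f (dwd Zs gs) + lm X Z Y f' (dwd Zs gs)"
      using p linear_on_add [OF multilin_hd [OF multilin_wd q(4) ob(2)]] ob f s q
      by (simp add: lm_dwd)
  qed
next
  fix c f assume f: "f \<in> hom D Z Y"
  have s: "scl D c f \<in> hom D Z Y" using f av.subspace_scale [OF hom_sub [OF ob]] by simp
  show "lm X Z Y (scl D c f) x = fscale c (lm X Z Y f x)"
  proof (rule linear_om_eqI [OF lm_linear [OF ob s]
        linear_on_scaled [OF vector_space_fscale lm_linear [OF ob f(1)]] _ _ x])
    fix Zs gs assume p: "path_between D X Z Zs gs" "gs \<noteq> []"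
    obtain Zs' where Zs: "Zs = Z # Zs'" using path_hd [OF p(1)] by blast
    obtain g gs' where "gs = g # gs'" using p(2) by (cases gs) auto
    note gs = this Zs
    from p have q: "is_path D Zs' gs'" "hd Zs' \<in> ob D" "g \<in> hom D (hd Zs') Z" "is_path D Zs gs" "hd Zs = Z"
      using is_path_hd [of D Zs' gs'] by (auto simp: gs path_between_def is_path_Cons)
    show "lm X Z Y (scl D c f) (wd Zs gs) = fscale c (lm X Z Y f (wd Zs gs))"
      using p linear_on_scale [OF cmp_linear(2) [OF q(2) ob q(3)] f]
        linear_on_scale [OF multilin_hd [OF multilin_wd q(1) ob(2)]] ob f s q
      by (simp add: gs lm_wd)
    show "lm X Z Y (scl D c f) (dwd Zs gs) = fscale c (lm X Z Y f (dwd Zs gs))"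
      using p linear_on_scale [OF multilin_hd [OF multilin_wd q(4) ob(2)]] ob f s q
      by (simp add: lm_dwd)
  qed
qed

text \<open>
  \<open>mw X Ys fs y\<close> is \<open>(f\<^sub>0 df\<^sub>1 \<dots> df\<^sub>n) y\<close>, computed from the right by
  \<open>(df\<^sub>1 \<dots> df\<^sub>n) y = d((f\<^sub>1 df\<^sub>2 \<dots> df\<^sub>n) y) + (-1)\<^sup>n (f\<^sub>1 df\<^sub>2 \<dots> df\<^sub>n) dy\<close>.
\<close>

fun mw :: "'o \<Rightarrow> 'o list \<Rightarrow> 'a list \<Rightarrow> ('k, 'o, 'a) omega \<Rightarrow> ('k, 'o, 'a) omega" where
  "mw X Ys [] y = 0"
| "mw X Ys [f] y = lm X (hd (tl Ys)) (hd Ys) f y"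
| "mw X Ys (f # g # gs) y = lm X (hd (tl Ys)) (hd Ys) f
     (odif X (hd (tl Ys)) (mw X (tl Ys) (g # gs) y) +
      fscale ((-1) ^ length (g # gs)) (mw X (tl Ys) (g # gs) (odif X (last Ys) y)))"

text \<open>The product with an exact left factor, by the Leibniz rule solved for it. The word
  \<open>fs\<close> has degree \<open>length fs - 1\<close>, and moving the second term across the
  equation adds one to the exponent.\<close>

definition mdw :: "'o \<Rightarrow> 'o list \<Rightarrow> 'a list \<Rightarrow> ('k, 'o, 'a) omega \<Rightarrow> ('k, 'o, 'a) omega" where
  "mdw X Ys fs y = odif X (hd Ys) (mw X Ys fs y) +
     fscale ((-1) ^ length fs) (mw X Ys fs (odif X (last Ys) y))"

lemma mw_Cons:
  "fs \<noteq> [] \<Longrightarrow> Ys \<noteq> [] \<Longrightarrow> mw X (Y # Ys) (f # fs) y = lm X (hd Ys) Y f (mdw X Ys fs y)"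
  by (cases fs) (auto simp: mdw_def)

lemma mw_mem:
  assumes "path_between D Z Y Ys fs" "fs \<noteq> []" "y \<in> om X Z"
  shows "mw X Ys fs y \<in> om X Y"
  using assms(1,2,3)
proof (induction arbitrary: y rule: path_between_induct)
  case (Cons Y Z' Ys f fs)
  have "last (Z' # Ys) = Z" using Cons by (simp add: path_between_def)
  with Cons show ?case by (subst mw_Cons) (auto simp: mdw_def simp del: last.simps)
qed simp

lemma mdw_mem:
  assumes p: "path_between D Z Y Ys fs" "fs \<noteq> []" "y \<in> om X Z"
  shows "mdw X Ys fs y \<in> om X Y"
proof -
  have "hd Ys = Y" "last Ys = Z" using p by (auto simp: path_between_def)
  then show ?thesis using mw_mem [OF p(1,2)] p(3) by (simp add: mdw_def)
qed

lemma mw_memd: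
  assumes "path_between D Z Y Ys fs" "fs \<noteq> []" "y \<in> omd j X Z"
  shows "mw X Ys fs y \<in> omd (length fs - 1 + j) X Y"
  using assms(1,2,3)
proof (induction arbitrary: y j rule: path_between_induct)
  case (single Y f)
  then show ?case by (simp add: lm_memd)
next
  case (Cons Y Z' Ys f fs)
  have l: "last (Z' # Ys) = Z" using Cons by (simp add: path_between_def)
  obtain n where n: "length fs = Suc n" using \<open>fs \<noteq> []\<close> by (cases fs) auto
  have "odif X Z y \<in> omd (Suc j) X Z" using Cons by (intro odif_memd)
  from Cons.IH [OF this] odif_memd [OF Cons.IH [OF Cons.prems]] n l
  have "mdw X (Z' # Ys) fs y \<in> omd (Suc (n + j)) X Z'"
    by (simp add: mdw_def del: last.simps)
  with Cons n show ?case by (subst mw_Cons) (auto intro: lm_memd)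
qed

lemma mw_linear:
  assumes "path_between D Z Y Ys fs" "fs \<noteq> []"
  shows "linear_on fscale (om X Z) fscale (mw X Ys fs)"
  using assms
proof (induction rule: path_between_induct)
  case (single Y f)
  then show ?case by (simp add: lm_linear)
next
  case (Cons Y Z' Ys f fs)
  have l: "last (Z' # Ys) = Z" using Cons by (simp add: path_between_def)
  have m: "linear_on fscale (om X Z) fscale (mdw X (Z' # Ys) fs)"
    unfolding mdw_def l list.sel
    using Cons
    by (intro linear_on_plus linear_on_scaled vector_space_fscale)
      (auto intro: linear_on_comp [OF Cons.IH odif_linear] linear_on_comp [OF odif_linear Cons.IH] mw_mem)
  show ?case
    using linear_on_comp [OF m lm_linear [of Z' Y f X]] Cons mdw_mem [of Z Z' "Z' # Ys" fs _ X] by (simp add: mw_Cons)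
qed

lemma mdw_linear:
  assumes p: "path_between D Z Y Ys fs" "fs \<noteq> []"
  shows "linear_on fscale (om X Z) fscale (mdw X Ys fs)"
proof -
  have h: "hd Ys = Y" "last Ys = Z" using p by (auto simp: path_between_def)
  show ?thesis
    unfolding mdw_def h
    by (intro linear_on_plus linear_on_scaled vector_space_fscale
        linear_on_comp [OF mw_linear [OF p] odif_linear] linear_on_comp [OF odif_linear mw_linear [OF p]])
      (simp_all add: mw_mem [OF p])
qed

lemma is_path_between: "is_path D Ys fs \<Longrightarrow> path_between D (last Ys) (hd Ys) Ys fs"
  by (simp add: path_between_def)

lemma mw_multilin:
  assumes "y \<in> om X (last Ys)"
  shows "multilin D fscale Ys (\<lambda>fs. mw X Ys fs y)"
  using assms
proof (induction Ys arbitrary: y)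
  case Nil
  then show ?case by (simp add: multilin_short)
next
  case (Cons Y Ys)
  show ?case
  proof (rule multilin_Cons)
    fix fs assume Y: "Y \<in> ob D" and p: "is_path D Ys fs"
    note q = is_path_between [OF p]
    have ob: "hd Ys \<in> ob D" using is_path_hd [OF p] .
    have y: "y \<in> om X (last Ys)" using Cons is_path_not_Nil [OF p] by simp
    show "linear_on (scl D) (hom D (hd Ys) Y) fscale (\<lambda>g. mw X (Y # Ys) (g # fs) y)"
    proof (cases "fs = []")
      case True
      with p obtain Z where "Ys = [Z]" "Z \<in> ob D" by (auto simp: is_path_Nil)
      with True Y y show ?thesis by (simp add: lm_linear_left)
    next
      case False
      then show ?thesis
        using lm_linear_left [OF ob Y mdw_mem [OF q _ y]] is_path_not_Nil [OF p] by (simp add: mw_Cons)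
    qed
  next
    fix f assume Y: "Y \<in> ob D" "Ys \<noteq> []" "hd Ys \<in> ob D" and f: "f \<in> hom D (hd Ys) Y"
    then have y: "y \<in> om X (last Ys)" using Cons by simp
    show "multilin D fscale Ys (\<lambda>fs. mw X (Y # Ys) (f # fs) y)"
    proof (cases "length Ys \<le> 1")
      case True
      then show ?thesis by (rule multilin_short)
    next
      case False
      then have ne: "fs \<noteq> []" if "is_path D Ys fs" for fs using that by (auto simp: is_path_def)
      have l: "length fs = length Ys - 1" if "is_path D Ys fs" for fs using that by (auto simp: is_path_def)
      have m: "mw X Ys fs z \<in> om X (hd Ys)" if "is_path D Ys fs" "z \<in> om X (last Ys)" for fs z
        using mw_mem [OF is_path_between [OF that(1)] ne [OF that(1)] that(2)] .
      \<comment> \<open>The sign is expressed through \<open>Ys\<close>, so that it does not vary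
        with the path.\<close>
      have "multilin D fscale Ys (\<lambda>fs. odif X (hd Ys) (mw X Ys fs y) +
          fscale ((-1) ^ (length Ys - 1)) (mw X Ys fs (odif X (last Ys) y)))"
        using y by (intro multilin_plus multilin_scaled vector_space_fscale Cons.IH odif_mem
          multilin_comp [OF Cons.IH odif_linear]) (auto intro: m)
      then have "multilin D fscale Ys (\<lambda>fs. mdw X Ys fs y)"
        by (rule multilin_cong) (simp add: mdw_def l)
      then have "multilin D fscale Ys (\<lambda>fs. lm X (hd Ys) Y f (mdw X Ys fs y))"
        by (rule multilin_comp [OF _ lm_linear [OF Y(3,1) f]])
          (auto intro!: mdw_mem [OF is_path_between] ne y)
      then show ?thesis
        by (rule multilin_cong) (simp add: mw_Cons ne Y)
    qed
  qed
qed

lemma mdw_multilin: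
  assumes "y \<in> om X (last Ys)"
  shows "multilin D fscale Ys (\<lambda>fs. mdw X Ys fs y)"
proof (cases "length Ys \<le> 1")
  case True
  then show ?thesis by (rule multilin_short)
next
  case False
  then have ne: "fs \<noteq> []" if "is_path D Ys fs" for fs using that by (auto simp: is_path_def)
  have l: "length fs = length Ys - 1" if "is_path D Ys fs" for fs using that by (auto simp: is_path_def)
  have m: "mw X Ys fs z \<in> om X (hd Ys)" if "is_path D Ys fs" "z \<in> om X (last Ys)" for fs z
    using mw_mem [OF is_path_between [OF that(1)] ne [OF that(1)] that(2)] .
  have "multilin D fscale Ys (\<lambda>fs. odif X (hd Ys) (mw X Ys fs y) +
      fscale ((-1) ^ (length Ys - 1)) (mw X Ys fs (odif X (last Ys) y)))"
    using assms by (intro multilin_plus multilin_scaled vector_space_fscale mw_multilin odif_mem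
      multilin_comp [OF mw_multilin odif_linear]) (auto intro: m)
  then show ?thesis
    by (rule multilin_cong) (simp add: mdw_def l)
qed

text \<open>The differential of the right factor is 0, so every step of the recursion keeps a single
  term and the words are concatenated without any composition.\<close>

lemma mw_dwd:
  assumes "path_between D Z Y Ys fs" "fs \<noteq> []" "path_between D X Z Zs gs" "gs \<noteq> []"
  shows "mw X Ys fs (dwd Zs gs) = wd (Ys @ tl Zs) (fs @ gs)"
  using assms(1,2)
proof (induction rule: path_between_induct)
  case (single Y f)
  then show ?case using path_hd [OF assms(3)] assms by (auto simp: lm_dwd)
next
  case (Cons Y Z' Ys f fs)
  have l: "last (Z' # Ys) = Z" using Cons by (simp add: path_between_def)
  note q = path_append [OF Cons(4) assms(3)]
  have "mw X (Z' # Ys) fs 0 = 0"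
    by (rule linear_on_0 [OF mw_linear [OF Cons(4,5)]]) simp
  then have "mdw X (Z' # Ys) fs (dwd Zs gs) = dwd ((Z' # Ys) @ tl Zs) (fs @ gs)"
    using Cons q assms l by (simp add: mdw_def odif_dwd odif_wd del: last.simps)
  then show ?case
    using Cons lm_dwd [OF Cons(2,1,3) q] by (simp add: mw_Cons)
qed

text \<open>Each step of the recursion shifts the compositions found so far by one place and adds
  the composition of its own morphism with the next one, coming from the term with
  \<open>dy\<close>. The result is the alternating sum of \<open>omega_mult\<close> for \<mu> =
  \<nu> = 0.\<close>

lemma mw_wd:
  assumes "path_between D Z Y Ys fs" "fs \<noteq> []" "path_between D X Z Zs gs" "gs \<noteq> []"
  shows "mw X Ys fs (wd Zs gs) = (\<Sum>i<length fs. fscale ((-1) ^ (length fs - Suc i))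
    (wd (del_nth (Suc i) (Ys @ tl Zs)) (merge D (Ys @ tl Zs) i (fs @ gs))))"
  using assms(1,2)
proof (induction rule: path_between_induct)
  case (single Y f)
  obtain g gs' where gs: "gs = g # gs'" using assms(4) by (cases gs) auto
  obtain Zs' where Zs: "Zs = Z # Zs'" using path_hd [OF assms(3)] by blast
  have "Zs' \<noteq> []" using assms(3) is_path_length [of D Zs gs] by (auto simp: Zs gs path_between_def)
  then have "Zs' ! 0 = hd Zs'" by (simp add: hd_conv_nth)
  then show ?case
    using lm_wd [OF single(1,2,3) assms(3) [unfolded gs]] by (simp add: gs Zs merge_def)
next
  case (Cons Y Z' Ys f fs)
  let ?Ws = "(Z' # Ys) @ tl Zs"
  let ?as = "fs @ gs"
  have l: "last (Z' # Ys) = Z" using Cons by (simp add: path_between_def)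
  have q: "path_between D X Z' ?Ws ?as" by (rule path_append [OF Cons(4) assms(3)])
  obtain g fs' where fs: "fs = g # fs'" using Cons(5) by (cases fs) auto
  have m: "path_between D X Z' (del_nth (Suc i) ?Ws) (merge D ?Ws i ?as)" if "i < length fs" for i
    using that assms(4) by (intro path_merge q) (simp add: less_Suc_eq_le Suc_le_eq flip: length_greater_0_conv)
  have mem: "fscale c (wd (del_nth (Suc i) ?Ws) (merge D ?Ws i ?as)) \<in> om X Z'" if "i < length fs" for i c
    by (intro om_scale omd_mem(3) m that) simp
  have dmem: "fscale c (dwd (del_nth (Suc i) ?Ws) (merge D ?Ws i ?as)) \<in> om X Z'" if "i < length fs" for i c
    by (intro om_scale omd_mem(4) m that) simp
  have "odif X Z' (mw X (Z' # Ys) fs (wd Zs gs)) = (\<Sum>i<length fs. fscale ((-1) ^ (length fs - Suc i))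
      (dwd (del_nth (Suc i) ?Ws) (merge D ?Ws i ?as)))"
    unfolding Cons.IH
    by (subst linear_on_apply_sum [OF vector_space_fscale om_sub odif_linear])
      (auto simp: linear_on_scale [OF odif_linear] mem omd_mem(3) [OF m] odif_wd [OF m] simp del: append_Cons del_nth_Cons)
  then have md: "mdw X (Z' # Ys) fs (wd Zs gs) = (\<Sum>i<length fs. fscale ((-1) ^ (length fs - Suc i))
      (dwd (del_nth (Suc i) ?Ws) (merge D ?Ws i ?as))) + fscale ((-1) ^ length fs) (wd ?Ws ?as)"
    using l mw_dwd [OF Cons(4,5) assms(3,4)] odif_wd [OF assms(3,4)]
    by (simp add: mdw_def del: last.simps)
  have wm: "wd ?Ws ?as \<in> om X Z'" by (rule omd_mem(3) [OF q]) (simp add: fs)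
  note lin = lm_linear [OF Cons(2,1,3)]
  have sm: "(\<Sum>i<length fs. fscale ((-1) ^ (length fs - Suc i))
        (dwd (del_nth (Suc i) ?Ws) (merge D ?Ws i ?as))) \<in> om X Z'"
    by (intro fscale.subspace_sum [OF om_sub] dmem) simp
  have "mw X (Y # Z' # Ys) (f # fs) (wd Zs gs) =
      lm X Z' Y f (\<Sum>i<length fs. fscale ((-1) ^ (length fs - Suc i))
        (dwd (del_nth (Suc i) ?Ws) (merge D ?Ws i ?as))) +
      fscale ((-1) ^ length fs) (lm X Z' Y f (wd ?Ws ?as))"
    using Cons(5) wm sm
    by (simp add: mw_Cons md linear_on_add [OF lin] linear_on_scale [OF lin]
      del: append_Cons del_nth_Cons)
  also have "lm X Z' Y f (\<Sum>i<length fs. fscale ((-1) ^ (length fs - Suc i))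
        (dwd (del_nth (Suc i) ?Ws) (merge D ?Ws i ?as))) =
      (\<Sum>i<length fs. fscale ((-1) ^ (length fs - Suc i))
        (wd (Y # del_nth (Suc i) ?Ws) (f # merge D ?Ws i ?as)))"
    by (subst linear_on_apply_sum [OF vector_space_fscale om_sub lin])
      (auto simp: linear_on_scale [OF lin] dmem omd_mem(4) [OF m] lm_dwd [OF Cons(2,1,3) m] simp del: append_Cons del_nth_Cons)
  \<comment> \<open>Left multiplication composes \<open>f\<close> with the first letter, which is
    the composition at position 0.\<close>
  also have "lm X Z' Y f (wd ?Ws ?as) = wd (del_nth (Suc 0) (Y # ?Ws)) (merge D (Y # ?Ws) 0 (f # ?as))"
  proof -
    have "Ys @ tl Zs \<noteq> []" using is_path_length [of D "Z' # Ys" fs] Cons(4) by (auto simp: fs path_between_def)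
    then have "hd (Ys @ tl Zs) = (Ys @ tl Zs) ! 0" by (simp add: hd_conv_nth)
    then show ?thesis
      using lm_wd [OF Cons(2,1,3), of X ?Ws g "fs' @ gs"] q by (simp add: fs merge_def)
  qed
  finally show ?case
    by (simp add: sum.lessThan_Suc_shift add.commute del: sum.lessThan_Suc)
qed

end

context semicat
begin

section \<open>The explicit product formula against the recursion\<close>

lemma om_gen: "g \<in> omega_gens D X Y \<Longrightarrow> omega_gen D g \<in> om X Y"
  unfolding om_def tensor_space_def omega_gen_def by (intro fscale.span_base) simp

text \<open>If a linear \<open>K\<close> with the right values is already known, no form has to be
  exhibited: \<open>K\<close> evaluates the chosen sum. Applied to the inner lift in
  \<open>ocmp\<close>.\<close>

lemma tensor_lift_of_linear:
  assumes K: "linear_on fscale (om X Y) sW K"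
    and F: "\<And>v. v \<in> omega_gens D X Y \<Longrightarrow> F v = K (omega_gen D v)" and y: "y \<in> om X Y"
  shows "tensor_lift (omega_gen D) (omega_gens D X Y) F y = K y"
proof -
  define hs where "hs = (SOME gs. set gs \<subseteq> omega_gens D X Y \<and> sum_list (map (omega_gen D) gs) = y)"
  have "\<exists>gs. set gs \<subseteq> omega_gens D X Y \<and> sum_list (map (omega_gen D) gs) = y"
    unfolding omega_gen_def
  proof (rule tensor_space_sums [OF _ y [unfolded om_def]])
    fix c g assume g: "g \<in> omega_gens D X Y"
    obtain Ys f \<mu> fs where "g = (Ys, (f, \<mu>), fs)" by (metis surj_pair)
    then show "\<exists>g'\<in>omega_gens D X Y. elem_tensor (omega_forms D) g' = fscale c (elem_tensor (omega_forms D) g)"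
      using omega_scale [of Ys f \<mu> fs X Y c] g unfolding omega_gen_def by blast
  qed
  then have hs: "set hs \<subseteq> omega_gens D X Y \<and> sum_list (map (omega_gen D) hs) = y"
    unfolding hs_def by (rule someI_ex)
  have "sum_list (map F hs) = sum_list (map (\<lambda>v. K (omega_gen D v)) hs)"
    using hs F by (intro arg_cong [where f = sum_list] map_cong) auto
  also have "\<dots> = K y"
    using hs by (subst linear_on_apply_sum_list [symmetric, OF vector_space_fscale om_sub K]) (auto simp: om_gen)
  finally show ?thesis by (simp add: tensor_lift_def hs_def)
qed

text \<open>Both sides are expanded into words. The \<nu>-part of the right factor begins with a
  differential and is only concatenated. The \<mu>-part of the left factor is matched summand by
  summand: i = 0 gives the term with \<open>dy\<close> in \<open>mdw\<close>, and i = j + 1 the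
  differential of the composition at j.\<close>

lemma omega_mult_eq:
  assumes u: "(Ys, (f, \<mu>), fs) \<in> omega_gens D Y Z" and v: "(Zs, (g, \<nu>), gs) \<in> omega_gens D X Y"
  shows "omega_mult D (Ys, (f, \<mu>), fs) (Zs, (g, \<nu>), gs) =
    mw X Ys (f # fs) (omega_gen D (Zs, (g, \<nu>), gs)) +
    fscale \<mu> (mdw X (tl Ys) fs (omega_gen D (Zs, (g, \<nu>), gs)))"
proof -
  let ?Ws = "Ys @ tl Zs" and ?as = "fs @ g # gs" and ?v = "omega_gen D (Zs, (g, \<nu>), gs)"
  let ?n = "length fs"
  from u have pu: "path_between D Y Z Ys (f # fs)" and mu: "fs = [] \<or> Ys ! 1 \<noteq> Z \<Longrightarrow> \<mu> = 0"
    by (auto simp: omega_gens_path)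
  from v have pv: "path_between D X Y Zs (g # gs)" and nu: "gs = [] \<or> Zs ! 1 \<noteq> Y \<Longrightarrow> \<nu> = 0"
    by (auto simp: omega_gens_path)
  obtain Ys' where Ys: "Ys = Z # Ys'" using path_hd [OF pu] by blast
  obtain Zs' where Zs: "Zs = Y # Zs'" using path_hd [OF pv] by blast
  have pu': "path_between D Y (hd Ys') Ys' fs" and pv': "path_between D X (hd Zs') Zs' gs"
    and f: "f \<in> hom D (hd Ys') Z" and obs: "Z \<in> ob D"
    using pu pv by (auto simp: Ys Zs path_between_Cons)
  have ne: "Ys' \<noteq> []" "Zs' \<noteq> []" using path_hd [OF pu'] path_hd [OF pv'] by auto
  have nth1: "Ys ! 1 = hd Ys'" "Zs ! 1 = hd Zs'" using ne by (simp_all add: Ys Zs hd_conv_nth)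
  have pW: "path_between D X Z ?Ws (f # ?as)" using path_append [OF pu pv] by simp
  have vsplit: "?v = wd Zs (g # gs) + fscale \<nu> (dwd Zs' gs)"
    using omega_gen_split [OF v] by (simp add: Zs)
  have wv: "wd Zs (g # gs) \<in> om X Y" by (rule omd_mem(3) [OF pv]) simp
  have dwv: "fscale \<nu> (dwd Zs' gs) \<in> om X Y"
  proof (cases "\<nu> = 0")
    case False
    then have "gs \<noteq> []" "hd Zs' = Y" using nu nth1 by auto
    then show ?thesis using omd_mem(4) [of X Y Zs' gs] pv' by simp
  qed simp
  have dv: "odif X Y ?v = dwd Zs (g # gs)"
  proof (cases "\<nu> = 0")
    case False
    then have "gs \<noteq> []" "hd Zs' = Y" using nu nth1 by auto
    then show ?thesis
      using pv' pv wv omd_mem(4) [of X Y Zs' gs]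
      by (simp add: vsplit linear_on_add [OF odif_linear] linear_on_scale [OF odif_linear] odif_wd odif_dwd)
  next
    case True
    then show ?thesis unfolding vsplit using odif_wd [OF pv] by simp
  qed
  \<comment> \<open>If \<nu> is nonzero, the tail of the symbol starts at \<open>Y\<close>, so it is
    a path and \<open>mw_dwd\<close> applies.\<close>
  have nterm: "mw X Vs hs (fscale \<nu> (dwd Zs' gs)) = fscale \<nu> (wd (Vs @ tl Zs') (hs @ gs))"
    if pV: "path_between D Y V Vs hs" "hs \<noteq> []" for V Vs hs
  proof (cases "\<nu> = 0")
    case True
    then show ?thesis using linear_on_0 [OF mw_linear [OF pV]] by simp
  next
    case False
    then have "gs \<noteq> []" "hd Zs' = Y" using nu nth1 by auto
    then show ?thesis
      using mw_dwd [OF pV, of X Zs' gs] pv' omd_mem(4) [of X Y Zs' gs]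
      by (simp add: linear_on_scale [OF mw_linear [OF pV]])
  qed
  have mwv: "mw X Ys (f # fs) ?v = (\<Sum>i\<le>?n. fscale ((-1) ^ (?n - i))
      (wd (del_nth (Suc i) ?Ws) (merge D ?Ws i (f # ?as)))) + fscale \<nu> (wd (Ys @ tl Zs') (f # fs @ gs))"
    unfolding vsplit
    by (subst linear_on_add [OF mw_linear [OF pu]])
      (simp_all add: wv dwv nterm [OF pu] mw_wd [OF pu _ pv] lessThan_Suc_atMost)
  define t where "t = (\<lambda>i. omega_gen D
        (case i of
           0 \<Rightarrow> (del_nth 1 ?Ws,
                (cmp D (?Ws ! 2) (?Ws ! 1) (?Ws ! 0) f (hd ?as) + scl D \<mu> (hd ?as), 0),
                tl ?as)
         | Suc j \<Rightarrow> (del_nth (Suc i) ?Ws, (f, \<mu>), merge D (tl ?Ws) j ?as)))"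
  have tl2: "drop 2 Zs = tl Zs'" by (simp add: Zs numeral_2_eq_2 drop_Suc)
  have om: "omega_mult D (Ys, (f, \<mu>), fs) (Zs, (g, \<nu>), gs) =
      (\<Sum>i\<le>?n. fscale ((-1) ^ (?n - i)) (t i)) +
      fscale \<nu> (omega_gen D (Ys @ tl Zs', (f, \<mu>), fs @ gs))"
    using tl2 by (simp add: omega_mult_def Let_def t_def)
  have hdas: "?as = hd ?as # tl ?as" by (cases fs) auto
  have m0: "merge D ?Ws 0 (f # ?as) = cmp D (?Ws ! 2) (?Ws ! 1) (?Ws ! 0) f (hd ?as) # tl ?as"
    by (cases fs) (simp_all add: merge_def numeral_2_eq_2)
  have mS: "merge D ?Ws (Suc j) (f # ?as) = f # merge D (tl ?Ws) j ?as" for j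
    by (simp add: Ys)
  show ?thesis
  proof (cases "\<mu> = 0")
    case True
    have "t i = wd (del_nth (Suc i) ?Ws) (merge D ?Ws i (f # ?as))" for i
    proof (cases i)
      case 0
      then show ?thesis unfolding 0 m0 by (simp add: t_def True wd_def)
    next
      case (Suc j)
      then show ?thesis unfolding Suc mS by (simp add: t_def True wd_def)
    qed
    then show ?thesis unfolding om mwv by (simp add: True wd_def)
  next
    case False
    then have fs: "fs \<noteq> []" and hdY: "hd Ys' = Z" using mu nth1 by auto
    from fs obtain f1 fs' where fs1: "fs = f1 # fs'" by (cases fs) auto
    obtain Ys'' where Ys': "Ys' = Z # Ys''" using ne hdY by (cases Ys') auto
    have puZ: "path_between D Y Z Ys' fs" using pu' hdY by simp
    have tlW: "tl ?Ws = Ys' @ tl Zs" by (simp add: Ys)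
    have pW': "path_between D X Z (tl ?Ws) ?as" unfolding tlW by (rule path_append [OF puZ pv])
    \<comment> \<open>The differential turns each composed word into one that starts with a
      differential. The last term comes from \<open>dy\<close>, which has lost its
      \<nu>-part.\<close>
    have mdwv: "mdw X (tl Ys) fs ?v = (\<Sum>i<?n. fscale ((-1) ^ (?n - Suc i))
        (dwd (del_nth (Suc i) (tl ?Ws)) (merge D (tl ?Ws) i ?as))) +
        fscale \<nu> (dwd (Ys' @ tl Zs') (fs @ gs)) + fscale ((-1) ^ ?n) (wd (tl ?Ws) ?as)"
    proof -
      have m: "path_between D X Z (del_nth (Suc i) (tl ?Ws)) (merge D (tl ?Ws) i ?as)" if "i < ?n" for i
        using that by (intro path_merge pW') simp
      have mem: "fscale c (wd (del_nth (Suc i) (tl ?Ws)) (merge D (tl ?Ws) i ?as)) \<in> om X Z" if "i < ?n" for i c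
        by (intro om_scale omd_mem(3) m that) simp
      have s: "odif X Z (\<Sum>i<?n. fscale ((-1) ^ (?n - Suc i)) (wd (del_nth (Suc i) (tl ?Ws)) (merge D (tl ?Ws) i ?as))) =
          (\<Sum>i<?n. fscale ((-1) ^ (?n - Suc i)) (dwd (del_nth (Suc i) (tl ?Ws)) (merge D (tl ?Ws) i ?as)))"
        by (subst linear_on_apply_sum [OF vector_space_fscale om_sub odif_linear])
          (auto simp: linear_on_scale [OF odif_linear] mem omd_mem(3) [OF m] odif_wd [OF m])
      have sm: "(\<Sum>i<?n. fscale ((-1) ^ (?n - Suc i)) (wd (del_nth (Suc i) (tl ?Ws)) (merge D (tl ?Ws) i ?as))) \<in> om X Z"
        by (intro fscale.subspace_sum [OF om_sub] mem) simp
      have n: "fscale \<nu> (wd (Ys' @ tl Zs') (fs @ gs)) \<in> om X Z \<and>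
          odif X Z (fscale \<nu> (wd (Ys' @ tl Zs') (fs @ gs))) = fscale \<nu> (dwd (Ys' @ tl Zs') (fs @ gs))"
      proof (cases "\<nu> = 0")
        case True
        then show ?thesis using linear_on_0 [OF odif_linear [of X Z]] by simp
      next
        case False
        then have "hd Zs' = Y" using nu nth1 by auto
        then have "path_between D X Z (Ys' @ tl Zs') (fs @ gs)"
          using path_append [OF puZ, of X Zs' gs] pv' by simp
        then show ?thesis using fs by (simp add: omd_mem(3) odif_wd linear_on_scale [OF odif_linear])
      qed
      have "mw X Ys' fs ?v = (\<Sum>i<?n. fscale ((-1) ^ (?n - Suc i))
          (wd (del_nth (Suc i) (tl ?Ws)) (merge D (tl ?Ws) i ?as))) + fscale \<nu> (wd (Ys' @ tl Zs') (fs @ gs))"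
        unfolding vsplit tlW
        by (subst linear_on_add [OF mw_linear [OF puZ fs]])
          (simp_all add: wv dwv nterm [OF puZ fs] mw_wd [OF puZ fs pv])
      moreover have "mw X Ys' fs (dwd Zs (g # gs)) = wd (tl ?Ws) ?as"
        unfolding tlW by (rule mw_dwd [OF puZ fs pv]) simp
      moreover have "last Ys' = Y" "tl Ys = Ys'" using puZ by (auto simp: path_between_def Ys)
      ultimately show ?thesis
        using n sm by (simp add: mdw_def dv hdY linear_on_add [OF odif_linear] s del: tl_append2)
    qed
    \<comment> \<open>In the summand i = 0 the unit adds \<mu> times the next morphism to the first
      letter; linearity in that letter splits it off.\<close>
    have t0: "t 0 = wd (del_nth (Suc 0) ?Ws) (merge D ?Ws 0 (f # ?as)) + fscale \<mu> (wd (tl ?Ws) ?as)"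
    proof -
      let ?a = "hd ?as" and ?as' = "tl ?as" and ?V = "Ys'' @ tl Zs"
      have W: "?Ws = Z # Z # ?V" by (simp add: Ys Ys')
      have pV: "is_path D ?V ?as'" and a: "?a \<in> hom D (hd ?V) Z"
        using pW' by (simp_all add: W fs1 path_between_Cons) (simp add: path_between_def)
      have V0: "?V ! 0 = hd ?V" using is_path_not_Nil [OF pV] by (simp add: hd_conv_nth)
      have hV: "hd ?V \<in> ob D" by (rule is_path_hd [OF pV])
      have fZ: "f \<in> hom D Z Z" using f hdY by simp
      note lin = multilin_hd [OF multilin_wd pV obs]
      have c: "cmp D (hd ?V) Z Z f ?a \<in> hom D (hd ?V) Z" using fZ a hV obs by simp
      have s: "scl D \<mu> ?a \<in> hom D (hd ?V) Z" using av.subspace_scale [OF hom_sub [OF hV obs] a] .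
      have "t 0 = wd (Z # ?V) ((cmp D (hd ?V) Z Z f ?a + scl D \<mu> ?a) # ?as')"
        unfolding t_def by (simp add: wd_def V0 W fs1)
      also have "\<dots> = wd (Z # ?V) (cmp D (hd ?V) Z Z f ?a # ?as') + fscale \<mu> (wd (Z # ?V) (?a # ?as'))"
        by (simp add: linear_on_add [OF lin c s] linear_on_scale [OF lin a])
      finally show ?thesis
        unfolding m0 hdas [symmetric] by (simp add: W V0)
    qed
    \<comment> \<open>For i > 0 the leading pair (f, \<mu>) is untouched, and splitting the symbol
      produces the two words.\<close>
    have tS: "t (Suc j) = wd (del_nth (Suc (Suc j)) ?Ws) (merge D ?Ws (Suc j) (f # ?as)) +
        fscale \<mu> (dwd (del_nth (Suc j) (tl ?Ws)) (merge D (tl ?Ws) j ?as))" if j: "j < ?n" for j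
    proof -
      have "path_between D X Z (del_nth (Suc (Suc j)) ?Ws) (merge D ?Ws (Suc j) (f # ?as))"
        using j by (intro path_merge pW) simp
      then have "(del_nth (Suc (Suc j)) ?Ws, (f, \<mu>), merge D (tl ?Ws) j ?as) \<in> omega_gens D X Z"
        unfolding mS by (simp add: omega_gens_path) (simp add: Ys Ys')
      from omega_gen_split [OF this] show ?thesis
        unfolding mS by (simp add: t_def Ys)
    qed
    have nt: "fscale \<nu> (omega_gen D (Ys @ tl Zs', (f, \<mu>), fs @ gs)) =
        fscale \<nu> (wd (Ys @ tl Zs') (f # fs @ gs)) + fscale \<mu> (fscale \<nu> (dwd (Ys' @ tl Zs') (fs @ gs)))"
    proof (cases "\<nu> = 0")
      case False
      then have "hd Zs' = Y" using nu nth1 by auto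
      then have "path_between D X Z (Ys @ tl Zs') (f # fs @ gs)"
        using path_append [OF pu, of X Zs' gs] pv' by simp
      then have "(Ys @ tl Zs', (f, \<mu>), fs @ gs) \<in> omega_gens D X Z"
        using fs by (simp add: omega_gens_path Ys Ys')
      from omega_gen_split [OF this] show ?thesis
        by (simp add: Ys fscale.scale_right_distrib mult.commute)
    qed simp
    have "(\<Sum>i\<le>?n. fscale ((-1) ^ (?n - i)) (t i)) =
        (\<Sum>i\<le>?n. fscale ((-1) ^ (?n - i)) (wd (del_nth (Suc i) ?Ws) (merge D ?Ws i (f # ?as)))) +
        fscale \<mu> ((\<Sum>i<?n. fscale ((-1) ^ (?n - Suc i)) (dwd (del_nth (Suc i) (tl ?Ws)) (merge D (tl ?Ws) i ?as))) +
          fscale ((-1) ^ ?n) (wd (tl ?Ws) ?as))"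
      unfolding lessThan_Suc_atMost [symmetric] sum.lessThan_Suc_shift
      by (simp add: t0 tS fscale.scale_right_distrib fscale.scale_sum_right sum.distrib mult.commute
        algebra_simps del: tl_append2)
    then show ?thesis
      unfolding om mwv mdwv nt
      by (simp add: fscale.scale_right_distrib algebra_simps)
  qed
qed

text \<open>The left factor is now described by words, with \<open>mw\<close> and \<open>mdw\<close>
  as the two families; \<open>omega_mult\<close> is not met again.\<close>

lemma ocmp_lift:
  assumes y: "y \<in> om X Y"
  shows ocmp_linear_left: "linear_on fscale (om Y Z) fscale (\<lambda>x. ocmp X Y Z x y)"
    and ocmp_wd: "path_between D Y Z Ys fs \<Longrightarrow> fs \<noteq> [] \<Longrightarrow> ocmp X Y Z (wd Ys fs) y = mw X Ys fs y"
    and ocmp_dwd: "path_between D Y Z Ys fs \<Longrightarrow> fs \<noteq> [] \<Longrightarrow> ocmp X Y Z (dwd Ys fs) y = mdw X Ys fs y"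
proof -
  let ?F = "\<lambda>u. tensor_lift (omega_gen D) (omega_gens D X Y) (\<lambda>v. omega_mult D u v) y"
  have F: "\<forall>Ys f \<mu> fs. (Ys, (f, \<mu>), fs) \<in> omega_gens D Y Z \<longrightarrow>
     ?F (Ys, (f, \<mu>), fs) = mw X Ys (f # fs) y + fscale \<mu> (mdw X (tl Ys) fs y)"
  proof (intro allI impI)
    fix Ys f \<mu> fs assume u: "(Ys, (f, \<mu>), fs) \<in> omega_gens D Y Z"
    then have p: "path_between D Y Z Ys (f # fs)" by (simp add: omega_gens_path)
    show "?F (Ys, (f, \<mu>), fs) = mw X Ys (f # fs) y + fscale \<mu> (mdw X (tl Ys) fs y)"
    proof (rule tensor_lift_of_linear [OF _ _ y])
      show "linear_on fscale (om X Y) fscale (\<lambda>y. mw X Ys (f # fs) y + fscale \<mu> (mdw X (tl Ys) fs y))"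
      proof (cases "\<mu> = 0")
        case True
        then show ?thesis using mw_linear [OF p] by simp
      next
        case False
        then have "fs \<noteq> []" using u by (simp add: omega_gens_path)
        obtain Ys' where "Ys = Z # Ys'" using path_hd [OF p] by blast
        with p have "path_between D Y (hd (tl Ys)) (tl Ys) fs" by (simp add: path_between_Cons)
        then show ?thesis
          using \<open>fs \<noteq> []\<close> p
          by (intro linear_on_plus linear_on_scaled vector_space_fscale mw_linear mdw_linear) auto
      qed
      fix v assume "v \<in> omega_gens D X Y"
      moreover obtain Zs g \<nu> gs where "v = (Zs, (g, \<nu>), gs)" by (metis surj_pair)
      ultimately show "omega_mult D (Ys, (f, \<mu>), fs) v =
          mw X Ys (f # fs) (omega_gen D v) + fscale \<mu> (mdw X (tl Ys) fs (omega_gen D v))"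
        using omega_mult_eq [OF u] by simp
    qed
  qed
  have A: "\<forall>Ys. hd Ys = Z \<and> last Ys = Y \<longrightarrow> multilin D fscale Ys (\<lambda>fs. mw X Ys fs y)"
    and B: "\<forall>Ys. hd Ys = Z \<and> last Ys = Y \<longrightarrow> multilin D fscale Ys (\<lambda>fs. mdw X Ys fs y)"
    using y by (auto intro: mw_multilin mdw_multilin)
  note L = omega_lift [where A = "\<lambda>Ys fs. mw X Ys fs y" and B = "\<lambda>Ys fs. mdw X Ys fs y" and F = ?F,
      OF vector_space_fscale A B F]
  have eq: "(\<lambda>x. ocmp X Y Z x y) = tensor_lift (omega_gen D) (omega_gens D Y Z) ?F"
    by (simp add: fun_eq_iff ocmp_def)
  show "linear_on fscale (om Y Z) fscale (\<lambda>x. ocmp X Y Z x y)" unfolding eq by (rule L(1))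
  show "path_between D Y Z Ys fs \<Longrightarrow> fs \<noteq> [] \<Longrightarrow> ocmp X Y Z (wd Ys fs) y = mw X Ys fs y"
    using L(2) by (simp add: ocmp_def)
  show "path_between D Y Z Ys fs \<Longrightarrow> fs \<noteq> [] \<Longrightarrow> ocmp X Y Z (dwd Ys fs) y = mdw X Ys fs y"
    using L(3) by (simp add: ocmp_def)
qed

lemma ocmp_linear_right:
  assumes x: "x \<in> om Y Z"
  shows "linear_on fscale (om X Y) fscale (ocmp X Y Z x)"
proof (rule linear_onI)
  fix y y' assume y: "y \<in> om X Y" "y' \<in> om X Y"
  then have s: "y + y' \<in> om X Y" by simp
  show "ocmp X Y Z x (y + y') = ocmp X Y Z x y + ocmp X Y Z x y'"
    by (rule linear_om_eqI [where F = "\<lambda>x. ocmp X Y Z x (y + y')" and G = "\<lambda>x. ocmp X Y Z x y + ocmp X Y Z x y'",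
        OF ocmp_linear_left [OF s] linear_on_plus [OF vector_space_fscale ocmp_linear_left [OF y(1)] ocmp_linear_left [OF y(2)]] _ _ x])
      (simp_all add: ocmp_wd ocmp_dwd s y linear_on_add [OF mw_linear] linear_on_add [OF mdw_linear])
next
  fix c y assume y: "y \<in> om X Y"
  then have s: "fscale c y \<in> om X Y" by simp
  show "ocmp X Y Z x (fscale c y) = fscale c (ocmp X Y Z x y)"
    by (rule linear_om_eqI [where F = "\<lambda>x. ocmp X Y Z x (fscale c y)" and G = "\<lambda>x. fscale c (ocmp X Y Z x y)",
        OF ocmp_linear_left [OF s] linear_on_scaled [OF vector_space_fscale ocmp_linear_left [OF y]] _ _ x])
      (simp_all add: ocmp_wd ocmp_dwd s y linear_on_scale [OF mw_linear] linear_on_scale [OF mdw_linear])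
qed

lemma ocmp_memd:
  assumes x: "x \<in> omd i Y Z" and y: "y \<in> omd j X Y"
  shows "ocmp X Y Z x y \<in> omd (i + j) X Z"
  using x
proof (induction rule: omd_induct)
  case zero
  show ?case using linear_on_0 [OF ocmp_linear_left [OF omd_om [OF y], of Z]] by simp
next
  case (wd Ys fs)
  then have "fs \<noteq> []" by auto
  with wd mw_memd [OF wd(1) this y] show ?case by (simp add: ocmp_wd omd_om [OF y])
next
  case (dwd Ys fs)
  have h: "hd Ys = Z" "last Ys = Y" using dwd by (auto simp: path_between_def)
  obtain n where n: "i = Suc n" using dwd by (cases i) auto
  show ?case
    using mw_memd [OF dwd(1,3) odif_memd [OF y]] odif_memd [OF mw_memd [OF dwd(1,3) y]] dwd
    by (simp add: ocmp_dwd omd_om [OF y] mdw_def h n)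
qed (simp_all add: omd_om linear_on_add [OF ocmp_linear_left [OF omd_om [OF y]]]
    linear_on_scale [OF ocmp_linear_left [OF omd_om [OF y]]])

lemma ocmp_mem [simp]:
  assumes x: "x \<in> om Y Z" and y: "y \<in> om X Y"
  shows "ocmp X Y Z x y \<in> om X Z"
  using x
proof (induction rule: om_induct)
  case (add x x')
  then show ?case by (simp add: linear_on_add [OF ocmp_linear_left [OF y]])
next
  case x: (hmg n x)
  from y show ?case
  proof (induction rule: om_induct)
    case (add y y')
    then show ?case by (simp add: linear_on_add [OF ocmp_linear_right [OF omd_om [OF x]]])
  next
    case (hmg m y)
    then show ?case using ocmp_memd [OF x] omd_om by blast
  qed
qed

lemma iota_memd: "X \<in> ob D \<Longrightarrow> Y \<in> ob D \<Longrightarrow> f \<in> hom D X Y \<Longrightarrow> iota X Y f \<in> omd 0 X Y"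
  unfolding iota_def by (rule omd_mem(1)) (simp_all add: path_single)

lemmas iota_mem [simp] = omd_om [OF iota_memd]

lemma iota_linear:
  assumes "X \<in> ob D" "Y \<in> ob D"
  shows "linear_on (scl D) (hom D X Y) fscale (iota X Y)"
  using multilin_hd [OF multilin_wd, of "[X]" "[]" Y] assms by (simp add: iota_def [abs_def] is_path_Nil)

lemma ocmp_iota:
  assumes "Z \<in> ob D" "Y \<in> ob D" "f \<in> hom D Z Y" "y \<in> om X Z"
  shows "ocmp X Z Y (iota Z Y f) y = lm X Z Y f y"
  using assms by (simp add: iota_def ocmp_wd path_single)

lemma lm_iota:
  assumes "X \<in> ob D" "Z \<in> ob D" "Y \<in> ob D" "f \<in> hom D Z Y" "g \<in> hom D X Z"
  shows "lm X Z Y f (iota X Z g) = iota X Y (cmp D X Z Y f g)"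
  using assms by (simp add: iota_def lm_wd path_single)

text \<open>Exhibits a word as a morphism times the differential of a shorter word, the step behind
  \<open>omd_struct_induct\<close>.\<close>

lemma wd_Cons:
  assumes "path_between D X Z Zs gs" "gs \<noteq> []" "Y \<in> ob D" "f \<in> hom D Z Y"
  shows "wd (Y # Zs) (f # gs) = lm X Z Y f (odif X Z (wd Zs gs))"
  using assms path_between_ob [OF assms(1)] by (simp add: odif_wd lm_dwd)

lemma lm_lm:
  assumes ob: "W \<in> ob D" "Z \<in> ob D" "Y \<in> ob D" and f: "f \<in> hom D Z Y" and g: "g \<in> hom D W Z"
    and x: "x \<in> om X W"
  shows "lm X Z Y f (lm X W Z g x) = lm X W Y (cmp D W Z Y f g) x"
proof -
  have fg: "cmp D W Z Y f g \<in> hom D W Y" using assms by simp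
  have 1: "linear_on fscale (om X W) fscale (\<lambda>x. lm X Z Y f (lm X W Z g x))"
    by (rule linear_on_comp [OF lm_linear lm_linear]) (use assms in auto)
  show ?thesis
  proof (rule linear_om_eqI [where F = "\<lambda>x. lm X Z Y f (lm X W Z g x)", OF 1 lm_linear _ _ x])
    fix Ys fs assume p: "path_between D X W Ys fs" "fs \<noteq> []"
    then obtain a fs' where fs: "fs = a # fs'" by (cases fs) auto
    obtain Ys' where Ys: "Ys = W # Ys'" using path_hd [OF p(1)] by blast
    from p have q: "a \<in> hom D (hd Ys') W" "path_between D X (hd Ys') Ys' fs'" by (auto simp: fs Ys path_between_Cons)
    note obY = conjunct2 [OF path_between_ob [OF q(2)]]
    have r: "path_between D X Z (Z # Ys') (cmp D (hd Ys') W Z g a # fs')"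
      using q ob obY g by (simp add: path_between_Cons)
    show "lm X Z Y f (lm X W Z g (wd Ys fs)) = lm X W Y (cmp D W Z Y f g) (wd Ys fs)"
      using p q r ob obY f g fg by (simp add: fs Ys lm_wd cmp_assoc)
    show "lm X Z Y f (lm X W Z g (dwd Ys fs)) = lm X W Y (cmp D W Z Y f g) (dwd Ys fs)"
      using p ob f g fg path_Cons [OF p(1) ob(2) g] path_hd [OF p(1)] by (auto simp: lm_dwd lm_wd)
  qed (use ob fg in auto)
qed

text \<open>Associativity with a morphism as leftmost factor. A word of one morphism leads back to
  \<open>lm_lm\<close>; on the other words both sides reduce to left multiplications of the same
  \<open>mdw\<close>.\<close>

lemma ocmp_lm:
  assumes ob: "W \<in> ob D" "Z \<in> ob D" "Y \<in> ob D" and f: "f \<in> hom D Z Y"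
    and x: "x \<in> om W Z" and y: "y \<in> om X W"
  shows "ocmp X W Y (lm W Z Y f x) y = lm X Z Y f (ocmp X W Z x y)"
proof -
  note ll = lm_linear [OF ob(2,3) f]
  have 1: "linear_on fscale (om W Z) fscale (\<lambda>x. ocmp X W Y (lm W Z Y f x) y)"
    by (rule linear_on_comp [OF ll ocmp_linear_left [OF y]]) (use assms in auto)
  have 2: "linear_on fscale (om W Z) fscale (\<lambda>x. lm X Z Y f (ocmp X W Z x y))"
    by (rule linear_on_comp [OF ocmp_linear_left [OF y] ll]) (use assms in auto)
  show ?thesis
  proof (rule linear_om_eqI [where F = "\<lambda>x. ocmp X W Y (lm W Z Y f x) y" and G = "\<lambda>x. lm X Z Y f (ocmp X W Z x y)", OF 1 2 _ _ x])
    fix Ys fs assume p: "path_between D W Z Ys fs" "fs \<noteq> []"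
    then obtain a fs' where fs: "fs = a # fs'" by (cases fs) auto
    obtain Ys' where Ys: "Ys = Z # Ys'" using path_hd [OF p(1)] by blast
    from p have q: "a \<in> hom D (hd Ys') Z" "path_between D W (hd Ys') Ys' fs'" by (auto simp: fs Ys path_between_Cons)
    note obY = conjunct2 [OF path_between_ob [OF q(2)]]
    have ne: "Ys' \<noteq> []" using path_hd [OF q(2)] by auto
    have r: "path_between D W Y (Y # Ys') (cmp D (hd Ys') Z Y f a # fs')"
      using q ob obY f by (simp add: path_between_Cons)
    show "ocmp X W Y (lm W Z Y f (wd Ys fs)) y = lm X Z Y f (ocmp X W Z (wd Ys fs) y)"
    proof (cases "fs' = []")
      case True
      with q obtain V where "Ys' = [V]" "V = W" by (auto simp: path_between_def is_path_Nil)
      with True show ?thesis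
        using p q r ob obY f y by (simp add: fs Ys lm_wd ocmp_wd lm_lm)
    next
      case False
      then show ?thesis
        using p q r ob obY f y ne mdw_mem [OF q(2) _ y] by (simp add: fs Ys lm_wd ocmp_wd mw_Cons lm_lm)
    qed
    show "ocmp X W Y (lm W Z Y f (dwd Ys fs)) y = lm X Z Y f (ocmp X W Z (dwd Ys fs) y)"
      using p ob f y path_Cons [OF p(1) ob(3) f] by (simp add: lm_dwd ocmp_wd ocmp_dwd mw_Cons Ys)
  qed
qed

text \<open>For a word that starts with a morphism this is the definition of \<open>mdw\<close>; for
  an exact word it follows from that definition and d d = 0. The left factor is homogeneous because
  its degree enters the sign.\<close>

lemma leibniz:
  assumes x: "x \<in> omd i Y Z" and y: "y \<in> om X Y"
  shows "odif X Z (ocmp X Y Z x y) =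
    ocmp X Y Z (odif Y Z x) y + fscale ((-1) ^ i) (ocmp X Y Z x (odif X Y y))"
  using x
proof (induction rule: omd_induct)
  case zero
  have "ocmp X Y Z 0 y = 0" "ocmp X Y Z 0 (odif X Y y) = 0" "odif Y Z 0 = 0" "odif X Z 0 = 0"
    using y by (auto intro!: linear_on_0 [OF odif_linear] linear_on_0 [OF ocmp_linear_left])
  then show ?case by simp
next
  case (add x x')
  then show ?case
    using y by (simp add: omd_om linear_on_add [OF odif_linear] linear_on_add [OF ocmp_linear_left]
      fscale.scale_right_distrib algebra_simps)
next
  case (scale c x)
  then show ?case
    using y by (simp add: omd_om linear_on_scale [OF odif_linear] linear_on_scale [OF ocmp_linear_left]
      fscale.scale_right_distrib mult.commute)
next
  case (wd Ys fs)
  then have "fs \<noteq> []" "hd Ys = Z" "last Ys = Y" by (auto simp: path_between_def)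
  with wd y show ?case by (simp add: ocmp_wd ocmp_dwd odif_wd mdw_def)
next
  case (dwd Ys fs)
  then have h: "hd Ys = Z" "last Ys = Y" by (auto simp: path_between_def)
  have "mw X Ys fs 0 = 0" "ocmp X Y Z 0 y = 0"
    using y by (auto intro!: linear_on_0 [OF mw_linear [OF dwd(1,3)]] linear_on_0 [OF ocmp_linear_left])
  with dwd y h show ?case
    by (simp add: ocmp_dwd odif_dwd mdw_def mw_mem [OF dwd(1,3)] linear_on_add [OF odif_linear]
      linear_on_scale [OF odif_linear])
qed

text \<open>The source \<open>X\<close> is fixed while left multiplication moves the target, hence
  \<open>P\<close> depends on \<open>Y\<close>. An identity on Omega is thereby reduced to
  morphisms, to the Leibniz rule and to left multiplication.\<close>

lemma omd_struct_induct [consumes 2, case_names zero add scale iota odif lm]: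
  assumes X: "X \<in> ob D" and x: "x \<in> omd n X Y"
    and zero: "\<And>n Y. P n Y 0"
    and add: "\<And>n Y x y. x \<in> omd n X Y \<Longrightarrow> y \<in> omd n X Y \<Longrightarrow> P n Y x \<Longrightarrow> P n Y y \<Longrightarrow> P n Y (x + y)"
    and scale: "\<And>n Y c x. x \<in> omd n X Y \<Longrightarrow> P n Y x \<Longrightarrow> P n Y (fscale c x)"
    and iota: "\<And>Y f. Y \<in> ob D \<Longrightarrow> f \<in> hom D X Y \<Longrightarrow> P 0 Y (iota X Y f)"
    and odif: "\<And>n Y x. Y \<in> ob D \<Longrightarrow> x \<in> omd n X Y \<Longrightarrow> P n Y x \<Longrightarrow> P (Suc n) Y (odif X Y x)"
    and lm: "\<And>n Y Z f x. Y \<in> ob D \<Longrightarrow> Z \<in> ob D \<Longrightarrow> f \<in> hom D Z Y \<Longrightarrow> x \<in> omd n X Z \<Longrightarrow>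
      P n Z x \<Longrightarrow> P n Y (lm X Z Y f x)"
  shows "P n Y x"
proof -
  have w: "P (length fs - 1) Y (wd Ys fs)" if "path_between D X Y Ys fs" "fs \<noteq> []" for Y Ys fs
    using that
  proof (induction rule: path_between_induct)
    case (single Y f)
    then show ?case using iota by (simp add: iota_def)
  next
    case (Cons Y Z Ys f fs)
    then obtain n where n: "length fs = Suc n" by (cases fs) auto
    have m: "wd (Z # Ys) fs \<in> omd n X Z" by (rule omd_mem(1)) (use Cons n in auto)
    have "P (Suc n) Z (odif X Z (wd (Z # Ys) fs))"
      using odif [OF Cons(2) m] Cons.IH n by simp
    then show ?case
      using lm [OF Cons(1,2,3) odif_memd [OF m]] wd_Cons [OF Cons(4,5,1,3)] n by simp
  qed
  from x show ?thesis
  proof (induction rule: omd_induct)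
    case (wd Ys fs)
    then have "fs \<noteq> []" by auto
    with w [OF wd(1)] wd show ?case by simp
  next
    case (dwd Ys fs)
    then obtain m where m: "n = Suc m" by (cases fs) auto
    then have "wd Ys fs \<in> omd m X Y" using dwd by (intro omd_mem(1)) auto
    from odif [OF _ this] w [OF dwd(1,3)] dwd m path_between_ob [OF dwd(1)] show ?case
      by (simp add: odif_wd)
  qed (auto intro: zero add scale)
qed

text \<open>Induction on the leftmost factor. For dx both sides become d(xyz), x (dy) z and x y (dz)
  with equal signs; the sign of the last term involves the degree of y.\<close>

lemma ocmp_assoc_hmg:
  assumes ob: "W \<in> ob D" "X \<in> ob D" "Y \<in> ob D"
    and x: "x \<in> omd n Y Z" and y: "y \<in> omd j X Y" and z: "z \<in> om W X"
  shows "ocmp W X Z (ocmp X Y Z x y) z = ocmp W Y Z x (ocmp W X Y y z)"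
proof -
  \<comment> \<open>The other two factors stay general, since the case of dx applies the hypothesis
    to dy, of degree j + 1, and to dz.\<close>
  have "\<forall>j y z. y \<in> omd j X Y \<and> z \<in> om W X \<longrightarrow>
    ocmp W X Z (ocmp X Y Z x y) z = ocmp W Y Z x (ocmp W X Y y z)"
    using ob(3) x
  proof (induction n Z x rule: omd_struct_induct)
    case (zero n Z)
    show ?case
      using linear_on_0 [OF ocmp_linear_left] by (auto dest!: omd_om)
  next
    case (add n Z x x')
    show ?case
    proof (intro allI impI, elim conjE)
      fix j y z assume y: "y \<in> omd j X Y" and z: "z \<in> om W X"
      with add ob omd_om [OF y] show "ocmp W X Z (ocmp X Y Z (x + x') y) z = ocmp W Y Z (x + x') (ocmp W X Y y z)"
        by (simp add: omd_om [OF add(1)] omd_om [OF add(2)] linear_on_add [OF ocmp_linear_left])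
    qed
  next
    case (scale n Z c x)
    show ?case
    proof (intro allI impI, elim conjE)
      fix j y z assume y: "y \<in> omd j X Y" and z: "z \<in> om W X"
      with scale ob omd_om [OF y] show "ocmp W X Z (ocmp X Y Z (fscale c x) y) z = ocmp W Y Z (fscale c x) (ocmp W X Y y z)"
        by (simp add: omd_om [OF scale(1)] linear_on_scale [OF ocmp_linear_left])
    qed
  next
    case (iota Z f)
    show ?case
    proof (intro allI impI, elim conjE)
      fix j y z assume y: "y \<in> omd j X Y" and z: "z \<in> om W X"
      with iota ob omd_om [OF y] show "ocmp W X Z (ocmp X Y Z (iota Y Z f) y) z = ocmp W Y Z (iota Y Z f) (ocmp W X Y y z)"
        by (simp add: ocmp_iota ocmp_lm)
    qed
  next
    case (lm n Z Z' f x)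
    show ?case
    proof (intro allI impI, elim conjE)
      fix j y z assume y: "y \<in> omd j X Y" and z: "z \<in> om W X"
      with lm ob omd_om [OF y] show "ocmp W X Z (ocmp X Y Z (lm Y Z' Z f x) y) z = ocmp W Y Z (lm Y Z' Z f x) (ocmp W X Y y z)"
        by (simp add: omd_om [OF lm(4)] ocmp_lm)
    qed
  next
    case (odif n Z x)
    show ?case
    proof (intro allI impI, elim conjE)
      fix j y z assume y: "y \<in> omd j X Y" and z: "z \<in> om W X"
      note m = omd_om [OF y] omd_om [OF odif(2)] z
      have L: "ocmp A Y Z (odif Y Z x) v = odif A Z (ocmp A Y Z x v) - fscale ((-1) ^ n) (ocmp A Y Z x (odif A Y v))"
        if "v \<in> om A Y" for A v
        using leibniz [OF odif(2) that] by simp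
      have IH: "ocmp W X Z (ocmp X Y Z x v) z' = ocmp W Y Z x (ocmp W X Y v z')"
        if "v \<in> omd k X Y" "z' \<in> om W X" for k v z'
        using odif(3) that by blast
      have "ocmp W X Z (ocmp X Y Z (odif Y Z x) y) z =
          ocmp W X Z (odif X Z (ocmp X Y Z x y)) z - fscale ((-1) ^ n) (ocmp W X Z (ocmp X Y Z x (odif X Y y)) z)"
        using m by (simp add: L linear_on_diff [OF ocmp_linear_left vector_space_fscale om_sub] linear_on_scale [OF ocmp_linear_left])
      also have "ocmp W X Z (odif X Z (ocmp X Y Z x y)) z =
          odif W Z (ocmp W Y Z x (ocmp W X Y y z)) - fscale ((-1) ^ (n + j)) (ocmp W Y Z x (ocmp W X Y y (odif W X z)))"
        using leibniz [OF ocmp_memd [OF odif(2) y] z] m IH [OF y z] IH [OF y, of "odif W X z"] by simp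
      also have "ocmp W X Z (ocmp X Y Z x (odif X Y y)) z = ocmp W Y Z x (ocmp W X Y (odif X Y y) z)"
        by (rule IH [OF odif_memd [OF y] z])
      finally have 1: "ocmp W X Z (ocmp X Y Z (odif Y Z x) y) z =
        odif W Z (ocmp W Y Z x (ocmp W X Y y z)) - fscale ((-1) ^ (n + j)) (ocmp W Y Z x (ocmp W X Y y (odif W X z))) -
        fscale ((-1) ^ n) (ocmp W Y Z x (ocmp W X Y (odif X Y y) z))" .
      have "ocmp W Y Z (odif Y Z x) (ocmp W X Y y z) = odif W Z (ocmp W Y Z x (ocmp W X Y y z)) -
          fscale ((-1) ^ n) (ocmp W Y Z x (ocmp W X Y (odif X Y y) z + fscale ((-1) ^ j) (ocmp W X Y y (odif W X z))))"
        using m leibniz [OF y z] by (simp add: L)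
      also have "\<dots> = odif W Z (ocmp W Y Z x (ocmp W X Y y z)) -
          (fscale ((-1) ^ n) (ocmp W Y Z x (ocmp W X Y (odif X Y y) z)) +
           fscale ((-1) ^ (n + j)) (ocmp W Y Z x (ocmp W X Y y (odif W X z))))"
        using m by (simp add: linear_on_add [OF ocmp_linear_right] linear_on_scale [OF ocmp_linear_right]
          fscale.scale_right_distrib power_add)
      finally have 2: "ocmp W Y Z (odif Y Z x) (ocmp W X Y y z) = odif W Z (ocmp W Y Z x (ocmp W X Y y z)) -
          (fscale ((-1) ^ n) (ocmp W Y Z x (ocmp W X Y (odif X Y y) z)) +
           fscale ((-1) ^ (n + j)) (ocmp W Y Z x (ocmp W X Y y (odif W X z))))" .
      show "ocmp W X Z (ocmp X Y Z (odif Y Z x) y) z = ocmp W Y Z (odif Y Z x) (ocmp W X Y y z)"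
        unfolding 1 2 by (simp add: diff_diff_eq add.commute)
    qed
  qed
  then show ?thesis using y z by blast
qed

lemma ocmp_assoc:
  assumes ob: "W \<in> ob D" "X \<in> ob D" "Y \<in> ob D"
    and x: "x \<in> om Y Z" and y: "y \<in> om X Y" and z: "z \<in> om W X"
  shows "ocmp W X Z (ocmp X Y Z x y) z = ocmp W Y Z x (ocmp W X Y y z)"
  using x
proof (induction rule: om_induct)
  case (add x x')
  then show ?case using y z by (simp add: linear_on_add [OF ocmp_linear_left])
next
  case x: (hmg n x)
  from y show ?case
  proof (induction rule: om_induct)
    case (add y y')
    then show ?case
      using z omd_om [OF x] by (simp add: linear_on_add [OF ocmp_linear_left] linear_on_add [OF ocmp_linear_right])
  next
    case (hmg j y)
    then show ?case using ocmp_assoc_hmg [OF ob x _ z] by blast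
  qed
qed

end

section \<open>The universal DGH-semicategory\<close>

lemma sweedlers_mem:
  assumes "vector_space sV" "module.subspace sV V" "\<And>hs. F hs \<in> V"
  shows "sweedlers H p h F \<in> V"
\<comment> \<open>The iterated sum over no legs is 0 by convention; the induction proper starts at
  one leg.\<close>
proof (cases "p = 0")
  case True
  interpret V: vector_space sV by fact
  show ?thesis using V.subspace_0 [OF assms(2)] True by simp
next
  case False
  then show ?thesis
    using assms(3)
  proof (induction p arbitrary: h F)
    case (Suc p)
    show ?case
    proof (cases p)
      case (Suc q)
      show ?thesis
        unfolding Suc sweedlers.simps
        by (rule sweedler_mem [OF assms(1,2)], rule Suc.IH [unfolded Suc]) (use Suc.prems in auto)
    qed (use Suc.prems in simp)
  qed simp
qed

lemma linear_on_sweedlers: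
  assumes "vector_space sV" "module.subspace sV V" "linear_on sV V sW L" "\<And>hs. F hs \<in> V"
  shows "L (sweedlers H p h F) = sweedlers H p h (\<lambda>hs. L (F hs))"
proof (cases "p = 0")
  case True
  interpret V: vector_space sV by fact
  show ?thesis using linear_on_0 [OF assms(3) V.subspace_0 [OF assms(2)]] True by simp
next
  case False
  then show ?thesis
    using assms(4)
  proof (induction p arbitrary: h F)
    case (Suc p)
    show ?case
    proof (cases p)
      case (Suc q)
      have "L (sweedlers H (Suc q) b (\<lambda>hs. F (a # hs))) = sweedlers H (Suc q) b (\<lambda>hs. L (F (a # hs)))" for a b
        by (rule Suc.IH [unfolded Suc]) (use Suc.prems in auto)
      moreover have "sweedlers H (Suc q) b (\<lambda>hs. F (a # hs)) \<in> V" for a b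
        by (rule sweedlers_mem [OF assms(1,2)]) (use Suc.prems in auto)
      ultimately show ?thesis
        unfolding Suc sweedlers.simps by (simp add: linear_on_sweedler [OF assms(1-3)])
    qed simp
  qed simp
qed

lemma act_path_Cons [simp]:
  "act_path D (Y # Ys) (a # hs) (f # fs) = act D (Ys ! 0) Y a f # act_path D Ys hs fs"
  by (simp add: act_path_def upt_conv_Cons map_Suc_upt [symmetric] comp_def del: upt_Suc)

lemma length_act_path [simp]: "length (act_path D Ys hs fs) = length fs"
  by (simp add: act_path_def)

lemma act_path_eq_Nil [simp]: "act_path D Ys hs fs = [] \<longleftrightarrow> fs = []"
  by (simp add: act_path_def)

lemma multilin_sweedler:
  assumes "vector_space sW" "\<And>a b. multilin D sW Ys (\<lambda>fs. F fs a b)"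
  shows "multilin D sW Ys (\<lambda>fs. sweedler H h (F fs))"
  using assms(2) by (auto simp: multilin_def intro!: linear_on_sweedler_param assms(1))

locale H_semicat = hopf_alg H + semicat D
  for H :: "('k::field_char_0, 'h::ring_1) hopf"
    and D :: "('k, 'h, 'o, 'a::ab_group_add, 'z) semicat_scheme" +
  assumes H_semicat: "left_H_semicategory H D"
begin

lemma act_mem [simp]: "X \<in> ob D \<Longrightarrow> Y \<in> ob D \<Longrightarrow> f \<in> hom D X Y \<Longrightarrow> act D X Y h f \<in> hom D X Y"
  using H_semicat by (simp add: left_H_semicategory_def)

lemma act_linear:
  assumes "X \<in> ob D" "Y \<in> ob D"
  shows "linear_on (scl D) (hom D X Y) (scl D) (act D X Y h)"
    and "f \<in> hom D X Y \<Longrightarrow> linear_on (hscale H) UNIV (scl D) (\<lambda>h. act D X Y h f)"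
  using H_semicat assms by (auto simp: left_H_semicategory_def bilinear_on_def)

lemma act_mult:
  "X \<in> ob D \<Longrightarrow> Y \<in> ob D \<Longrightarrow> f \<in> hom D X Y \<Longrightarrow> act D X Y (h * h') f = act D X Y h (act D X Y h' f)"
  and act_1: "X \<in> ob D \<Longrightarrow> Y \<in> ob D \<Longrightarrow> f \<in> hom D X Y \<Longrightarrow> act D X Y 1 f = f"
  using H_semicat by (simp_all add: left_H_semicategory_def)

lemma act_cmp:
  "X \<in> ob D \<Longrightarrow> Y \<in> ob D \<Longrightarrow> Z \<in> ob D \<Longrightarrow> g \<in> hom D Y Z \<Longrightarrow> f \<in> hom D X Y \<Longrightarrow>
    act D X Z h (cmp D X Y Z g f) = sweedler H h (\<lambda>h1 h2. cmp D X Y Z (act D Y Z h1 g) (act D X Y h2 f))"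
  using H_semicat by (simp add: left_H_semicategory_def)

lemma path_act:
  assumes "path_between D X Y Ys fs"
  shows "path_between D X Y Ys (act_path D Ys hs fs)"
proof -
  have "is_path D Ys fs" using assms by (simp add: path_between_def)
  then have "Ys ! i \<in> ob D \<and> Ys ! Suc i \<in> ob D" if "i < length fs" for i
    using that by (auto simp: is_path_def)
  with assms show ?thesis by (auto simp: path_between_def is_path_def act_path_def)
qed

text \<open>The intended value of h on \<open>wd Ys fs\<close>, named before the action is known to
  be well defined.\<close>

definition aw :: "'h \<Rightarrow> 'o list \<Rightarrow> 'a list \<Rightarrow> ('k, 'o, 'a) omega" where
  "aw h Ys fs = sweedlers H (length fs) h (\<lambda>hs. wd Ys (act_path D Ys hs fs))"

lemma aw_mem:
  assumes "path_between D X Y Ys fs" "fs \<noteq> []"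
  shows "aw h Ys fs \<in> om X Y"
  unfolding aw_def
  by (rule sweedlers_mem [OF vector_space_fscale om_sub], rule omd_mem(3) [OF path_act [OF assms(1)]])
    (simp add: assms)

lemma aw_memd:
  assumes "path_between D X Y Ys fs" "length fs = Suc n"
  shows "aw h Ys fs \<in> omd n X Y"
  unfolding aw_def
  by (rule sweedlers_mem [OF vector_space_fscale omd_sub], rule omd_mem(1) [OF path_act [OF assms(1)]])
    (use assms in auto)

lemma aw_single: "aw h [Y, X] [f] = iota X Y (act D X Y h f)"
  by (simp add: aw_def iota_def act_path_def)

text \<open>Splitting off the first leg matches \<open>wd_Cons\<close>: this leg acts on the leading
  morphism, the remaining ones on the word under the differential. Coassociativity in its binary
  form therefore suffices later.\<close>

lemma aw_Cons:
  assumes p: "path_between D X Z Ys fs" "fs \<noteq> []" and Y: "Y \<in> ob D" and f: "f \<in> hom D Z Y"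
  shows "aw h (Y # Ys) (f # fs) =
    sweedler H h (\<lambda>a b. lm X Z Y (act D Z Y a f) (odif X Z (aw b Ys fs)))"
proof -
  have Z: "Z \<in> ob D" and Ys: "Ys ! 0 = Z"
    using path_between_ob [OF p(1)] path_hd [OF p(1)] by auto
  obtain n where n: "length fs = Suc n" using p(2) by (cases fs) auto
  have af: "act D Z Y a f \<in> hom D Z Y" for a using f Y Z by simp
  note pa = path_act [OF p(1)]
  have "sweedlers H (length fs) b (\<lambda>hs. wd (Y # Ys) (act D Z Y a f # act_path D Ys hs fs)) =
      lm X Z Y (act D Z Y a f) (odif X Z (aw b Ys fs))" for a b
  proof -
    have "linear_on fscale (om X Z) fscale (\<lambda>x. lm X Z Y (act D Z Y a f) (odif X Z x))"
      by (rule linear_on_comp [OF odif_linear lm_linear [OF Z Y af]]) simp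
    moreover have "wd Ys (act_path D Ys hs fs) \<in> om X Z" for hs
      by (rule omd_mem(3) [OF pa]) (simp add: p)
    ultimately have "lm X Z Y (act D Z Y a f) (odif X Z (aw b Ys fs)) =
        sweedlers H (length fs) b (\<lambda>hs. lm X Z Y (act D Z Y a f) (odif X Z (wd Ys (act_path D Ys hs fs))))"
      unfolding aw_def by (rule linear_on_sweedlers [OF vector_space_fscale om_sub])
    then show ?thesis by (simp add: p wd_Cons [OF pa _ Y af])
  qed
  then show ?thesis by (simp add: aw_def n Ys)
qed

lemma aw_linear:
  assumes "path_between D X Y Ys fs" "fs \<noteq> []"
  shows "linear_on (hscale H) UNIV fscale (\<lambda>h. aw h Ys fs)"
  using assms
proof (induction rule: path_between_induct)
  case (single Y f)
  then show ?case
    unfolding aw_single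
    by (intro linear_on_comp [OF act_linear(2) iota_linear]) auto
next
  case (Cons Y Z Ys f fs)
  have "linear_on (hscale H) UNIV fscale (\<lambda>a. lm X Z Y (act D Z Y a f) (odif X Z (aw b (Z # Ys) fs)))" for b
    using Cons by (intro linear_on_comp [OF act_linear(2) lm_linear_left]) (auto simp: aw_mem)
  moreover have "linear_on (hscale H) UNIV fscale (\<lambda>b. lm X Z Y (act D Z Y a f) (odif X Z (aw b (Z # Ys) fs)))" for a
    using Cons by (intro linear_on_comp [OF linear_on_comp [OF Cons.IH odif_linear] lm_linear]) (auto simp: aw_mem)
  ultimately show ?case
    using Cons by (simp add: aw_Cons linear_sweedler [OF vector_space_fscale])
qed

lemma aw_multilin: "multilin D fscale Ys (aw h Ys)"
proof (induction Ys arbitrary: h)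
  case Nil
  then show ?case by (simp add: multilin_short)
next
  case (Cons Y Ys)
  show ?case
  proof (rule multilin_Cons)
    fix fs assume Y: "Y \<in> ob D" and p: "is_path D Ys fs"
    note q = is_path_between [OF p]
    have ob: "hd Ys \<in> ob D" using is_path_hd [OF p] .
    show "linear_on (scl D) (hom D (hd Ys) Y) fscale (\<lambda>g. aw h (Y # Ys) (g # fs))"
    proof (cases "fs = []")
      case True
      with p obtain Z where "Ys = [Z]" "Z \<in> ob D" by (auto simp: is_path_Nil)
      with True Y show ?thesis
        by (simp add: aw_single) (intro linear_on_comp [OF act_linear(1) iota_linear]; simp)
    next
      case False
      have "linear_on (scl D) (hom D (hd Ys) Y) fscale (\<lambda>g. sweedler H h (\<lambda>a b.
          lm (last Ys) (hd Ys) Y (act D (hd Ys) Y a g) (odif (last Ys) (hd Ys) (aw b Ys fs))))"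
        using ob Y aw_mem [OF q False]
        by (intro linear_on_sweedler_param vector_space_fscale linear_on_comp [OF act_linear(1) lm_linear_left]) auto
      then show ?thesis
        by (rule linear_on_cong [OF _ hom_sub [OF ob Y] avs]) (simp add: aw_Cons [OF q False Y])
    qed
  next
    fix f assume Y: "Y \<in> ob D" "Ys \<noteq> []" "hd Ys \<in> ob D" and f: "f \<in> hom D (hd Ys) Y"
    show "multilin D fscale Ys (\<lambda>fs. aw h (Y # Ys) (f # fs))"
    proof (cases "length Ys \<le> 1")
      case True
      then show ?thesis by (rule multilin_short)
    next
      case False
      then have ne: "fs \<noteq> []" if "is_path D Ys fs" for fs using that by (auto simp: is_path_def)
      have "multilin D fscale Ys (\<lambda>fs. sweedler H h (\<lambda>a b.
          lm (last Ys) (hd Ys) Y (act D (hd Ys) Y a f) (odif (last Ys) (hd Ys) (aw b Ys fs))))"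
        using Y f
        by (intro multilin_sweedler vector_space_fscale multilin_comp [OF multilin_comp [OF Cons.IH odif_linear] lm_linear])
          (auto intro!: odif_mem aw_mem [OF is_path_between] ne)
      then show ?thesis
        by (rule multilin_cong) (simp add: aw_Cons [OF is_path_between ne Y(1) f])
    qed
  qed
qed

abbreviation oact :: "'o \<Rightarrow> 'o \<Rightarrow> 'h \<Rightarrow> ('k, 'o, 'a) omega \<Rightarrow> ('k, 'o, 'a) omega" where
  "oact \<equiv> act (Omega H D)"

text \<open>On the adjoined unit h acts through the counit. In the action on
  \<open>df\<^sup>1 ... df\<^sup>n\<close> the first leg is thus absorbed by the counit axiom, and
  the others act as on \<open>f\<^sup>1 df\<^sup>2 ... df\<^sup>n\<close> under the
  differential.\<close>

lemma oact_lift: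
  shows oact_linear: "linear_on fscale (om X Y) fscale (oact X Y h)"
    and oact_wd: "path_between D X Y Ys fs \<Longrightarrow> fs \<noteq> [] \<Longrightarrow> oact X Y h (wd Ys fs) = aw h Ys fs"
    and oact_dwd: "path_between D X Y Ys fs \<Longrightarrow> fs \<noteq> [] \<Longrightarrow> oact X Y h (dwd Ys fs) = odif X Y (aw h Ys fs)"
proof -
  let ?F = "\<lambda>(Ys, (f, \<mu>), fs).
         sweedlers H (Suc (length fs)) h (\<lambda>hs. omega_gen D
           (Ys, (act D (Ys ! 1) (Ys ! 0) (hd hs) f, \<mu> * counit H (hd hs)),
            act_path D (tl Ys) (tl hs) fs))"
  have F: "\<forall>Ys f \<mu> fs. (Ys, (f, \<mu>), fs) \<in> omega_gens D X Y \<longrightarrow>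
     ?F (Ys, (f, \<mu>), fs) = aw h Ys (f # fs) + fscale \<mu> (odif X Y (aw h (tl Ys) fs))"
  proof (intro allI impI)
    fix Ys f \<mu> fs assume u: "(Ys, (f, \<mu>), fs) \<in> omega_gens D X Y"
    then have p: "path_between D X Y Ys (f # fs)" and mu: "fs = [] \<or> Ys ! 1 \<noteq> Y \<Longrightarrow> \<mu> = 0"
      by (auto simp: omega_gens_path)
    obtain Ys' where Ys: "Ys = Y # Ys'" using path_hd [OF p] by blast
    have p': "path_between D X (hd Ys') Ys' fs" and f: "f \<in> hom D (hd Ys') Y" and Y: "Y \<in> ob D"
      using p by (auto simp: Ys path_between_Cons)
    have ne: "Ys' \<noteq> []" and ob: "hd Ys' \<in> ob D" using path_hd [OF p'] path_between_ob [OF p'] by auto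
    then have n0: "Ys' ! 0 = hd Ys'" by (simp add: hd_conv_nth)
    have g: "(Ys, (act D (Ys ! 1) (Ys ! 0) a f, \<mu> * counit H a), act_path D (tl Ys) hs fs) \<in> omega_gens D X Y" for a hs
      using path_act [OF p'] f Y ob mu p'
      by (auto simp: omega_gens_path Ys n0 path_between_Cons)
    have split: "omega_gen D (Ys, (act D (Ys ! 1) (Ys ! 0) (hd hs) f, \<mu> * counit H (hd hs)), act_path D (tl Ys) (tl hs) fs) =
        wd Ys (act_path D Ys hs (f # fs)) + fscale (\<mu> * counit H (hd hs)) (dwd (tl Ys) (act_path D (tl Ys) (tl hs) fs))"
      if "hs \<noteq> []" for hs
      using omega_gen_split [OF g] that by (cases hs) (auto simp: Ys)
    show "?F (Ys, (f, \<mu>), fs) = aw h Ys (f # fs) + fscale \<mu> (odif X Y (aw h (tl Ys) fs))"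
    proof (cases fs)
      case Nil
      then have "\<mu> = 0" using mu by simp
      then show ?thesis using split [of "[h]"] by (simp add: Nil aw_def)
    next
      case fs: (Cons f1 fs1)
      let ?n = "length fs"
      \<comment> \<open>For each first leg \<open>a\<close>, splitting the symbol leaves \<mu> times
        the counit of \<open>a\<close> in front of the exact word.\<close>
      have sp: "sweedlers H ?n b (\<lambda>hs. omega_gen D (Ys, (act D (Ys ! 1) (Ys ! 0) a f, \<mu> * counit H a), act_path D (tl Ys) hs fs)) =
          sweedlers H ?n b (\<lambda>hs. wd Ys (act_path D Ys (a # hs) (f # fs))) +
          fscale (\<mu> * counit H a) (odif X Y (aw b Ys' fs))" for a b
      proof (cases "\<mu> = 0")
        case True
        then show ?thesis using split [of "a # _"] by (simp add: Ys n0)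
      next
        case False
        then have hd: "hd Ys' = Y" using mu fs n0 by (auto simp: Ys)
        note q = path_act [OF p' [unfolded hd]]
        have dw: "odif X Y (wd Ys' (act_path D Ys' hs fs)) = dwd Ys' (act_path D Ys' hs fs)" for hs
          by (rule odif_wd [OF q]) (simp add: fs)
        have wp: "path_between D X Y Ys (act_path D Ys hs (f # fs))" for hs by (rule path_act [OF p])
        have add: "sweedlers H (Suc m) b (\<lambda>hs. P hs + Q hs) = sweedlers H (Suc m) b P + sweedlers H (Suc m) b Q"
          for m b and P Q :: "'h list \<Rightarrow> ('k, 'o, 'a) omega"
          by (induction m arbitrary: b P Q) (simp_all add: sweedler_add)
        have "sweedlers H ?n b (\<lambda>hs. omega_gen D (Ys, (act D (Ys ! 1) (Ys ! 0) a f, \<mu> * counit H a), act_path D (tl Ys) hs fs)) =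
          sweedlers H ?n b (\<lambda>hs. wd Ys (act_path D Ys (a # hs) (f # fs)) +
            fscale (\<mu> * counit H a) (odif X Y (wd Ys' (act_path D Ys' hs fs))))"
          using split [of "a # _"] fs dw by (simp add: Ys n0)
        also have "\<dots> = sweedlers H ?n b (\<lambda>hs. wd Ys (act_path D Ys (a # hs) (f # fs))) +
            sweedlers H ?n b (\<lambda>hs. fscale (\<mu> * counit H a) (odif X Y (wd Ys' (act_path D Ys' hs fs))))"
          using add fs by simp
        also have "sweedlers H ?n b (\<lambda>hs. fscale (\<mu> * counit H a) (odif X Y (wd Ys' (act_path D Ys' hs fs)))) =
            fscale (\<mu> * counit H a) (odif X Y (aw b Ys' fs))"
          unfolding aw_def
          by (rule linear_on_sweedlers [symmetric, OF vector_space_fscale om_sub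
                linear_on_scaled [OF vector_space_fscale odif_linear]])
            (rule omd_mem(3) [OF q], simp add: fs)
        finally show ?thesis .
      qed
      have "?F (Ys, (f, \<mu>), fs) = sweedler H h (\<lambda>a b.
          sweedlers H ?n b (\<lambda>hs. wd Ys (act_path D Ys (a # hs) (f # fs))) +
          fscale (\<mu> * counit H a) (odif X Y (aw b Ys' fs)))"
        using sp fs by simp
      also have "\<dots> = aw h Ys (f # fs) + sweedler H h (\<lambda>a b. fscale (\<mu> * counit H a) (odif X Y (aw b Ys' fs)))"
        by (simp add: sweedler_add aw_def fs)
      \<comment> \<open>Here the leg that acts on the unit is absorbed.\<close>
      also have "sweedler H h (\<lambda>a b. fscale (\<mu> * counit H a) (odif X Y (aw b Ys' fs))) =
          fscale \<mu> (odif X Y (aw h Ys' fs))"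
      proof (cases "\<mu> = 0")
        case True
        then show ?thesis using sweedler_scale [OF vector_space_fscale, of H h 0] by simp
      next
        case False
        then have hd: "hd Ys' = Y" using mu fs n0 by (auto simp: Ys)
        have "linear_on (hscale H) UNIV fscale (\<lambda>h. odif X Y (aw h Ys' fs))"
          using p' fs by (intro linear_on_comp [OF aw_linear odif_linear]) (auto simp: hd aw_mem)
        from sweedler_counit_left [OF vector_space_fscale this] show ?thesis
          using sweedler_scale [OF vector_space_fscale, of H h \<mu> "\<lambda>a b. fscale (counit H a) (odif X Y (aw b Ys' fs))"]
          by (simp)
      qed
      finally show ?thesis by (simp add: Ys)
    qed
  qed
  have A: "\<forall>Ys. hd Ys = Y \<and> last Ys = X \<longrightarrow> multilin D fscale Ys (aw h Ys)"
    by (simp add: aw_multilin)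
  have B: "\<forall>Ys. hd Ys = Y \<and> last Ys = X \<longrightarrow> multilin D fscale Ys (\<lambda>fs. odif X Y (aw h Ys fs))"
  proof (intro allI impI)
    fix Ys assume h: "hd Ys = Y \<and> last Ys = X"
    show "multilin D fscale Ys (\<lambda>fs. odif X Y (aw h Ys fs))"
    proof (cases "length Ys \<le> 1")
      case True
      then show ?thesis by (rule multilin_short)
    next
      case False
      then have ne: "fs \<noteq> []" if "is_path D Ys fs" for fs using that by (auto simp: is_path_def)
      show ?thesis
        by (rule multilin_comp [OF aw_multilin odif_linear]) (use h ne aw_mem in \<open>auto simp: path_between_def\<close>)
    qed
  qed
  note L = omega_lift [where A = "aw h" and B = "\<lambda>Ys fs. odif X Y (aw h Ys fs)" and F = ?F,
      OF vector_space_fscale A B F]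
  have eq: "oact X Y h = tensor_lift (omega_gen D) (omega_gens D X Y) ?F"
    by (simp add: Omega_def)
  show "linear_on fscale (om X Y) fscale (oact X Y h)" unfolding eq by (rule L(1))
  show "path_between D X Y Ys fs \<Longrightarrow> fs \<noteq> [] \<Longrightarrow> oact X Y h (wd Ys fs) = aw h Ys fs"
    unfolding eq by (rule L(2))
  show "path_between D X Y Ys fs \<Longrightarrow> fs \<noteq> [] \<Longrightarrow> oact X Y h (dwd Ys fs) = odif X Y (aw h Ys fs)"
    unfolding eq by (rule L(3))
qed

lemma oact_memd: "x \<in> omd n X Y \<Longrightarrow> oact X Y h x \<in> omd n X Y"
proof (induction rule: omd_induct)
  case zero
  then show ?case using linear_on_0 [OF oact_linear [of X Y h]] by simp
next
  case (wd Ys fs)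
  moreover from wd have "fs \<noteq> []" by auto
  ultimately show ?case by (simp add: oact_wd aw_memd)
next
  case (dwd Ys fs)
  then obtain m where m: "n = Suc m" by (cases fs) auto
  with dwd show ?case by (simp add: oact_dwd) (rule odif_memd [OF aw_memd], auto)
qed (simp_all add: omd_om linear_on_add [OF oact_linear] linear_on_scale [OF oact_linear])

lemma oact_mem [simp]: "x \<in> om X Y \<Longrightarrow> oact X Y h x \<in> om X Y"
  by (induction rule: om_induct)
    (auto simp: linear_on_add [OF oact_linear] intro: omd_om oact_memd)

lemma oact_iota:
  "X \<in> ob D \<Longrightarrow> Y \<in> ob D \<Longrightarrow> f \<in> hom D X Y \<Longrightarrow> oact X Y h (iota X Y f) = iota X Y (act D X Y h f)"
  by (subst (1) iota_def) (simp add: oact_wd path_single aw_single)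

lemma oact_odif:
  assumes x: "x \<in> om X Y"
  shows "oact X Y h (odif X Y x) = odif X Y (oact X Y h x)"
proof -
  have 1: "linear_on fscale (om X Y) fscale (\<lambda>x. oact X Y h (odif X Y x))"
    by (rule linear_on_comp [OF odif_linear oact_linear]) simp
  have 2: "linear_on fscale (om X Y) fscale (\<lambda>x. odif X Y (oact X Y h x))"
    by (rule linear_on_comp [OF oact_linear odif_linear]) simp
  have z: "odif X Y 0 = 0" "oact X Y h 0 = 0"
    by (rule linear_on_0 [OF odif_linear] linear_on_0 [OF oact_linear], simp)+
  show ?thesis
    by (rule linear_om_eqI [where F = "\<lambda>x. oact X Y h (odif X Y x)" and G = "\<lambda>x. odif X Y (oact X Y h x)",
        OF 1 2 _ _ x])
      (simp_all add: odif_wd odif_dwd oact_wd oact_dwd z aw_mem)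
qed

lemma oact_linear_left:
  assumes x: "x \<in> om X Y"
  shows "linear_on (hscale H) UNIV fscale (\<lambda>h. oact X Y h x)"
proof (rule linear_onI)
  fix h h' :: 'h
  show "oact X Y (h + h') x = oact X Y h x + oact X Y h' x"
  proof (rule linear_om_eqI [where F = "oact X Y (h + h')" and G = "\<lambda>x. oact X Y h x + oact X Y h' x",
        OF oact_linear linear_on_plus [OF vector_space_fscale oact_linear oact_linear] _ _ x])
    fix Ys fs assume p: "path_between D X Y Ys fs" "fs \<noteq> []"
    show "oact X Y (h + h') (wd Ys fs) = oact X Y h (wd Ys fs) + oact X Y h' (wd Ys fs)"
      using p linear_on_add [OF aw_linear [OF p]] by (simp add: oact_wd)
    show "oact X Y (h + h') (dwd Ys fs) = oact X Y h (dwd Ys fs) + oact X Y h' (dwd Ys fs)"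
      using p linear_on_add [OF aw_linear [OF p]] by (simp add: oact_dwd aw_mem linear_on_add [OF odif_linear])
  qed
next
  fix c h
  show "oact X Y (hscale H c h) x = fscale c (oact X Y h x)"
  proof (rule linear_om_eqI [where F = "oact X Y (hscale H c h)" and G = "\<lambda>x. fscale c (oact X Y h x)",
        OF oact_linear linear_on_scaled [OF vector_space_fscale oact_linear] _ _ x])
    fix Ys fs assume p: "path_between D X Y Ys fs" "fs \<noteq> []"
    show "oact X Y (hscale H c h) (wd Ys fs) = fscale c (oact X Y h (wd Ys fs))"
      using p linear_on_scale [OF aw_linear [OF p]] by (simp add: oact_wd)
    show "oact X Y (hscale H c h) (dwd Ys fs) = fscale c (oact X Y h (dwd Ys fs))"
      using p linear_on_scale [OF aw_linear [OF p]] by (simp add: oact_dwd aw_mem linear_on_scale [OF odif_linear])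
  qed
qed

text \<open>For a word g dw the product is (f g) dw. Compatibility of the action with composition in
  D distributes the first leg over f and g, and coassociativity regroups the legs as f against g
  dw.\<close>

lemma oact_lm:
  assumes ob: "X \<in> ob D" "Z \<in> ob D" "Y \<in> ob D" and f: "f \<in> hom D Z Y" and x: "x \<in> om X Z"
  shows "oact X Y h (lm X Z Y f x) = sweedler H h (\<lambda>a b. lm X Z Y (act D Z Y a f) (oact X Z b x))"
proof -
  note vf = vector_space_fscale
  have af: "act D Z Y a f \<in> hom D Z Y" for a using ob f by simp
  have 1: "linear_on fscale (om X Z) fscale (\<lambda>x. oact X Y h (lm X Z Y f x))"
    by (rule linear_on_comp [OF lm_linear [OF ob(2,3) f] oact_linear]) (simp add: ob f)
  have 2: "linear_on fscale (om X Z) fscale (\<lambda>x. sweedler H h (\<lambda>a b. lm X Z Y (act D Z Y a f) (oact X Z b x)))"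
    by (intro linear_on_sweedler_param vf linear_on_comp [OF oact_linear lm_linear [OF ob(2,3) af]]) simp
  show ?thesis
  proof (rule linear_om_eqI [where F = "\<lambda>x. oact X Y h (lm X Z Y f x)" and
        G = "\<lambda>x. sweedler H h (\<lambda>a b. lm X Z Y (act D Z Y a f) (oact X Z b x))", OF 1 2 _ _ x])
    fix Ys fs assume p: "path_between D X Z Ys fs" "fs \<noteq> []"
    then obtain g gs where fs: "fs = g # gs" by (cases fs) auto
    obtain Ys' where Ys: "Ys = Z # Ys'" using path_hd [OF p(1)] by blast
    define W where "W = hd Ys'"
    from p have q: "g \<in> hom D W Z" "path_between D X W Ys' gs" by (auto simp: fs Ys path_between_Cons W_def)
    have W: "W \<in> ob D" using path_between_ob [OF q(2)] by simp
    have r: "path_between D X Y (Y # Ys') (cmp D W Z Y f g # gs)"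
      using q ob W f by (simp add: path_between_Cons W_def)
    note ag = act_mem [OF W ob(2) q(1)]
    show "oact X Y h (lm X Z Y f (wd Ys fs)) = sweedler H h (\<lambda>a b. lm X Z Y (act D Z Y a f) (oact X Z b (wd Ys fs)))"
    proof (cases "gs = []")
      case True
      with q have Ys': "Ys' = [X]" "W = X" by (auto simp: path_between_def is_path_Nil)
      have i: "wd Ys fs = iota X Z g" by (simp add: iota_def fs Ys Ys' True)
      have "oact X Y h (lm X Z Y f (iota X Z g)) = iota X Y (sweedler H h (\<lambda>a b. cmp D X Z Y (act D Z Y a f) (act D X Z b g)))"
        using ob f q by (simp add: Ys' lm_iota oact_iota act_cmp)
      also have "\<dots> = sweedler H h (\<lambda>a b. iota X Y (cmp D X Z Y (act D Z Y a f) (act D X Z b g)))"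
        by (rule linear_on_sweedler [OF avs hom_sub [OF ob(1,3)] iota_linear [OF ob(1,3)]]) (use ob f q Ys' in simp)
      finally show ?thesis
        unfolding i using ob f q by (simp add: Ys' lm_iota oact_iota)
    next
      case False
      let ?z = "\<lambda>b. odif X W (aw b Ys' gs)"
      have z: "?z b \<in> om X W" for b using aw_mem [OF q(2) False] by simp
      have zl: "linear_on (hscale H) UNIV fscale ?z"
        by (rule linear_on_comp [OF aw_linear [OF q(2) False] odif_linear]) (simp add: aw_mem [OF q(2) False])
      have "oact X Y h (lm X Z Y f (wd Ys fs)) =
          sweedler H h (\<lambda>a b. lm X W Y (act D W Y a (cmp D W Z Y f g)) (?z b))"
        using p q r ob W f False by (simp add: fs Ys lm_wd oact_wd aw_Cons W_def [symmetric])
      also have "\<dots> = sweedler H h (\<lambda>a b. sweedler H a (\<lambda>a1 a2.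
          lm X Z Y (act D Z Y a1 f) (lm X W Z (act D W Z a2 g) (?z b))))"
      proof -
        have "lm X W Y (act D W Y a (cmp D W Z Y f g)) (?z b) =
          sweedler H a (\<lambda>a1 a2. lm X W Y (cmp D W Z Y (act D Z Y a1 f) (act D W Z a2 g)) (?z b))" for a b
          unfolding act_cmp [OF W ob(2,3) f q(1)]
          by (rule linear_on_sweedler [OF avs hom_sub [OF W ob(3)] lm_linear_left [OF W ob(3) z]])
            (use af ag ob W in auto)
        then show ?thesis using z ob W af ag by (simp add: lm_lm)
      qed
      \<comment> \<open>From the bracketing that splits the leg on f g to the one that splits the
        leg on g dw.\<close>
      also have "\<dots> = sweedler H h (\<lambda>a b. sweedler H b (\<lambda>b1 b2.
          lm X Z Y (act D Z Y a f) (lm X W Z (act D W Z b1 g) (?z b2))))"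
        by (rule sweedler_coassoc [OF vf])
          (use z ob W af ag f q in \<open>auto intro!: linear_on_comp [OF act_linear(2) lm_linear_left]
            linear_on_comp [OF linear_on_comp [OF act_linear(2) lm_linear_left] lm_linear]
            linear_on_comp [OF linear_on_comp [OF zl lm_linear] lm_linear]\<close>)
      also have "\<dots> = sweedler H h (\<lambda>a b. lm X Z Y (act D Z Y a f) (aw b Ys fs))"
      proof -
        have "lm X Z Y (act D Z Y a f) (sweedler H b (\<lambda>b1 b2. lm X W Z (act D W Z b1 g) (?z b2))) =
          sweedler H b (\<lambda>b1 b2. lm X Z Y (act D Z Y a f) (lm X W Z (act D W Z b1 g) (?z b2)))" for a b
          by (rule linear_on_sweedler [OF vf om_sub lm_linear [OF ob(2,3) af]]) (use z ob W ag in auto)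
        then show ?thesis using aw_Cons [OF q(2) False ob(2) q(1)] by (simp add: fs Ys)
      qed
      finally show ?thesis using p by (simp add: oact_wd)
    qed
    show "oact X Y h (lm X Z Y f (dwd Ys fs)) = sweedler H h (\<lambda>a b. lm X Z Y (act D Z Y a f) (oact X Z b (dwd Ys fs)))"
      using p ob f path_Cons [OF p(1) ob(3) f] by (simp add: lm_dwd oact_wd oact_dwd aw_Cons)
  qed
qed

text \<open>Left multiplication leads to the coproduct of h h', which is the product of the
  coproducts.\<close>

lemma oact_mult:
  assumes "X \<in> ob D" and x: "x \<in> omd n X Y"
  shows "oact X Y (h * h') x = oact X Y h (oact X Y h' x)"
proof -
  note vf = vector_space_fscale
  have "\<forall>h h'. oact X Y (h * h') x = oact X Y h (oact X Y h' x)"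
    using assms
  proof (induction n Y x rule: omd_struct_induct)
    case (zero n Y)
    then show ?case using linear_on_0 [OF oact_linear] by simp
  next
    case (add n Y x y)
    then show ?case by (simp add: omd_om linear_on_add [OF oact_linear])
  next
    case (scale n Y c x)
    then show ?case by (simp add: omd_om linear_on_scale [OF oact_linear])
  next
    case (iota Y f)
    then show ?case using assms by (simp add: oact_iota act_mult)
  next
    case (odif n Y x)
    then show ?case by (simp add: omd_om oact_odif)
  next
    case (lm n Y Z f x)
    note ob = lm(2,1) and x = omd_om [OF lm(4)]
    have af: "act D Z Y a f \<in> hom D Z Y" for a using lm by simp
    show ?case
    proof (intro allI)
      fix h h'
      have "oact X Y (h * h') (lm X Z Y f x) = sweedler H h (\<lambda>a b. sweedler H h' (\<lambda>a' b'.
          lm X Z Y (act D Z Y (a * a') f) (oact X Z (b * b') x)))"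
        unfolding oact_lm [OF assms(1) ob lm(3) x]
        by (rule sweedler_mult [OF vf])
          (use x ob lm(3) af in \<open>auto intro!: linear_on_comp [OF act_linear(2) lm_linear_left]
            linear_on_comp [OF oact_linear_left lm_linear]\<close>)
      also have "\<dots> = sweedler H h' (\<lambda>a' b'. sweedler H h (\<lambda>a b.
          lm X Z Y (act D Z Y a (act D Z Y a' f)) (oact X Z b (oact X Z b' x))))"
        using lm by (subst sweedler_swap) (simp add: act_mult)
      also have "\<dots> = oact X Y h (oact X Y h' (lm X Z Y f x))"
        unfolding oact_lm [OF assms(1) ob lm(3) x]
        by (subst linear_on_sweedler [OF vf om_sub oact_linear])
          (use assms(1) ob lm(3) x af in \<open>auto simp: oact_lm\<close>)
      finally show "oact X Y (h * h') (lm X Z Y f x) = oact X Y h (oact X Y h' (lm X Z Y f x))" .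
    qed
  qed
  then show ?thesis by blast
qed

lemma oact_1:
  assumes "X \<in> ob D" and x: "x \<in> omd n X Y"
  shows "oact X Y 1 x = x"
  using assms
proof (induction n Y x rule: omd_struct_induct)
  case (zero n Y)
  then show ?case using linear_on_0 [OF oact_linear] by simp
next
  case (add n Y x y)
  then show ?case by (simp add: omd_om linear_on_add [OF oact_linear])
next
  case (scale n Y c x)
  then show ?case by (simp add: omd_om linear_on_scale [OF oact_linear])
next
  case (iota Y f)
  then show ?case using assms by (simp add: oact_iota act_1)
next
  case (odif n Y x)
  then show ?case by (simp add: omd_om oact_odif)
next
  case (lm n Y Z f x)
  note ob = lm(2,1) and x = omd_om [OF lm(4)]
  have af: "act D Z Y a f \<in> hom D Z Y" for a using lm by simp
  have "oact X Y 1 (lm X Z Y f x) = lm X Z Y (act D Z Y 1 f) (oact X Z 1 x)"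
    unfolding oact_lm [OF assms(1) ob lm(3) x]
    by (rule sweedler_1 [OF vector_space_fscale])
      (use x ob lm(3) af in \<open>auto intro!: linear_on_comp [OF act_linear(2) lm_linear_left]
        linear_on_comp [OF oact_linear_left lm_linear]\<close>)
  then show ?case using lm by (simp add: act_1)
qed

text \<open>Left multiplication repeats the coassociativity argument of \<open>oact_lm\<close>; the
  case dx uses the Leibniz rule on both sides, with equal signs because the action keeps
  degrees.\<close>

lemma oact_ocmp_hmg:
  assumes ob: "X \<in> ob D" "Y \<in> ob D" and x: "x \<in> omd n Y Z" and y: "y \<in> om X Y"
  shows "oact X Z h (ocmp X Y Z x y) = sweedler H h (\<lambda>a b. ocmp X Y Z (oact Y Z a x) (oact X Y b y))"
proof -
  note vf = vector_space_fscale
  have "\<forall>h. \<forall>y\<in>om X Y. oact X Z h (ocmp X Y Z x y) = sweedler H h (\<lambda>a b. ocmp X Y Z (oact Y Z a x) (oact X Y b y))"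
    using ob(2) x
  proof (induction n Z x rule: omd_struct_induct)
    case (zero n Z)
    have "sweedler H h (\<lambda>a b. 0) = (0 :: ('k, 'o, 'a) omega)" for h
      using sweedler_scale [OF vf, of H h 0] by simp
    then show ?case
      using linear_on_0 [OF ocmp_linear_left] linear_on_0 [OF oact_linear] by simp
  next
    case (add n Z x x')
    then show ?case
      by (simp add: omd_om linear_on_add [OF ocmp_linear_left] linear_on_add [OF oact_linear] sweedler_add)
  next
    case (scale n Z c x)
    then show ?case
      by (simp add: omd_om linear_on_scale [OF ocmp_linear_left] linear_on_scale [OF oact_linear] sweedler_scale [OF vf])
  next
    case (iota Z f)
    then show ?case using ob by (simp add: ocmp_iota oact_iota oact_lm)
  next
    case (odif n Z x)
    show ?case
    proof (intro allI ballI)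
      fix h y assume y: "y \<in> om X Y"
      note x = omd_om [OF odif(2)]
      have L: "ocmp X Y Z (odif Y Z u) v = odif X Z (ocmp X Y Z u v) + fscale (- ((-1) ^ n)) (ocmp X Y Z u (odif X Y v))"
        if "u \<in> omd n Y Z" "v \<in> om X Y" for u v
        using leibniz [OF that] by simp
      have "oact X Z h (ocmp X Y Z (odif Y Z x) y) = odif X Z (oact X Z h (ocmp X Y Z x y)) +
          fscale (- ((-1) ^ n)) (oact X Z h (ocmp X Y Z x (odif X Y y)))"
        using x y odif(2) by (simp only: L linear_on_add [OF oact_linear] linear_on_scale [OF oact_linear]
          oact_odif odif_mem ocmp_mem om_scale)
      also have "\<dots> = sweedler H h (\<lambda>a b. odif X Z (ocmp X Y Z (oact Y Z a x) (oact X Y b y))) +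
          sweedler H h (\<lambda>a b. fscale (- ((-1) ^ n)) (ocmp X Y Z (oact Y Z a x) (odif X Y (oact X Y b y))))"
        using odif(3) x y
        by (simp add: linear_on_sweedler [OF vf om_sub odif_linear] oact_odif flip: sweedler_scale [OF vf])
      also have "\<dots> = sweedler H h (\<lambda>a b. ocmp X Y Z (odif Y Z (oact Y Z a x)) (oact X Y b y))"
        using y by (simp add: L oact_memd [OF odif(2)] flip: sweedler_add)
      finally show "oact X Z h (ocmp X Y Z (odif Y Z x) y) =
          sweedler H h (\<lambda>a b. ocmp X Y Z (oact Y Z a (odif Y Z x)) (oact X Y b y))"
        using x by (simp add: oact_odif)
    qed
  next
    case (lm n Z W f x)
    note obs = ob(1) lm(2,1) and x = omd_om [OF lm(4)]
    have af: "act D W Z a f \<in> hom D W Z" for a using lm by simp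
    show ?case
    proof (intro allI ballI)
      fix h y assume y: "y \<in> om X Y"
      have "oact X Z h (ocmp X Y Z (lm Y W Z f x) y) =
          sweedler H h (\<lambda>a b. lm X W Z (act D W Z a f) (oact X W b (ocmp X Y W x y)))"
        using ob lm x y by (simp add: ocmp_lm oact_lm)
      also have "\<dots> = sweedler H h (\<lambda>a b. sweedler H b (\<lambda>b1 b2.
          lm X W Z (act D W Z a f) (ocmp X Y W (oact Y W b1 x) (oact X Y b2 y))))"
        using lm(5) x y by (simp add: linear_on_sweedler [OF vf om_sub lm_linear [OF obs(2,3) af]])
      also have "\<dots> = sweedler H h (\<lambda>a b. sweedler H a (\<lambda>a1 a2.
          lm X W Z (act D W Z a1 f) (ocmp X Y W (oact Y W a2 x) (oact X Y b y))))"
        by (rule sweedler_coassoc [OF vf, symmetric])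
          (use x y ob obs lm(3) af in \<open>auto intro!: linear_on_comp [OF act_linear(2) lm_linear_left]
            linear_on_comp [OF linear_on_comp [OF oact_linear_left ocmp_linear_left] lm_linear]
            linear_on_comp [OF linear_on_comp [OF oact_linear_left ocmp_linear_right] lm_linear]\<close>)
      also have "\<dots> = sweedler H h (\<lambda>a b. ocmp X Y Z (oact Y Z a (lm Y W Z f x)) (oact X Y b y))"
      proof -
        have "ocmp X Y Z (sweedler H a (\<lambda>a1 a2. lm Y W Z (act D W Z a1 f) (oact Y W a2 x))) (oact X Y b y) =
            sweedler H a (\<lambda>a1 a2. ocmp X Y Z (lm Y W Z (act D W Z a1 f) (oact Y W a2 x)) (oact X Y b y))" for a b
          by (rule linear_on_sweedler [OF vf om_sub ocmp_linear_left]) (use x y ob obs af in auto)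
        then show ?thesis using ob obs lm(3) x y af by (simp add: oact_lm ocmp_lm)
      qed
      finally show "oact X Z h (ocmp X Y Z (lm Y W Z f x) y) =
          sweedler H h (\<lambda>a b. ocmp X Y Z (oact Y Z a (lm Y W Z f x)) (oact X Y b y))" .
    qed
  qed
  then show ?thesis using y by blast
qed

section \<open>The DGH axioms for the universal semicategory\<close>

lemma Omega_simps [simp]:
  "ob (Omega H D) = ob D" "hom (Omega H D) = om" "scl (Omega H D) = fscale"
  "cmp (Omega H D) = ocmp" "homd (Omega H D) = omd" "dif (Omega H D) = odif"
  by (simp_all add: Omega_def om_def omd_def ocmp_def odif_def fun_eq_iff)

lemma oact_mult_om:
  assumes "X \<in> ob D" and x: "x \<in> om X Y"
  shows "oact X Y (h * h') x = oact X Y h (oact X Y h' x)"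
  using x
proof (induction rule: om_induct)
  case (add x y)
  then show ?case by (simp add: linear_on_add [OF oact_linear])
qed (rule oact_mult [OF assms(1)])

lemma oact_1_om:
  assumes "X \<in> ob D" and x: "x \<in> om X Y"
  shows "oact X Y 1 x = x"
  using x
proof (induction rule: om_induct)
  case (add x y)
  then show ?case by (simp add: linear_on_add [OF oact_linear])
qed (rule oact_1 [OF assms(1)])

lemma oact_ocmp:
  assumes ob: "X \<in> ob D" "Y \<in> ob D" and x: "x \<in> om Y Z" and y: "y \<in> om X Y"
  shows "oact X Z h (ocmp X Y Z x y) = sweedler H h (\<lambda>a b. ocmp X Y Z (oact Y Z a x) (oact X Y b y))"
  using x
proof (induction rule: om_induct)
  case (add x x')
  then show ?case
    using y by (simp add: linear_on_add [OF ocmp_linear_left] linear_on_add [OF oact_linear] sweedler_add)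
qed (rule oact_ocmp_hmg [OF ob _ y])

text \<open>Evaluating against multilinear forms that vanish outside one degree separates the degrees.\<close>

lemma omd_independent:
  assumes I: "finite I" and x: "\<forall>n\<in>I. x n \<in> omd n X Y" and s: "(\<Sum>n\<in>I. x n) = 0" and m: "m \<in> I"
  shows "x m = 0"
proof -
  \<comment> \<open>\<open>P \<beta>\<close> keeps \<beta> on symbols with m differentials and is 0
    elsewhere. Each linearity condition on forms concerns symbols of one length, so this is a form
    again.\<close>
  define P where "P = (\<lambda>(\<beta> :: ('k, 'o, 'a) omega_symbol \<Rightarrow> 'k). \<lambda>(Ys, a, fs). if length fs = m then \<beta> (Ys, a, fs) else 0)"
  have P: "P \<beta> \<in> omega_forms D" if "\<beta> \<in> omega_forms D" for \<beta>
    unfolding omega_forms_def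
  proof (intro CollectI ballI, clarify, intro conjI allI impI)
    fix X' Y' Ys f \<mu> fs assume g: "(Ys, (f, \<mu>), fs) \<in> omega_gens D X' Y'"
    show "linear_on (\<lambda>c (f, \<mu>). (scl D c f, c * \<mu>)) {a'. (Ys, a', fs) \<in> omega_gens D X' Y'} (*)
        (\<lambda>a'. P \<beta> (Ys, a', fs))"
      by (cases "length fs = m") (simp_all add: P_def omega_formD(1) [OF that g] linear_on_zero vector_space_mult)
    fix i assume "i < length fs"
    then show "linear_on (scl D) (hom D (Ys ! (i + 2)) (Ys ! (i + 1))) (*) (\<lambda>g. P \<beta> (Ys, (f, \<mu>), fs[i := g]))"
      using omega_formD(2) [OF that g]
      by (cases "length fs = m") (simp_all add: P_def linear_on_zero vector_space_mult)
  qed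
  have ev: "y (P \<beta>) = (if n = m then y \<beta> else 0)" if \<beta>: "\<beta> \<in> omega_forms D" and y: "y \<in> omd n X Y" for \<beta> n y
    using y unfolding omd_def
  proof (rule omega_span_induct [where X = X and Y = Y])
    fix c g assume "g \<in> {(Ys, a, fs). (Ys, a, fs) \<in> omega_gens D X Y \<and> length fs = n}"
    then show "fscale c (omega_gen D g) (P \<beta>) = (if n = m then fscale c (omega_gen D g) \<beta> else 0)"
      using \<beta> P [OF \<beta>] by (auto simp: fscale_def omega_gen_def elem_tensor_def P_def)
  qed (auto simp: plus_fun_apply zero_fun_apply)
  have app: "(\<Sum>n\<in>J. x n) \<beta> = (\<Sum>n\<in>J. x n \<beta>)" for J \<beta>
    by (induction J rule: infinite_finite_induct) (auto simp: plus_fun_apply zero_fun_apply)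
  have "x m \<beta> = 0" for \<beta>
  proof (cases "\<beta> \<in> omega_forms D")
    case True
    have "0 = (\<Sum>n\<in>I. x n (P \<beta>))" using s app [of I "P \<beta>"] by (simp add: zero_fun_apply)
    also have "\<dots> = (\<Sum>n\<in>I. if n = m then x n \<beta> else 0)"
      by (rule sum.cong) (simp_all add: ev [OF True] x)
    finally show ?thesis using I m by simp
  next
    \<comment> \<open>Outside the forms every tensor takes the value 0, so these arguments carry no
      information.\<close>
    case False
    have "y \<beta> = 0" if "y \<in> omd m X Y" for y
      using that unfolding omd_def
      by (rule omega_span_induct [where X = X and Y = Y])
        (use False in \<open>auto simp: plus_fun_apply zero_fun_apply fscale_def omega_gen_def elem_tensor_def\<close>)
    then show ?thesis using x m by simp
  qed
  then show ?thesis by (simp add: fun_eq_iff zero_fun_apply)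
qed

theorem DGH_Omega: "DGH_semicategory H (Omega H D)"
proof -
  have lin: "linear_semicategory (Omega H D)"
    unfolding linear_semicategory_def
    by (simp add: vector_space_fscale bilinear_on_def ocmp_linear_left ocmp_linear_right ocmp_assoc)
  have "left_H_semicategory H (Omega H D)"
    unfolding left_H_semicategory_def
    using lin by (simp add: bilinear_on_def oact_linear oact_linear_left oact_mult_om oact_1_om oact_ocmp)
  moreover have "DG_semicategory (Omega H D)"
    unfolding DG_semicategory_def
    using lin by (auto simp: om_span [symmetric] odif_linear odif_memd odif_odif ocmp_memd omd_om leibniz
      intro: omd_independent)
  ultimately show ?thesis
    unfolding DGH_semicategory_def by (simp add: oact_memd oact_odif)
qed

end

section \<open>Extension of semifunctors to the universal DGH-semicategory\<close>

lemma dif_path_Cons [simp]: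
  "dif_path S Fo Fm (Y # Ys) (f # fs) =
    dif S (Fo (Ys ! 0)) (Fo Y) (Fm (Ys ! 0) Y f) # dif_path S Fo Fm Ys fs"
  by (simp add: dif_path_def upt_conv_Cons map_Suc_upt [symmetric] comp_def del: upt_Suc)

lemma dif_path_Nil [simp]: "dif_path S Fo Fm Ys [] = []"
  by (simp add: dif_path_def)

lemma compose_path_Cons:
  "gs \<noteq> [] \<Longrightarrow> compose_path S (V # Vs) (g # gs) = cmp S (last (V # Vs)) (Vs ! 0) V g (compose_path S Vs gs)"
  by (cases gs) auto

locale omega_functor = H_semicat H D
  for H :: "('k::field_char_0, 'h::ring_1) hopf"
    and D :: "('k, 'h, 'o, 'a::ab_group_add, 'z) semicat_scheme" +
  fixes S :: "('k, 'h, 'p, 'b::ab_group_add, 'y) dgsemicat_scheme"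
    and Fo :: "'o \<Rightarrow> 'p" and Fm :: "'o \<Rightarrow> 'o \<Rightarrow> 'a \<Rightarrow> 'b"
  assumes DGH: "DGH_semicategory H S" and semifun: "H_semifunctor D (degree_zero S) Fo Fm"
begin

lemma DG: "DG_semicategory S"
  using DGH by (simp add: DGH_semicategory_def)

sublocale T: H_semicat H S
proof
  show "linear_semicategory S" using DG by (simp add: DG_semicategory_def)
  show "left_H_semicategory H S" using DGH by (simp add: DGH_semicategory_def)
qed

lemma homd_sub: "X \<in> ob S \<Longrightarrow> Y \<in> ob S \<Longrightarrow> T.av.subspace (homd S n X Y)"
  using DG by (simp add: DG_semicategory_def)

lemma homd_hom: "X \<in> ob S \<Longrightarrow> Y \<in> ob S \<Longrightarrow> x \<in> homd S n X Y \<Longrightarrow> x \<in> hom S X Y"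
  using DG by (auto simp: DG_semicategory_def intro: T.av.span_base)

lemma dif_linear: "X \<in> ob S \<Longrightarrow> Y \<in> ob S \<Longrightarrow> linear_on (scl S) (hom S X Y) (scl S) (dif S X Y)"
  using DG unfolding DG_semicategory_def by blast

lemma dif_memd: "X \<in> ob S \<Longrightarrow> Y \<in> ob S \<Longrightarrow> x \<in> homd S n X Y \<Longrightarrow> dif S X Y x \<in> homd S (Suc n) X Y"
  and dif_dif: "X \<in> ob S \<Longrightarrow> Y \<in> ob S \<Longrightarrow> y \<in> hom S X Y \<Longrightarrow> dif S X Y (dif S X Y y) = 0"
  using DG by (simp_all add: DG_semicategory_def)

lemma cmp_memd:
  "X \<in> ob S \<Longrightarrow> Y \<in> ob S \<Longrightarrow> Z \<in> ob S \<Longrightarrow> x \<in> homd S i Y Z \<Longrightarrow> y \<in> homd S j X Y \<Longrightarrow>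
    cmp S X Y Z x y \<in> homd S (i + j) X Z"
  and dif_cmp:
  "X \<in> ob S \<Longrightarrow> Y \<in> ob S \<Longrightarrow> Z \<in> ob S \<Longrightarrow> x \<in> homd S i Y Z \<Longrightarrow> y \<in> homd S j X Y \<Longrightarrow>
    dif S X Z (cmp S X Y Z x y) =
      cmp S X Y Z (dif S Y Z x) y + scl S ((-1) ^ i) (cmp S X Y Z x (dif S X Y y))"
  using DG by (simp_all add: DG_semicategory_def)

lemma dif_act: "X \<in> ob S \<Longrightarrow> Y \<in> ob S \<Longrightarrow> x \<in> hom S X Y \<Longrightarrow> dif S X Y (act S X Y h x) = act S X Y h (dif S X Y x)"
  using DGH by (simp add: DGH_semicategory_def)

lemma Fo_ob [simp]: "X \<in> ob D \<Longrightarrow> Fo X \<in> ob S"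
  using semifun by (simp add: H_semifunctor_def degree_zero_def)

lemma Fm_memd: "X \<in> ob D \<Longrightarrow> Y \<in> ob D \<Longrightarrow> f \<in> hom D X Y \<Longrightarrow> Fm X Y f \<in> homd S 0 (Fo X) (Fo Y)"
  and Fm_linear0: "X \<in> ob D \<Longrightarrow> Y \<in> ob D \<Longrightarrow> linear_on (scl D) (hom D X Y) (scl S) (Fm X Y)"
  and Fm_act: "X \<in> ob D \<Longrightarrow> Y \<in> ob D \<Longrightarrow> f \<in> hom D X Y \<Longrightarrow>
    Fm X Y (act D X Y h f) = act S (Fo X) (Fo Y) h (Fm X Y f)"
  and Fm_cmp: "X \<in> ob D \<Longrightarrow> Y \<in> ob D \<Longrightarrow> Z \<in> ob D \<Longrightarrow> g \<in> hom D Y Z \<Longrightarrow> f \<in> hom D X Y \<Longrightarrow>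
    Fm X Z (cmp D X Y Z g f) = cmp S (Fo X) (Fo Y) (Fo Z) (Fm Y Z g) (Fm X Y f)"
  using semifun by (simp_all add: H_semifunctor_def degree_zero_def)

lemma Fm_mem [simp]: "X \<in> ob D \<Longrightarrow> Y \<in> ob D \<Longrightarrow> f \<in> hom D X Y \<Longrightarrow> Fm X Y f \<in> hom S (Fo X) (Fo Y)"
  using homd_hom [OF _ _ Fm_memd] by simp

lemma dif_mem [simp]:
  assumes "X \<in> ob S" "Y \<in> ob S" "x \<in> hom S X Y"
  shows "dif S X Y x \<in> hom S X Y"
proof -
  have "x \<in> T.av.span (\<Union>n. homd S n X Y)" using DG assms by (simp add: DG_semicategory_def)
  moreover have sp: "hom S X Y = T.av.span (\<Union>n. homd S n X Y)" using DG assms by (simp add: DG_semicategory_def)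
  ultimately have "x \<in> hom S X Y \<and> dif S X Y x \<in> hom S X Y"
  proof (induction rule: T.av.span_induct_alt)
    case base
    then show ?case
      using linear_on_0 [OF dif_linear [OF assms(1,2)]] T.hom_0 [OF assms(1,2)] by simp
  next
    case (step c x y)
    then obtain n where n: "x \<in> homd S n X Y" by auto
    note L = dif_linear [OF assms(1,2)]
    have x: "x \<in> hom S X Y" "dif S X Y x \<in> hom S X Y"
      using homd_hom [OF assms(1,2)] n dif_memd [OF assms(1,2) n] by auto
    note sub = T.hom_sub [OF assms(1,2)]
    show ?case
      using step x T.av.subspace_add [OF sub] T.av.subspace_scale [OF sub]
      by (simp add: linear_on_add [OF L] linear_on_scale [OF L])
  qed
  then show ?thesis by simp
qed

text \<open>\<open>iw\<close> and \<open>bw\<close> are the prospective images of \<open>wd\<close>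
  and \<open>dwd\<close>; they are built from the images of the morphisms in S.\<close>

definition iw :: "'o list \<Rightarrow> 'a list \<Rightarrow> 'b" where
  "iw Ys fs = image_word S Fo Fm Ys (hd fs) (tl fs)"

definition bw :: "'o list \<Rightarrow> 'a list \<Rightarrow> 'b" where
  "bw Ys fs = compose_path S (map Fo Ys) (dif_path S Fo Fm Ys fs)"

lemma word_Cons:
  assumes p: "path_between D X Z Ys fs" "fs \<noteq> []"
  shows "iw (Y # Ys) (f # fs) = cmp S (Fo X) (Fo Z) (Fo Y) (Fm Z Y f) (bw Ys fs)"
    and "bw (Y # Ys) (f # fs) = cmp S (Fo X) (Fo Z) (Fo Y) (dif S (Fo Z) (Fo Y) (Fm Z Y f)) (bw Ys fs)"
proof -
  obtain Ys' where Ys: "Ys = Z # Ys'" using path_hd [OF p(1)] by blast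
  have l: "last (Fo Y # map Fo Ys) = Fo X" using p by (auto simp: Ys path_between_def last_map)
  obtain g gs where fs: "fs = g # gs" using p(2) by (cases fs) auto
  have ne: "dif_path S Fo Fm Ys fs \<noteq> []" by (simp add: dif_path_def fs)
  show "iw (Y # Ys) (f # fs) = cmp S (Fo X) (Fo Z) (Fo Y) (Fm Z Y f) (bw Ys fs)"
    "bw (Y # Ys) (f # fs) = cmp S (Fo X) (Fo Z) (Fo Y) (dif S (Fo Z) (Fo Y) (Fm Z Y f)) (bw Ys fs)"
    using ne l by (simp_all add: iw_def bw_def image_word_def compose_path_Cons Ys)
qed

lemma word_single:
  "iw [Y, X] [f] = Fm X Y f" "bw [Y, X] [f] = dif S (Fo X) (Fo Y) (Fm X Y f)"
  by (simp_all add: iw_def bw_def image_word_def)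

text \<open>The reason why the extension commutes with differentials: in a product of \<rho>(f) with
  a word of differentials only the first factor is differentiated, as the rest is exact. The degree
  is carried along because the Leibniz rule in S concerns homogeneous elements.\<close>

lemma word_props:
  assumes "path_between D X Y Ys fs" "fs \<noteq> []"
  shows "iw Ys fs \<in> homd S (length fs - 1) (Fo X) (Fo Y) \<and> bw Ys fs = dif S (Fo X) (Fo Y) (iw Ys fs)"
  using assms
proof (induction rule: path_between_induct)
  case (single Y f)
  then show ?case by (simp add: word_single Fm_memd)
next
  case (Cons Y Z Ys f fs)
  obtain n where n: "length fs = Suc n" using \<open>fs \<noteq> []\<close> by (cases fs) auto
  have X: "X \<in> ob D" using path_between_ob [OF Cons(4)] by simp
  note w = word_Cons [OF Cons(4,5)]
  have i: "iw (Z # Ys) fs \<in> homd S n (Fo X) (Fo Z)" using Cons.IH n by simp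
  have b: "bw (Z # Ys) fs = dif S (Fo X) (Fo Z) (iw (Z # Ys) fs)" using Cons.IH by simp
  have b': "bw (Z # Ys) fs \<in> homd S (Suc n) (Fo X) (Fo Z)"
    unfolding b by (rule dif_memd) (use X Cons i in auto)
  have db: "dif S (Fo X) (Fo Z) (bw (Z # Ys) fs) = 0"
    unfolding b by (rule dif_dif) (use X Cons homd_hom [OF _ _ i] in auto)
  have f0: "Fm Z Y f \<in> homd S 0 (Fo Z) (Fo Y)" using Cons by (simp add: Fm_memd)
  have z: "cmp S (Fo X) (Fo Z) (Fo Y) (Fm Z Y f) 0 = 0"
    by (rule linear_on_0 [OF T.cmp_linear(1)]) (use X Cons in auto)
  have "iw (Y # Z # Ys) (f # fs) \<in> homd S (0 + Suc n) (Fo X) (Fo Y)"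
    unfolding w by (rule cmp_memd [OF _ _ _ f0 b']) (use X Cons in auto)
  moreover have "dif S (Fo X) (Fo Y) (iw (Y # Z # Ys) (f # fs)) = bw (Y # Z # Ys) (f # fs)"
    unfolding w by (subst dif_cmp [OF _ _ _ f0 b']) (use X Cons db z in auto)
  ultimately show ?case using n by simp
qed

lemma iw_mem:
  assumes "path_between D X Y Ys fs" "fs \<noteq> []"
  shows "iw Ys fs \<in> hom S (Fo X) (Fo Y)"
  using word_props [OF assms] path_between_ob [OF assms(1)] homd_hom by auto

lemma iw_multilin: "multilin D (scl S) Ys (iw Ys)"
proof (induction Ys)
  case Nil
  then show ?case by (simp add: multilin_short)
next
  case (Cons Y Ys)
  show ?case
  proof (rule multilin_Cons)
    fix fs assume Y: "Y \<in> ob D" and p: "is_path D Ys fs"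
    note q = is_path_between [OF p]
    have ob: "hd Ys \<in> ob D" "last Ys \<in> ob D" using path_between_ob [OF q] by auto
    show "linear_on (scl D) (hom D (hd Ys) Y) (scl S) (\<lambda>g. iw (Y # Ys) (g # fs))"
    proof (cases "fs = []")
      case True
      with p obtain Z where "Ys = [Z]" "Z \<in> ob D" by (auto simp: is_path_Nil)
      with True Y show ?thesis by (simp add: word_single Fm_linear0)
    next
      case False
      have "bw Ys fs \<in> hom S (Fo (last Ys)) (Fo (hd Ys))"
        using word_props [OF q False] iw_mem [OF q False] ob by simp
      then show ?thesis
        using ob Y unfolding word_Cons [OF q False]
        by (intro linear_on_comp [OF Fm_linear0 T.cmp_linear(2)]) auto
    qed
  next
    fix f assume Y: "Y \<in> ob D" "Ys \<noteq> []" "hd Ys \<in> ob D" and f: "f \<in> hom D (hd Ys) Y"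
    show "multilin D (scl S) Ys (\<lambda>fs. iw (Y # Ys) (f # fs))"
    \<comment> \<open>If the last entry is not an object, there is no path over \<open>Ys\<close>
      and nothing to prove.\<close>
    proof (cases "length Ys \<le> 1 \<or> last Ys \<notin> ob D")
      case True
      then show ?thesis using path_between_ob [OF is_path_between]
        by (auto simp: multilin_short) (auto simp: multilin_def)
    next
      case False
      then have ne: "fs \<noteq> []" if "is_path D Ys fs" for fs using that by (auto simp: is_path_def)
      have "multilin D (scl S) Ys (\<lambda>fs. cmp S (Fo (last Ys)) (Fo (hd Ys)) (Fo Y) (Fm (hd Ys) Y f)
          (dif S (Fo (last Ys)) (Fo (hd Ys)) (iw Ys fs)))"
        using False Y f
        by (intro multilin_comp [OF multilin_comp [OF Cons.IH dif_linear] T.cmp_linear(1)])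
          (auto intro!: dif_mem iw_mem [OF is_path_between] ne)
      then show ?thesis
        by (rule multilin_cong)
          (simp add: word_Cons(1) [OF is_path_between ne] word_props [OF is_path_between ne])
    qed
  qed
qed

lemma bw_multilin: "multilin D (scl S) Ys (bw Ys)"
proof (cases "length Ys \<le> 1 \<or> last Ys \<notin> ob D \<or> hd Ys \<notin> ob D")
  case True
  then show ?thesis using path_between_ob [OF is_path_between]
    by (auto simp: multilin_short) (auto simp: multilin_def)
next
  case False
  then have ne: "fs \<noteq> []" if "is_path D Ys fs" for fs using that by (auto simp: is_path_def)
  have "multilin D (scl S) Ys (\<lambda>fs. dif S (Fo (last Ys)) (Fo (hd Ys)) (iw Ys fs))"
    using False by (intro multilin_comp [OF iw_multilin dif_linear]) (auto intro!: iw_mem [OF is_path_between] ne)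
  then show ?thesis
    by (rule multilin_cong) (simp add: word_props [OF is_path_between ne])
qed

abbreviation rho :: "'o \<Rightarrow> 'o \<Rightarrow> ('k, 'o, 'a) omega \<Rightarrow> 'b" where
  "rho \<equiv> rho_hat D S Fo Fm"

lemma rho_lift:
  shows rho_linear: "linear_on fscale (om X Y) (scl S) (rho X Y)"
    and rho_wd: "path_between D X Y Ys fs \<Longrightarrow> fs \<noteq> [] \<Longrightarrow> rho X Y (wd Ys fs) = iw Ys fs"
    and rho_dwd: "path_between D X Y Ys fs \<Longrightarrow> fs \<noteq> [] \<Longrightarrow>
      rho X Y (dwd Ys fs) = dif S (Fo X) (Fo Y) (iw Ys fs)"
proof -
  let ?F = "\<lambda>(Ys, (f, \<mu>), fs). image_word S Fo Fm Ys f fs +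
       scl S \<mu> (compose_path S (map Fo (tl Ys)) (dif_path S Fo Fm (tl Ys) fs))"
  have A: "\<forall>Ys. hd Ys = Y \<and> last Ys = X \<longrightarrow> multilin D (scl S) Ys (iw Ys)"
    and B: "\<forall>Ys. hd Ys = Y \<and> last Ys = X \<longrightarrow> multilin D (scl S) Ys (bw Ys)"
    and F: "\<forall>Ys f \<mu> fs. (Ys, (f, \<mu>), fs) \<in> omega_gens D X Y \<longrightarrow>
     ?F (Ys, (f, \<mu>), fs) = iw Ys (f # fs) + scl S \<mu> (bw (tl Ys) fs)"
    by (simp_all add: iw_multilin bw_multilin iw_def bw_def)
  note L = omega_lift [where A = iw and B = bw and F = ?F, OF T.avs A B F, folded rho_hat_def]
  show "linear_on fscale (om X Y) (scl S) (rho X Y)" by (rule L(1))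
  show "path_between D X Y Ys fs \<Longrightarrow> fs \<noteq> [] \<Longrightarrow> rho X Y (wd Ys fs) = iw Ys fs" by (rule L(2))
  show "rho X Y (dwd Ys fs) = dif S (Fo X) (Fo Y) (iw Ys fs)"
    if p: "path_between D X Y Ys fs" "fs \<noteq> []"
    using L(3) [OF p] word_props [OF p] by simp
qed

lemma rho_0 [simp]: "rho X Y 0 = 0"
  by (rule linear_on_0 [OF rho_linear]) simp

lemma rho_memd:
  assumes ob: "X \<in> ob D" "Y \<in> ob D" and x: "x \<in> omd n X Y"
  shows "rho X Y x \<in> homd S n (Fo X) (Fo Y)"
proof -
  note sub = homd_sub [OF Fo_ob [OF ob(1)] Fo_ob [OF ob(2)]]
  from x show ?thesis
  proof (induction rule: omd_induct)
    case zero
    then show ?case using T.av.subspace_0 [OF sub] by simp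
  next
    case (add x y)
    then show ?case using T.av.subspace_add [OF sub] by (simp add: omd_om linear_on_add [OF rho_linear])
  next
    case (scale c x)
    then show ?case using T.av.subspace_scale [OF sub] by (simp add: omd_om linear_on_scale [OF rho_linear])
  next
    case (wd Ys fs)
    then have ne: "fs \<noteq> []" by auto
    show ?case using word_props [OF wd(1) ne] wd ne by (simp add: rho_wd)
  next
    case (dwd Ys fs)
    then obtain m where m: "n = Suc m" by (cases fs) auto
    show ?case using word_props [OF dwd(1,3)] dwd m ob by (simp add: rho_dwd dif_memd)
  qed
qed

lemma rho_mem [simp]:
  assumes ob: "X \<in> ob D" "Y \<in> ob D" and x: "x \<in> om X Y"
  shows "rho X Y x \<in> hom S (Fo X) (Fo Y)"
  using x
proof (induction rule: om_induct)
  case (add x y)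
  then show ?case
    using T.av.subspace_add [OF T.hom_sub [OF Fo_ob [OF ob(1)] Fo_ob [OF ob(2)]]]
    by (simp add: linear_on_add [OF rho_linear])
next
  case (hmg n x)
  then show ?case using rho_memd [OF ob] homd_hom ob by (metis Fo_ob)
qed

lemma rho_iota: "X \<in> ob D \<Longrightarrow> Y \<in> ob D \<Longrightarrow> f \<in> hom D X Y \<Longrightarrow> rho X Y (iota X Y f) = Fm X Y f"
  by (simp add: iota_def rho_wd path_single word_single)

lemma rho_odif:
  assumes ob: "X \<in> ob D" "Y \<in> ob D" and x: "x \<in> om X Y"
  shows "rho X Y (odif X Y x) = dif S (Fo X) (Fo Y) (rho X Y x)"
proof (rule linear_om_eqI [where F = "\<lambda>x. rho X Y (odif X Y x)" and G = "\<lambda>x. dif S (Fo X) (Fo Y) (rho X Y x)", OF _ _ _ _ x])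
  show "linear_on fscale (om X Y) (scl S) (\<lambda>x. rho X Y (odif X Y x))"
    by (rule linear_on_comp [OF odif_linear rho_linear]) simp
  show "linear_on fscale (om X Y) (scl S) (\<lambda>x. dif S (Fo X) (Fo Y) (rho X Y x))"
    by (rule linear_on_comp [OF rho_linear dif_linear]) (use ob in auto)
  fix Ys fs assume p: "path_between D X Y Ys fs" "fs \<noteq> []"
  show "rho X Y (odif X Y (wd Ys fs)) = dif S (Fo X) (Fo Y) (rho X Y (wd Ys fs))"
    using p by (simp add: odif_wd rho_wd rho_dwd)
  show "rho X Y (odif X Y (dwd Ys fs)) = dif S (Fo X) (Fo Y) (rho X Y (dwd Ys fs))"
    using p iw_mem [OF p] ob by (simp add: odif_dwd rho_dwd dif_dif)
qed

text \<open>On a word g dw functoriality turns the image of f g into a composite, and associativity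
  in S does the rest.\<close>

lemma rho_lm:
  assumes ob: "X \<in> ob D" "Z \<in> ob D" "Y \<in> ob D" and f: "f \<in> hom D Z Y" and x: "x \<in> om X Z"
  shows "rho X Y (lm X Z Y f x) = cmp S (Fo X) (Fo Z) (Fo Y) (Fm Z Y f) (rho X Z x)"
proof (rule linear_om_eqI [where F = "\<lambda>x. rho X Y (lm X Z Y f x)" and
      G = "\<lambda>x. cmp S (Fo X) (Fo Z) (Fo Y) (Fm Z Y f) (rho X Z x)", OF _ _ _ _ x])
  show "linear_on fscale (om X Z) (scl S) (\<lambda>x. rho X Y (lm X Z Y f x))"
    by (rule linear_on_comp [OF lm_linear rho_linear]) (use ob f in auto)
  show "linear_on fscale (om X Z) (scl S) (\<lambda>x. cmp S (Fo X) (Fo Z) (Fo Y) (Fm Z Y f) (rho X Z x))"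
    by (rule linear_on_comp [OF rho_linear T.cmp_linear(1)]) (use ob f in auto)
  fix Ys fs assume p: "path_between D X Z Ys fs" "fs \<noteq> []"
  obtain g gs where fs: "fs = g # gs" using p(2) by (cases fs) auto
  obtain Ys' where Ys: "Ys = Z # Ys'" using path_hd [OF p(1)] by blast
  define W where "W = hd Ys'"
  from p have q: "g \<in> hom D W Z" "path_between D X W Ys' gs" by (auto simp: fs Ys path_between_Cons W_def)
  have W: "W \<in> ob D" using path_between_ob [OF q(2)] by simp
  have r: "path_between D X Y (Y # Ys') (cmp D W Z Y f g # gs)"
    using q ob W f by (simp add: path_between_Cons W_def)
  show "rho X Y (lm X Z Y f (wd Ys fs)) = cmp S (Fo X) (Fo Z) (Fo Y) (Fm Z Y f) (rho X Z (wd Ys fs))"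
  proof (cases "gs = []")
    case True
    with q have "Ys' = [X]" "W = X" by (auto simp: path_between_def is_path_Nil)
    then show ?thesis
      using p q r ob W f True by (simp add: fs Ys lm_wd rho_wd word_single Fm_cmp)
  next
    case False
    have "bw Ys' gs \<in> hom S (Fo X) (Fo W)"
      using word_props [OF q(2) False] iw_mem [OF q(2) False] ob W by simp
    then show ?thesis
      using p q r ob W f by (simp add: fs Ys lm_wd rho_wd word_Cons [OF q(2) False] Fm_cmp T.cmp_assoc W_def [symmetric])
  qed
  show "rho X Y (lm X Z Y f (dwd Ys fs)) = cmp S (Fo X) (Fo Z) (Fo Y) (Fm Z Y f) (rho X Z (dwd Ys fs))"
    using p ob f path_Cons [OF p(1) ob(3) f] word_props [OF p]
    by (simp add: lm_dwd rho_wd rho_dwd word_Cons [OF p])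
qed

text \<open>Structural induction on x: the differential and left multiplication are already known to
  be preserved, and the case dx compares the Leibniz rules of Omega and of S.\<close>

lemma rho_ocmp:
  assumes ob: "X \<in> ob D" "Y \<in> ob D" "Z \<in> ob D" and x: "x \<in> omd i Y Z" and y: "y \<in> omd j X Y"
  shows "rho X Z (ocmp X Y Z x y) = cmp S (Fo X) (Fo Y) (Fo Z) (rho Y Z x) (rho X Y y)"
proof -
  \<comment> \<open>The target moves in the induction and not every case supplies that it is an
    object, so this premise is carried inside.\<close>
  have "Z \<in> ob D \<longrightarrow> (\<forall>j. \<forall>y\<in>omd j X Y.
      rho X Z (ocmp X Y Z x y) = cmp S (Fo X) (Fo Y) (Fo Z) (rho Y Z x) (rho X Y y))"
    using ob(2) x
  proof (induction i Z x rule: omd_struct_induct)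
    case (zero n Z)
    show ?case
    proof (intro allI impI ballI)
      fix j y assume Z: "Z \<in> ob D" and y: "y \<in> omd j X Y"
      have "cmp S (Fo X) (Fo Y) (Fo Z) 0 (rho X Y y) = 0"
        by (rule linear_on_0 [OF T.cmp_linear(2)]) (use ob Z omd_om [OF y] in auto)
      then show "rho X Z (ocmp X Y Z 0 y) = cmp S (Fo X) (Fo Y) (Fo Z) (rho Y Z 0) (rho X Y y)"
        using linear_on_0 [OF ocmp_linear_left [OF omd_om [OF y]], of Z] by simp
    qed
  next
    case (add n Z x x')
    show ?case
    proof (intro allI impI ballI)
      fix j y assume Z: "Z \<in> ob D" and y: "y \<in> omd j X Y"
      note m = omd_om [OF add(1)] omd_om [OF add(2)] omd_om [OF y]
      have r: "rho X Y y \<in> hom S (Fo X) (Fo Y)" using ob m by simp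
      show "rho X Z (ocmp X Y Z (x + x') y) = cmp S (Fo X) (Fo Y) (Fo Z) (rho Y Z (x + x')) (rho X Y y)"
        using add(3,4) Z y m ob linear_on_add [OF T.cmp_linear(2) [OF _ _ _ r], of "Fo Z" "rho Y Z x" "rho Y Z x'"]
        by (simp add: linear_on_add [OF ocmp_linear_left] linear_on_add [OF rho_linear])
    qed
  next
    case (scale n Z c x)
    show ?case
    proof (intro allI impI ballI)
      fix j y assume Z: "Z \<in> ob D" and y: "y \<in> omd j X Y"
      note m = omd_om [OF scale(1)] omd_om [OF y]
      have r: "rho X Y y \<in> hom S (Fo X) (Fo Y)" using ob m by simp
      show "rho X Z (ocmp X Y Z (fscale c x) y) = cmp S (Fo X) (Fo Y) (Fo Z) (rho Y Z (fscale c x)) (rho X Y y)"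
        using scale(2) Z y m ob linear_on_scale [OF T.cmp_linear(2) [OF _ _ _ r], of "Fo Z" "rho Y Z x" c]
        by (simp add: linear_on_scale [OF ocmp_linear_left] linear_on_scale [OF rho_linear])
    qed
  next
    case (iota Z f)
    show ?case
    proof (intro allI impI ballI)
      fix j y assume "Z \<in> ob D" and y: "y \<in> omd j X Y"
      then show "rho X Z (ocmp X Y Z (iota Y Z f) y) = cmp S (Fo X) (Fo Y) (Fo Z) (rho Y Z (iota Y Z f)) (rho X Y y)"
        using iota ob omd_om [OF y] by (simp add: ocmp_iota rho_iota rho_lm)
    qed
  next
    case (odif n Z x)
    show ?case
    proof (intro allI impI ballI)
      fix j y assume "Z \<in> ob D" and y: "y \<in> omd j X Y"
      note m = omd_om [OF odif(2)] omd_om [OF y]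
      note d = rho_memd [OF ob(2) odif(1,2)] rho_memd [OF ob(1,2) y]
      have "rho X Z (ocmp X Y Z (odif Y Z x) y) = rho X Z (odif X Z (ocmp X Y Z x y) +
          fscale (- ((-1) ^ n)) (ocmp X Y Z x (odif X Y y)))"
        using leibniz [OF odif(2) m(2)] by simp
      also have "\<dots> = dif S (Fo X) (Fo Z) (rho X Z (ocmp X Y Z x y)) +
          scl S (- ((-1) ^ n)) (rho X Z (ocmp X Y Z x (odif X Y y)))"
        using m ob odif(1)
        by (simp only: linear_on_add [OF rho_linear] linear_on_scale [OF rho_linear] rho_odif odif_mem ocmp_mem om_scale)
      also have "\<dots> = dif S (Fo X) (Fo Z) (cmp S (Fo X) (Fo Y) (Fo Z) (rho Y Z x) (rho X Y y)) -
          scl S ((-1) ^ n) (cmp S (Fo X) (Fo Y) (Fo Z) (rho Y Z x) (dif S (Fo X) (Fo Y) (rho X Y y)))"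
        using odif y odif_memd [OF y] m ob by (simp add: rho_odif)
      also have "\<dots> = cmp S (Fo X) (Fo Y) (Fo Z) (rho Y Z (odif Y Z x)) (rho X Y y)"
        using odif(1) ob m by (simp add: dif_cmp [OF _ _ _ d] rho_odif)
      finally show "rho X Z (ocmp X Y Z (odif Y Z x) y) =
          cmp S (Fo X) (Fo Y) (Fo Z) (rho Y Z (odif Y Z x)) (rho X Y y)" .
    qed
  next
    case (lm n Z W f x)
    show ?case
    proof (intro allI impI ballI)
      fix j y assume "Z \<in> ob D" and y: "y \<in> omd j X Y"
      note m = omd_om [OF lm(4)] omd_om [OF y]
      show "rho X Z (ocmp X Y Z (lm Y W Z f x) y) = cmp S (Fo X) (Fo Y) (Fo Z) (rho Y Z (lm Y W Z f x)) (rho X Y y)"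
        using lm y m ob by (simp add: ocmp_lm rho_lm T.cmp_assoc)
    qed
  qed
  then show ?thesis using ob(3) y by blast
qed

lemma rho_oact:
  assumes ob: "X \<in> ob D" "Y \<in> ob D" and x: "x \<in> omd n X Y"
  shows "rho X Y (oact X Y h x) = act S (Fo X) (Fo Y) h (rho X Y x)"
proof -
  have "Y \<in> ob D \<longrightarrow> (\<forall>h. rho X Y (oact X Y h x) = act S (Fo X) (Fo Y) h (rho X Y x))"
    using ob(1) x
  proof (induction n Y x rule: omd_struct_induct)
    case (zero n Y)
    then show ?case
      using linear_on_0 [OF oact_linear] linear_on_0 [OF T.act_linear(1)] ob(1) by simp
  next
    case (add n Y x y)
    then show ?case
      using ob(1) by (simp add: omd_om linear_on_add [OF oact_linear] linear_on_add [OF rho_linear]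
        linear_on_add [OF T.act_linear(1)])
  next
    case (scale n Y c x)
    then show ?case
      using ob(1) by (simp add: omd_om linear_on_scale [OF oact_linear] linear_on_scale [OF rho_linear]
        linear_on_scale [OF T.act_linear(1)])
  next
    case (iota Y f)
    then show ?case using ob(1) by (simp add: oact_iota rho_iota Fm_act)
  next
    case (odif n Y x)
    then show ?case using ob(1) by (simp add: omd_om oact_odif rho_odif dif_act)
  next
    case (lm n Y Z f x)
    note m = omd_om [OF lm(4)]
    have af: "act D Z Y a f \<in> hom D Z Y" for a using lm by simp
    show ?case
    proof (intro impI allI)
      fix h
      have "rho X Y (oact X Y h (lm X Z Y f x)) =
          sweedler H h (\<lambda>a b. rho X Y (lm X Z Y (act D Z Y a f) (oact X Z b x)))"
        unfolding oact_lm [OF ob(1) lm(2,1,3) m]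
        by (rule linear_on_sweedler [OF vector_space_fscale om_sub rho_linear]) (use lm m af ob in auto)
      also have "\<dots> = act S (Fo X) (Fo Y) h (rho X Y (lm X Z Y f x))"
        using lm m af ob(1) by (simp add: rho_lm T.act_cmp Fm_act)
      finally show "rho X Y (oact X Y h (lm X Z Y f x)) = act S (Fo X) (Fo Y) h (rho X Y (lm X Z Y f x))" .
    qed
  qed
  then show ?thesis using ob(2) by blast
qed

end

section \<open>Traces on the universal DGH-semicategory\<close>

lemma tmul_bilinear: "bilinear_on sU U sV V fscale (\<lambda>(u, v). tmul sU U sV V u v)"
  by (auto simp: bilinear_on_def linear_on_def tmul_def elem_tensor_def fscale_def fun_eq_iff
      bilinear_forms_def plus_fun_apply)

lemma tmul_linear_left: "v \<in> V \<Longrightarrow> linear_on sU U fscale (\<lambda>u. tmul sU U sV V u v)"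
  and tmul_linear_right: "u \<in> U \<Longrightarrow> linear_on sV V fscale (tmul sU U sV V u)"
  using tmul_bilinear [of sU U sV V] by (simp_all add: bilinear_on_def)

lemma tmul_mem: "u \<in> U \<Longrightarrow> v \<in> V \<Longrightarrow> tmul sU U sV V u v \<in> tprod sU U sV V"
  unfolding tprod_def tensor_space_def tmul_def by (rule fscale.span_base) auto

lemma multilin_cosweedler:
  assumes "vector_space sW" "\<And>a b. multilin D sW Ys (\<lambda>fs. F fs a b)"
  shows "multilin D sW Ys (\<lambda>fs. cosweedler H M m (F fs))"
  using assms(2) by (auto simp: multilin_def intro!: linear_on_cosweedler_param assms(1))

text \<open>Paths are built at the target end; cyclic chains need access to the last morphism, the
  one carried around by the rotation and by the last face.\<close>

lemma is_path_snoc: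
  "Xs \<noteq> [] \<Longrightarrow> is_path D (Xs @ [X]) (gs @ [f]) \<longleftrightarrow> is_path D Xs gs \<and> X \<in> ob D \<and> f \<in> hom D X (last Xs)"
proof (induction gs arbitrary: Xs)
  case Nil
  then obtain Y Ys where Xs: "Xs = Y # Ys" by (cases Xs) auto
  show ?case
  proof (cases Ys)
    case Nil
    then show ?thesis by (auto simp: Xs is_path_Cons is_path_Nil)
  next
    case (Cons Z Zs)
    then show ?thesis by (simp add: Xs is_path_def)
  qed
next
  case (Cons g gs)
  then obtain Y Ys where Xs: "Xs = Y # Ys" by (cases Xs) auto
  show ?case
  proof (cases "Ys = []")
    case True
    then show ?thesis by (simp add: Xs is_path_def)
  next
    case False
    then show ?thesis using Cons.IH [OF False] by (auto simp: Xs is_path_Cons)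
  qed
qed

context semicat
begin

section \<open>Cyclic chains as closed paths\<close>

lemma cn_gens_path:
  assumes "(Xs, fs) \<in> cn_gens D n"
  shows "path_between D (hd Xs) (hd Xs) (Xs @ [hd Xs]) fs" "length fs = Suc n"
  using assms by (auto simp: cn_gens_def path_between_def)

text \<open>A symbol of \<open>CN\<close> omits the repeated last object of the closed path, which
  \<open>butlast\<close> removes and \<open>hd\<close> restores.\<close>

lemma path_cn_gens:
  assumes "path_between D X X Ys fs" "length fs = Suc n"
  shows "(butlast Ys, fs) \<in> cn_gens D n" "butlast Ys @ [hd (butlast Ys)] = Ys" "hd (butlast Ys) = X"
proof -
  have l: "length Ys = Suc (Suc n)" "hd Ys = X" "last Ys = X" "is_path D Ys fs"
    using assms by (auto simp: path_between_def is_path_def)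
  then obtain Ys' where Y: "Ys = X # Ys'" by (cases Ys) auto
  then have Ys: "Ys = X # Ys'" "Ys' \<noteq> []" using l(1) by auto
  then show h: "hd (butlast Ys) = X" by simp
  show e: "butlast Ys @ [hd (butlast Ys)] = Ys"
    unfolding h using l(3) append_butlast_last_id [of Ys] Ys by simp
  show "(butlast Ys, fs) \<in> cn_gens D n"
  proof -
    have "is_path D (butlast Ys @ [hd (butlast Ys)]) fs" unfolding e by (rule l(4))
    moreover have "butlast Ys \<noteq> []" using Ys by simp
    ultimately show ?thesis using assms(2) by (simp add: cn_gens_def)
  qed
qed

text \<open>Opens the cycle at its last morphism: an ordinary path from \<open>last Xs\<close> to
  \<open>hd Xs\<close>, closed up by one morphism back. In this shape the trace property
  applies.\<close>

lemma cn_gens_snoc: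
  "(Xs, fs) \<in> cn_gens D n \<longleftrightarrow> length fs = Suc n \<and> Xs \<noteq> [] \<and>
    path_between D (last Xs) (hd Xs) Xs (butlast fs) \<and> last fs \<in> hom D (hd Xs) (last Xs)"
proof -
  show ?thesis
  proof (cases "length fs = Suc n \<and> Xs \<noteq> []")
    case True
    then have "fs = butlast fs @ [last fs]" by (metis append_butlast_last_id length_0_conv nat.distinct(1))
    then have "is_path D (Xs @ [hd Xs]) fs \<longleftrightarrow> is_path D Xs (butlast fs) \<and> hd Xs \<in> ob D \<and> last fs \<in> hom D (hd Xs) (last Xs)"
      using is_path_snoc [of Xs D "hd Xs" "butlast fs" "last fs"] True by simp
    then show ?thesis using True is_path_hd [of D Xs "butlast fs"]
      by (auto simp: cn_gens_def path_between_def)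
  qed (auto simp: cn_gens_def)
qed

lemma cn_form_multilin:
  assumes "\<beta> \<in> cn_forms D n"
  shows "length Xs = Suc n \<Longrightarrow> multilin D (*) (Xs @ [hd Xs]) (\<lambda>fs. \<beta> (Xs, fs))"
  unfolding multilin_def
proof (intro allI impI)
  fix fs i assume l: "length Xs = Suc n" and p: "is_path D (Xs @ [hd Xs]) fs" and i: "i < length fs"
  then have "(Xs, fs) \<in> cn_gens D n" and n: "length fs = Suc n" by (auto simp: cn_gens_def is_path_def)
  then have "\<forall>i\<le>n. linear_on (scl D) (hom D ((Xs @ [hd Xs]) ! Suc i) (Xs ! i)) (*) (\<lambda>g. \<beta> (Xs, fs[i := g]))"
    using assms unfolding cn_forms_def by auto
  then show "linear_on (scl D) (hom D ((Xs @ [hd Xs]) ! Suc i) ((Xs @ [hd Xs]) ! i)) (*) (\<lambda>g. \<beta> (Xs, fs[i := g]))"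
    using i n l by (simp add: nth_append)
qed

lemma cn_gen_multilin: "length Xs = Suc n \<Longrightarrow> multilin D fscale (Xs @ [hd Xs]) (\<lambda>fs. cn_gen D n (Xs, fs))"
  unfolding cn_gen_def by (rule multilin_elem [OF cn_form_multilin])

lemma cn_gens_update:
  assumes "(Xs, fs) \<in> cn_gens D n" "i \<le> n" "g \<in> hom D ((Xs @ [hd Xs]) ! Suc i) (Xs ! i)"
  shows "(Xs, fs[i := g]) \<in> cn_gens D n"
proof -
  have "length Xs = Suc n" using assms(1) by (auto simp: cn_gens_def is_path_def)
  then have "(Xs @ [hd Xs]) ! i = Xs ! i" using assms(2) by (simp add: nth_append)
  then show ?thesis
    using assms is_path_update [of D "Xs @ [hd Xs]" fs g i] by (simp add: cn_gens_def)
qed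

lemma cn_scale:
  assumes "x \<in> cn_gens D n"
  shows "\<exists>x'\<in>cn_gens D n. elem_tensor (cn_forms D n) x' = fscale c (elem_tensor (cn_forms D n) x)"
proof -
  obtain Xs fs where x: "x = (Xs, fs)" by (cases x)
  have l: "length Xs = Suc n" "length fs = Suc n" "set Xs \<subseteq> ob D"
    using assms by (auto simp: x cn_gens_def is_path_def)
  have f: "fs ! 0 \<in> hom D ((Xs @ [hd Xs]) ! Suc 0) (Xs ! 0)"
    using assms l by (auto simp: x cn_gens_def is_path_def nth_append)
  have ob: "(Xs @ [hd Xs]) ! Suc 0 \<in> ob D" "Xs ! 0 \<in> ob D"
    using l by (cases Xs; auto simp: nth_append nth_Cons split: nat.splits)+
  have m: "scl D c (fs ! 0) \<in> hom D ((Xs @ [hd Xs]) ! Suc 0) (Xs ! 0)"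
    by (rule av.subspace_scale [OF hom_sub [OF ob] f])
  have "elem_tensor (cn_forms D n) (Xs, fs[0 := scl D c (fs ! 0)]) = fscale c (elem_tensor (cn_forms D n) x)"
  proof (rule ext)
    fix \<beta> show "elem_tensor (cn_forms D n) (Xs, fs[0 := scl D c (fs ! 0)]) \<beta> = fscale c (elem_tensor (cn_forms D n) x) \<beta>"
    proof (cases "\<beta> \<in> cn_forms D n")
      case True
      then have "linear_on (scl D) (hom D ((Xs @ [hd Xs]) ! Suc 0) (Xs ! 0)) (*) (\<lambda>g. \<beta> (Xs, fs[0 := g]))"
        using assms unfolding cn_forms_def x by auto
      from linear_on_scale [OF this f, of c] True show ?thesis
        by (simp add: elem_tensor_def fscale_def x)
    qed (simp add: elem_tensor_def fscale_def)
  qed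
  then show ?thesis using cn_gens_update [of Xs fs n 0] assms m x by blast
qed

lemma CN_sub [simp]: "fscale.subspace (CN D n)"
  unfolding CN_def tensor_space_def by simp

lemma cn_gen_mem: "x \<in> cn_gens D n \<Longrightarrow> cn_gen D n x \<in> CN D n"
  unfolding CN_def tensor_space_def cn_gen_def by (intro fscale.span_base) simp

lemma CN_sums:
  assumes "c \<in> CN D n"
  shows "\<exists>xs. set xs \<subseteq> cn_gens D n \<and> sum_list (map (cn_gen D n) xs) = c"
  using tensor_space_sums [OF cn_scale assms [unfolded CN_def]] unfolding cn_gen_def by blast

lemma cn_lift:
  fixes sW :: "'k \<Rightarrow> 'w::ab_group_add \<Rightarrow> 'w"
  assumes W: "vector_space sW"
    and G: "\<And>Xs. length Xs = Suc n \<Longrightarrow> multilin D sW (Xs @ [hd Xs]) (G Xs)"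
  defines "L \<equiv> tensor_lift (cn_gen D n) (cn_gens D n) (\<lambda>(Xs, fs). G Xs fs)"
  shows "linear_on fscale (CN D n) sW L"
    and "(Xs, fs) \<in> cn_gens D n \<Longrightarrow> L (cn_gen D n (Xs, fs)) = G Xs fs"
proof -
  have F1: "linear_on (scl D) (hom D ((Xs @ [hd Xs]) ! Suc i) (Xs ! i)) (*) (\<lambda>g. l (G Xs (fs[i := g])))"
    if l: "Vector_Spaces.linear sW (*) l" and g: "(Xs, fs) \<in> cn_gens D n" and i: "i \<le> n" for l Xs fs i
  proof -
    have lX: "length Xs = Suc n" and lf: "length fs = Suc n" and p: "is_path D (Xs @ [hd Xs]) fs"
      using g by (auto simp: cn_gens_def is_path_def)
    have "linear_on (scl D) (hom D ((Xs @ [hd Xs]) ! Suc i) ((Xs @ [hd Xs]) ! i)) sW (\<lambda>g. G Xs (fs[i := g]))"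
      using G [OF lX] p i lf unfolding multilin_def by simp
    then have "linear_on (scl D) (hom D ((Xs @ [hd Xs]) ! Suc i) ((Xs @ [hd Xs]) ! i)) (*) (\<lambda>g. l (G Xs (fs[i := g])))"
      by (rule linear_on_comp [OF _ linear_linear_on [OF l] UNIV_I])
    moreover have "(Xs @ [hd Xs]) ! i = Xs ! i" using lX i by (simp add: nth_append)
    ultimately show ?thesis by simp
  qed
  then have F: "(\<lambda>g. l (case g of (Xs, fs) \<Rightarrow> G Xs fs)) \<in> cn_forms D n" if "Vector_Spaces.linear sW (*) l" for l
    unfolding cn_forms_def using that by auto
  note lift = elem_tensor_lift [where F = "\<lambda>(Xs, fs). G Xs fs" and F' = "\<lambda>(Xs, fs). G Xs fs" and G = "cn_gens D n" and \<Phi> = "cn_forms D n", OF W]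
  show "linear_on fscale (CN D n) sW L"
    unfolding CN_def L_def cn_gen_def by (rule lift(1), erule cn_scale, erule F, rule refl)
  show "L (cn_gen D n (Xs, fs)) = G Xs fs" if "(Xs, fs) \<in> cn_gens D n"
    unfolding L_def cn_gen_def using lift(2) [OF cn_scale F refl that] by simp
qed

text \<open>The mirror image of \<open>multilin_Cons\<close>, for expressions that treat the last
  morphism apart from the others.\<close>

lemma multilin_snoc:
  assumes "\<And>fs. is_path D Ys fs \<Longrightarrow> X \<in> ob D \<Longrightarrow> linear_on (scl D) (hom D X (last Ys)) sW (\<lambda>g. F (fs @ [g]))"
    and "\<And>f. X \<in> ob D \<Longrightarrow> Ys \<noteq> [] \<Longrightarrow> last Ys \<in> ob D \<Longrightarrow> f \<in> hom D X (last Ys) \<Longrightarrow>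
      multilin D sW Ys (\<lambda>fs. F (fs @ [f]))"
  shows "multilin D sW (Ys @ [X]) F"
  unfolding multilin_def
proof (intro allI impI)
  fix fs i assume p: "is_path D (Ys @ [X]) fs" and i: "i < length fs"
  then obtain gs f where fs: "fs = gs @ [f]" by (cases fs rule: rev_cases) auto
  have l: "length Ys = Suc (length gs)" using p by (simp add: is_path_def fs)
  then have ne: "Ys \<noteq> []" by auto
  have la: "Ys ! length gs = last Ys" using l ne by (simp add: last_conv_nth)
  have X: "X \<in> ob D" "last Ys \<in> ob D" using p ne by (auto simp: is_path_def)
  have nth: "fs ! j \<in> hom D ((Ys @ [X]) ! Suc j) ((Ys @ [X]) ! j)" if "j < length fs" for j
    using p that by (simp add: is_path_def)
  have f: "f \<in> hom D X (last Ys)" using nth [of "length gs"] l la by (simp add: fs nth_append)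
  have q: "is_path D Ys gs"
    unfolding is_path_def
  proof (intro conjI allI impI)
    show "set Ys \<subseteq> ob D" using p by (simp add: is_path_def)
    fix j assume "j < length gs"
    then show "gs ! j \<in> hom D (Ys ! Suc j) (Ys ! j)" using nth [of j] l by (simp add: fs nth_append)
  qed (rule l)
  show "linear_on (scl D) (hom D ((Ys @ [X]) ! Suc i) ((Ys @ [X]) ! i)) sW (\<lambda>g. F (fs[i := g]))"
  proof (cases "i = length gs")
    case True
    then show ?thesis using assms(1) [OF q X(1)] l la by (simp add: fs nth_append)
  next
    case False
    then have "i < length gs" using i by (simp add: fs)
    then show ?thesis
      using assms(2) [OF X(1) ne X(2) f] q l unfolding multilin_def
      by (simp add: fs nth_append list_update_append)
  qed
qed

end

section \<open>Cycles over D and traces on the universal semicategory\<close>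

locale omega_trace = sayd H M + H_semicat H D
  for H :: "('k::field_char_0, 'h::ring_1) hopf"
    and M :: "('k, 'h, 'm::ab_group_add) hmod"
    and D :: "('k, 'h, 'o, 'a::ab_group_add, 'z) semicat_scheme"
begin

abbreviation Sinv :: "'h \<Rightarrow> 'h" where
  "Sinv \<equiv> inv (antipode H)"

text \<open>Apart from linearity, the axioms of a trace speak of elementary tensors in degree n, so
  the universal property of M \<otimes> Hom makes a bilinear \<open>t\<close> sufficient. This
  serves both the pulled-back trace and the trace of a cocycle.\<close>

lemma trace_of_bilinear:
  fixes t :: "'o \<Rightarrow> 'm \<Rightarrow> ('k, 'o, 'a) omega \<Rightarrow> 'k"
  assumes lin1: "\<And>X x. X \<in> ob D \<Longrightarrow> x \<in> omd n X X \<Longrightarrow> linear_on (mscale M) UNIV (*) (\<lambda>m. t X m x)"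
    and lin2: "\<And>X m. X \<in> ob D \<Longrightarrow> linear_on fscale (omd n X X) (*) (t X m)"
    and inv: "\<And>X h m x. X \<in> ob D \<Longrightarrow> x \<in> omd n X X \<Longrightarrow>
      sweedler H h (\<lambda>h1 h2. t X (ract M m h1) (oact X X (antipode H h2) x)) = counit H h * t X m x"
    and closed: "\<And>X m l x. X \<in> ob D \<Longrightarrow> Suc l = n \<Longrightarrow> x \<in> omd l X X \<Longrightarrow> t X m (odif X X x) = 0"
    and trace: "\<And>X Y m i j g g'. X \<in> ob D \<Longrightarrow> Y \<in> ob D \<Longrightarrow> i + j = n \<Longrightarrow> g \<in> omd i X Y \<Longrightarrow> g' \<in> omd j Y X \<Longrightarrow>
      t X m (ocmp X Y X g' g) =
      (-1) ^ (i * j) * cosweedler H M m (\<lambda>a m0. t Y m0 (ocmp Y X Y (oact X Y (Sinv a) g) g'))"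
  obtains T where "closed_graded_trace H M n (Omega H D) T"
    "\<And>X m x. X \<in> ob D \<Longrightarrow> x \<in> omd n X X \<Longrightarrow> T X (mten M (Omega H D) n X m x) = t X m x"
proof -
  define T where "T = (\<lambda>X. tensor_lift (case_prod (tmul (mscale M) UNIV fscale (omd n X X)))
    (UNIV \<times> omd n X X) (\<lambda>(m, x). t X m x))"
  have b: "bilinear_on (mscale M) UNIV fscale (omd n X X) (*) (\<lambda>(m, x). t X m x)" if "X \<in> ob D" for X
    using lin1 lin2 that by (simp add: bilinear_on_def)
  note u = tprod_universal [OF mvs mv.subspace_UNIV vector_space_fscale omd_sub vector_space_mult b]
  have T: "T X (mten M (Omega H D) n X m x) = t X m x" if "X \<in> ob D" "x \<in> omd n X X" for X m x
    using u(2) that by (simp add: mten_def T_def)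
  have "closed_graded_trace H M n (Omega H D) T"
    unfolding closed_graded_trace_def Omega_simps
  proof (intro conjI ballI allI impI)
    show "linear_on fscale (tprod (mscale M) UNIV fscale (omd n X X)) (*) (T X)" if "X \<in> ob D" for X
      unfolding T_def by (rule u(1) [OF that])
    show "sweedler H h (\<lambda>h1 h2. T X (mten M (Omega H D) n X (ract M m h1) (oact X X (antipode H h2) f))) =
        counit H h * T X (mten M (Omega H D) n X m f)" if "X \<in> ob D" "f \<in> omd n X X" for X h m f
      using that by (simp add: T oact_memd inv)
    show "T X (mten M (Omega H D) n X m (odif X X f')) = 0" if "X \<in> ob D" "Suc l = n" "f' \<in> omd l X X" for X m l f'
      using closed [OF that] odif_memd [OF that(3)] that by (simp add: T)
    show "T X (mten M (Omega H D) n X m (ocmp X Y X g' g)) =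
        (-1) ^ (i * j) * cosweedler H M m (\<lambda>a m0.
          T Y (mten M (Omega H D) n Y m0 (ocmp Y X Y (oact X Y (Sinv a) g) g')))"
      if "X \<in> ob D" "Y \<in> ob D" "i + j = n" "g \<in> omd i X Y" "g' \<in> omd j Y X" for X Y m i j g g'
      using trace [OF that] that ocmp_memd [OF that(5,4)] ocmp_memd [OF oact_memd [OF that(4)] that(5)]
      by (simp add: T add.commute)
  qed
  with T show ?thesis using that by blast
qed

lemma omega_word_wd: "omega_word D Xs fs = wd (Xs @ [hd Xs]) fs"
  by (simp add: omega_word_def wd_def)

lemma word_memd:
  assumes "(Xs, fs) \<in> cn_gens D n"
  shows "wd (Xs @ [hd Xs]) fs \<in> omd n (hd Xs) (hd Xs)"
proof (rule omd_mem(1) [OF cn_gens_path(1) [OF assms] _ cn_gens_path(2) [OF assms]])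
  show "fs \<noteq> []" using cn_gens_path(2) [OF assms] by auto
qed

text \<open>The trace on Omega is the given one after \<open>rho\<close>; each axiom is transported
  because the extension preserves degree, differential, composition and action.\<close>

lemma character_imp_Omega_trace:
  fixes S :: "('k, 'h, 'p, 'b::ab_group_add) dgsemicat"
  assumes "is_character H D M n \<phi> S T Fo Fm"
  shows "character_of_Omega_trace H D M n \<phi>"
proof -
  have DGH: "DGH_semicategory H S" and T: "closed_graded_trace H M n S T"
    and F: "H_semifunctor D (degree_zero S) Fo Fm"
    using assms by (auto simp: is_character_def cycle_def)
  interpret omega_functor H D S Fo Fm
    by unfold_locales (fact DGH F)+
  define t where "t = (\<lambda>X m x. T (Fo X) (mten M S n (Fo X) m (rho X X x)))"
  have Tlin: "linear_on fscale (tprod (mscale M) UNIV (scl S) (homd S n X X)) (*) (T X)" if "X \<in> ob S" for X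
    using T that by (simp add: closed_graded_trace_def)
  have Tinv: "sweedler H h (\<lambda>h1 h2. T X (mten M S n X (ract M m h1) (act S X X (antipode H h2) f))) =
      counit H h * T X (mten M S n X m f)" if "X \<in> ob S" "f \<in> homd S n X X" for X h m f
    using T that by (simp add: closed_graded_trace_def)
  have Tclosed: "T X (mten M S n X m (dif S X X f)) = 0" if "X \<in> ob S" "Suc l = n" "f \<in> homd S l X X" for X m l f
    using T that by (auto simp: closed_graded_trace_def)
  have Ttrace: "T X (mten M S n X m (cmp S X Y X g' g)) =
        (-1) ^ (i * j) * cosweedler H M m (\<lambda>a m0.
          T Y (mten M S n Y m0 (cmp S Y X Y (act S X Y (Sinv a) g) g')))"
    if "X \<in> ob S" "Y \<in> ob S" "i + j = n" "g \<in> homd S i X Y" "g' \<in> homd S j Y X" for X Y m i j g g'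
    using T that by (simp add: closed_graded_trace_def)
  obtain T' where T': "closed_graded_trace H M n (Omega H D) T'"
    "\<And>X m x. X \<in> ob D \<Longrightarrow> x \<in> omd n X X \<Longrightarrow> T' X (mten M (Omega H D) n X m x) = t X m x"
  proof (rule trace_of_bilinear [of n t])
    fix X x assume X: "X \<in> ob D" and x: "x \<in> omd n X X"
    note r = rho_memd [OF X X x]
    show "linear_on (mscale M) UNIV (*) (\<lambda>m. t X m x)"
      unfolding t_def mten_def
      by (rule linear_on_comp [OF tmul_linear_left [OF r] Tlin]) (use X r in \<open>auto intro: tmul_mem\<close>)
    show "sweedler H h (\<lambda>h1 h2. t X (ract M m h1) (oact X X (antipode H h2) x)) = counit H h * t X m x" for h m
      using Tinv [OF _ r] X by (simp add: t_def rho_oact [OF X X x])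
  next
    fix X m assume X: "X \<in> ob D"
    show "linear_on fscale (omd n X X) (*) (t X m)"
      unfolding t_def mten_def
      by (rule linear_on_comp [OF linear_on_comp [OF linear_on_subset [OF rho_linear] tmul_linear_right] Tlin])
        (use X rho_memd [OF X X] in \<open>auto intro: tmul_mem omd_om\<close>)
  next
    fix X m l x assume "X \<in> ob D" "Suc l = n" "x \<in> omd l X X"
    then show "t X m (odif X X x) = 0"
      using Tclosed rho_memd by (simp add: t_def rho_odif omd_om)
  next
    fix X Y m i j g g'
    assume a: "X \<in> ob D" "Y \<in> ob D" "i + j = n" "g \<in> omd i X Y" "g' \<in> omd j Y X"
    have "rho Y Y (ocmp Y X Y (oact X Y h g) g') = cmp S (Fo Y) (Fo X) (Fo Y) (act S (Fo X) (Fo Y) h (rho X Y g)) (rho Y X g')" for h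
      using a rho_ocmp [OF a(2,1,2) oact_memd [OF a(4)] a(5)] by (simp add: rho_oact)
    then show "t X m (ocmp X Y X g' g) =
      (-1) ^ (i * j) * cosweedler H M m (\<lambda>a m0. t Y m0 (ocmp Y X Y (oact X Y (Sinv a) g) g'))"
      using Ttrace [OF _ _ a(3) rho_memd [OF a(1,2,4)] rho_memd [OF a(2,1,5)]] a
      by (simp add: t_def rho_ocmp [OF a(1,2,1,5,4)])
  qed blast
  have "\<phi> (mcn M D n m (cn_gen D n (Xs, fs))) = T' (hd Xs) (mten M (Omega H D) n (hd Xs) m (omega_word D Xs fs))"
    if g: "(Xs, fs) \<in> cn_gens D n" for m Xs fs
  proof -
    have "\<phi> (mcn M D n m (cn_gen D n (Xs, fs))) = t (hd Xs) m (omega_word D Xs fs)"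
      using assms g by (auto simp: is_character_def Let_def t_def)
    then show ?thesis
      using T'(2) [OF _ word_memd [OF g]] path_between_ob [OF cn_gens_path(1) [OF g]] by (simp add: omega_word_wd)
  qed
  with T'(1) show ?thesis unfolding character_of_Omega_trace_def by auto
qed

text \<open>Omega is a cycle over D through the inclusion \<open>iota\<close> in degree 0. Its
  character involves the extension of \<open>iota\<close>, which has to be recognised as the
  identity.\<close>

lemma Omega_trace_imp_character:
  assumes "character_of_Omega_trace H D M n \<phi>"
  shows "\<exists>T. is_character H D M n \<phi> (Omega H D) T id iota"
proof -
  obtain T where T: "closed_graded_trace H M n (Omega H D) T"
    and \<phi>: "\<And>m Xs fs. (Xs, fs) \<in> cn_gens D n \<Longrightarrow> \<phi> (mcn M D n m (cn_gen D n (Xs, fs))) =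
      T (hd Xs) (mten M (Omega H D) n (hd Xs) m (omega_word D Xs fs))"
    using assms unfolding character_of_Omega_trace_def by blast
  define Fo where "Fo = (id :: 'o \<Rightarrow> 'o)"
  have Fo [simp]: "Fo X = X" for X by (simp add: Fo_def)
  have F: "H_semifunctor D (degree_zero (Omega H D)) Fo iota"
    by (simp add: H_semifunctor_def degree_zero_def iota_memd iota_linear oact_iota ocmp_iota lm_iota)
  interpret omega_functor H D "Omega H D" Fo iota
    by unfold_locales (fact DGH_Omega F)+
  define r where "r = rho"
  have r: "r X Y 0 = 0" "x \<in> om X Y \<Longrightarrow> y \<in> om X Y \<Longrightarrow> r X Y (x + y) = r X Y x + r X Y y"
    "x \<in> om X Y \<Longrightarrow> r X Y (fscale c x) = fscale c (r X Y x)" for X Y x y c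
    using linear_on_add [OF rho_linear] linear_on_scale [OF rho_linear] by (simp_all add: r_def)
  have r_gen: "X \<in> ob D \<Longrightarrow> Y \<in> ob D \<Longrightarrow> f \<in> hom D X Y \<Longrightarrow> r X Y (iota X Y f) = iota X Y f"
    "X \<in> ob D \<Longrightarrow> Y \<in> ob D \<Longrightarrow> x \<in> om X Y \<Longrightarrow> r X Y (odif X Y x) = odif X Y (r X Y x)"
    "X \<in> ob D \<Longrightarrow> Z \<in> ob D \<Longrightarrow> Y \<in> ob D \<Longrightarrow> g \<in> hom D Z Y \<Longrightarrow> z \<in> om X Z \<Longrightarrow>
      r X Y (lm X Z Y g z) = ocmp X Z Y (iota Z Y g) (r X Z z)" for X Y Z f g x z
    using rho_iota [of X Y f] rho_odif [of X Y x] rho_lm [of X Z Y g z] by (simp_all add: r_def)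
  \<comment> \<open>The extension fixes morphisms and commutes with the differential and with left
    multiplication, which generate everything.\<close>
  have id: "rho X Y x = x" if "X \<in> ob D" "Y \<in> ob D" "x \<in> omd n X Y" for X Y n x
  proof -
    have "Y \<in> ob D \<longrightarrow> r X Y x = x"
      using that(1,3)
      by (induction n Y x rule: omd_struct_induct) (simp_all add: that(1) omd_om r r_gen ocmp_iota)
    then show ?thesis using that(2) by (simp add: r_def)
  qed
  have "is_character H D M n \<phi> (Omega H D) T Fo iota"
    unfolding is_character_def
  proof (intro conjI allI ballI, unfold cycle_def, intro conjI DGH_Omega T, rule F, clarify)
    fix m Xs fs assume g: "(Xs, fs) \<in> cn_gens D n"
    have X: "hd Xs \<in> ob D" using path_between_ob [OF cn_gens_path(1) [OF g]] by simp
    have ne: "fs \<noteq> []" using cn_gens_path(2) [OF g] by auto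
    have r: "rho (hd Xs) (hd Xs) (omega_word D Xs fs) = omega_word D Xs fs"
      using id [OF X X word_memd [OF g]] by (simp add: omega_word_wd)
    have "iw (Xs @ [hd Xs]) fs = wd (Xs @ [hd Xs]) fs"
      using rho_wd [OF cn_gens_path(1) [OF g] ne] id [OF X X word_memd [OF g]] by simp
    with r show "let X0 = hd Xs; x = mcn M D n m (cn_gen D n (Xs, fs)) in
        \<phi> x = T (Fo X0) (mten M (Omega H D) n (Fo X0) m (rho X0 X0 (omega_word D Xs fs))) \<and>
        \<phi> x = T (Fo X0) (mten M (Omega H D) n (Fo X0) m
                 (image_word (Omega H D) Fo iota (Xs @ [hd Xs]) (hd fs) (tl fs)))"
      using \<phi> [OF g, of m] by (simp add: Let_def iw_def omega_word_wd)
  qed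
  then show ?thesis unfolding Fo_def by blast
qed

end

context omega_trace
begin

section \<open>Cyclic cocycles and traces\<close>

lemma mcn_linear_left: "c \<in> CN D n \<Longrightarrow> linear_on (mscale M) UNIV fscale (\<lambda>m. mcn M D n m c)"
  and mcn_linear_right: "linear_on fscale (CN D n) fscale (mcn M D n m)"
  unfolding mcn_def by (rule tmul_linear_left, assumption) (rule tmul_linear_right, simp)

lemma mcn_mem: "c \<in> CN D n \<Longrightarrow> mcn M D n m c \<in> MCN M D n"
  unfolding mcn_def MCN_def by (rule tmul_mem) auto

lemma MCN_sub [simp]: "fscale.subspace (MCN M D n)"
  unfolding MCN_def tprod_def tensor_space_def by simp

lemma MCN_sums:
  assumes "t \<in> MCN M D n"
  shows "\<exists>gs. set gs \<subseteq> UNIV \<times> cn_gens D n \<and>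
    sum_list (map (\<lambda>(m, x). mcn M D n m (cn_gen D n x)) gs) = t"
proof -
  obtain hs where hs: "set hs \<subseteq> UNIV \<times> CN D n" "sum_list (map (case_prod (mcn M D n)) hs) = t"
    using tprod_sums [OF mv.subspace_UNIV mvs assms [unfolded MCN_def]] by (auto simp: mcn_def)
  have "\<exists>gs. set gs \<subseteq> UNIV \<times> cn_gens D n \<and> sum_list (map (\<lambda>(m, x). mcn M D n m (cn_gen D n x)) gs) =
      sum_list (map (case_prod (mcn M D n)) hs)"
    using hs(1)
  proof (induction hs)
    case Nil
    show ?case by (rule exI [of _ "[]"]) simp
  next
    case (Cons h hs)
    obtain m c where h: "h = (m, c)" "c \<in> CN D n" using Cons.prems by (cases h) auto
    obtain gs where gs: "set gs \<subseteq> UNIV \<times> cn_gens D n" "sum_list (map (\<lambda>(m, x). mcn M D n m (cn_gen D n x)) gs) =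
      sum_list (map (case_prod (mcn M D n)) hs)" using Cons by auto
    obtain xs where xs: "set xs \<subseteq> cn_gens D n" "sum_list (map (cn_gen D n) xs) = c"
      using CN_sums [OF h(2)] by blast
    have "mcn M D n m c = sum_list (map (\<lambda>x. mcn M D n m (cn_gen D n x)) xs)"
      unfolding xs(2) [symmetric]
      by (rule linear_on_apply_sum_list [OF vector_space_fscale CN_sub mcn_linear_right])
        (use xs cn_gen_mem in auto)
    then show ?case
      using gs xs(1) h by (intro exI [of _ "map (Pair m) xs @ gs"]) (auto simp: comp_def)
  qed
  with hs(2) show ?thesis by simp
qed

text \<open>The decomposition used inside \<open>cochain_of\<close>. It does not depend on the
  cochain, so all faces of a cochain are summed over one list.\<close>

definition chain_list :: "nat \<Rightarrow> ('k, 'm \<times> ('k, 'o list \<times> 'a list) tens) tens \<Rightarrow> ('m \<times> 'o list \<times> 'a list) list" where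
  "chain_list n t = (SOME gs. set gs \<subseteq> UNIV \<times> cn_gens D n \<and>
     sum_list (map (\<lambda>(m, x). mcn M D n m (cn_gen D n x)) gs) = t)"

lemma chain_list:
  assumes "t \<in> MCN M D n"
  shows "set (chain_list n t) \<subseteq> UNIV \<times> cn_gens D n"
    "sum_list (map (\<lambda>(m, x). mcn M D n m (cn_gen D n x)) (chain_list n t)) = t"
  using someI_ex [OF MCN_sums [OF assms]] unfolding chain_list_def by blast+

lemma cochain_of_eq: "cochain_of D M n F t = sum_list (map (\<lambda>(m, Xs, fs). F m Xs fs) (chain_list n t))"
  by (simp add: cochain_of_def tensor_lift_def chain_list_def)

text \<open>The list chosen for an elementary chain need not be that chain alone. A multilinear
  \<open>G\<close> gives a form, so the sum depends on the chain only. This is how an equation on M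
  \<otimes> CN is read off at a single symbol.\<close>

lemma chain_sum:
  fixes G :: "'m \<Rightarrow> 'o list \<Rightarrow> 'a list \<Rightarrow> 'k"
  assumes G1: "\<And>Xs fs. (Xs, fs) \<in> cn_gens D n \<Longrightarrow> linear_on (mscale M) UNIV (*) (\<lambda>m. G m Xs fs)"
    and G2: "\<And>m Xs. length Xs = Suc n \<Longrightarrow> multilin D (*) (Xs @ [hd Xs]) (G m Xs)"
    and x: "(Xs, fs) \<in> cn_gens D n"
  shows "sum_list (map (\<lambda>(m, Xs, fs). G m Xs fs) (chain_list n (mcn M D n m (cn_gen D n (Xs, fs))))) = G m Xs fs"
proof -
  define L where "L = (\<lambda>m. tensor_lift (cn_gen D n) (cn_gens D n) (\<lambda>(Xs, fs). G m Xs fs))"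
  have L1: "linear_on fscale (CN D n) (*) (L m)" for m
    unfolding L_def by (rule cn_lift(1), rule vector_space_mult, erule G2)
  have L2: "L m (cn_gen D n (Xs, fs)) = G m Xs fs" if "(Xs, fs) \<in> cn_gens D n" for m Xs fs
    unfolding L_def by (rule cn_lift(2), rule vector_space_mult, erule G2, rule that)
  \<comment> \<open>The form at which the chain is evaluated.\<close>
  define \<beta> where "\<beta> = (\<lambda>(m, c). L m c)"
  \<comment> \<open>The decomposition of \<open>c\<close> is the same for all m, so linearity in m
    is checked on symbols.\<close>
  have Lm: "linear_on (mscale M) UNIV (*) (\<lambda>m. L m c)" if "c \<in> CN D n" for c
  proof -
    define xs where "xs = (SOME xs. set xs \<subseteq> cn_gens D n \<and> sum_list (map (cn_gen D n) xs) = c)"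
    have "set xs \<subseteq> cn_gens D n" using someI_ex [OF CN_sums [OF that]] unfolding xs_def by blast
    then show ?thesis
      unfolding L_def tensor_lift_def xs_def [symmetric]
      by (intro linear_on_sum_list vector_space_mult) (auto intro: G1)
  qed
  have \<beta>: "\<beta> \<in> bilinear_forms (mscale M) UNIV fscale (CN D n)"
    using L1 Lm by (simp add: bilinear_forms_def bilinear_on_def \<beta>_def)
  have ev: "mcn M D n m (cn_gen D n (Xs, fs)) \<beta> = G m Xs fs" if "(Xs, fs) \<in> cn_gens D n" for m Xs fs
    using \<beta> L2 [OF that] by (simp add: mcn_def tmul_def elem_tensor_def \<beta>_def)
  let ?t = "mcn M D n m (cn_gen D n (Xs, fs))"
  note cl = chain_list [OF mcn_mem [OF cn_gen_mem [OF x]], of m]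
  have "sum_list (map (\<lambda>(m, Xs, fs). G m Xs fs) (chain_list n ?t)) =
      sum_list (map (\<lambda>(m, x). mcn M D n m (cn_gen D n x) \<beta>) (chain_list n ?t))"
    using cl(1) by (intro arg_cong [where f = sum_list] map_cong) (auto simp: ev)
  also have "\<dots> = sum_list (map (\<lambda>(m, x). mcn M D n m (cn_gen D n x)) (chain_list n ?t)) \<beta>"
    by (simp add: sum_list_fun_apply case_prod_unfold)
  also have "\<dots> = G m Xs fs" using cl(2) ev [OF x] by simp
  finally show ?thesis .
qed

text \<open>The values that \<open>face\<close> prescribes on symbols, kept apart from the choice of
  a decomposition in \<open>cochain_of\<close>.\<close>

definition face_val :: "nat \<Rightarrow> ('k, 'o, 'a, 'm) cochain \<Rightarrow> nat \<Rightarrow> 'm \<Rightarrow> 'o list \<Rightarrow> 'a list \<Rightarrow> 'k" where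
  "face_val n \<phi> i m Xs fs = (if i \<le> n then
       \<phi> (mcn M D n m (cn_gen D n (del_nth (Suc i) Xs, merge D (Xs @ [hd Xs]) i fs)))
     else
       cosweedler H M m (\<lambda>a m0. \<phi> (mcn M D n m0 (cn_gen D n
         (last Xs # butlast (tl Xs),
          cmp D (Xs ! 1) (Xs ! 0) (last Xs) (act D (Xs ! 0) (last Xs) (Sinv a) (last fs)) (hd fs)
            # butlast (tl fs))))))"

definition rot_val :: "nat \<Rightarrow> ('k, 'o, 'a, 'm) cochain \<Rightarrow> 'm \<Rightarrow> 'o list \<Rightarrow> 'a list \<Rightarrow> 'k" where
  "rot_val n \<phi> m Xs fs = cosweedler H M m (\<lambda>a m0. \<phi> (mcn M D n m0 (cn_gen D n
       (last Xs # butlast Xs,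
        act D (hd Xs) (last Xs) (Sinv a) (last fs) # butlast fs))))"

lemma coboundary_eq:
  "coboundary H D M n \<phi> t = sum_list (map (\<lambda>(m, Xs, fs).
     \<Sum>i\<le>Suc n. (-1) ^ i * face_val n \<phi> i m Xs fs) (chain_list (Suc n) t))"
proof -
  have "coboundary H D M n \<phi> t = (\<Sum>i\<le>Suc n. (-1) ^ i *
      sum_list (map (\<lambda>(m, Xs, fs). face_val n \<phi> i m Xs fs) (chain_list (Suc n) t)))"
    unfolding coboundary_def face_def cochain_of_eq face_val_def ..
  also have "(\<Sum>i\<le>Suc n. (-1) ^ i * sum_list (map (\<lambda>(m, Xs, fs). face_val n \<phi> i m Xs fs) gs)) =
      sum_list (map (\<lambda>(m, Xs, fs). \<Sum>i\<le>Suc n. (-1) ^ i * face_val n \<phi> i m Xs fs) gs)" for gs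
    by (induction gs) (simp_all add: sum.distrib distrib_left case_prod_unfold del: sum.atMost_Suc)
  finally show ?thesis .
qed

lemma rotation_eq:
  "rotation H D M n \<phi> t = sum_list (map (\<lambda>(m, Xs, fs). rot_val n \<phi> m Xs fs) (chain_list n t))"
  unfolding rotation_def cochain_of_eq rot_val_def ..

lemma cn_gens_Suc:
  assumes "(Xs, fs) \<in> cn_gens D (Suc n)"
  obtains X Xs' where "Xs = X # Xs'" "Xs' \<noteq> []"
proof -
  have "length Xs = Suc (Suc n)" using assms by (auto simp: cn_gens_def is_path_def)
  then have "Xs = hd Xs # tl Xs" "tl Xs \<noteq> []" by (cases Xs; auto)+
  then show ?thesis using that by blast
qed

lemma butlast_last: "length fs = Suc n \<Longrightarrow> butlast fs @ [last fs] = fs"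
  by (rule append_butlast_last_id) auto

text \<open>
  The faces of a cochain written as \<open>t(f\<^sup>0 df\<^sup>1 \<dots> df\<^sup>n)\<close>: the first \<open>n + 1\<close> of them add up to
  right multiplication by \<open>f\<^sup>n\<^sup>+\<^sup>1\<close>, the last one is left multiplication by the twisted \<open>f\<^sup>n\<^sup>+\<^sup>1\<close>.
\<close>

lemma face_sum:
  assumes t': "\<forall>X m. X \<in> ob D \<longrightarrow> linear_on fscale (omd n X X) (*) (t X m)"
    and \<phi>': "\<forall>m Xs fs. (Xs, fs) \<in> cn_gens D n \<longrightarrow>
      \<phi> (mcn M D n m (cn_gen D n (Xs, fs))) = t (hd Xs) m (wd (Xs @ [hd Xs]) fs)"
    and g: "(Xs, fs) \<in> cn_gens D (Suc n)"
  defines "X \<equiv> hd Xs" and "Y \<equiv> last Xs"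
  shows "(\<Sum>i\<le>Suc n. (-1) ^ i * face_val n \<phi> i m Xs fs) =
    (-1) ^ n * (t X m (ocmp X Y X (wd Xs (butlast fs)) (iota X Y (last fs))) -
      cosweedler H M m (\<lambda>a m0. t Y m0 (ocmp Y X Y (oact X Y (Sinv a) (iota X Y (last fs))) (wd Xs (butlast fs)))))"
proof -
  note t = t' [rule_format] and \<phi> = \<phi>' [rule_format]
  have p: "path_between D Y X Xs (butlast fs)" and l: "last fs \<in> hom D X Y" and n: "length fs = Suc (Suc n)"
    using g by (auto simp: cn_gens_snoc X_def Y_def)
  have ob: "X \<in> ob D" "Y \<in> ob D" using path_between_ob [OF p] by auto
  obtain Z Xs' where "Xs = Z # Xs'" "Xs' \<noteq> []" using cn_gens_Suc [OF g] by blast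
  then have Xs: "Xs = X # Xs'" "Xs' \<noteq> []" by (simp_all add: X_def)
  have lX: "length Xs = Suc (Suc n)" using is_path_length [of D Xs "butlast fs"] p n by (simp add: path_between_def)
  have ne: "butlast fs \<noteq> []" and lb: "length (butlast fs) = Suc n" using n by (auto simp flip: length_greater_0_conv)
  have pi: "path_between D X Y [Y, X] [last fs]" using ob l by (simp add: path_single)
  have io: "iota X Y (last fs) \<in> om X Y" using ob l by simp
  have cl: "path_between D X X (Xs @ [X]) fs"
    using cn_gens_path(1) [OF g] by (simp add: X_def)
  have m: "path_between D X X (del_nth (Suc i) (Xs @ [X])) (merge D (Xs @ [X]) i fs)"
    and lm: "length (merge D (Xs @ [X]) i fs) = Suc n" if "i \<le> n" for i
    using that n path_merge [OF cl] length_merge [of i fs] by simp_all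
  have dl: "del_nth (Suc i) (Xs @ [X]) = del_nth (Suc i) Xs @ [X]" if "i \<le> n" for i
    using that lX by (simp add: del_nth_def)
  have f1: "face_val n \<phi> i m Xs fs = t X m (wd (del_nth (Suc i) (Xs @ [X])) (merge D (Xs @ [X]) i fs))" if "i \<le> n" for i
  proof -
    have "hd (del_nth (Suc i) Xs) = X" by (simp add: Xs)
    then show ?thesis
      using path_cn_gens(1) [OF m lm, OF that that] that
      by (simp add: face_val_def dl \<phi> X_def [symmetric])
  qed
  have mem: "fscale c (wd (del_nth (Suc i) (Xs @ [X])) (merge D (Xs @ [X]) i fs)) \<in> omd n X X" if "i \<le> n" for i c
    by (intro omd_scale omd_mem(1) [OF m [OF that] _ lm [OF that]]) simp
  \<comment> \<open>Right multiplication by one morphism is \<open>mw_wd\<close> with a one-letter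
    word; its summands are the n + 1 faces that compose neighbours.\<close>
  have "t X m (ocmp X Y X (wd Xs (butlast fs)) (iota X Y (last fs))) = t X m (\<Sum>i\<le>n. fscale ((-1) ^ (n - i))
      (wd (del_nth (Suc i) (Xs @ [X])) (merge D (Xs @ [X]) i fs)))"
    using ocmp_wd [OF io p ne] mw_wd [OF p ne pi] butlast_last [OF n]
    by (simp add: iota_def lessThan_Suc_atMost n)
  also have "\<dots> = (\<Sum>i\<le>n. (-1) ^ (n - i) * face_val n \<phi> i m Xs fs)"
  proof -
    have "t X m (\<Sum>i\<le>n. fscale ((-1) ^ (n - i)) (wd (del_nth (Suc i) (Xs @ [X])) (merge D (Xs @ [X]) i fs))) =
        (\<Sum>i\<le>n. t X m (fscale ((-1) ^ (n - i)) (wd (del_nth (Suc i) (Xs @ [X])) (merge D (Xs @ [X]) i fs))))"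
      by (rule linear_on_apply_sum [OF vector_space_fscale omd_sub t [OF ob(1)]]) (simp add: mem)
    also have "\<dots> = (\<Sum>i\<le>n. (-1) ^ (n - i) * face_val n \<phi> i m Xs fs)"
      by (rule sum.cong) (use mem [where c = 1] in \<open>simp_all add: linear_on_scale [OF t [OF ob(1)]] f1\<close>)
    finally show ?thesis .
  qed
  finally have A: "t X m (ocmp X Y X (wd Xs (butlast fs)) (iota X Y (last fs))) =
      (\<Sum>i\<le>n. (-1) ^ (n - i) * face_val n \<phi> i m Xs fs)" .
  \<comment> \<open>The recursion counts signs from the right, the coboundary from the left; the
    factor \<open>(-1) ^ n\<close> translates.\<close>
  have 1: "(-1) ^ n * t X m (ocmp X Y X (wd Xs (butlast fs)) (iota X Y (last fs))) =
      (\<Sum>i\<le>n. (-1) ^ i * face_val n \<phi> i m Xs fs)"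
    unfolding A sum_distrib_left
  proof (intro sum.cong refl)
    fix i assume "i \<in> {..n}"
    then obtain k where "n = i + k" using le_iff_add by auto
    then show "(-1) ^ n * ((-1) ^ (n - i) * face_val n \<phi> i m Xs fs) = (-1) ^ i * face_val n \<phi> i m Xs fs"
      by (simp add: power_add flip: power_mult_distrib mult.assoc)
  qed
  \<comment> \<open>Left multiplication by the twisted last morphism composes it with the first
    letter, as the last face does.\<close>
  have 2: "face_val n \<phi> (Suc n) m Xs fs =
      cosweedler H M m (\<lambda>a m0. t Y m0 (ocmp Y X Y (oact X Y (Sinv a) (iota X Y (last fs))) (wd Xs (butlast fs))))"
  proof -
    have "\<phi> (mcn M D n m0 (cn_gen D n (last Xs # butlast (tl Xs),
          cmp D (Xs ! 1) (Xs ! 0) (last Xs) (act D (Xs ! 0) (last Xs) h (last fs)) (hd fs) # butlast (tl fs)))) =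
        t Y m0 (ocmp Y X Y (oact X Y h (iota X Y (last fs))) (wd Xs (butlast fs)))" for h m0
    proof -
      let ?f = "act D X Y h (last fs)"
      have f: "?f \<in> hom D X Y" using ob l by simp
      obtain g gs where fs: "butlast fs = g # gs" using ne by (cases "butlast fs") auto
      have g: "hd fs = g" "butlast (tl fs) = gs"
        using fs n by (cases fs; auto split: if_splits)+
      have w: "ocmp Y X Y (oact X Y h (iota X Y (last fs))) (wd Xs (butlast fs)) =
          wd (Y # Xs') (cmp D (hd Xs') X Y ?f g # gs)"
        using ob l f p omd_mem(3) [OF p ne] lm_wd [OF ob f, of Y Xs g gs]
        by (simp add: oact_iota ocmp_iota fs) (simp add: Xs)
      have q: "path_between D Y Y (Y # Xs') (cmp D (hd Xs') X Y ?f g # gs)"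
        using path_cmp [OF _ ob(2) f, of Y Xs g gs] p by (simp add: fs Xs)
      have e: "butlast (Y # Xs') = Y # butlast Xs'" using Xs by simp
      have "length (cmp D (hd Xs') X Y ?f g # gs) = Suc n" using lb fs by simp
      note r = path_cn_gens [OF q this]
      have "\<phi> (mcn M D n m0 (cn_gen D n (Y # butlast Xs', cmp D (hd Xs') X Y ?f g # gs))) =
          t Y m0 (wd (Y # Xs') (cmp D (hd Xs') X Y ?f g # gs))"
        using \<phi> [OF r(1)] unfolding r(2) unfolding r(3) unfolding e by simp
      moreover have "Xs ! 0 = X" "Xs ! 1 = hd Xs'" "tl Xs = Xs'" using Xs by (simp_all add: hd_conv_nth)
      ultimately show ?thesis unfolding w g Y_def [symmetric] by simp
    qed
    then show ?thesis by (simp add: face_val_def)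
  qed
  show ?thesis
    by (simp add: 2 1 [symmetric] right_diff_distrib)
qed

text \<open>Prepending the twisted last morphism to the opened cycle gives the closed path of the
  rotated symbol.\<close>

lemma rot_eq:
  assumes \<phi>': "\<forall>m Xs fs. (Xs, fs) \<in> cn_gens D n \<longrightarrow>
      \<phi> (mcn M D n m (cn_gen D n (Xs, fs))) = t (hd Xs) m (wd (Xs @ [hd Xs]) fs)"
    and g: "(Xs, fs) \<in> cn_gens D n"
  defines "X \<equiv> hd Xs" and "Y \<equiv> last Xs"
  shows "rot_val n \<phi> m Xs fs =
    cosweedler H M m (\<lambda>a m0. t Y m0 (wd (Y # Xs) (act D X Y (Sinv a) (last fs) # butlast fs)))"
proof -
  note \<phi> = \<phi>' [rule_format]
  have p: "path_between D Y X Xs (butlast fs)" and l: "last fs \<in> hom D X Y" and n: "length fs = Suc n"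
    and ne: "Xs \<noteq> []"
    using g by (auto simp: cn_gens_snoc X_def Y_def)
  have ob: "X \<in> ob D" "Y \<in> ob D" using path_between_ob [OF p] by auto
  have "\<phi> (mcn M D n m0 (cn_gen D n (last Xs # butlast Xs, act D X Y h (last fs) # butlast fs))) =
      t Y m0 (wd (Y # Xs) (act D X Y h (last fs) # butlast fs))" for h m0
  proof -
    have q: "path_between D Y Y (Y # Xs) (act D X Y h (last fs) # butlast fs)"
      by (rule path_Cons [OF p]) (use ob l in auto)
    have "length (act D X Y h (last fs) # butlast fs) = Suc n" using n by simp
    note r = path_cn_gens [OF q this]
    have e: "butlast (Y # Xs) = Y # butlast Xs" using ne by simp
    show ?thesis
      using \<phi> [OF r(1)] unfolding r(2) unfolding r(3) unfolding e by (simp add: Y_def)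
  qed
  then show ?thesis by (simp add: rot_val_def X_def [symmetric] Y_def [symmetric])
qed

section \<open>From traces to cyclic cocycles\<close>

text \<open>Vanishing and invariance are established symbol by symbol, so the chosen decompositions
  do no harm. The identity morphisms of D serve in degree 0.\<close>

lemma Omega_trace_imp_cocycle:
  assumes ch: "character_of_Omega_trace H D M n \<phi>" and coch: "\<phi> \<in> hopf_cochains H D M n"
    and cat: "left_H_category H D"
  shows "\<phi> \<in> hopf_cyclic_cocycles H D M n"
proof -
  obtain T where T: "closed_graded_trace H M n (Omega H D) T"
    and \<phi>T: "\<forall>m. \<forall>(Xs, fs)\<in>cn_gens D n. \<phi> (mcn M D n m (cn_gen D n (Xs, fs))) =
      T (hd Xs) (mten M (Omega H D) n (hd Xs) m (omega_word D Xs fs))"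
    using ch unfolding character_of_Omega_trace_def by blast
  define t where "t = (\<lambda>X m x. T X (mten M (Omega H D) n X m x))"
  have lin: "linear_on fscale (omd n X X) (*) (t X m)" if "X \<in> ob D" for X m
  proof -
    have l: "linear_on fscale (tprod (mscale M) UNIV fscale (omd n X X)) (*) (T X)"
      using T that by (simp add: closed_graded_trace_def)
    show ?thesis
      unfolding t_def mten_def Omega_simps
      by (rule linear_on_comp [OF tmul_linear_right l]) (auto intro: tmul_mem)
  qed
  have closed: "t X m (odif X X x) = 0" if "X \<in> ob D" "Suc l = n" "x \<in> omd l X X" for X m l x
    using T that by (auto simp: closed_graded_trace_def t_def)
  have trace: "t X m (ocmp X Y X g' g) =
      (-1) ^ (i * j) * cosweedler H M m (\<lambda>a m0. t Y m0 (ocmp Y X Y (oact X Y (Sinv a) g) g'))"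
    if "X \<in> ob D" "Y \<in> ob D" "i + j = n" "g \<in> omd i X Y" "g' \<in> omd j Y X" for X Y m i j g g'
    using T that by (simp add: closed_graded_trace_def t_def)
  have \<phi>: "\<phi> (mcn M D n m (cn_gen D n (Xs, fs))) = t (hd Xs) m (wd (Xs @ [hd Xs]) fs)"
    if "(Xs, fs) \<in> cn_gens D n" for m Xs fs
    using \<phi>T that by (auto simp: t_def omega_word_wd)
  have lin': "\<forall>X m. X \<in> ob D \<longrightarrow> linear_on fscale (omd n X X) (*) (t X m)" using lin by blast
  have \<phi>': "\<forall>m Xs fs. (Xs, fs) \<in> cn_gens D n \<longrightarrow>
      \<phi> (mcn M D n m (cn_gen D n (Xs, fs))) = t (hd Xs) m (wd (Xs @ [hd Xs]) fs)" using \<phi> by blast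
  have "coboundary H D M n \<phi> c = 0" if c: "c \<in> MCN M D (Suc n)" for c
  proof -
    \<comment> \<open>A morphism has degree 0, so the trace property carries no sign and the bracket
      in \<open>face_sum\<close> vanishes.\<close>
    have z: "(\<Sum>i\<le>Suc n. (-1) ^ i * face_val n \<phi> i m Xs fs) = 0" if g: "(Xs, fs) \<in> cn_gens D (Suc n)" for m Xs fs
    proof -
      let ?X = "hd Xs" and ?Y = "last Xs"
      have p: "path_between D ?Y ?X Xs (butlast fs)" and l: "last fs \<in> hom D ?X ?Y" and n: "length fs = Suc (Suc n)"
        using g by (auto simp: cn_gens_snoc)
      have ob: "?X \<in> ob D" "?Y \<in> ob D" using path_between_ob [OF p] by auto
      have "wd Xs (butlast fs) \<in> omd n ?Y ?X"
        by (rule omd_mem(1) [OF p]) (use n in \<open>auto simp flip: length_greater_0_conv\<close>)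
      from trace [OF ob _ iota_memd [OF ob l] this] face_sum [where t = t, OF lin' \<phi>' g] show ?thesis
        by simp
    qed
    have "sum_list (map (\<lambda>(m, Xs, fs). \<Sum>i\<le>Suc n. (-1) ^ i * face_val n \<phi> i m Xs fs) gs) = 0"
      if "set gs \<subseteq> UNIV \<times> cn_gens D (Suc n)" for gs
      using that by (induction gs) (auto simp: z simp del: sum.atMost_Suc)
    then show ?thesis using chain_list(1) [OF c] by (simp only: coboundary_eq)
  qed
  moreover have "(-1) ^ n * rotation H D M n \<phi> c = \<phi> c" if c: "c \<in> MCN M D n" for c
  proof -
    have rot: "(-1) ^ n * rot_val n \<phi> m Xs fs = \<phi> (mcn M D n m (cn_gen D n (Xs, fs)))"
      if g: "(Xs, fs) \<in> cn_gens D n" for m Xs fs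
    proof -
      let ?X = "hd Xs" and ?Y = "last Xs" and ?f = "last fs" and ?w = "wd Xs (butlast fs)"
      have p: "path_between D ?Y ?X Xs (butlast fs)" and l: "?f \<in> hom D ?X ?Y" and n: "length fs = Suc n"
        using g by (auto simp: cn_gens_snoc)
      have ob: "?X \<in> ob D" "?Y \<in> ob D" using path_between_ob [OF p] by auto
      have af: "act D ?X ?Y h ?f \<in> hom D ?X ?Y" for h using ob l by simp
      show ?thesis
      proof (cases n)
        \<comment> \<open>There is no word left to pair with df. Instead f = e f for the identity e,
          and the trace property moves f around e.\<close>
        case 0
        with n obtain f where fs: "fs = [f]" by (cases fs) auto
        with p obtain X where Xs: "Xs = [X]" and X: "X \<in> ob D" by (auto simp: path_between_def is_path_Nil)
        have f: "f \<in> hom D X X" using l by (simp add: fs Xs)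
        obtain e where e: "e \<in> hom D X X" "\<And>g. g \<in> hom D X X \<Longrightarrow> cmp D X X X e g = g"
            "\<And>g. g \<in> hom D X X \<Longrightarrow> cmp D X X X g e = g"
          using cat X unfolding left_H_category_def by blast
        have io: "wd (Xs @ [hd Xs]) fs = iota X X f" "wd (last Xs # Xs) (g # butlast fs) = iota X X g" for g
          by (simp_all add: iota_def fs Xs)
        have "\<phi> (mcn M D n m (cn_gen D n (Xs, fs))) = t X m (ocmp X X X (iota X X e) (iota X X f))"
          using X e f \<phi> [OF g, of m] unfolding io by (simp add: ocmp_iota lm_iota Xs)
        also have "\<dots> = cosweedler H M m (\<lambda>a m0. t X m0 (ocmp X X X (oact X X (Sinv a) (iota X X f)) (iota X X e)))"
          using trace [OF X X _ iota_memd [OF X X f] iota_memd [OF X X e(1)]] by (simp add: 0)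
        also have "\<dots> = rot_val n \<phi> m Xs fs"
          using rot_eq [where t = t, OF \<phi>' g, of m] X e f unfolding io by (simp add: oact_iota ocmp_iota lm_iota fs Xs)
        finally show ?thesis by (simp add: 0)
      next
        case (Suc k)
        have ne: "butlast fs \<noteq> []" using n Suc by (auto simp flip: length_greater_0_conv)
        have w: "?w \<in> omd k ?Y ?X" by (rule omd_mem(1) [OF p ne]) (use n Suc in auto)
        have io: "iota ?X ?Y ?f \<in> omd 0 ?X ?Y" by (rule iota_memd [OF ob l])
        have pi: "path_between D ?X ?Y [?Y, ?X] [?f]" using ob l by (simp add: path_single)
        \<comment> \<open>The word is cut before its last factor, the exact df of degree 1, which
          faces a word of degree k = n - 1.\<close>
        have "ocmp ?X ?Y ?X ?w (odif ?X ?Y (iota ?X ?Y ?f)) = wd (Xs @ [?X]) fs"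
          using ocmp_wd [OF odif_mem [OF omd_om [OF io]] p ne] mw_dwd [OF p ne pi] butlast_last [OF n]
          by (simp add: iota_def odif_wd [OF pi])
        then have "\<phi> (mcn M D n m (cn_gen D n (Xs, fs))) =
            (-1) ^ k * cosweedler H M m (\<lambda>a m0. t ?Y m0 (ocmp ?Y ?X ?Y
              (oact ?X ?Y (Sinv a) (odif ?X ?Y (iota ?X ?Y ?f))) ?w))"
          using trace [OF ob _ odif_memd [OF io] w, of m] \<phi> [OF g, of m] by (simp add: Suc)
        also have "\<dots> = (-1) ^ k * cosweedler H M m (\<lambda>a m0. - t ?Y m0 (wd (?Y # Xs) (act D ?X ?Y (Sinv a) ?f # butlast fs)))"
        proof -
          \<comment> \<open>Leibniz with f of degree 0: (df) w = d(f w) - f dw. Closedness removes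
            the first term, and the minus sign completes \<open>(-1) ^ k\<close> to
            \<open>(-1) ^ n\<close>.\<close>
          have "t ?Y m0 (ocmp ?Y ?X ?Y (oact ?X ?Y h (odif ?X ?Y (iota ?X ?Y ?f))) ?w) =
              - t ?Y m0 (wd (?Y # Xs) (act D ?X ?Y h ?f # butlast fs))" for h m0
          proof -
            let ?i = "iota ?X ?Y (act D ?X ?Y h ?f)"
            have i: "?i \<in> omd 0 ?X ?Y" by (rule iota_memd [OF ob af])
            have "oact ?X ?Y h (odif ?X ?Y (iota ?X ?Y ?f)) = odif ?X ?Y ?i"
              using ob l by (simp add: oact_odif oact_iota)
            moreover have "ocmp ?Y ?X ?Y (odif ?X ?Y ?i) ?w = odif ?Y ?Y (ocmp ?Y ?X ?Y ?i ?w) - ocmp ?Y ?X ?Y ?i (odif ?Y ?X ?w)"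
              using leibniz [OF i omd_om [OF w]] by simp
            moreover have "ocmp ?Y ?X ?Y ?i (odif ?Y ?X ?w) = wd (?Y # Xs) (act D ?X ?Y h ?f # butlast fs)"
              using wd_Cons [OF p ne ob(2) af, of h] omd_om [OF w] ob af by (simp add: ocmp_iota)
            moreover have "t ?Y m0 (odif ?Y ?Y (ocmp ?Y ?X ?Y ?i ?w)) = 0"
              using closed [OF ob(2) _ ocmp_memd [OF i w], of m0] by (simp add: Suc)
            moreover have "odif ?Y ?Y (ocmp ?Y ?X ?Y ?i ?w) \<in> omd n ?Y ?Y" "ocmp ?Y ?X ?Y ?i (odif ?Y ?X ?w) \<in> omd n ?Y ?Y"
              using odif_memd [OF ocmp_memd [OF i w]] ocmp_memd [OF i odif_memd [OF w]] by (simp_all add: Suc)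
            ultimately show ?thesis
              by (simp add: linear_on_diff [OF lin [OF ob(2)] vector_space_fscale omd_sub])
          qed
          then show ?thesis by simp
        qed
        also have "\<dots> = (-1) ^ n * rot_val n \<phi> m Xs fs"
          using cosweedler_scale [OF vector_space_mult, of H M m "-1"
              "\<lambda>a m0. t ?Y m0 (wd (?Y # Xs) (act D ?X ?Y (Sinv a) ?f # butlast fs))"]
            rot_eq [where t = t, OF \<phi>' g, of m] by (simp add: Suc)
        finally show ?thesis by simp
      qed
    qed
    have lin\<phi>: "linear_on fscale (MCN M D n) (*) \<phi>" using coch by (simp add: hopf_cochains_def)
    note cl = chain_list [OF c]
    \<comment> \<open>By linearity the value of \<open>\<phi>\<close> at \<open>c\<close> is a sum
      over the very list that defines the rotation.\<close>
    have "\<phi> (sum_list (map (\<lambda>(m, x). mcn M D n m (cn_gen D n x)) gs)) =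
        sum_list (map (\<lambda>(m, x). \<phi> (mcn M D n m (cn_gen D n x))) gs)" if "set gs \<subseteq> UNIV \<times> cn_gens D n" for gs
      by (subst linear_on_apply_sum_list [OF vector_space_fscale MCN_sub lin\<phi>])
        (use that in \<open>auto simp: case_prod_unfold intro!: mcn_mem cn_gen_mem\<close>)
    from this [OF cl(1)] have "\<phi> c = sum_list (map (\<lambda>(m, x). \<phi> (mcn M D n m (cn_gen D n x))) (chain_list n c))"
      by (simp only: cl(2))
    also have "\<dots> = sum_list (map (\<lambda>(m, Xs, fs). (-1) ^ n * rot_val n \<phi> m Xs fs) (chain_list n c))"
      using cl(1) by (intro arg_cong [where f = sum_list] map_cong) (auto simp: rot)
    also have "\<dots> = (-1) ^ n * rotation H D M n \<phi> c"
      by (simp add: rotation_eq case_prod_unfold sum_list_const_mult)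
    finally show ?thesis by simp
  qed
  ultimately show ?thesis using coch by (simp add: hopf_cyclic_cocycles_def)
qed

section \<open>From cyclic cocycles to traces\<close>

text \<open>Reads off the tensor underlying a word of degree n. Ignoring \<mu> sends exact words to
  0, which is what makes the resulting trace closed.\<close>

definition to_CN :: "nat \<Rightarrow> 'o \<Rightarrow> ('k, 'o, 'a) omega \<Rightarrow> ('k, 'o list \<times> 'a list) tens" where
  "to_CN n X = tensor_lift (omega_gen D) (omega_gens D X X) (\<lambda>(Ys, (f, \<mu>), fs).
     if length fs = n then cn_gen D n (butlast Ys, f # fs) else 0)"

lemma to_CN_lift:
  shows to_CN_linear: "linear_on fscale (om X X) fscale (to_CN n X)"
    and to_CN_wd: "path_between D X X Ys fs \<Longrightarrow> fs \<noteq> [] \<Longrightarrow>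
      to_CN n X (wd Ys fs) = (if length fs = Suc n then cn_gen D n (butlast Ys, fs) else 0)"
    and to_CN_dwd: "path_between D X X Ys fs \<Longrightarrow> fs \<noteq> [] \<Longrightarrow> to_CN n X (dwd Ys fs) = 0"
proof -
  let ?A = "\<lambda>Ys fs. if length fs = Suc n then cn_gen D n (butlast Ys, fs) else 0"
  let ?F = "\<lambda>(Ys, (f, \<mu>), fs). if length fs = n then cn_gen D n (butlast Ys, f # fs) else 0"
  have A: "\<forall>Ys. hd Ys = X \<and> last Ys = X \<longrightarrow> multilin D fscale Ys (?A Ys)"
  proof (intro allI impI)
    fix Ys assume h: "hd Ys = X \<and> last Ys = X"
    show "multilin D fscale Ys (?A Ys)"
    proof (cases "length Ys = Suc (Suc n)")
      case True
      then obtain Ys' where Y: "Ys = X # Ys'" using h by (cases Ys) auto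
      moreover have "Ys' \<noteq> []" using Y True by auto
      ultimately have "butlast Ys @ [hd (butlast Ys)] = Ys" using h append_butlast_last_id [of Ys] by simp
      then have "multilin D fscale Ys (\<lambda>fs. cn_gen D n (butlast Ys, fs))"
        using cn_gen_multilin [of "butlast Ys" n] True by simp
      then show ?thesis by (rule multilin_cong) (use True in \<open>auto simp: is_path_def\<close>)
    next
      case False
      have "multilin D fscale Ys (\<lambda>fs. 0 :: ('k, 'o list \<times> 'a list) tens)"
        by (rule multilin_zero [OF vector_space_fscale])
      then show ?thesis by (rule multilin_cong) (use False in \<open>auto simp: is_path_def\<close>)
    qed
  qed
  have B: "\<forall>Ys. hd Ys = X \<and> last Ys = X \<longrightarrow>
      multilin D fscale Ys (\<lambda>fs. 0 :: ('k, 'o list \<times> 'a list) tens)"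
    by (simp add: multilin_zero vector_space_fscale)
  have F: "\<forall>Ys f \<mu> fs. (Ys, (f, \<mu>), fs) \<in> omega_gens D X X \<longrightarrow>
      ?F (Ys, (f, \<mu>), fs) = ?A Ys (f # fs) + fscale \<mu> 0" by simp
  note L = omega_lift [where A = ?A and B = "\<lambda>Ys fs. 0" and F = ?F, OF vector_space_fscale A B F, folded to_CN_def]
  show "linear_on fscale (om X X) fscale (to_CN n X)" by (rule L(1))
  show "path_between D X X Ys fs \<Longrightarrow> fs \<noteq> [] \<Longrightarrow>
      to_CN n X (wd Ys fs) = (if length fs = Suc n then cn_gen D n (butlast Ys, fs) else 0)" by (rule L(2))
  show "path_between D X X Ys fs \<Longrightarrow> fs \<noteq> [] \<Longrightarrow> to_CN n X (dwd Ys fs) = 0" by (rule L(3))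
qed

lemma to_CN_0 [simp]: "to_CN n X 0 = 0"
  by (rule linear_on_0 [OF to_CN_linear]) simp

lemma to_CN_mem [simp]:
  assumes "x \<in> om X X"
  shows "to_CN n X x \<in> CN D n"
  using assms
proof (induction rule: om_induct)
  case (add x y)
  then show ?case by (simp add: linear_on_add [OF to_CN_linear] fscale.subspace_add)
next
  case (hmg k x)
  then show ?case
  proof (induction rule: omd_induct)
    case (wd Ys fs)
    then have "fs \<noteq> []" by auto
    with wd show ?case
      by (auto simp: to_CN_wd fscale.subspace_0 intro!: cn_gen_mem path_cn_gens(1))
  qed (auto simp: to_CN_dwd omd_om linear_on_add [OF to_CN_linear] linear_on_scale [OF to_CN_linear]
    fscale.subspace_add fscale.subspace_scale fscale.subspace_0)
qed

lemma to_CN_odif: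
  assumes x: "x \<in> om X X"
  shows "to_CN n X (odif X X x) = 0"
  by (rule linear_om_eqI [where F = "\<lambda>x. to_CN n X (odif X X x)" and G = "\<lambda>x. 0",
      OF linear_on_comp [OF odif_linear to_CN_linear] linear_on_zero [OF vector_space_fscale] _ _ x])
    (simp_all add: odif_wd odif_dwd to_CN_dwd)

text \<open>Both actions distribute the legs of the iterated coproduct over the same letters. The
  invariance of a cochain thereby becomes the invariance of the trace.\<close>

lemma cn_act_eq:
  assumes g: "(Xs, fs) \<in> cn_gens D n"
  shows "cn_act H D n h (cn_gen D n (Xs, fs)) = to_CN n (hd Xs) (aw h (Xs @ [hd Xs]) fs)"
proof -
  define G where "G = (\<lambda>Xs fs. to_CN n (hd Xs) (aw h (Xs @ [hd Xs]) fs))"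
  have val: "to_CN n (hd Xs) (aw h (Xs @ [hd Xs]) fs) =
      sweedlers H (Suc n) h (\<lambda>hs. cn_gen D n (Xs, act_path D (Xs @ [hd Xs]) hs fs))"
    if g: "(Xs, fs) \<in> cn_gens D n" for Xs fs
  proof -
    note p = cn_gens_path [OF g]
    have ne: "fs \<noteq> []" using p(2) by auto
    have m: "wd (Xs @ [hd Xs]) (act_path D (Xs @ [hd Xs]) hs fs) \<in> om (hd Xs) (hd Xs)" for hs
      by (rule omd_mem(3) [OF path_act [OF p(1)]]) (simp add: ne)
    show ?thesis
      unfolding aw_def p(2)
      by (subst linear_on_sweedlers [OF vector_space_fscale om_sub to_CN_linear m])
        (simp add: to_CN_wd [OF path_act [OF p(1)]] ne p(2))
  qed
  have G: "multilin D fscale (Xs @ [hd Xs]) (G Xs)" if "length Xs = Suc n" for Xs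
  proof -
    have "Xs \<noteq> []" using that by auto
    then have b: "hd (Xs @ [hd Xs]) = hd Xs" "last (Xs @ [hd Xs]) = hd Xs" by simp_all
    show ?thesis
      unfolding G_def
    proof (rule multilin_comp [OF aw_multilin to_CN_linear])
      fix fs assume p: "is_path D (Xs @ [hd Xs]) fs"
      have "fs \<noteq> []" using is_path_length [OF p] that by auto
      then show "aw h (Xs @ [hd Xs]) fs \<in> om (hd Xs) (hd Xs)"
        using aw_mem [OF is_path_between [OF p]] unfolding b by simp
    qed
  qed
  \<comment> \<open>The two lifts sum over the same list of symbols, on which their summands
    agree.\<close>
  have "cn_act H D n h (cn_gen D n (Xs, fs)) = tensor_lift (cn_gen D n) (cn_gens D n) (\<lambda>(Xs, fs). G Xs fs) (cn_gen D n (Xs, fs))"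
  proof -
    define xs where "xs = (SOME xs. set xs \<subseteq> cn_gens D n \<and> sum_list (map (cn_gen D n) xs) = cn_gen D n (Xs, fs))"
    have "set xs \<subseteq> cn_gens D n" using someI_ex [OF CN_sums [OF cn_gen_mem [OF g]]] unfolding xs_def by blast
    then show ?thesis
      unfolding cn_act_def tensor_lift_def xs_def [symmetric]
      by (intro arg_cong [where f = sum_list] map_cong) (auto simp: G_def val)
  qed
  also have "\<dots> = G Xs fs"
    by (rule cn_lift(2) [OF vector_space_fscale G g])
  finally show ?thesis by (simp add: G_def)
qed

text \<open>The cocycle conditions are equations between functions of chains. They are first turned
  into the equations \<open>rot_t\<close> and \<open>face_t\<close> on symbols, for which
  multilinearity of the expressions in all arguments has to be checked.\<close>

lemma cocycle_imp_Omega_trace: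
  assumes Z: "\<phi> \<in> hopf_cyclic_cocycles H D M n"
  shows "character_of_Omega_trace H D M n \<phi>"
proof -
  have coch: "\<phi> \<in> hopf_cochains H D M n" and cob: "\<And>c. c \<in> MCN M D (Suc n) \<Longrightarrow> coboundary H D M n \<phi> c = 0"
    and rot: "\<And>c. c \<in> MCN M D n \<Longrightarrow> (-1) ^ n * rotation H D M n \<phi> c = \<phi> c"
    using Z by (auto simp: hopf_cyclic_cocycles_def)
  have lin\<phi>: "linear_on fscale (MCN M D n) (*) \<phi>"
    and inv\<phi>: "\<And>h m x. x \<in> cn_gens D n \<Longrightarrow> sweedler H h (\<lambda>h1 h2.
              \<phi> (mcn M D n (ract M m h1) (cn_act H D n (antipode H h2) (cn_gen D n x)))) =
            counit H h * \<phi> (mcn M D n m (cn_gen D n x))"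
    using coch by (auto simp: hopf_cochains_def)
  note vm = vector_space_mult
  define t where "t = (\<lambda>X m x. \<phi> (mcn M D n m (to_CN n X x)))"
  have tm: "linear_on (mscale M) UNIV (*) (\<lambda>m. t X m x)" if "x \<in> om X X" for X x
    unfolding t_def
    by (rule linear_on_comp [OF mcn_linear_left lin\<phi>]) (use that in \<open>auto intro: mcn_mem\<close>)
  have tx: "linear_on fscale (om X X) (*) (t X m)" for X m
    unfolding t_def
    by (rule linear_on_comp [OF linear_on_comp [OF to_CN_linear mcn_linear_right] lin\<phi>]) (auto intro: mcn_mem)
  have t_zero: "t X m x = 0" if "to_CN n X x = 0" for X m x
    using linear_on_0 [OF mcn_linear_right, of n m] linear_on_0 [OF lin\<phi>] that
    by (simp add: t_def fscale.subspace_0)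
  have t_odif: "t X m (odif X X x) = 0" if "x \<in> om X X" for X m x
    by (rule t_zero) (rule to_CN_odif [OF that])
  have t_dwd: "t X m (dwd Ys fs) = 0" if "path_between D X X Ys fs" "fs \<noteq> []" for X m Ys fs
    by (rule t_zero) (rule to_CN_dwd [OF that])
  have \<phi>: "\<phi> (mcn M D n m (cn_gen D n (Xs, fs))) = t (hd Xs) m (wd (Xs @ [hd Xs]) fs)"
    if g: "(Xs, fs) \<in> cn_gens D n" for m Xs fs
  proof -
    have "fs \<noteq> []" using cn_gens_path(2) [OF g] by auto
    then show ?thesis using to_CN_wd [OF cn_gens_path(1) [OF g]] cn_gens_path(2) [OF g] by (simp add: t_def)
  qed
  have txd: "linear_on fscale (omd n X X) (*) (t X m)" for X m
    by (rule linear_on_subset [OF tx]) (auto intro: omd_om)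
  have txd': "\<forall>X m. X \<in> ob D \<longrightarrow> linear_on fscale (omd n X X) (*) (t X m)" using txd by blast
  have \<phi>': "\<forall>m Xs fs. (Xs, fs) \<in> cn_gens D n \<longrightarrow>
      \<phi> (mcn M D n m (cn_gen D n (Xs, fs))) = t (hd Xs) m (wd (Xs @ [hd Xs]) fs)" using \<phi> by blast
  \<comment> \<open>Linearity in m of a twisted value, one of the conditions of
    \<open>chain_sum\<close>. It rests on linearity in the coaction leg, which enters through the
    inverse antipode.\<close>
  have cosw: "linear_on (mscale M) UNIV (*) (\<lambda>m. cosweedler H M m (\<lambda>a m0. t Y m0 (L (Sinv a))))"
    if L: "linear_on (hscale H) UNIV fscale L" and m: "\<And>h. L h \<in> om Y Y" for Y L
    by (intro linear_cosweedler vm linear_on_comp [OF linear_on_comp [OF linear_inv_antipode L] tx] tm m) auto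

  have inv: "sweedler H h (\<lambda>h1 h2. t X (ract M m h1) (oact X X (antipode H h2) x)) = counit H h * t X m x"
    if x: "x \<in> om X X" for X h m x
  proof (rule linear_om_eqI [where F = "\<lambda>x. sweedler H h (\<lambda>h1 h2. t X (ract M m h1) (oact X X (antipode H h2) x))"
        and G = "\<lambda>x. counit H h * t X m x", OF _ _ _ _ x])
    show "linear_on fscale (om X X) (*) (\<lambda>x. sweedler H h (\<lambda>h1 h2. t X (ract M m h1) (oact X X (antipode H h2) x)))"
      by (intro linear_on_sweedler_param vm linear_on_comp [OF oact_linear tx]) simp
    show "linear_on fscale (om X X) (*) (\<lambda>x. counit H h * t X m x)"
      by (rule linear_on_scaled [OF vm tx])
    have sz: "sweedler H h (\<lambda>a b. 0 :: 'k) = 0"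
      using sweedler_scale [OF vm, of H h 0 "\<lambda>a b. 0"] by simp
    fix Ys fs assume p: "path_between D X X Ys fs" "fs \<noteq> []"
    show "sweedler H h (\<lambda>h1 h2. t X (ract M m h1) (oact X X (antipode H h2) (dwd Ys fs))) = counit H h * t X m (dwd Ys fs)"
      using p by (simp add: oact_dwd t_odif aw_mem t_dwd sz)
    show "sweedler H h (\<lambda>h1 h2. t X (ract M m h1) (oact X X (antipode H h2) (wd Ys fs))) = counit H h * t X m (wd Ys fs)"
    proof (cases "length fs = Suc n")
      case True
      note g = path_cn_gens [OF p(1) True]
      show ?thesis
        using inv\<phi> [OF g(1), of h m] p True unfolding cn_act_eq [OF g(1)] unfolding g(2) unfolding g(3)
        by (simp add: oact_wd t_def to_CN_wd)
    next
      \<comment> \<open>The action preserves the number of letters, so words of other degrees stay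
        in the kernel of \<open>to_CN\<close>.\<close>
      case False
      have "to_CN n X (wd Ys gs) = 0" if "path_between D X X Ys gs" "length gs = length fs" for gs
        using that False p(2) by (subst to_CN_wd) auto
      then have "to_CN n X (aw h' Ys fs) = 0" for h'
      proof -
        have m: "wd Ys (act_path D Ys hs fs) \<in> om X X" for hs
          by (rule omd_mem(3) [OF path_act [OF p(1)]]) (simp add: p(2))
        have "to_CN n X (aw h' Ys fs) = sweedlers H (length fs) h' (\<lambda>hs. to_CN n X (wd Ys (act_path D Ys hs fs)))"
          unfolding aw_def by (rule linear_on_sweedlers [OF vector_space_fscale om_sub to_CN_linear m])
        also have "\<dots> = sweedlers H (length fs) h' (\<lambda>hs. 0)"
          using to_CN_wd [OF path_act [OF p(1)]] False p(2) by simp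
        also have "\<dots> \<in> {0}"
          by (rule sweedlers_mem [OF vector_space_fscale]) simp_all
        finally show ?thesis by simp
      qed
      then show ?thesis
        using p False by (simp add: oact_wd t_zero to_CN_wd sz)
    qed
  qed

  have rot_t: "t (hd Xs) m (wd (Xs @ [hd Xs]) fs) = (-1) ^ n * rot_val n \<phi> m Xs fs"
    if g: "(Xs, fs) \<in> cn_gens D n" for m Xs fs
  proof -
    \<comment> \<open>\<open>rot_val\<close> is written with \<open>\<phi>\<close> and bare symbols;
      \<open>G\<close> expresses it by \<open>t\<close>, where the multilinearity established for
      Omega is at hand.\<close>
    define G where "G = (\<lambda>m Xs fs. cosweedler H M m (\<lambda>a m0. t (last Xs) m0
      (wd (last Xs # Xs) (act D (hd Xs) (last Xs) (Sinv a) (last fs) # butlast fs))))"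
    have Geq: "rot_val n \<phi> m Xs fs = G m Xs fs" if "(Xs, fs) \<in> cn_gens D n" for m Xs fs
      unfolding G_def by (rule rot_eq [where t = t, OF \<phi>' that])
    have "sum_list (map (\<lambda>(m, Xs, fs). G m Xs fs) (chain_list n (mcn M D n m (cn_gen D n (Xs, fs))))) = G m Xs fs"
    proof (rule chain_sum [OF _ _ g])
      fix Xs fs assume g: "(Xs, fs) \<in> cn_gens D n"
      let ?X = "hd Xs" and ?Y = "last Xs"
      have p: "path_between D ?Y ?X Xs (butlast fs)" and l: "last fs \<in> hom D ?X ?Y"
        using g by (auto simp: cn_gens_snoc)
      have ob: "?X \<in> ob D" "?Y \<in> ob D" using path_between_ob [OF p] by auto
      have q: "path_between D ?Y ?Y (?Y # Xs) (act D ?X ?Y h (last fs) # butlast fs)" for h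
        by (rule path_Cons [OF p]) (use ob l in auto)
      have "is_path D Xs (butlast fs)" using p by (simp add: path_between_def)
      note lin = multilin_hd [OF multilin_wd this ob(2)]
      show "linear_on (mscale M) UNIV (*) (\<lambda>m. G m Xs fs)"
        unfolding G_def
        by (rule cosw, rule linear_on_comp [OF act_linear(2) [OF ob l] lin])
          (use ob l omd_mem(3) [OF q] in auto)
    next
      fix m and Xs :: "'o list" assume lX: "length Xs = Suc n"
      let ?X = "hd Xs" and ?Y = "last Xs"
      \<comment> \<open>The last morphism is acted upon and moved to the front, so its slot is
        treated apart.\<close>
      have sn: "multilin D (*) (Xs @ [?X]) (\<lambda>fs. t ?Y m0 (wd (?Y # Xs) (act D ?X ?Y h (last fs) # butlast fs)))" for h m0
      proof (rule multilin_snoc)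
        fix fs assume p: "is_path D Xs fs" and "?X \<in> ob D"
        have ob: "?X \<in> ob D" "?Y \<in> ob D" using path_between_ob [OF is_path_between [OF p]] by auto
        show "linear_on (scl D) (hom D ?X ?Y) (*) (\<lambda>g. t ?Y m0 (wd (?Y # Xs) (act D ?X ?Y h (last (fs @ [g])) # butlast (fs @ [g]))))"
          using ob omd_mem(3) [OF path_Cons [OF is_path_between [OF p] ob(2)]]
          by (simp, intro linear_on_comp [OF linear_on_comp [OF act_linear(1) multilin_hd [OF multilin_wd p ob(2)]] tx]) auto
      next
        fix f assume ob: "?X \<in> ob D" "?Y \<in> ob D" and f: "f \<in> hom D ?X ?Y"
        have af: "act D ?X ?Y h f \<in> hom D ?X ?Y" using ob f by simp
        have "multilin D (*) Xs (\<lambda>fs. t ?Y m0 (wd (?Y # Xs) (act D ?X ?Y h f # fs)))"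
          using multilin_tl [OF multilin_wd af ob(2)] tx
        proof (rule multilin_comp)
          fix fs assume p: "is_path D Xs fs"
          show "wd (?Y # Xs) (act D ?X ?Y h f # fs) \<in> om ?Y ?Y"
            by (rule omd_mem(3) [OF path_Cons [OF is_path_between [OF p] ob(2) af]]) simp
        qed
        then show "multilin D (*) Xs (\<lambda>fs. t ?Y m0 (wd (?Y # Xs) (act D ?X ?Y h (last (fs @ [f])) # butlast (fs @ [f]))))"
          by simp
      qed
      show "multilin D (*) (Xs @ [?X]) (G m Xs)"
        unfolding G_def by (intro multilin_cosweedler vm sn)
    qed
    moreover have "sum_list (map (\<lambda>(m, Xs, fs). rot_val n \<phi> m Xs fs) gs) = sum_list (map (\<lambda>(m, Xs, fs). G m Xs fs) gs)"
      if "set gs \<subseteq> UNIV \<times> cn_gens D n" for gs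
      using that by (intro arg_cong [where f = sum_list] map_cong) (auto simp: Geq)
    moreover have c: "mcn M D n m (cn_gen D n (Xs, fs)) \<in> MCN M D n" by (rule mcn_mem [OF cn_gen_mem [OF g]])
    ultimately have "rotation H D M n \<phi> (mcn M D n m (cn_gen D n (Xs, fs))) = rot_val n \<phi> m Xs fs"
      using chain_list(1) [OF c] by (simp add: rotation_eq Geq [OF g])
    then show ?thesis using rot [OF c] \<phi> [OF g] by simp
  qed

  have face_t: "t (hd Xs) m (ocmp (hd Xs) (last Xs) (hd Xs) (wd Xs (butlast fs)) (iota (hd Xs) (last Xs) (last fs))) =
      cosweedler H M m (\<lambda>a m0. t (last Xs) m0 (ocmp (last Xs) (hd Xs) (last Xs)
        (oact (hd Xs) (last Xs) (Sinv a) (iota (hd Xs) (last Xs) (last fs))) (wd Xs (butlast fs))))"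
    if g: "(Xs, fs) \<in> cn_gens D (Suc n)" for m Xs fs
  proof -
    define G1 where "G1 = (\<lambda>m Xs fs. t (hd Xs) m (ocmp (hd Xs) (last Xs) (hd Xs) (wd Xs (butlast fs)) (iota (hd Xs) (last Xs) (last fs))))"
    define G2 where "G2 = (\<lambda>m Xs fs. cosweedler H M m (\<lambda>a m0. t (last Xs) m0 (ocmp (last Xs) (hd Xs) (last Xs)
        (oact (hd Xs) (last Xs) (Sinv a) (iota (hd Xs) (last Xs) (last fs))) (wd Xs (butlast fs)))))"
    \<comment> \<open>The difference is written with a factor \<open>-1\<close>, so that closure of
      multilinear maps under sums and multiples suffices.\<close>
    define G where "G = (\<lambda>m Xs fs. (-1) ^ n * (G1 m Xs fs + (-1) * G2 m Xs fs))"
    have Geq: "(\<Sum>i\<le>Suc n. (-1) ^ i * face_val n \<phi> i m Xs fs) = G m Xs fs" if "(Xs, fs) \<in> cn_gens D (Suc n)" for m Xs fs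
      using face_sum [where t = t, OF txd' \<phi>' that] by (simp add: G_def G1_def G2_def)
    have "sum_list (map (\<lambda>(m, Xs, fs). G m Xs fs) (chain_list (Suc n) (mcn M D (Suc n) m (cn_gen D (Suc n) (Xs, fs))))) = G m Xs fs"
    proof (rule chain_sum [OF _ _ g])
      fix Xs fs assume g: "(Xs, fs) \<in> cn_gens D (Suc n)"
      let ?X = "hd Xs" and ?Y = "last Xs"
      have p: "path_between D ?Y ?X Xs (butlast fs)" and l: "last fs \<in> hom D ?X ?Y" and n: "length fs = Suc (Suc n)"
        using g by (auto simp: cn_gens_snoc)
      have ob: "?X \<in> ob D" "?Y \<in> ob D" using path_between_ob [OF p] by auto
      have w: "wd Xs (butlast fs) \<in> om ?Y ?X"
        by (rule omd_mem(3) [OF p]) (use n in \<open>auto simp flip: length_greater_0_conv\<close>)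
      have i: "iota ?X ?Y (last fs) \<in> om ?X ?Y" using ob l by simp
      have "linear_on (mscale M) UNIV (*) (\<lambda>m. G1 m Xs fs)"
        unfolding G1_def by (rule tm) (use w i in simp)
      moreover have "linear_on (mscale M) UNIV (*) (\<lambda>m. G2 m Xs fs)"
        unfolding G2_def
        by (rule cosw, rule linear_on_comp [OF oact_linear_left [OF i] ocmp_linear_left [OF w]]) (use w i in auto)
      ultimately show "linear_on (mscale M) UNIV (*) (\<lambda>m. G m Xs fs)"
        unfolding G_def by (intro linear_on_scaled linear_on_plus vm)
    next
      fix m and Xs :: "'o list" assume lX: "length Xs = Suc (Suc n)"
      let ?X = "hd Xs" and ?Y = "last Xs"
      have ne: "fs \<noteq> []" if "is_path D Xs fs" for fs using is_path_length [OF that] lX by auto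
      have mem: "wd Xs fs \<in> om ?Y ?X" if "is_path D Xs fs" for fs
        by (rule omd_mem(3) [OF is_path_between [OF that] ne [OF that]])
      have "multilin D (*) (Xs @ [?X]) (G1 m Xs)"
        unfolding G1_def
      proof (rule multilin_snoc)
        fix fs assume p: "is_path D Xs fs" and "?X \<in> ob D"
        have ob: "?X \<in> ob D" "?Y \<in> ob D" using path_between_ob [OF is_path_between [OF p]] by auto
        show "linear_on (scl D) (hom D ?X ?Y) (*) (\<lambda>g. t ?X m (ocmp ?X ?Y ?X (wd Xs (butlast (fs @ [g]))) (iota ?X ?Y (last (fs @ [g])))))"
          using ob mem [OF p]
          by (simp, intro linear_on_comp [OF linear_on_comp [OF iota_linear ocmp_linear_right [OF mem [OF p]]] tx]) auto
      next
        fix f assume ob: "?X \<in> ob D" "?Y \<in> ob D" and f: "f \<in> hom D ?X ?Y"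
        have i: "iota ?X ?Y f \<in> om ?X ?Y" using ob f by simp
        have "multilin D (*) Xs (\<lambda>fs. t ?X m (ocmp ?X ?Y ?X (wd Xs fs) (iota ?X ?Y f)))"
          by (rule multilin_comp [OF multilin_comp [OF multilin_wd ocmp_linear_left [OF i]] tx]) (use mem i in auto)
        then show "multilin D (*) Xs (\<lambda>fs. t ?X m (ocmp ?X ?Y ?X (wd Xs (butlast (fs @ [f]))) (iota ?X ?Y (last (fs @ [f])))))"
          by simp
      qed
      moreover have "multilin D (*) (Xs @ [?X]) (\<lambda>fs. t ?Y m0 (ocmp ?Y ?X ?Y (oact ?X ?Y h (iota ?X ?Y (last fs))) (wd Xs (butlast fs))))" for h m0
      proof (rule multilin_snoc)
        fix fs assume p: "is_path D Xs fs" and "?X \<in> ob D"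
        have ob: "?X \<in> ob D" "?Y \<in> ob D" using path_between_ob [OF is_path_between [OF p]] by auto
        show "linear_on (scl D) (hom D ?X ?Y) (*) (\<lambda>g. t ?Y m0 (ocmp ?Y ?X ?Y (oact ?X ?Y h (iota ?X ?Y (last (fs @ [g])))) (wd Xs (butlast (fs @ [g])))))"
          using ob mem [OF p]
          by (simp, intro linear_on_comp [OF linear_on_comp [OF linear_on_comp [OF iota_linear oact_linear] ocmp_linear_left [OF mem [OF p]]] tx]) auto
      next
        fix f assume ob: "?X \<in> ob D" "?Y \<in> ob D" and f: "f \<in> hom D ?X ?Y"
        have i: "oact ?X ?Y h (iota ?X ?Y f) \<in> om ?X ?Y" using ob f by simp
        have "multilin D (*) Xs (\<lambda>fs. t ?Y m0 (ocmp ?Y ?X ?Y (oact ?X ?Y h (iota ?X ?Y f)) (wd Xs fs)))"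
          by (rule multilin_comp [OF multilin_comp [OF multilin_wd ocmp_linear_right [OF i]] tx]) (use mem i in auto)
        then show "multilin D (*) Xs (\<lambda>fs. t ?Y m0 (ocmp ?Y ?X ?Y (oact ?X ?Y h (iota ?X ?Y (last (fs @ [f])))) (wd Xs (butlast (fs @ [f])))))"
          by simp
      qed
      then have "multilin D (*) (Xs @ [?X]) (G2 m Xs)"
        unfolding G2_def by (intro multilin_cosweedler vm)
      ultimately show "multilin D (*) (Xs @ [?X]) (G m Xs)"
        unfolding G_def by (intro multilin_scaled multilin_plus vm)
    qed
    moreover have "sum_list (map (\<lambda>(m, Xs, fs). \<Sum>i\<le>Suc n. (-1) ^ i * face_val n \<phi> i m Xs fs) gs) =
        sum_list (map (\<lambda>(m, Xs, fs). G m Xs fs) gs)" if "set gs \<subseteq> UNIV \<times> cn_gens D (Suc n)" for gs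
      using that by (intro arg_cong [where f = sum_list] map_cong) (auto simp only: Geq split: prod.splits)
    moreover have c: "mcn M D (Suc n) m (cn_gen D (Suc n) (Xs, fs)) \<in> MCN M D (Suc n)"
      by (rule mcn_mem [OF cn_gen_mem [OF g]])
    ultimately have "G m Xs fs = 0"
      using chain_list(1) [OF c] cob [OF c] by (simp only: coboundary_eq)
    then show ?thesis by (simp add: G_def G1_def G2_def)
  qed

  have degree_zero_trace: "t X m (ocmp X Y X g' (iota X Y f)) =
      cosweedler H M m (\<lambda>a m0. t Y m0 (ocmp Y X Y (oact X Y (Sinv a) (iota X Y f)) g'))"
    if ob: "X \<in> ob D" "Y \<in> ob D" and f: "f \<in> hom D X Y" and g': "g' \<in> omd n Y X" for X Y m f g'
  proof -
    have i: "iota X Y f \<in> om X Y" using ob f by simp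
    have l1: "linear_on fscale (om Y X) (*) (\<lambda>g'. t X m (ocmp X Y X g' (iota X Y f)))"
      by (rule linear_on_comp [OF ocmp_linear_left [OF i] tx]) (use i in simp)
    have l2: "linear_on fscale (om Y X) (*) (\<lambda>g'. cosweedler H M m (\<lambda>a m0. t Y m0 (ocmp Y X Y (oact X Y (Sinv a) (iota X Y f)) g')))"
      by (intro linear_on_cosweedler_param vm linear_on_comp [OF ocmp_linear_right tx]) (use i in auto)
    from g' show ?thesis
    proof (induction rule: omd_induct)
      case zero
      then show ?case using linear_on_0 [OF l1] linear_on_0 [OF l2] by simp
    next
      case (add x y)
      then show ?case using linear_on_add [OF l1] linear_on_add [OF l2] by (simp add: omd_om)
    next
      case (scale c x)
      then show ?case using linear_on_scale [OF l1] linear_on_scale [OF l2] by (simp add: omd_om)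
    next
      \<comment> \<open>A word that starts with a morphism, followed by f, has n + 2 letters and is
        a symbol for b\<phi> = 0.\<close>
      case (wd Ys fs)
      have "hd Ys = X" "last Ys = Y" "Ys \<noteq> []" using wd path_hd [OF wd(1)] by (auto simp: path_between_def)
      then show ?case
        using face_t [of Ys "fs @ [f]"] wd f by (simp add: cn_gens_snoc)
    next
      \<comment> \<open>An exact word followed by f has n + 1 letters only. Leibniz trades the
        product, up to an exact term, for the word ending in df, to which the rotation
        applies.\<close>
      case (dwd Ys fs)
      have h: "hd Ys = X" "last Ys = Y" "Ys \<noteq> []" using dwd path_hd [OF dwd(1)] by (auto simp: path_between_def)
      have g: "(Ys, fs @ [f]) \<in> cn_gens D n" using dwd h f by (simp add: cn_gens_snoc)
      have pi: "path_between D X Y [Y, X] [f]" using ob f by (simp add: path_single)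
      have d: "mw X Ys fs (odif X Y (iota X Y f)) = wd (Ys @ [X]) (fs @ [f])"
        using mw_dwd [OF dwd(1,3) pi] by (simp add: iota_def odif_wd [OF pi])
      have m: "mw X Ys fs (iota X Y f) \<in> om X X" "wd (Ys @ [X]) (fs @ [f]) \<in> om X X"
        using mw_mem [OF dwd(1,3) i] word_memd [OF g] h omd_om by auto
      have "t X m (ocmp X Y X (dwd Ys fs) (iota X Y f)) = (-1) ^ n * t X m (wd (Ys @ [X]) (fs @ [f]))"
        using ocmp_dwd [OF i dwd(1,3)] m dwd h
        by (simp add: mdw_def d linear_on_add [OF tx] linear_on_scale [OF tx] t_odif)
      \<comment> \<open>The sign from the Leibniz rule cancels the one in \<lambda>.\<close>
      also have "\<dots> = rot_val n \<phi> m Ys (fs @ [f])"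
        using rot_t [OF g, of m] h by (simp flip: mult.assoc power_mult_distrib)
      also have "\<dots> = cosweedler H M m (\<lambda>a m0. t Y m0 (wd (Y # Ys) (act D X Y (Sinv a) f # fs)))"
        using rot_eq [where t = t, OF \<phi>' g, of m] h by simp
      also have "\<dots> = cosweedler H M m (\<lambda>a m0. t Y m0 (ocmp Y X Y (oact X Y (Sinv a) (iota X Y f)) (dwd Ys fs)))"
        using ob f omd_mem(4) [OF dwd(1,3)] lm_dwd [OF ob _ dwd(1,3)] by (simp add: oact_iota ocmp_iota)
      finally show ?case .
    qed
  qed

  have trace: "t X m (ocmp X Y X g' g) =
      (-1) ^ (i * j) * cosweedler H M m (\<lambda>a m0. t Y m0 (ocmp Y X Y (oact X Y (Sinv a) g) g'))"
    if ob: "X \<in> ob D" "Y \<in> ob D" and ij: "i + j = n" and g: "g \<in> omd i X Y" and g': "g' \<in> omd j Y X"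
    for X Y m i j g g'
  proof -
    \<comment> \<open>The left factor stays general: the case dx replaces g' by dg', and the case f
      x replaces it by g' f.\<close>
    have "Y \<in> ob D \<longrightarrow> (\<forall>j g' m. i + j = n \<and> g' \<in> omd j Y X \<longrightarrow> t X m (ocmp X Y X g' g) =
      (-1) ^ (i * j) * cosweedler H M m (\<lambda>a m0. t Y m0 (ocmp Y X Y (oact X Y (Sinv a) g) g')))"
      using ob(1) g
    proof (induction i Y g rule: omd_struct_induct)
      case (zero i Y)
      show ?case
      proof (intro allI impI, elim conjE)
        fix j g' m assume Y: "Y \<in> ob D" and g': "g' \<in> omd j Y X"
        have z: "ocmp X Y X g' 0 = 0" "oact X Y h 0 = 0" "ocmp Y X Y 0 g' = 0" for h
          using linear_on_0 [OF ocmp_linear_right [OF omd_om [OF g'], of X]] linear_on_0 [OF oact_linear [of X Y h]]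
            linear_on_0 [OF ocmp_linear_left [OF omd_om [OF g'], of Y]] by simp_all
        have "cosweedler H M m (\<lambda>a m0. 0 :: 'k) = 0"
          using cosweedler_scale [OF vm, of H M m 0 "\<lambda>a b. 0"] by simp
        then show "t X m (ocmp X Y X g' 0) =
            (-1) ^ (i * j) * cosweedler H M m (\<lambda>a m0. t Y m0 (ocmp Y X Y (oact X Y (Sinv a) 0) g'))"
          by (simp add: z t_zero)
      qed
    next
      case (add i Y x y)
      show ?case
      proof (intro allI impI, elim conjE)
        fix j g' m assume Y: "Y \<in> ob D" and ij: "i + j = n" and g': "g' \<in> omd j Y X"
        note m = omd_om [OF add(1)] omd_om [OF add(2)] omd_om [OF g']
        show "t X m (ocmp X Y X g' (x + y)) =
            (-1) ^ (i * j) * cosweedler H M m (\<lambda>a m0. t Y m0 (ocmp Y X Y (oact X Y (Sinv a) (x + y)) g'))"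
          using add(3,4) Y ij g' m
          by (simp add: linear_on_add [OF ocmp_linear_right] linear_on_add [OF ocmp_linear_left] linear_on_add [OF oact_linear]
            linear_on_add [OF tx] cosweedler_add distrib_left)
      qed
    next
      case (scale i Y c x)
      show ?case
      proof (intro allI impI, elim conjE)
        fix j g' m assume Y: "Y \<in> ob D" and ij: "i + j = n" and g': "g' \<in> omd j Y X"
        note m = omd_om [OF scale(1)] omd_om [OF g']
        show "t X m (ocmp X Y X g' (fscale c x)) =
            (-1) ^ (i * j) * cosweedler H M m (\<lambda>a m0. t Y m0 (ocmp Y X Y (oact X Y (Sinv a) (fscale c x)) g'))"
          using scale(2) Y ij g' m
          by (simp add: linear_on_scale [OF ocmp_linear_right] linear_on_scale [OF ocmp_linear_left] linear_on_scale [OF oact_linear]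
            linear_on_scale [OF tx] cosweedler_scale [OF vm] mult.left_commute)
      qed
    next
      case (iota Y f)
      then show ?case using degree_zero_trace [OF ob(1) iota(1,2)] by simp
    next
      case (odif i Y x)
      show ?case
      proof (intro allI impI, elim conjE)
        fix j g' m assume ij: "Suc i + j = n" and g': "g' \<in> omd j Y X"
        note m = omd_om [OF odif(2)] omd_om [OF g']
        \<comment> \<open>Closedness applied to d(g' x) moves the differential from x to g'.\<close>
        have "t X m (odif X X (ocmp X Y X g' x)) = 0" using m by (simp add: t_odif)
        then have 1: "(-1) ^ j * t X m (ocmp X Y X g' (odif X Y x)) = - t X m (ocmp X Y X (odif Y X g') x)"
          using leibniz [OF g' m(1)] m
          by (simp add: linear_on_add [OF tx] linear_on_scale [OF tx] eq_neg_iff_add_eq_0 add.commute)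
        \<comment> \<open>The same on the other side of the trace, with x twisted.\<close>
        have 2: "t Y m0 (ocmp Y X Y (oact X Y h x) (odif Y X g')) =
            - ((-1) ^ i) * t Y m0 (ocmp Y X Y (oact X Y h (odif X Y x)) g')" for h m0
        proof -
          have "t Y m0 (odif Y Y (ocmp Y X Y (oact X Y h x) g')) = 0" using m by (simp add: t_odif)
          then have "t Y m0 (ocmp Y X Y (oact X Y h (odif X Y x)) g') = - ((-1) ^ i * t Y m0 (ocmp Y X Y (oact X Y h x) (odif Y X g')))"
            using leibniz [OF oact_memd [OF odif(2)] m(2)] m
            by (simp add: oact_odif linear_on_add [OF tx] linear_on_scale [OF tx] eq_neg_iff_add_eq_0)
          then show ?thesis by (simp flip: mult.assoc power_mult_distrib)
        qed
        have "t X m (ocmp X Y X g' (odif X Y x)) = (-1) ^ j * ((-1) ^ j * t X m (ocmp X Y X g' (odif X Y x)))"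
          by (simp flip: mult.assoc power_mult_distrib)
        also have "\<dots> = - ((-1) ^ j) * t X m (ocmp X Y X (odif Y X g') x)"
          by (simp add: 1)
        also have "t X m (ocmp X Y X (odif Y X g') x) = (-1) ^ (i * Suc j) * cosweedler H M m (\<lambda>a m0.
            t Y m0 (ocmp Y X Y (oact X Y (Sinv a) x) (odif Y X g')))"
        proof -
          have "i + Suc j = n" using ij by simp
          then show ?thesis using odif(3) odif(1) odif_memd [OF g'] by blast
        qed
        also have "\<dots> = (-1) ^ (i * Suc j) * (- ((-1) ^ i) * cosweedler H M m (\<lambda>a m0.
            t Y m0 (ocmp Y X Y (oact X Y (Sinv a) (odif X Y x)) g')))"
          by (simp only: 2 cosweedler_scale [OF vm])
        \<comment> \<open>The signs collected are \<open>(-1) ^ (j + 1)\<close>,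
          \<open>(-1) ^ (i * (j + 1))\<close> and \<open>(-1) ^ (i + 1)\<close>; their product is
          \<open>(-1) ^ ((i + 1) * j)\<close>.\<close>
        finally show "t X m (ocmp X Y X g' (odif X Y x)) = (-1) ^ (Suc i * j) * cosweedler H M m (\<lambda>a m0.
            t Y m0 (ocmp Y X Y (oact X Y (Sinv a) (odif X Y x)) g'))"
          by (simp add: power_add flip: mult.assoc power_mult_distrib)
      qed
    next
      case (lm i Y W f x)
      show ?case
      proof (intro allI impI, elim conjE)
        fix j g' m assume ij: "i + j = n" and g': "g' \<in> omd j Y X"
        note obs = ob(1) lm(2,1)
        note fm = iota_memd [OF lm(2,1,3)]
        note m = omd_om [OF lm(4)] omd_om [OF g'] omd_om [OF fm]
        have af: "act D W Y a f \<in> hom D W Y" for a using lm by simp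
        have gf: "ocmp W Y X g' (iota W Y f) \<in> omd j W X" using ocmp_memd [OF g' fm] by simp
        have xg: "ocmp Y X W (oact X W h x) g' \<in> omd n Y W" for h
          using ocmp_memd [OF oact_memd [OF lm(4)] g'] ij by simp
        \<comment> \<open>The value reached when x, twisted by the leg \<open>a\<close>, and f,
          twisted by the leg \<open>b\<close>, have both passed around g'.\<close>
        define K where "K = (\<lambda>a b m0. t Y m0 (ocmp Y X Y (lm X W Y (act D W Y (Sinv b) f) (oact X W (Sinv a) x)) g'))"
        have K: "ocmp Y W Y (oact W Y b (iota W Y f)) (ocmp Y X W (oact X W a x) g') =
            ocmp Y X Y (lm X W Y (act D W Y b f) (oact X W a x)) g'" for a b
          using obs lm(3) m af by (simp add: oact_iota ocmp_iota ocmp_lm)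
        \<comment> \<open>First x passes around g' f by the induction hypothesis, then f around the
          rest by the degree 0 case; the sign comes from x alone.\<close>
        have "t X m (ocmp X Y X g' (lm X W Y f x)) = t X m (ocmp X W X (ocmp W Y X g' (iota W Y f)) x)"
          using obs lm(3) m by (simp add: ocmp_assoc ocmp_iota)
        also have "\<dots> = (-1) ^ (i * j) * cosweedler H M m (\<lambda>a m0. t W m0 (ocmp W X W (oact X W (Sinv a) x) (ocmp W Y X g' (iota W Y f))))"
          using lm(5,2) ij gf by blast
        also have "cosweedler H M m (\<lambda>a m0. t W m0 (ocmp W X W (oact X W (Sinv a) x) (ocmp W Y X g' (iota W Y f)))) =
            cosweedler H M m (\<lambda>a m0. cosweedler H M m0 (\<lambda>b m00. K a b m00))"
        proof -
          have "t W m0 (ocmp W X W (oact X W h x) (ocmp W Y X g' (iota W Y f))) =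
              cosweedler H M m0 (\<lambda>b m00. t Y m00 (ocmp Y W Y (oact W Y (Sinv b) (iota W Y f)) (ocmp Y X W (oact X W h x) g')))" for h m0
            using degree_zero_trace [OF lm(2,1,3) xg, of m0 h] obs m by (simp add: ocmp_assoc)
          then show ?thesis by (simp add: K K_def)
        qed
        \<comment> \<open>Two successive coactions become one coaction followed by a
          coproduct.\<close>
        also have "\<dots> = cosweedler H M m (\<lambda>a m0. sweedler H a (\<lambda>a1 a2. K a1 a2 m0))"
        proof (rule cosweedler_coassoc [OF vm, symmetric])
          show "linear_on (hscale H) UNIV (*) (\<lambda>a. K a b m0)" for b m0
            unfolding K_def using obs m af
            by (intro linear_on_comp [OF linear_on_comp [OF linear_on_comp [OF linear_on_comp [OF linear_inv_antipode
                oact_linear_left] lm_linear] ocmp_linear_left] tx]) auto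
          show "linear_on (hscale H) UNIV (*) (\<lambda>b. K a b m0)" for a m0
            unfolding K_def using obs m af lm(3)
            by (intro linear_on_comp [OF linear_on_comp [OF linear_on_comp [OF linear_on_comp [OF linear_inv_antipode
                act_linear(2)] lm_linear_left] ocmp_linear_left] tx]) auto
          show "linear_on (mscale M) UNIV (*) (K a b)" for a b
            unfolding K_def using obs m af by (intro tm) simp
        qed
        also have "\<dots> = cosweedler H M m (\<lambda>a m0. t Y m0 (ocmp Y X Y (oact X Y (Sinv a) (lm X W Y f x)) g'))"
        proof -
          \<comment> \<open>The action on f x takes the coproduct of the twisting element. The
            inverse antipode swaps its legs, so that f receives the second leg and x the first, as
            in \<open>K\<close>.\<close>
          have "t Y m0 (ocmp Y X Y (oact X Y (Sinv h) (lm X W Y f x)) g') = sweedler H h (\<lambda>a1 a2. K a1 a2 m0)" for h m0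
          proof -
            have "t Y m0 (ocmp Y X Y (oact X Y (Sinv h) (lm X W Y f x)) g') =
                sweedler H (Sinv h) (\<lambda>p q. t Y m0 (ocmp Y X Y (lm X W Y (act D W Y p f) (oact X W q x)) g'))"
              unfolding oact_lm [OF obs lm(3) m(1)]
              by (rule linear_on_sweedler [OF vector_space_fscale om_sub linear_on_comp [OF ocmp_linear_left [OF m(2)] tx]])
                (use obs m af in auto)
            also have "\<dots> = sweedler H h (\<lambda>a1 a2. K a1 a2 m0)"
              unfolding K_def
              by (rule sweedler_inv_antipode [OF vm])
                (use obs m af lm(3) in \<open>auto intro!: linear_on_comp [OF linear_on_comp [OF linear_on_comp [OF
                oact_linear_left lm_linear] ocmp_linear_left] tx] linear_on_comp [OF linear_on_comp [OF linear_on_comp [OF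
                act_linear(2) lm_linear_left] ocmp_linear_left] tx]\<close>)
            finally show ?thesis .
          qed
          then show ?thesis by simp
        qed
        finally show "t X m (ocmp X Y X g' (lm X W Y f x)) =
            (-1) ^ (i * j) * cosweedler H M m (\<lambda>a m0. t Y m0 (ocmp Y X Y (oact X Y (Sinv a) (lm X W Y f x)) g'))" .
      qed
    qed
    then show ?thesis using ob(2) ij g' by blast
  qed

  obtain T where T: "closed_graded_trace H M n (Omega H D) T"
    "\<And>X m x. X \<in> ob D \<Longrightarrow> x \<in> omd n X X \<Longrightarrow> T X (mten M (Omega H D) n X m x) = t X m x"
  proof (rule trace_of_bilinear [of n t])
    show "linear_on (mscale M) UNIV (*) (\<lambda>m. t X m x)" if "x \<in> omd n X X" for X x
      by (rule tm [OF omd_om [OF that]])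
    show "linear_on fscale (omd n X X) (*) (t X m)" for X m
      by (rule txd)
    show "sweedler H h (\<lambda>h1 h2. t X (ract M m h1) (oact X X (antipode H h2) x)) = counit H h * t X m x"
      if "x \<in> omd n X X" for X h m x
      by (rule inv [OF omd_om [OF that]])
    show "t X m (odif X X x) = 0" if "x \<in> omd l X X" for X m l x
      by (rule t_odif [OF omd_om [OF that]])
    show "t X m (ocmp X Y X g' g) =
        (-1) ^ (i * j) * cosweedler H M m (\<lambda>a m0. t Y m0 (ocmp Y X Y (oact X Y (Sinv a) g) g'))"
      if "X \<in> ob D" "Y \<in> ob D" "i + j = n" "g \<in> omd i X Y" "g' \<in> omd j Y X" for X Y m i j g g'
      by (rule trace [OF that])
  qed blast
  have "\<phi> (mcn M D n m (cn_gen D n (Xs, fs))) = T (hd Xs) (mten M (Omega H D) n (hd Xs) m (omega_word D Xs fs))"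
    if g: "(Xs, fs) \<in> cn_gens D n" for m Xs fs
    using T(2) [OF _ word_memd [OF g]] path_between_ob [OF cn_gens_path(1) [OF g]] \<phi> [OF g]
    by (simp add: omega_word_wd)
  with T(1) show ?thesis unfolding character_of_Omega_trace_def by auto
qed

end

text \<open>Cycles range over all types of objects and morphisms, over which a formula cannot
  quantify. The universal cycle lives at \<open>'o\<close> and \<open>('k, 'o, 'a) omega\<close>;
  the last conjunct brings the character of a cycle at arbitrary types \<open>'p\<close> and
  \<open>'b\<close> back to these.\<close>

theorem theorem3p8:
  fixes H :: "('k::field_char_0, 'h::ring_1) hopf"
    and D :: "('k, 'h, 'o, 'a::ab_group_add) semicat"
    and M :: "('k, 'h, 'm::ab_group_add) hmod"
    and n :: nat
    and \<phi> :: "('k, 'o, 'a, 'm) cochain"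
  assumes "hopf_algebra H"
    and "left_H_category H D"
    and "sayd_module H M"
    and "\<phi> \<in> hopf_cochains H D M n"
  shows
    "(character_of_cycle TYPE('o) TYPE(('k, 'o, 'a) omega) H D M n \<phi> \<longleftrightarrow>
        character_of_Omega_trace H D M n \<phi>) \<and>
     (character_of_Omega_trace H D M n \<phi> \<longleftrightarrow> \<phi> \<in> hopf_cyclic_cocycles H D M n) \<and>
     (character_of_cycle TYPE('p) TYPE('b::ab_group_add) H D M n \<phi> \<longrightarrow>
        character_of_cycle TYPE('o) TYPE(('k, 'o, 'a) omega) H D M n \<phi>)"
proof -
  have "left_H_semicategory H D"
    using assms(2) by (simp add: left_H_category_def)
  then interpret omega_trace H M D
    using assms(1,3) by unfold_locales (simp_all add: left_H_semicategory_def)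
  have "character_of_Omega_trace H D M n \<phi>"
    if "character_of_cycle TYPE('o) TYPE(('k, 'o, 'a) omega) H D M n \<phi>"
    using that character_imp_Omega_trace unfolding character_of_cycle_def by blast
  moreover have "character_of_Omega_trace H D M n \<phi>"
    if "character_of_cycle TYPE('p) TYPE('b) H D M n \<phi>"
    using that character_imp_Omega_trace unfolding character_of_cycle_def by blast
  moreover have "character_of_cycle TYPE('o) TYPE(('k, 'o, 'a) omega) H D M n \<phi>"
    if "character_of_Omega_trace H D M n \<phi>"
    using Omega_trace_imp_character [OF that] unfolding character_of_cycle_def by blast
  moreover have "character_of_Omega_trace H D M n \<phi> \<longleftrightarrow> \<phi> \<in> hopf_cyclic_cocycles H D M n"
    using Omega_trace_imp_cocycle [OF _ assms(4,2)] cocycle_imp_Omega_trace by blast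
  ultimately show ?thesis
    by blast
qed

end
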